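(* For any $0 < \varepsilon < 1/2$ and for any $\alpha > 0$, almost surely there exists $N\geq 1$ such that for any $n\geq N$, $$R_{n/2 - n^{1/2+\varepsilon}} \cap \mathbb{Z}_{n^\alpha} \subset A_n^*[\infty] \cap \mathbb{Z}_{n^\alpha} \subset R_{n/2 + n^{1/2+\varepsilon}} \cap \mathbb{Z}_{n^\alpha}.$$ The same holds for $A_n^\dag[\infty]$ in place of $A_n^*[\infty]$.
   Context: Let $(S_{i,j})_{i\in\mathbb{Z},j\geq1}$ be independent simple symmetric random walks on $\mathbb{Z}^2$, $S_{i,j}$ starting at $(0,i)$. When the current aggregate is $A\subset\mathbb{Z}^2$, sending particle $(i,j)$ (from level $i$) means: follow $S_{i,j}$ until the first time (possibly time $0$) it is at a site $z\notin A$; the particle stops there and the aggregate becomes $A\cup\{z\}$. For an integer $n\geq1$, let $(N_i)_{i\in\mathbb{Z}}$ be i.i.d. Poisson random variables with parameter $n$, independent of the walks. $A_n^*[M]$ ($M\geq0$) is the aggregate obtained from $\emptyset$ by sending $N_i$ particles from each level $i$ with $|i|\leq M$, levels being treated in the usual order $0,1,-1,2,-2,\dots,M,-M$; $A_n^*[\infty]=\bigcup_{M\geq0}A_n^*[M]$ (increasing union). The $A_n^*[\infty]$, $n\geq1$, are regarded as defined on a common probability space. Let $(\mathcal{N}_i)_{i\in\mathbb{Z}}$ be i.i.d. Poisson point processes on $\mathbb{R}^+$ with intensity $1$, independent of the walks, and let $T_{i,1}<T_{i,2}<\dots$ be the points of $\mathcal{N}_i$. $A_n^\dag[M]$ is the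 aggregate obtained from $\emptyset$ by sending, in increasing order of the times $T_{i,j}$ (a.s. distinct), all particles $(i,j)$ with $|i|\leq M$ and $T_{i,j}\leq n$ (trajectories are realized instantaneously); $A_n^\dag[\infty]=\bigcup_{M\geq0}A_n^\dag[M]$ (increasing union). For real $r>0$, $R_r=([-r,r]\cap\mathbb{Z})\times\mathbb{Z}$ and $\mathbb{Z}_r=\mathbb{Z}\times([-r,r]\cap\mathbb{Z})$. *)

theory Defs
  imports "HOL-Probability.Probability"
begin

section \<open>Aggregates built from given trajectories\<close>

text \<open>If the trajectory never leaves the aggregate (a null event for a random walk and a finite
  aggregate), the aggregate is left unchanged.\<close>

definition deposit :: "(nat \<Rightarrow> int \<times> int) \<Rightarrow> (int \<times> int) set \<Rightarrow> (int \<times> int) set" where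
  "deposit w A = (if \<exists>k. w k \<notin> A then insert (w (LEAST k. w k \<notin> A)) A else A)"

text \<open>A particle is a pair \<open>(i, j)\<close> of a level \<open>i\<close> and a number \<open>j \<ge> 1\<close>; \<open>s i j k\<close> is the position
  of its trajectory at time \<open>k\<close>.\<close>

definition aggregate :: "(int \<Rightarrow> nat \<Rightarrow> nat \<Rightarrow> int \<times> int) \<Rightarrow> (int \<times> nat) list \<Rightarrow> (int \<times> int) set" where
  "aggregate s ps = fold (\<lambda>(i, j). deposit (s i j)) ps {}"

fun levels :: "nat \<Rightarrow> int list" where
  "levels 0 = [0]"
| "levels (Suc m) = levels m @ [int (Suc m), - int (Suc m)]"

definition A_star :: "(int \<Rightarrow> nat \<Rightarrow> nat \<Rightarrow> int \<times> int) \<Rightarrow> (int \<Rightarrow> nat) \<Rightarrow> nat \<Rightarrow> (int \<times> int) set" where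
  "A_star s \<nu> m = aggregate s (concat (map (\<lambda>i. map (Pair i) [1..<Suc (\<nu> i)]) (levels m)))"

definition A_star_inf :: "(int \<Rightarrow> nat \<Rightarrow> nat \<Rightarrow> int \<times> int) \<Rightarrow> (int \<Rightarrow> nat) \<Rightarrow> (int \<times> int) set" where
  "A_star_inf s \<nu> = (\<Union>m. A_star s \<nu> m)"

text \<open>The \<open>j\<close>-th smallest point of a locally finite \<open>X \<subseteq> {0..}\<close>, for \<open>j \<ge> 1\<close>.\<close>

definition nth_point :: "real set \<Rightarrow> nat \<Rightarrow> real" where
  "nth_point X j = (THE t. t \<in> X \<and> card (X \<inter> {0..t}) = j)"

definition clock_particles :: "(int \<Rightarrow> real set) \<Rightarrow> nat \<Rightarrow> nat \<Rightarrow> (int \<times> nat) set" where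
  "clock_particles X n m = {(i, j). \<bar>i\<bar> \<le> int m \<and> 1 \<le> j \<and> nth_point (X i) j \<le> real n}"

text \<open>The list below is determined when the times are distinct and each \<open>X i\<close> is infinite and
  locally finite, hence almost surely for independent Poisson processes.\<close>

definition clock_order :: "(int \<Rightarrow> real set) \<Rightarrow> nat \<Rightarrow> nat \<Rightarrow> (int \<times> nat) list" where
  "clock_order X n m =
     (THE ps. set ps = clock_particles X n m \<and>
        sorted_wrt (\<lambda>(i, j) (i', j'). nth_point (X i) j < nth_point (X i') j') ps)"

definition A_dag ::
  "(int \<Rightarrow> nat \<Rightarrow> nat \<Rightarrow> int \<times> int) \<Rightarrow> (int \<Rightarrow> real set) \<Rightarrow> nat \<Rightarrow> nat \<Rightarrow> (int \<times> int) set" where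
  "A_dag s X n m = aggregate s (clock_order X n m)"

definition A_dag_inf ::
  "(int \<Rightarrow> nat \<Rightarrow> nat \<Rightarrow> int \<times> int) \<Rightarrow> (int \<Rightarrow> real set) \<Rightarrow> nat \<Rightarrow> (int \<times> int) set" where
  "A_dag_inf s X n = (\<Union>m. A_dag s X n m)"

definition vstrip :: "real \<Rightarrow> (int \<times> int) set" where
  "vstrip r = {(x, y). \<bar>real_of_int x\<bar> \<le> r}"

definition hstrip :: "real \<Rightarrow> (int \<times> int) set" where
  "hstrip r = {(x, y). \<bar>real_of_int y\<bar> \<le> r}"


section \<open>The random inputs\<close>

definition simple_random_walk :: "'w measure \<Rightarrow> int \<times> int \<Rightarrow> (nat \<Rightarrow> 'w \<Rightarrow> int \<times> int) \<Rightarrow> bool" where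
  "simple_random_walk M x S \<longleftrightarrow>
     (\<forall>k. S k \<in> M \<rightarrow>\<^sub>M count_space UNIV) \<and>
     (AE \<omega> in M. S 0 \<omega> = x) \<and>
     prob_space.indep_vars M (\<lambda>_. count_space UNIV) (\<lambda>k \<omega>. S (Suc k) \<omega> - S k \<omega>) UNIV \<and>
     (\<forall>k. distr M (count_space UNIV) (\<lambda>\<omega>. S (Suc k) \<omega> - S k \<omega>)
          = measure_pmf (pmf_of_set {(1, 0), (-1, 0), (0, 1), (0, -1)}))"

abbreviation path_space :: "(nat \<Rightarrow> int \<times> int) measure" where
  "path_space \<equiv> PiM UNIV (\<lambda>_. count_space UNIV)"

abbreviation particles :: "(int \<times> nat) set" where
  "particles \<equiv> UNIV \<times> {1..}"

definition independent_walks :: "'w measure \<Rightarrow> (int \<Rightarrow> nat \<Rightarrow> nat \<Rightarrow> 'w \<Rightarrow> int \<times> int) \<Rightarrow> bool" where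
  "independent_walks M S \<longleftrightarrow>
     (\<forall>i. \<forall>j\<ge>1. simple_random_walk M (0, i) (S i j)) \<and>
     prob_space.indep_vars M (\<lambda>_. path_space) (\<lambda>(i, j) \<omega> k. S i j k \<omega>) particles"

text \<open>Independence of two random elements with values in possibly different types (which
  \<^const>\<open>prob_space.indep_var\<close> does not allow).\<close>

definition indep_elements ::
  "'w measure \<Rightarrow> 'a measure \<Rightarrow> ('w \<Rightarrow> 'a) \<Rightarrow> 'b measure \<Rightarrow> ('w \<Rightarrow> 'b) \<Rightarrow> bool" where
  "indep_elements M Ma Y Mb Z \<longleftrightarrow>
     Y \<in> M \<rightarrow>\<^sub>M Ma \<and> Z \<in> M \<rightarrow>\<^sub>M Mb \<and>
     prob_space.indep_set M (sets (vimage_algebra (space M) Y Ma))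
                            (sets (vimage_algebra (space M) Z Mb))"

definition walks_space :: "(int \<times> nat \<Rightarrow> nat \<Rightarrow> int \<times> int) measure" where
  "walks_space = PiM particles (\<lambda>_. path_space)"

definition all_walks ::
  "(int \<Rightarrow> nat \<Rightarrow> nat \<Rightarrow> 'w \<Rightarrow> int \<times> int) \<Rightarrow> 'w \<Rightarrow> (int \<times> nat \<Rightarrow> nat \<Rightarrow> int \<times> int)" where
  "all_walks S \<omega> = (\<lambda>(i, j) \<in> particles. \<lambda>k. S i j k \<omega>)"

definition star_model ::
  "'w measure \<Rightarrow> nat \<Rightarrow> (int \<Rightarrow> nat \<Rightarrow> nat \<Rightarrow> 'w \<Rightarrow> int \<times> int) \<Rightarrow> (int \<Rightarrow> 'w \<Rightarrow> nat) \<Rightarrow> bool" where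
  "star_model M n S N \<longleftrightarrow>
     independent_walks M S \<and>
     prob_space.indep_vars M (\<lambda>_. count_space UNIV) N UNIV \<and>
     (\<forall>i. distr M (count_space UNIV) (N i) = measure_pmf (poisson_pmf (real n))) \<and>
     indep_elements M (PiM UNIV (\<lambda>_. count_space UNIV)) (\<lambda>\<omega> i. N i \<omega>)
                      walks_space (all_walks S)"

text \<open>Point processes on \<open>{0..}\<close> are random locally finite sets; the \<open>\<sigma>\<close>-algebra on configurations
  is the one generated by the numbers of points in bounded Borel sets.\<close>

definition bounded_borel :: "real set set" where
  "bounded_borel = {B \<in> sets borel. bounded B \<and> B \<subseteq> {0..}}"

definition counts_space :: "(real set \<Rightarrow> nat) measure" where
  "counts_space = PiM bounded_borel (\<lambda>_. count_space UNIV)"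

definition counts :: "real set \<Rightarrow> (real set \<Rightarrow> nat)" where
  "counts X = (\<lambda>B \<in> bounded_borel. card (X \<inter> B))"

definition unit_poisson_process :: "'w measure \<Rightarrow> ('w \<Rightarrow> real set) \<Rightarrow> bool" where
  "unit_poisson_process M X \<longleftrightarrow>
     (\<forall>\<omega> \<in> space M. X \<omega> \<subseteq> {0..} \<and> (\<forall>t. finite (X \<omega> \<inter> {0..t}))) \<and>
     (\<lambda>\<omega>. counts (X \<omega>)) \<in> M \<rightarrow>\<^sub>M counts_space \<and>
     (\<forall>B \<in> bounded_borel. \<forall>k.
        measure M {\<omega> \<in> space M. card (X \<omega> \<inter> B) = k}
          = measure lborel B ^ k / fact k * exp (- measure lborel B)) \<and>
     (\<forall>B :: nat \<Rightarrow> real set. range B \<subseteq> bounded_borel \<and> disjoint_family B \<longrightarrow>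
        prob_space.indep_vars M (\<lambda>_. count_space UNIV) (\<lambda>l \<omega>. card (X \<omega> \<inter> B l)) UNIV)"

definition dag_model ::
  "'w measure \<Rightarrow> (int \<Rightarrow> nat \<Rightarrow> nat \<Rightarrow> 'w \<Rightarrow> int \<times> int) \<Rightarrow> (int \<Rightarrow> 'w \<Rightarrow> real set) \<Rightarrow> bool" where
  "dag_model M S X \<longleftrightarrow>
     independent_walks M S \<and>
     (\<forall>i. unit_poisson_process M (X i)) \<and>
     prob_space.indep_vars M (\<lambda>_. counts_space) (\<lambda>i \<omega>. counts (X i \<omega>)) UNIV \<and>
     indep_elements M (PiM UNIV (\<lambda>_. counts_space)) (\<lambda>\<omega> i. counts (X i \<omega>))
                      walks_space (all_walks S)"

text \<open>\<open>star_model\<close> prescribes the law of the inputs for one \<open>n\<close> only. In a statement about a sequence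
  of models \<open>star_model M n (S n) (N n)\<close> on one probability space, the coupling between different
  \<open>n\<close> is therefore arbitrary; using the same walks for all \<open>n\<close> is the case of constant \<open>S\<close>.\<close>

end

theory Submission
  imports Defs "HOL-Real_Asymp.Real_Asymp"
begin

text \<open>Discard every particle that leaves a box of its own before settling; the box of level \<open>i\<close> is
  slightly wider than \<open>n\<close> and its height grows with \<open>\<bar>i\<bar>\<close>. The discarding aggregate \<open>B\<close> is contained in the
  true one, and equal to it if nothing is discarded. Fix the order of the particles.

  \<^item> A site \<open>z\<close> with \<open>\<bar>fst z\<bar> \<le> n/2 - d0\<close> is occupied by \<open>B\<close>: let \<open>h\<close> be the Green function with pole \<open>z\<close> on a
    strip of width about \<open>n\<close>. While \<open>z\<close> is vacant, the sum of \<open>h\<close> over \<open>B\<close> grows on average by the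
    sum of \<open>h\<close> over the starting points. The explicit solution \<open>2(R - \<bar>x\<bar>)(n - R - \<bar>x\<bar>)\<close> of the associated
    Poisson problem shows that this exceeds the sum over the whole strip by a multiple of \<open>d0\<^sup>2\<close>, and an
    exponential supermartingale makes the vacancy of \<open>z\<close> improbable.
  \<^item> Since the inside is full, the same comparison with the Green potential of a small ball leaves at most
    of order \<open>d d0\<close> sites of \<open>B\<close> in any ball of radius \<open>l\<close> near the sides of the box.
  \<^item> A walk crosses such a sparsely occupied ball inside \<open>B\<close> with probability at most of order
    \<open>d d0 log l / l\<^sup>2\<close>, hence it crosses many disjoint layers with negligible probability, and no particle is discarded.

  These bounds are uniform over all orders with typical counts, so they hold for a random order that is
  independent of the walks, and Borel-Cantelli applies.\<close>

section \<open>Potential theory on the square lattice\<close>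

text \<open>Discarding removes a circularity: the Green function estimates need boxes that no
  particle leaves, while the confinement of the particles is a consequence of these estimates. For
  \<open>B\<close> it holds by construction. The sizes are d ~ n^(1/2) and d0 ~ n^(2/5). Up to
  logarithmic factors in the exponent, a vacancy inside costs exp(- d0^3 / n), so d0 has to exceed
  n^(1/3). Near the sides a ball of radius l, proportional to d, holds at most of order d d0 sites;
  the crossing factor d d0 log l / l^2 is about n^(-1/10), a negative power of n because d0 is much
  smaller than d. A number of layers that does not depend on n therefore beats any prescribed power
  of n.\<close>

definition dirs :: "(int \<times> int) set" where
  "dirs = {(1, 0), (-1, 0), (0, 1), (0, -1)}"

text \<open>The transition operator of the walk. \<open>f - avg f\<close> is minus the Laplacian and
  is called the charge of \<open>f\<close> in the comments below; \<open>f z \<le> avg f z\<close>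
  means that \<open>f\<close> is subharmonic at \<open>z\<close>.\<close>

definition avg :: "(int \<times> int \<Rightarrow> real) \<Rightarrow> int \<times> int \<Rightarrow> real" where
  "avg f z = (\<Sum>e\<in>dirs. f (z + e)) / 4"

definition nbrs :: "(int \<times> int) set \<Rightarrow> (int \<times> int) set" where
  "nbrs C = (\<Union>z\<in>C. (+) z ` dirs)"

lemma finite_dirs [simp]: "finite dirs"
  by (simp add: dirs_def)

lemma card_dirs [simp]: "card dirs = 4"
  by (simp add: dirs_def)

lemma finite_nbrs [simp]: "finite C \<Longrightarrow> finite (nbrs C)"
  by (simp add: nbrs_def)

lemma nbrsI: "z \<in> C \<Longrightarrow> e \<in> dirs \<Longrightarrow> z + e \<in> nbrs C"
  by (auto simp: nbrs_def)

lemma nbrsE: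
  assumes "y \<in> nbrs C"
  obtains z e where "z \<in> C" "e \<in> dirs" "y = z + e"
  using assms by (auto simp: nbrs_def)

lemma avg_eq: "avg f (x, y) = (f (x + 1, y) + f (x - 1, y) + f (x, y + 1) + f (x, y - 1)) / 4"
  by (simp add: avg_def dirs_def)

lemma avg_mono: "(\<And>e. e \<in> dirs \<Longrightarrow> f (z + e) \<le> g (z + e)) \<Longrightarrow> avg f z \<le> avg g z"
  unfolding avg_def by (intro divide_right_mono sum_mono) auto

lemma avg_cong: "(\<And>e. e \<in> dirs \<Longrightarrow> f (z + e) = g (z + e)) \<Longrightarrow> avg f z = avg g z"
  unfolding avg_def by (intro arg_cong2[where f = "(/)"] sum.cong) auto

lemma avg_const [simp]: "avg (\<lambda>_. c) z = c"
  by (simp add: avg_def)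

lemma avg_add: "avg (\<lambda>x. f x + g x) z = avg f z + avg g z"
  by (simp add: avg_def sum.distrib add_divide_distrib)

lemma avg_diff: "avg (\<lambda>x. f x - g x) z = avg f z - avg g z"
  by (simp add: avg_def sum_subtractf diff_divide_distrib)

lemma avg_cmult: "avg (\<lambda>x. c * f x) z = c * avg f z"
  by (simp add: avg_def sum_distrib_left)

lemma avg_sum: "avg (\<lambda>x. \<Sum>y\<in>A. f y x) z = (\<Sum>y\<in>A. avg (f y) z)"
  by (simp add: avg_def sum_divide_distrib sum.swap[of _ dirs])

lemma avg_nonneg: "(\<And>x. 0 \<le> f x) \<Longrightarrow> 0 \<le> avg f z"
  unfolding avg_def by (intro divide_nonneg_nonneg sum_nonneg) auto

lemma avg_shift: "avg (\<lambda>x. f (x - y)) z = avg f (z - y)"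
  by (simp add: avg_def algebra_simps)

section \<open>Maximum principle and Poisson problem\<close>

text \<open>Among the points of \<open>C\<close> where the maximum is attained take one furthest to
  the right. The mean value inequality forces its right neighbour to attain the maximum too; by the
  choice of the point this neighbour lies outside \<open>C\<close>, where \<open>u\<close> is at
  most \<open>K\<close>.\<close>

lemma max_principle:
  fixes u :: "int \<times> int \<Rightarrow> real"
  assumes C: "finite C" and sub: "\<And>x. x \<in> C \<Longrightarrow> u x \<le> avg u x"
    and out: "\<And>y. y \<in> nbrs C \<Longrightarrow> y \<notin> C \<Longrightarrow> u y \<le> K" and "x \<in> C"
  shows "u x \<le> K"
proof (rule ccontr)
  assume "\<not> u x \<le> K"
  define m where "m = Max (u ` C)"
  have m: "u y \<le> m" if "y \<in> C" for y
    using C that by (simp add: m_def)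
  have "m > K" using m[OF \<open>x \<in> C\<close>] \<open>\<not> u x \<le> K\<close> by simp
  define C' where "C' = {y \<in> C. u y = m}"
  have "m \<in> u ` C" using C \<open>x \<in> C\<close> unfolding m_def by (intro Max_in) auto
  hence "C' \<noteq> {}" by (auto simp: C'_def)
  have "finite C'" using C by (simp add: C'_def)
  define a where "a = Max (fst ` C')"
  have "a \<in> fst ` C'" using \<open>finite C'\<close> \<open>C' \<noteq> {}\<close> unfolding a_def by (intro Max_in) auto
  then obtain z where z: "z \<in> C'" "fst z = a" by auto
  have zC: "z \<in> C" "u z = m" using z by (auto simp: C'_def)
  have le: "u (z + e) \<le> m" if "e \<in> dirs" for e
    using m[of "z + e"] out[of "z + e"] nbrsI[OF zC(1) that] \<open>m > K\<close> by force
  have e: "(1, 0) \<in> dirs" by (simp add: dirs_def)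
  have "u (z + (1, 0)) = m"
  proof (rule ccontr)
    assume "u (z + (1, 0)) \<noteq> m"
    hence "u (z + (1, 0)) < m" using le[OF e] by simp
    hence "(\<Sum>e\<in>dirs. u (z + e)) < (\<Sum>e\<in>dirs. m)"
      using le e by (intro sum_strict_mono_ex1) auto
    hence "avg u z < m" by (simp add: avg_def)
    thus False using sub[OF zC(1)] zC by simp
  qed
  moreover have "z + (1, 0) \<in> C"
    using out[OF nbrsI[OF zC(1) e]] calculation \<open>m > K\<close> by force
  ultimately have "z + (1, 0) \<in> C'" by (simp add: C'_def)
  hence "fst (z + (1, 0)) \<in> fst ` C'" by (rule imageI)
  hence "fst (z + (1, 0)) \<le> a" using \<open>finite C'\<close> unfolding a_def by (intro Max_ge) simp_all
  thus False using z by simp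
qed

text \<open>Green functions and hitting probabilities are bounded below by exhibiting a function
  \<open>F\<close> that has at least their charge and at least their boundary values.\<close>

lemma comparison:
  assumes "finite C"
    and sub: "\<And>x. x \<in> C \<Longrightarrow> u x - avg u x \<le> F x - avg F x"
    and out: "\<And>y. y \<in> nbrs C \<Longrightarrow> y \<notin> C \<Longrightarrow> u y \<le> F y" and "x \<in> C"
  shows "u x \<le> F x"
proof -
  have "(\<lambda>x. u x - F x) x \<le> 0"
  proof (rule max_principle[OF \<open>finite C\<close> _ _ \<open>x \<in> C\<close>])
    fix y assume "y \<in> C"
    show "u y - F y \<le> avg (\<lambda>x. u x - F x) y"
      using sub[OF \<open>y \<in> C\<close>] by (simp add: avg_diff)
  next
    fix y assume "y \<in> nbrs C" "y \<notin> C"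
    from out[OF this] show "u y - F y \<le> 0" by simp
  qed
  thus ?thesis by simp
qed

text \<open>For integer R, the expected exit time from the strip |x| < R. A step is horizontal with
  probability 1/2, whence the factor 2 in front of the one-dimensional value.\<close>

definition parab :: "real \<Rightarrow> int \<times> int \<Rightarrow> real" where
  "parab R z = 2 * (R\<^sup>2 - (of_int (fst z))\<^sup>2)"

lemma avg_parab: "avg (parab R) z = parab R z - 1"
  by (cases z) (simp add: avg_eq parab_def power2_eq_square field_simps)

lemma finite_bounded_fst:
  assumes "finite (C :: (int \<times> int) set)"
  obtains R :: nat where "R \<ge> 1" "\<And>z. z \<in> C \<Longrightarrow> \<bar>fst z\<bar> < int R"
proof -
  define R where "R = nat (Max (insert 1 ((\<lambda>z. \<bar>fst z\<bar>) ` C)) + 1)"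
  have fin: "finite (insert 1 ((\<lambda>z. \<bar>fst z\<bar>) ` C))" using assms by simp
  have "Max (insert 1 ((\<lambda>z. \<bar>fst z\<bar>) ` C)) \<ge> 1" by (rule Max_ge[OF fin]) simp
  moreover have "\<bar>fst z\<bar> \<le> Max (insert 1 ((\<lambda>z. \<bar>fst z\<bar>) ` C))" if "z \<in> C" for z
    by (rule Max_ge[OF fin]) (use that in simp)
  ultimately show ?thesis by (intro that[of R]) (force simp: R_def)+
qed

lemma parab_nonneg: "\<bar>fst z\<bar> \<le> int R \<Longrightarrow> 0 \<le> parab (real R) z"
proof -
  assume "\<bar>fst z\<bar> \<le> int R"
  hence "\<bar>real_of_int (fst z)\<bar> \<le> real R" by linarith
  hence "(real_of_int (fst z))\<^sup>2 \<le> (real R)\<^sup>2" by (metis abs_le_square_iff abs_of_nat)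
  thus ?thesis by (simp add: parab_def)
qed

lemma fst_nbr: "y \<in> nbrs C \<Longrightarrow> (\<And>z. z \<in> C \<Longrightarrow> \<bar>fst z\<bar> < R) \<Longrightarrow> \<bar>fst y\<bar> \<le> R"
proof (elim nbrsE)
  fix z e assume a: "\<And>z. z \<in> C \<Longrightarrow> \<bar>fst z\<bar> < R" "z \<in> C" "e \<in> dirs" "y = z + e"
  have "\<bar>fst z\<bar> < R" by (rule a(1)[OF a(2)])
  moreover have "\<bar>fst e\<bar> \<le> 1" using a(3) by (auto simp: dirs_def)
  ultimately show ?thesis using a(4) by simp
qed

text \<open>The iteration v -> avg v + mu, started at zero inside \<open>C\<close>, is increasing. A
  constant plus a multiple of \<open>parab\<close> bounds it, so it converges to a solution.\<close>

lemma poisson_problem: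
  fixes \<mu> \<phi> :: "int \<times> int \<Rightarrow> real"
  assumes C: "finite C" and nonneg: "\<And>x. 0 \<le> \<mu> x" "\<And>x. 0 \<le> \<phi> x"
  shows "\<exists>u. (\<forall>x. x \<notin> C \<longrightarrow> u x = \<phi> x) \<and> (\<forall>x\<in>C. u x = avg u x + \<mu> x) \<and> (\<forall>x. 0 \<le> u x)"
proof -
  define it where "it = rec_nat (\<lambda>x. if x \<in> C then 0 else \<phi> x)
      (\<lambda>_ v x. if x \<in> C then avg v x + \<mu> x else \<phi> x)"
  have it0: "it 0 = (\<lambda>x. if x \<in> C then 0 else \<phi> x)"
    and itS: "it (Suc t) = (\<lambda>x. if x \<in> C then avg (it t) x + \<mu> x else \<phi> x)" for t
    unfolding it_def by simp_all
  have it_nonneg: "0 \<le> it t x" for t x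
    by (induction t arbitrary: x) (simp_all add: it0 itS nonneg avg_nonneg)
  have mono: "it t x \<le> it (Suc t) x" for t x
  proof (induction t arbitrary: x)
    case 0
    show ?case by (auto simp: it0 itS nonneg intro!: add_nonneg_nonneg avg_nonneg)
  next
    case (Suc t)
    show ?case
      using avg_mono[where z = x and f = "it t" and g = "it (Suc t)"] Suc
      by (simp add: itS[of "Suc t", THEN fun_cong] itS[of t, THEN fun_cong])
  qed
  obtain R where R: "R \<ge> 1" "\<And>z. z \<in> C \<Longrightarrow> \<bar>fst z\<bar> < int R"
    using finite_bounded_fst[OF C] by blast
  define B where "B = (\<Sum>y\<in>nbrs C. \<phi> y)"
  define m where "m = (\<Sum>y\<in>C. \<mu> y)"
  have B: "\<phi> y \<le> B" if "y \<in> nbrs C" for y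
    unfolding B_def using that C nonneg by (intro member_le_sum) auto
  have "0 \<le> B" unfolding B_def by (intro sum_nonneg nonneg)
  have m: "\<mu> y \<le> m" if "y \<in> C" for y
    unfolding m_def using that C nonneg by (intro member_le_sum) auto
  have "0 \<le> m" unfolding m_def by (intro sum_nonneg nonneg)
  \<comment> \<open>\<open>B\<close> dominates the boundary values. As \<open>parab\<close> has
    charge 1 everywhere, the second summand has at least the charge of \<open>\<mu>\<close>.\<close>
  define F where "F z = B + m * parab (real R) z" for z
  have F: "0 \<le> parab (real R) z" "B \<le> F z" if "\<bar>fst z\<bar> \<le> int R" for z
    using parab_nonneg[OF that] \<open>0 \<le> m\<close> by (auto simp: F_def)
  have bd: "it t x \<le> F x" if "x \<in> C" for t x
    using that
  proof (induction t arbitrary: x)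
    case 0
    thus ?case using F(2)[of x] R(2)[of x] \<open>0 \<le> B\<close> by (simp add: it0)
  next
    case (Suc t)
    have "avg (it t) x \<le> avg F x"
    proof (rule avg_mono)
      fix e assume e: "e \<in> dirs"
      have n: "x + e \<in> nbrs C" using Suc.prems e by (rule nbrsI)
      have "\<bar>fst (x + e)\<bar> \<le> int R" using n R(2) by (rule fst_nbr)
      hence "\<phi> (x + e) \<le> F (x + e)" using B[OF n] F(2)[of "x + e"] by linarith
      thus "it t (x + e) \<le> F (x + e)"
        using Suc.IH[of "x + e"] by (cases "x + e \<in> C"; cases t) (auto simp: it0 itS)
    qed
    also have "avg F x = F x - m" unfolding F_def by (simp add: avg_add avg_cmult avg_parab algebra_simps)
    finally show ?case using m[OF Suc.prems] Suc.prems by (simp add: itS)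
  qed
  have off: "it t x = \<phi> x" if "x \<notin> C" for t x
    using that by (cases t) (simp_all add: it0 itS)
  have conv: "convergent (\<lambda>t. it t x)" for x
  proof (cases "x \<in> C")
    case True
    have "incseq (\<lambda>t. it t x)" using mono by (intro incseq_SucI)
    thus ?thesis using bd[OF True] it_nonneg[of _ x]
      by (intro Bseq_monoseq_convergent BseqI'[of _ "F x"] incseq_imp_monoseq) auto
  qed (simp add: off convergent_const)
  define u where "u x = lim (\<lambda>t. it t x)" for x
  have u: "(\<lambda>t. it t x) \<longlonglongrightarrow> u x" for x
    using conv[of x] by (simp add: convergent_LIMSEQ_iff u_def)
  have "u x = avg u x + \<mu> x" if "x \<in> C" for x
  proof (rule LIMSEQ_unique)
    show "(\<lambda>t. it (Suc t) x) \<longlonglongrightarrow> u x" by (rule LIMSEQ_Suc[OF u])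
    show "(\<lambda>t. it (Suc t) x) \<longlonglongrightarrow> avg u x + \<mu> x"
      using that unfolding itS avg_def by (auto intro!: tendsto_intros u)
  qed
  moreover have "0 \<le> u x" for x
    by (rule LIMSEQ_le_const[OF u]) (use it_nonneg in auto)
  moreover have "u x = \<phi> x" if "x \<notin> C" for x
    using that off by (simp add: u_def)
  ultimately show ?thesis by blast
qed

text \<open>The Green potential of \<open>\<mu>\<close>: the expected sum of \<open>\<mu>\<close>
  along a walk up to its exit from \<open>C\<close>. For a unit mass it is the Green function with
  that pole.\<close>

definition green :: "(int \<times> int) set \<Rightarrow> (int \<times> int \<Rightarrow> real) \<Rightarrow> int \<times> int \<Rightarrow> real" where
  "green C \<mu> = (SOME u. (\<forall>x. x \<notin> C \<longrightarrow> u x = 0) \<and> (\<forall>x\<in>C. u x = avg u x + \<mu> x) \<and> (\<forall>x. 0 \<le> u x))"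

lemma green:
  assumes "finite C" "\<And>x. 0 \<le> \<mu> x"
  shows green_outside: "x \<notin> C \<Longrightarrow> green C \<mu> x = 0"
    and green_eq: "x \<in> C \<Longrightarrow> green C \<mu> x = avg (green C \<mu>) x + \<mu> x"
    and green_nonneg: "0 \<le> green C \<mu> x"
proof -
  have "(\<forall>x. x \<notin> C \<longrightarrow> green C \<mu> x = 0) \<and> (\<forall>x\<in>C. green C \<mu> x = avg (green C \<mu>) x + \<mu> x) \<and>
      (\<forall>x. 0 \<le> green C \<mu> x)"
    using someI_ex[OF poisson_problem[OF assms, of "\<lambda>_. 0"]] unfolding green_def by simp
  thus "x \<notin> C \<Longrightarrow> green C \<mu> x = 0" "x \<in> C \<Longrightarrow> green C \<mu> x = avg (green C \<mu>) x + \<mu> x"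
    "0 \<le> green C \<mu> x" by blast+
qed

lemma green_le:
  assumes C: "finite C" "\<And>x. 0 \<le> \<mu> x"
    and sup: "\<And>x. x \<in> C \<Longrightarrow> \<mu> x \<le> F x - avg F x"
    and out: "\<And>y. y \<in> nbrs C \<Longrightarrow> y \<notin> C \<Longrightarrow> 0 \<le> F y" and "x \<in> C"
  shows "green C \<mu> x \<le> F x"
  using \<open>finite C\<close> _ _ \<open>x \<in> C\<close>
proof (rule comparison)
  fix x assume "x \<in> C"
  thus "green C \<mu> x - avg (green C \<mu>) x \<le> F x - avg F x"
    using green_eq[OF C \<open>x \<in> C\<close>] sup[OF \<open>x \<in> C\<close>] by simp
qed (simp add: green_outside[OF C] out)

lemma le_green:
  assumes C: "finite C" "\<And>x. 0 \<le> \<mu> x"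
    and sub: "\<And>x. x \<in> C \<Longrightarrow> v x - avg v x \<le> \<mu> x"
    and out: "\<And>y. y \<in> nbrs C \<Longrightarrow> y \<notin> C \<Longrightarrow> v y \<le> 0" and "x \<in> C"
  shows "v x \<le> green C \<mu> x"
  using \<open>finite C\<close> _ _ \<open>x \<in> C\<close>
proof (rule comparison)
  fix x assume "x \<in> C"
  thus "v x - avg v x \<le> green C \<mu> x - avg (green C \<mu>) x"
    using green_eq[OF C \<open>x \<in> C\<close>] sub[OF \<open>x \<in> C\<close>] by simp
qed (simp add: green_outside[OF C] out)

section \<open>Logarithmic potentials and Green's identity\<close>

definition sqn :: "int \<times> int \<Rightarrow> real" where
  "sqn z = (of_int (fst z))\<^sup>2 + (of_int (snd z))\<^sup>2"

lemma sqn_nonneg [simp]: "0 \<le> sqn z"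
  by (simp add: sqn_def)

lemma sqn_0 [simp]: "sqn (0, 0) = 0" "sqn 0 = 0"
  by (simp_all add: sqn_def)

lemma avg_sqn: "avg sqn z = sqn z + 1"
  by (cases z) (simp add: avg_eq sqn_def power2_eq_square field_simps)

text \<open>An explicit substitute for the potential kernel of the planar walk. Base 2 makes its
  average around the origin equal to 1, so that \<open>L - logpot\<close> has charge exactly 1 at
  the origin and nonnegative charge elsewhere.\<close>

definition logpot :: "int \<times> int \<Rightarrow> real" where
  "logpot z = log 2 (1 + sqn z)"

lemma logpot_0 [simp]: "logpot 0 = 0"
  by (simp add: logpot_def)

lemma logpot_nonneg: "0 \<le> logpot z"
  using sqn_nonneg[of z] unfolding logpot_def by (intro zero_le_log_cancel_iff[THEN iffD2]) linarith+

lemma avg_logpot_0: "avg logpot 0 = 1"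
  by (simp add: zero_prod_def avg_eq logpot_def sqn_def)

text \<open>With \<open>s = 1 + x\<^sup>2 + y\<^sup>2\<close> the product of the four neighbouring values of \<open>1 + sqn\<close> is
  \<open>((s + 1)\<^sup>2 - 4x\<^sup>2)((s + 1)\<^sup>2 - 4y\<^sup>2) = s\<^sup>4 + 2s\<^sup>2 + 8s + 4 - 3 + 16x\<^sup>2y\<^sup>2\<close> up to nonnegative terms.\<close>

lemma logpot_subharmonic: "logpot z \<le> avg logpot z"
proof -
  obtain i j where z: "z = (i, j)" by (cases z)
  define x y :: real where "x = of_int i" and "y = of_int j"
  define s where "s = 1 + (x\<^sup>2 + y\<^sup>2)"
  define p where "p = (1 + ((x+1)\<^sup>2 + y\<^sup>2)) * (1 + ((x-1)\<^sup>2 + y\<^sup>2)) *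
      ((1 + (x\<^sup>2 + (y+1)\<^sup>2)) * (1 + (x\<^sup>2 + (y-1)\<^sup>2)))"
  have pos: "0 < 1 + (a\<^sup>2 + b\<^sup>2)" for a b :: real
    by (intro add_pos_nonneg) auto
  have "s \<ge> 1" by (simp add: s_def)
  have "p - s ^ 4 = 2 * s\<^sup>2 + 8 * s + 5 + 16 * (x\<^sup>2 * y\<^sup>2)"
    unfolding p_def s_def by algebra
  hence "s ^ 4 \<le> p" using \<open>s \<ge> 1\<close>
    by (smt (verit) zero_le_power2 mult_nonneg_nonneg)
  hence "log 2 (s ^ 4) \<le> log 2 p"
    using \<open>s \<ge> 1\<close> by (intro log_mono) auto
  also have "log 2 p = log 2 (1 + ((x+1)\<^sup>2 + y\<^sup>2)) + log 2 (1 + ((x-1)\<^sup>2 + y\<^sup>2)) +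
      (log 2 (1 + (x\<^sup>2 + (y+1)\<^sup>2)) + log 2 (1 + (x\<^sup>2 + (y-1)\<^sup>2)))"
    unfolding p_def by (simp add: log_mult_pos pos)
  also have "log 2 (s ^ 4) = 4 * log 2 s"
    using \<open>s \<ge> 1\<close> by (simp add: log_nat_power)
  finally show ?thesis
    unfolding z avg_eq logpot_def sqn_def by (simp add: x_def y_def s_def)
qed

text \<open>The functions \<open>L - logpot (x - y)\<close> are superharmonic in \<open>x\<close>,
  have charge 1 at \<open>y\<close> and are nonnegative on \<open>C\<close> and its neighbours.
  Superposed with the weights \<open>\<mu> y\<close> they dominate the potential.\<close>

lemma green_le_log:
  assumes C: "finite C" "\<And>x. 0 \<le> \<mu> x"
    and L: "\<And>x y. x \<in> C \<union> nbrs C \<Longrightarrow> y \<in> C \<Longrightarrow> logpot (x - y) \<le> L"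
  shows "green C \<mu> x \<le> L * (\<Sum>y\<in>C. \<mu> y)"
proof (cases "x \<in> C")
  case True
  define F where "F = (\<lambda>x. \<Sum>y\<in>C. \<mu> y * (L - logpot (x - y)))"
  have avgF: "avg F z = (\<Sum>y\<in>C. \<mu> y * (L - avg logpot (z - y)))" for z
    unfolding F_def avg_sum by (intro sum.cong refl) (simp add: avg_cmult avg_diff avg_shift[of logpot])
  have "green C \<mu> x \<le> F x"
  proof (rule green_le[OF C _ _ True])
    fix z assume "z \<in> C"
    have "\<mu> z = (\<Sum>y\<in>C. if y = z then \<mu> y else 0)" using \<open>z \<in> C\<close> C by simp
    also have "\<dots> \<le> (\<Sum>y\<in>C. \<mu> y * (avg logpot (z - y) - logpot (z - y)))"
    proof (rule sum_mono)
      fix y assume "y \<in> C"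
      show "(if y = z then \<mu> y else 0) \<le> \<mu> y * (avg logpot (z - y) - logpot (z - y))"
        using C(2)[of y] logpot_subharmonic[of "z - y"] by (auto simp: avg_logpot_0)
    qed
    also have "\<dots> = F z - avg F z"
      unfolding avgF by (simp add: F_def sum_subtractf[symmetric] algebra_simps)
    finally show "\<mu> z \<le> F z - avg F z" .
  next
    fix y assume "y \<in> nbrs C" "y \<notin> C"
    thus "0 \<le> F y" unfolding F_def using C L by (intro sum_nonneg mult_nonneg_nonneg) auto
  qed
  also have "F x \<le> (\<Sum>y\<in>C. \<mu> y * L)"
    unfolding F_def using C(2) by (intro sum_mono mult_left_mono) (auto simp: logpot_nonneg)
  also have "\<dots> = L * (\<Sum>y\<in>C. \<mu> y)" by (simp add: sum_distrib_left mult.commute)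
  finally show ?thesis .
next
  case False
  have "0 \<le> L * (\<Sum>y\<in>C. \<mu> y)"
  proof (cases "C = {}")
    case False
    then obtain y where "y \<in> C" by auto
    hence "logpot (y - y) \<le> L" by (intro L) auto
    thus ?thesis using C(2) by (intro mult_nonneg_nonneg sum_nonneg) auto
  qed simp
  thus ?thesis using False by (simp add: green_outside[OF C])
qed

text \<open>\<open>avg\<close> is self-adjoint because \<open>dirs\<close> is closed under negation.
  The left sum includes \<open>nbrs D\<close> because \<open>avg \<psi>\<close> reaches one step
  beyond the support of \<open>\<psi>\<close>.\<close>

lemma sum_avg_swap:
  assumes D: "finite D" and out: "\<And>x. x \<notin> D \<Longrightarrow> \<psi> x = 0"
  shows "(\<Sum>x\<in>D \<union> nbrs D. f x * avg \<psi> x) = (\<Sum>x\<in>D. \<psi> x * avg f x)"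
proof -
  have shift: "(\<Sum>x\<in>D \<union> nbrs D. f x * \<psi> (x + e)) = (\<Sum>y\<in>D. \<psi> y * f (y + - e))" if "e \<in> dirs" for e
  proof -
    have e: "- e \<in> dirs" using that by (auto simp: dirs_def)
    have "(\<Sum>x\<in>D \<union> nbrs D. f x * \<psi> (x + e)) = (\<Sum>x\<in>(\<lambda>y. y + - e) ` D. f x * \<psi> (x + e))"
    proof (rule sum.mono_neutral_right)
      show "(\<lambda>y. y + - e) ` D \<subseteq> D \<union> nbrs D" using nbrsI[OF _ e] by blast
      show "\<forall>i\<in>D \<union> nbrs D - (\<lambda>y. y + - e) ` D. f i * \<psi> (i + e) = 0"
      proof
        fix i assume i: "i \<in> D \<union> nbrs D - (\<lambda>y. y + - e) ` D"
        have "i = (i + e) + - e" by simp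
        hence "i + e \<notin> D" using i by blast
        thus "f i * \<psi> (i + e) = 0" by (simp add: out)
      qed
    qed (use D in simp)
    also have "\<dots> = (\<Sum>y\<in>D. \<psi> y * f (y + - e))"
      by (subst sum.reindex) (auto simp: inj_on_def mult.commute)
    finally show ?thesis .
  qed
  have "(\<Sum>x\<in>D \<union> nbrs D. f x * avg \<psi> x) = (\<Sum>e\<in>dirs. \<Sum>x\<in>D \<union> nbrs D. f x * \<psi> (x + e)) / 4"
    by (simp add: avg_def sum_distrib_left sum_divide_distrib sum.swap[of _ dirs])
  also have "\<dots> = (\<Sum>e\<in>dirs. \<Sum>y\<in>D. \<psi> y * f (y + - e)) / 4"
    using shift by simp
  also have "(\<Sum>e\<in>dirs. \<Sum>y\<in>D. \<psi> y * f (y + - e)) = (\<Sum>e\<in>dirs. \<Sum>y\<in>D. \<psi> y * f (y + e))"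
    by (rule sum.reindex_bij_witness[of _ uminus uminus]) (auto simp: dirs_def)
  also have "\<dots> / 4 = (\<Sum>x\<in>D. \<psi> x * avg f x)"
    by (simp add: avg_def sum_distrib_left sum_divide_distrib sum.swap[of _ dirs])
  finally show ?thesis .
qed

text \<open>Green's second identity for a potential that vanishes outside \<open>D\<close>. With an
  explicit \<open>f\<close> it evaluates weighted sums of a Green function by the values of
  \<open>f\<close> on the support of \<open>\<mu>\<close>, up to a boundary sum.\<close>

lemma green_parts:
  assumes D: "finite D" "\<And>x. 0 \<le> \<mu> x"
  shows "(\<Sum>x\<in>D. green D \<mu> x * (f x - avg f x)) =
    (\<Sum>x\<in>D. f x * \<mu> x) - (\<Sum>x\<in>nbrs D - D. f x * avg (green D \<mu>) x)"
proof -
  let ?g = "green D \<mu>"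
  have "(\<Sum>x\<in>D. ?g x * avg f x) = (\<Sum>x\<in>D \<union> nbrs D. f x * avg ?g x)"
    using sum_avg_swap[OF D(1), of ?g f] green_outside[OF D] by simp
  also have "D \<union> nbrs D = D \<union> (nbrs D - D)" by auto
  also have "(\<Sum>x\<in>\<dots>. f x * avg ?g x) = (\<Sum>x\<in>D. f x * avg ?g x) + (\<Sum>x\<in>nbrs D - D. f x * avg ?g x)"
    using D by (intro sum.union_disjoint) auto
  also have "(\<Sum>x\<in>D. f x * avg ?g x) = (\<Sum>x\<in>D. f x * ?g x) - (\<Sum>x\<in>D. f x * \<mu> x)"
    using green_eq[OF D] by (simp add: sum_subtractf[symmetric] algebra_simps)
  finally show ?thesis
    by (simp add: sum_subtractf right_diff_distrib mult.commute)
qed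

section \<open>Crossing sparsely occupied balls\<close>

definition nrm :: "int \<times> int \<Rightarrow> real" where
  "nrm z = sqrt (sqn z)"

lemma nrm_triangle: "nrm (x + y) \<le> nrm x + nrm y"
  using real_sqrt_sum_squares_triangle_ineq[of "of_int (fst x)" "of_int (fst y)" "of_int (snd x)" "of_int (snd y)"]
  by (simp add: nrm_def sqn_def)

lemma nrm_minus: "nrm (- x) = nrm x"
  by (simp add: nrm_def sqn_def)

lemma nrm_dirs: "e \<in> dirs \<Longrightarrow> nrm e = 1"
  by (auto simp: dirs_def nrm_def sqn_def)

lemma sqn_less_iff: "0 \<le> l \<Longrightarrow> sqn z < l\<^sup>2 \<longleftrightarrow> nrm z < l"
  by (metis nrm_def real_sqrt_less_iff real_sqrt_abs abs_of_nonneg)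

lemma logpot_le: "nrm z \<le> r \<Longrightarrow> logpot z \<le> log 2 (1 + r\<^sup>2)"
proof -
  assume "nrm z \<le> r"
  hence "sqn z \<le> r\<^sup>2" unfolding nrm_def by (rule sqrt_le_D)
  thus ?thesis unfolding logpot_def
    by (intro log_mono) (auto intro: add_pos_nonneg)
qed

lemma abs_fst_le_nrm: "\<bar>real_of_int (fst z)\<bar> \<le> nrm z"
  and abs_snd_le_nrm: "\<bar>real_of_int (snd z)\<bar> \<le> nrm z"
  by (simp_all add: nrm_def sqn_def)

text \<open>The comparison function is the square of the distance to \<open>x0\<close>, corrected by logarithmic
  potentials on the occupied sites of the ball.\<close>

lemma ball_crossing:
  assumes C: "finite C" "x0 \<in> C" and l: "0 < l" and K: "0 \<le> K"
    and sub: "\<And>x. x \<in> C \<Longrightarrow> u x \<le> avg u x"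
    and inside: "\<And>y. y \<notin> C \<Longrightarrow> nrm (y - x0) < l \<Longrightarrow> u y \<le> 0"
    and outside: "\<And>y. l \<le> nrm (y - x0) \<Longrightarrow> nrm (y - x0) \<le> l + 1 \<Longrightarrow> u y \<le> K"
  shows "u x0 \<le> K * (card {x \<in> C. nrm (x - x0) < l} * log 2 (1 + (2 * l + 1)\<^sup>2) / l\<^sup>2)"
proof -
  define C' where "C' = {x \<in> C. nrm (x - x0) < l}"
  define L where "L = log 2 (1 + (2 * l + 1)\<^sup>2)"
  define F where "F = (\<lambda>z. K * ((1 / l\<^sup>2) * sqn (z - x0) + (1 / l\<^sup>2) * (\<Sum>y\<in>C'. L - logpot (z - y))))"
  have fin: "finite C'" using C by (simp add: C'_def)
  have avgF: "avg F z = K * ((1 / l\<^sup>2) * (sqn (z - x0) + 1) + (1 / l\<^sup>2) * (\<Sum>y\<in>C'. L - avg logpot (z - y)))" for z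
    unfolding F_def by (simp only: avg_cmult avg_add avg_sum avg_diff avg_shift[of logpot] avg_shift[of sqn] avg_const avg_sqn)
  have "x0 \<in> C'" using C l by (simp add: C'_def nrm_def)
  have "u x0 \<le> F x0"
    using fin _ _ \<open>x0 \<in> C'\<close>
  proof (rule comparison)
    fix z assume z: "z \<in> C'"
    \<comment> \<open>The charge of \<open>sqn\<close> is -1. The logarithmic potential whose pole
      is the occupied site \<open>z\<close> itself compensates this, and the other poles contribute
      nonnegative charge.\<close>
    have "1 = (\<Sum>y\<in>C'. if y = z then 1 else 0 :: real)" using z fin by simp
    also have "\<dots> \<le> (\<Sum>y\<in>C'. avg logpot (z - y) - logpot (z - y))"
      using logpot_subharmonic by (intro sum_mono) (auto simp: avg_logpot_0)
    finally have *: "(\<Sum>y\<in>C'. L - avg logpot (z - y)) + 1 \<le> (\<Sum>y\<in>C'. L - logpot (z - y))"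
      by (simp add: sum_subtractf)
    have "avg F z \<le> F z"
      apply (subst avgF)
      unfolding F_def using K *
      by (intro mult_left_mono) (simp_all add: add_divide_distrib[symmetric] divide_right_mono)
    thus "u z - avg u z \<le> F z - avg F z" using sub[of z] z by (simp add: C'_def)
  next
    fix y assume y: "y \<in> nbrs C'" "y \<notin> C'"
    have ball: "nrm (y - x) \<le> 2 * l + 1" "nrm (y - x0) \<le> l + 1" if "x \<in> C'" for x
    proof -
      obtain z e where z: "z \<in> C'" "e \<in> dirs" "y = z + e" using y by (elim nbrsE)
      have "nrm (y - x0) \<le> nrm (z - x0) + nrm e" using nrm_triangle[of "z - x0" e] z by (simp add: algebra_simps)
      thus 1: "nrm (y - x0) \<le> l + 1" using z nrm_dirs[of e] by (simp add: C'_def)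
      have "nrm (y - x) \<le> nrm (y - x0) + nrm (- (x - x0))" using nrm_triangle[of "y - x0" "- (x - x0)"] by simp
      thus "nrm (y - x) \<le> 2 * l + 1" using 1 that by (simp add: C'_def nrm_minus[of "x - x0"] del: minus_diff_eq)
    qed
    have S: "0 \<le> (\<Sum>x\<in>C'. L - logpot (y - x))"
      using ball(1) logpot_le unfolding L_def by (intro sum_nonneg) (auto simp: le_diff_eq)
    show "u y \<le> F y"
    proof (cases "nrm (y - x0) < l")
      case True
      hence "u y \<le> 0" using y inside[of y] by (auto simp: C'_def)
      also have "0 \<le> F y" unfolding F_def using S K by simp
      finally show ?thesis .
    next
      case False
      hence "u y \<le> K" using outside[of y] ball(2)[OF \<open>x0 \<in> C'\<close>] by auto
      also have "1 \<le> (1 / l\<^sup>2) * sqn (y - x0)"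
        using False sqn_less_iff[of l "y - x0"] l by (simp add: field_simps)
      hence "1 \<le> (1 / l\<^sup>2) * sqn (y - x0) + (1 / l\<^sup>2) * (\<Sum>x\<in>C'. L - logpot (y - x))"
        using S by (intro add_increasing2 mult_nonneg_nonneg) auto
      hence "K \<le> F y" unfolding F_def using K mult_left_mono[of 1 _ K] by force
      finally show ?thesis .
    qed
  qed
  also have "F x0 \<le> K * ((1 / l\<^sup>2) * (\<Sum>y\<in>C'. L))"
  proof -
    have "(\<Sum>y\<in>C'. L - logpot (x0 - y)) \<le> (\<Sum>y\<in>C'. L)"
      by (intro sum_mono) (simp add: logpot_nonneg)
    thus ?thesis unfolding F_def using K by (intro mult_left_mono) (simp_all add: divide_right_mono)
  qed
  finally show ?thesis by (simp add: C'_def L_def)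
qed

text \<open>\<open>\<xi>\<close> measures depth, and \<open>u\<close> stands for the probability
  that a walk inside \<open>C\<close> ends beyond the deepest layer. The induction starts at the
  deepest layer and works back to depth \<open>c\<close>; every layer gains a factor
  \<open>q\<close> by \<open>ball_crossing\<close>.\<close>

lemma layered_crossing:
  fixes \<xi> :: "int \<times> int \<Rightarrow> real"
  assumes C: "finite C" and l: "0 < l" and q: "0 \<le> q"
    and lip: "\<And>x y. \<xi> y \<le> \<xi> x + nrm (y - x)"
    and sub: "\<And>x. x \<in> C \<Longrightarrow> u x \<le> avg u x"
    and u: "\<And>x. u x \<le> 1"
    and off: "\<And>x. x \<notin> C \<Longrightarrow> \<xi> x \<le> c + m * (l + 2) \<Longrightarrow> u x \<le> 0"
    and dens: "\<And>x0. x0 \<in> C \<Longrightarrow> c < \<xi> x0 \<Longrightarrow> \<xi> x0 \<le> c + m * (l + 2) \<Longrightarrow>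
      card {x \<in> C. nrm (x - x0) < l} * log 2 (1 + (2 * l + 1)\<^sup>2) / l\<^sup>2 \<le> q"
    and "\<xi> x \<le> c"
  shows "u x \<le> q ^ m"
proof -
  have "\<forall>x. \<xi> x \<le> c + (real m - real k) * (l + 2) \<longrightarrow> u x \<le> q ^ k" if "k \<le> m" for k
    using that
  proof (induction k)
    case 0
    thus ?case using u by simp
  next
    case (Suc k)
    define t where "t = c + (real m - real (Suc k)) * (l + 2)"
    have t1: "t + (l + 2) = c + (real m - real k) * (l + 2)" by (simp add: t_def algebra_simps)
    have "(real m - real k) * (l + 2) \<le> real m * (l + 2)" using l by (intro mult_right_mono) auto
    hence t2: "t + (l + 2) \<le> c + m * (l + 2)" using t1 by linarith
    have t3: "c \<le> t" unfolding t_def using Suc.prems l by simp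
    have IH: "u x \<le> q ^ k" if "\<xi> x \<le> t + (l + 2)" for x
      using Suc.IH Suc.prems that t1 by (metis Suc_leD)
    have qk: "0 \<le> q ^ k" "0 \<le> q ^ Suc k" using q by simp_all
    \<comment> \<open>The shell at depth t has thickness 1 because a step may overshoot by 1, and a
      walk leaving a ball of radius l overshoots by at most 1 again. So the ball is left at depth at
      most t + l + 2, where the induction hypothesis applies; this explains the width l + 2.\<close>
    have shell: "u y \<le> q ^ Suc k" if y: "y \<in> C" "t < \<xi> y" "\<xi> y \<le> t + 1" for y
    proof -
      have "u y \<le> q ^ k * (card {x \<in> C. nrm (x - y) < l} * log 2 (1 + (2 * l + 1)\<^sup>2) / l\<^sup>2)"
      proof (rule ball_crossing[OF C y(1) l qk(1) sub])
        fix z assume "z \<notin> C" "nrm (z - y) < l"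
        thus "u z \<le> 0" using off[of z] lip[of z y] y t2 by linarith
      next
        fix z assume "nrm (z - y) \<le> l + 1"
        thus "u z \<le> q ^ k" using IH[of z] lip[of z y] y by linarith
      qed
      also have "\<dots> \<le> q ^ k * q"
        using y t2 t3 l by (intro mult_left_mono[OF dens] qk) auto
      finally show ?thesis by (simp add: mult.commute)
    qed
    show ?case
    proof (intro allI impI)
      fix x assume "\<xi> x \<le> c + (real m - real (Suc k)) * (l + 2)"
      hence x: "\<xi> x \<le> t" by (simp add: t_def)
      show "u x \<le> q ^ Suc k"
      proof (cases "x \<in> C")
        case False
        thus ?thesis using off[of x] x t2 l qk(2) by simp
      next
        case True
        \<comment> \<open>A walk that starts at depth at most t meets the shell or leaves
          \<open>C\<close> first, so the bound on the shell carries over.\<close>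
        show ?thesis
        proof (rule max_principle[of "{x \<in> C. \<xi> x \<le> t}"])
          fix y assume y: "y \<in> nbrs {x \<in> C. \<xi> x \<le> t}" "y \<notin> {x \<in> C. \<xi> x \<le> t}"
          then obtain z e where z: "z \<in> C" "\<xi> z \<le> t" "e \<in> dirs" "y = z + e" by (auto elim!: nbrsE)
          hence y1: "\<xi> y \<le> t + 1" using lip[of y z] nrm_dirs[of e] by simp
          show "u y \<le> q ^ Suc k"
          proof (cases "y \<in> C")
            case True
            thus ?thesis using shell[of y] y y1 by auto
          next
            case False
            thus ?thesis using off[of y] y1 t2 l qk(2) by simp
          qed
        qed (use C True x sub in auto)
      qed
    qed
  qed
  from this[of m, THEN spec, of x] show ?thesis using \<open>\<xi> x \<le> c\<close> by simp
qed

section \<open>Green functions of boxes and explicit profiles on the strip\<close>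

definition sbox :: "int \<Rightarrow> int \<Rightarrow> int \<Rightarrow> (int \<times> int) set" where
  "sbox R H c = {(x, y). \<bar>x\<bar> < R \<and> \<bar>y - c\<bar> < H}"

lemma sbox_iff [simp]: "z \<in> sbox R H c \<longleftrightarrow> \<bar>fst z\<bar> < R \<and> \<bar>snd z - c\<bar> < H"
  by (cases z) (simp add: sbox_def)

lemma finite_sbox [simp]: "finite (sbox R H c)"
  by (rule finite_subset[of _ "{-R..R} \<times> {c-H..c+H}"]) auto

lemma nbrs_sbox:
  assumes "y \<in> nbrs (sbox R H c)" "y \<notin> sbox R H c"
  shows "(\<bar>fst y\<bar> = R \<and> \<bar>snd y - c\<bar> < H) \<or> (\<bar>fst y\<bar> < R \<and> \<bar>snd y - c\<bar> = H)"
proof -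
  obtain z e where z: "z \<in> sbox R H c" "e \<in> dirs" "y = z + e" using assms(1) by (elim nbrsE)
  thus ?thesis using assms(2) by (auto simp: dirs_def)
qed

text \<open>Away from 0 this is the identity b^(k-1) + b^(k+1) = (b + 1/b) b^k; at the kink it reads
  2 b \<le> b + 1/b.\<close>

lemma power_sum_nbrs:
  fixes b :: real
  assumes "0 < b" "b \<le> 1"
  shows "b ^ nat \<bar>y + 1\<bar> + b ^ nat \<bar>y - 1\<bar> \<le> (b + 1 / b) * b ^ nat \<bar>y\<bar>"
proof (cases "y = 0")
  case True
  have "b * b \<le> 1" using assms by (simp add: mult_le_one)
  hence "b \<le> 1 / b" using assms by (simp add: field_simps)
  thus ?thesis using True by simp
next
  case False
  define k where "k = nat \<bar>y\<bar> - 1"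
  have k: "nat \<bar>y\<bar> = Suc k" using False by (simp add: k_def)
  have "b ^ nat \<bar>y + 1\<bar> + b ^ nat \<bar>y - 1\<bar> = b ^ k + b ^ Suc (Suc k)"
  proof (cases "y > 0")
    case True
    hence k': "nat \<bar>y + 1\<bar> = Suc (Suc k)" "nat \<bar>y - 1\<bar> = k" by (auto simp: k_def)
    show ?thesis unfolding k' by simp
  next
    case False
    hence k': "nat \<bar>y - 1\<bar> = Suc (Suc k)" "nat \<bar>y + 1\<bar> = k" using \<open>y \<noteq> 0\<close> by (auto simp: k_def)
    show ?thesis unfolding k' by simp
  qed
  also have "\<dots> = (b + 1 / b) * b ^ Suc k" using assms by (simp add: field_simps)
  finally show ?thesis by (simp add: k)
qed

text \<open>The barrier is \<open>(2R\<^sup>2 - x\<^sup>2) b\<^bsup>|y - c|\<^esup>\<close>; its Laplacian is at most \<open>- b\<^bsup>|y - c|\<^esup> / 4\<close> on the strip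
  because \<open>b + 1/b - 2 \<le> 1/(2R\<^sup>2)\<close>.\<close>

lemma green_decay:
  fixes R K T :: nat
  assumes R: "R \<ge> 1" and \<mu>: "\<And>x. 0 \<le> \<mu> x" "\<And>x. \<mu> x \<le> m"
    and supp: "\<And>x. \<mu> x \<noteq> 0 \<Longrightarrow> \<bar>snd x - c\<bar> \<le> int K"
    and z: "int (K + T) \<le> \<bar>snd z - c\<bar>"
  shows "green (sbox R H c) \<mu> z \<le> 8 * m * (real R)\<^sup>2 * exp (- (real T / (2 * real R)))"
proof (cases "z \<in> sbox R H c")
  case False
  have "0 \<le> m" using \<mu>[of 0] by linarith
  thus ?thesis using False by (simp add: green_outside \<mu>)
next
  case True
  have m: "0 \<le> m" using \<mu>[of 0] by linarith
  \<comment> \<open>With this rate the growth in the vertical direction uses up only half of the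
    charge p/2 that the concave horizontal factor provides, where p is the power of b at the given
    height. A charge p/4 is left.\<close>
  define b where "b = 1 - 1 / (2 * real R)"
  have b: "1/2 \<le> b" "b < 1" using R by (simp_all add: b_def field_simps)
  have bb: "(b + 1 / b) * (real R)\<^sup>2 \<le> 2 * (real R)\<^sup>2 + 1 / 2"
  proof -
    have "b + 1 / b - 2 = (1 - b)\<^sup>2 / b" using b by (simp add: power2_eq_square field_simps)
    also have "\<dots> \<le> (1 - b)\<^sup>2 / (1 / 2)" using b by (intro divide_left_mono) auto
    also have "\<dots> = 1 / (2 * (real R)\<^sup>2)" using R by (simp add: b_def power2_eq_square field_simps)
    finally have "(b + 1 / b) * (real R)\<^sup>2 \<le> (2 + 1 / (2 * (real R)\<^sup>2)) * (real R)\<^sup>2"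
      by (intro mult_right_mono) auto
    also have "\<dots> = 2 * (real R)\<^sup>2 + 1 / 2" using R by (simp add: distrib_right)
    finally show ?thesis .
  qed
  \<comment> \<open>On the support of \<open>\<mu>\<close> the power of \<open>b\<close> is at least
    \<open>b ^ K\<close>, so this normalisation raises the charge p/4 to at least \<open>m\<close>
    there.\<close>
  define F where "F = (\<lambda>z. 4 * m / b ^ K * ((2 * (real R)\<^sup>2 - (of_int (fst z))\<^sup>2) * b ^ nat \<bar>snd z - c\<bar>))"
  have "green (sbox R H c) \<mu> z \<le> F z"
    using finite_sbox \<mu>(1) _ _ True
  proof (rule green_le)
    fix x assume x: "x \<in> sbox R H c"
    obtain i j where ij: "x = (i, j)" by (cases x)
    define a where "a = real_of_int i"
    define p where "p = b ^ nat \<bar>j - c\<bar>"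
    define s where "s = b ^ nat \<bar>j + 1 - c\<bar> + b ^ nat \<bar>j - 1 - c\<bar>"
    have s: "s \<le> (b + 1 / b) * p"
      using power_sum_nbrs[of b "j - c"] b by (simp add: s_def p_def algebra_simps)
    have p: "0 < p" using b by (simp add: p_def)
    have "\<bar>a\<bar> \<le> real R" using x by (simp add: ij a_def) linarith
    hence "a\<^sup>2 \<le> (real R)\<^sup>2" by (metis abs_le_square_iff abs_of_nat)
    hence a: "a\<^sup>2 \<le> 2 * (real R)\<^sup>2" using zero_le_power2[of "real R"] by linarith
    have "(2 * (real R)\<^sup>2 - a\<^sup>2) * s \<le> (2 * (real R)\<^sup>2 - a\<^sup>2) * ((b + 1 / b) * p)"
      using a s by (intro mult_left_mono) auto
    also have "\<dots> = 2 * p * (2 * (real R)\<^sup>2 - a\<^sup>2) + (2 * (real R)\<^sup>2 - a\<^sup>2) * (b + 1 / b - 2) * p"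
      by (simp add: algebra_simps)
    also have "(2 * (real R)\<^sup>2 - a\<^sup>2) * (b + 1 / b - 2) \<le> (2 * (real R)\<^sup>2) * (b + 1 / b - 2)"
    proof (rule mult_right_mono)
      have "b + 1 / b - 2 = (1 - b)\<^sup>2 / b" using b by (simp add: power2_eq_square field_simps)
      thus "0 \<le> b + 1 / b - 2" using b by simp
    qed simp
    also have "\<dots> \<le> 1" using bb by (simp add: algebra_simps)
    finally have key: "(2 * (real R)\<^sup>2 - a\<^sup>2) * s \<le> 2 * p * (2 * (real R)\<^sup>2 - a\<^sup>2) + p" using p by simp
    have "avg F x = 4 * m / b ^ K * ((2 * p * (2 * (real R)\<^sup>2 - a\<^sup>2 - 1) + (2 * (real R)\<^sup>2 - a\<^sup>2) * s) / 4)"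
      unfolding ij avg_eq F_def s_def p_def a_def by (simp add: power2_eq_square algebra_simps add_divide_distrib diff_divide_distrib)
    also have "\<dots> \<le> 4 * m / b ^ K * ((2 * (real R)\<^sup>2 - a\<^sup>2) * p - p / 4)"
      using key b m by (intro mult_left_mono) (auto simp: field_simps)
    also have "\<dots> = F x - m * (p / b ^ K)" by (simp add: F_def ij p_def a_def algebra_simps)
    finally have "m * (p / b ^ K) \<le> F x - avg F x" by simp
    moreover have "\<mu> x \<le> m * (p / b ^ K)"
    proof (cases "\<mu> x = 0")
      case False
      hence "nat \<bar>j - c\<bar> \<le> K" using supp[of x] by (simp add: ij)
      hence "b ^ K \<le> p" unfolding p_def using b by (intro power_decreasing) auto
      hence "1 \<le> p / b ^ K" using b by (simp add: field_simps)
      thus ?thesis using \<mu>(2)[of x] m mult_left_mono[of 1 "p / b ^ K" m] by linarith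
    qed (use m p b in simp)
    ultimately show "\<mu> x \<le> F x - avg F x" by linarith
  next
    fix y assume "y \<in> nbrs (sbox R H c)" "y \<notin> sbox R H c"
    hence "\<bar>fst y\<bar> \<le> int R" using nbrs_sbox[of y "int R" H c] by auto
    hence "0 \<le> parab (real R) y" by (rule parab_nonneg)
    hence "(real_of_int (fst y))\<^sup>2 \<le> (real R)\<^sup>2" by (simp add: parab_def)
    also have "\<dots> \<le> 2 * (real R)\<^sup>2" by simp
    finally have "(real_of_int (fst y))\<^sup>2 \<le> 2 * (real R)\<^sup>2" .
    thus "0 \<le> F y" unfolding F_def using m b by (intro mult_nonneg_nonneg) auto
  qed
  also have "F z \<le> 4 * m / b ^ K * (2 * (real R)\<^sup>2 * b ^ (K + T))"
    unfolding F_def using m b z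
    by (intro mult_left_mono mult_mono power_decreasing) auto
  also have "\<dots> = 8 * m * (real R)\<^sup>2 * b ^ T" using b by (simp add: power_add field_simps)
  also have "b ^ T \<le> exp (- (1 / (2 * real R))) ^ T"
    using b exp_ge_add_one_self[of "- (1 / (2 * real R))"] by (intro power_mono) (auto simp: b_def)
  also have "\<dots> = exp (- (real T / (2 * real R)))" by (simp add: exp_of_nat_mult[symmetric])
  finally show ?thesis using m by (simp add: mult_left_mono)
qed

text \<open>The paraboloid on the left has constant charge 1 / (4 l^2). Cutting it off at zero is a
  maximum with the constant 0, which can only lower the charge, so the cap is a subsolution. Within
  distance \<open>l\<close> of \<open>x0\<close> the cap is at least 3/4: the potential then counts
  sites of that smaller ball.\<close>

lemma bump_le_green:
  assumes l: "0 < l" and C: "finite C" "z \<in> C" and C2: "\<And>x. nrm (x - x0) < 2 * l \<Longrightarrow> x \<in> C"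
  shows "1 - sqn (z - x0) / (4 * l\<^sup>2) \<le> green C (\<lambda>x. if nrm (x - x0) < 2 * l then 1 / (4 * l\<^sup>2) else 0) z"
proof -
  define v where "v x = max 0 (1 - sqn (x - x0) / (4 * l\<^sup>2))" for x
  have inball: "1 - sqn (x - x0) / (4 * l\<^sup>2) > 0 \<longleftrightarrow> nrm (x - x0) < 2 * l" for x
    using sqn_less_iff[of "2 * l" "x - x0"] l by (simp add: field_simps power_mult_distrib)
  have "v z \<le> green C (\<lambda>x. if nrm (x - x0) < 2 * l then 1 / (4 * l\<^sup>2) else 0) z"
  proof (rule le_green[OF C(1) _ _ _ C(2)])
    fix x assume "x \<in> C"
    show "v x - avg v x \<le> (if nrm (x - x0) < 2 * l then 1 / (4 * l\<^sup>2) else 0)"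
    proof (cases "nrm (x - x0) < 2 * l")
      case True
      have "avg (\<lambda>x. 1 - (1 / (4 * l\<^sup>2)) * sqn (x - x0)) x \<le> avg v x"
        by (intro avg_mono) (simp add: v_def)
      hence "1 - (1 / (4 * l\<^sup>2)) * (sqn (x - x0) + 1) \<le> avg v x"
        by (simp only: avg_diff avg_const avg_cmult avg_shift[of sqn] avg_sqn)
      thus ?thesis using True inball[of x] by (simp add: v_def add_divide_distrib)
    next
      case False
      hence "v x = 0" using inball[of x] by (simp add: v_def)
      moreover have "0 \<le> avg v x" by (rule avg_nonneg) (simp add: v_def)
      ultimately show ?thesis using False by simp
    qed
  next
    fix y assume "y \<notin> C"
    hence "\<not> nrm (y - x0) < 2 * l" using C2 by blast
    thus "v y \<le> 0" using inball[of y] by (simp add: v_def)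
  qed (use l in simp)
  thus ?thesis by (simp add: v_def)
qed

lemma fst_axis_sum:
  fixes g :: "int \<times> int \<Rightarrow> real"
  assumes "R > 0"
  shows "(\<Sum>z\<in>sbox R H c. g z * (if fst z = 0 then a else 0)) = a * (\<Sum>k\<in>{c-H<..<c+H}. g (0, k))"
proof -
  have "(\<Sum>z\<in>sbox R H c. g z * (if fst z = 0 then a else 0)) =
      (\<Sum>z\<in>Pair 0 ` {c-H<..<c+H}. g z * (if fst z = 0 then a else 0))"
    using assms by (intro sum.mono_neutral_right finite_sbox) (auto simp: image_iff)
  also have "\<dots> = a * (\<Sum>k\<in>{c-H<..<c+H}. g (0, k))"
    by (subst sum.reindex) (auto simp: inj_on_def sum_distrib_left mult.commute)
  finally show ?thesis .
qed

text \<open>The potential, in the strip |x| < R, of a unit charge at every site of the axis on which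
  the walks start.\<close>

definition tent :: "real \<Rightarrow> int \<times> int \<Rightarrow> real" where
  "tent R z = 2 * (R - \<bar>of_int (fst z)\<bar>)"

text \<open>Charge n - 1 on the axis and -1 elsewhere: n particles start on average at every level,
  and each site absorbs one. It vanishes at |x| = R.\<close>

definition inner_fn :: "real \<Rightarrow> real \<Rightarrow> int \<times> int \<Rightarrow> real" where
  "inner_fn n R z = 2 * (R - \<bar>of_int (fst z)\<bar>) * (n - R - \<bar>of_int (fst z)\<bar>)"

text \<open>As \<open>inner_fn\<close>, but with absorption only for |x| \<le> r. The surplus n - 2r
  - 1 per level flows out to both sides, which gives the linear piece vanishing at |x| = R its
  slope.\<close>

definition outer_fn :: "real \<Rightarrow> int \<Rightarrow> real \<Rightarrow> int \<times> int \<Rightarrow> real" where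
  "outer_fn n r R z = (if \<bar>fst z\<bar> \<le> r
     then 2 * (of_int (fst z))\<^sup>2 - 2 * n * \<bar>of_int (fst z)\<bar>
       + (2 * (n - 2 * of_int r - 1) * (R - of_int r) - 2 * (of_int r)\<^sup>2 + 2 * n * of_int r)
     else 2 * (n - 2 * of_int r - 1) * (R - \<bar>of_int (fst z)\<bar>))"

lemma even_laplace:
  fixes g s :: "int \<Rightarrow> real"
  assumes f: "\<And>z. f z = g \<bar>fst z\<bar>" and "2 * g 0 - 2 * g 1 = 4 * s 0"
    and "\<And>t. 1 \<le> t \<Longrightarrow> 2 * g t - g (t + 1) - g (t - 1) = 4 * s t"
  shows "f z - avg f z = s \<bar>fst z\<bar>"
proof -
  obtain i j where z: "z = (i, j)" by (cases z)
  have "4 * (f z - avg f z) = 2 * g \<bar>i\<bar> - g \<bar>i + 1\<bar> - g \<bar>i - 1\<bar>"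
    by (simp add: z avg_eq f field_simps)
  also have "\<dots> = 4 * s \<bar>i\<bar>"
  proof -
    consider "i = 0" | "i \<ge> 1" | "i \<le> -1" by linarith
    thus ?thesis
    proof cases
      case 3
      hence "\<bar>i + 1\<bar> = - i - 1" "\<bar>i - 1\<bar> = - i + 1" "\<bar>i\<bar> = - i" by auto
      thus ?thesis using assms(3)[of "- i"] 3 by simp
    qed (use assms in auto)
  qed
  finally show ?thesis by (simp add: z)
qed

lemma tent_laplace: "tent R z - avg (tent R) z = (if fst z = 0 then 1 else 0)"
  using even_laplace[of "tent R" "\<lambda>t. 2 * (R - of_int t)" "\<lambda>t. if t = 0 then 1 else 0" z]
  by (auto simp: tent_def algebra_simps)

lemma inner_fn_laplace: "inner_fn n R z - avg (inner_fn n R) z = (if fst z = 0 then n else 0) - 1"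
  using even_laplace[of "inner_fn n R" "\<lambda>t. 2 * (R - of_int t) * (n - R - of_int t)"
      "\<lambda>t. (if t = 0 then n else 0) - 1" z]
  by (auto simp: inner_fn_def algebra_simps)

lemma outer_fn_laplace:
  assumes r: "r \<ge> 1"
  shows "outer_fn n r R z - avg (outer_fn n r R) z =
    (if fst z = 0 then n else 0) - (if \<bar>fst z\<bar> \<le> r then 1 else 0)"
proof -
  define A where "A = 2 * (n - 2 * of_int r - 1) * (R - of_int r) - 2 * (of_int r)\<^sup>2 + 2 * n * of_int r"
  \<comment> \<open>Both formulas agree at r and at r + 1. Hence every second difference, also at
    these two points, can be computed from one formula alone.\<close>
  define g where "g t = (if t \<le> r + 1 then 2 * (of_int t)\<^sup>2 - 2 * n * of_int t + A
      else 2 * (n - 2 * of_int r - 1) * (R - of_int t))" for t :: int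
  have lin: "g t = 2 * (n - 2 * of_int r - 1) * (R - of_int t)" if "r \<le> t" for t
  proof -
    have "t = r \<or> t = r + 1 \<or> t > r + 1" using that by linarith
    thus ?thesis by (elim disjE) (simp_all add: g_def A_def power2_eq_square algebra_simps)
  qed
  have quad: "g t = 2 * (of_int t)\<^sup>2 - 2 * n * of_int t + A" if "t \<le> r + 1" for t
    using that by (simp add: g_def)
  have f: "outer_fn n r R z = g \<bar>fst z\<bar>" for z
    using lin[of "\<bar>fst z\<bar>"] quad[of "\<bar>fst z\<bar>"] by (auto simp: outer_fn_def A_def)
  have step: "2 * g t - g (t + 1) - g (t - 1) = 4 * ((if t = 0 then n else 0) - (if t \<le> r then 1 else 0))"
    if "1 \<le> t" for t
  proof (cases "t \<le> r")
    case True
    thus ?thesis using that by (simp add: quad power2_eq_square algebra_simps)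
  next
    case False
    thus ?thesis using that by (simp add: lin algebra_simps)
  qed
  have "2 * g 0 - 2 * g 1 = 4 * ((if (0::int) = 0 then n else 0) - (if 0 \<le> r then 1 else 0))"
    using r by (simp add: quad)
  from even_laplace[of "outer_fn n r R" g "\<lambda>t. (if t = 0 then n else 0) - (if t \<le> r then 1 else 0)", OF f this step]
  show ?thesis by simp
qed

text \<open>Green's identity with \<open>tent\<close>, whose charge singles out the axis and which
  is nonnegative on the boundary of the box.\<close>

lemma green_axis_sum_le:
  assumes R: "0 < R" and \<mu>: "\<And>x. 0 \<le> \<mu> x"
  shows "(\<Sum>k\<in>{c-H<..<c+H}. green (sbox R H c) \<mu> (0, k)) \<le> (\<Sum>z\<in>sbox R H c. tent (of_int R) z * \<mu> z)"
proof -
  let ?D = "sbox R H c" and ?g = "green (sbox R H c) \<mu>" and ?f = "tent (of_int R)"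
  have "(\<Sum>k\<in>{c-H<..<c+H}. ?g (0, k)) = (\<Sum>z\<in>?D. ?g z * (if fst z = 0 then 1 else 0))"
    using fst_axis_sum[OF R, of ?g 1] by simp
  also have "\<dots> = (\<Sum>z\<in>?D. ?f z * \<mu> z) - (\<Sum>x\<in>nbrs ?D - ?D. ?f x * avg ?g x)"
    using green_parts[OF finite_sbox \<mu>, where f = ?f] by (simp add: tent_laplace)
  also have "0 \<le> (\<Sum>x\<in>nbrs ?D - ?D. ?f x * avg ?g x)"
  proof (intro sum_nonneg mult_nonneg_nonneg avg_nonneg)
    fix x assume "x \<in> nbrs ?D - ?D"
    hence "\<bar>fst x\<bar> \<le> R" using nbrs_sbox[of x R H c] by auto
    thus "0 \<le> ?f x" by (simp add: tent_def)
  qed (simp add: green_nonneg \<mu>)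
  ultimately show ?thesis by linarith
qed

text \<open>Green's identity with \<open>outer_fn\<close>, which is nonnegative on the boundary. The
  potential brought by n particles per level is compared with the potential used up by a full strip
  |x| \<le> r; the bound controls what remains for the sites further out.\<close>

lemma green_outer_sum_le:
  assumes R: "0 < R" and \<mu>: "\<And>x. 0 \<le> \<mu> x" and r: "1 \<le> r" "r < R" and n: "2 * of_int r + 1 \<le> n"
  shows "n * (\<Sum>k\<in>{c-H<..<c+H}. green (sbox R H c) \<mu> (0, k)) -
      (\<Sum>z\<in>{z \<in> sbox R H c. \<bar>fst z\<bar> \<le> r}. green (sbox R H c) \<mu> z)
    \<le> (\<Sum>z\<in>sbox R H c. outer_fn n r (of_int R) z * \<mu> z)"
proof -
  let ?D = "sbox R H c" and ?g = "green (sbox R H c) \<mu>" and ?f = "outer_fn n r (of_int R)"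
  have "(\<Sum>z\<in>{z \<in> ?D. \<bar>fst z\<bar> \<le> r}. ?g z) = (\<Sum>z\<in>?D. ?g z * (if \<bar>fst z\<bar> \<le> r then 1 else 0))"
    by (subst sum.inter_filter) (auto intro!: sum.cong)
  moreover have "n * (\<Sum>k\<in>{c-H<..<c+H}. ?g (0, k)) = (\<Sum>z\<in>?D. ?g z * (if fst z = 0 then n else 0))"
    using fst_axis_sum[OF R, of ?g n] by simp
  ultimately have "n * (\<Sum>k\<in>{c-H<..<c+H}. ?g (0, k)) - (\<Sum>z\<in>{z \<in> ?D. \<bar>fst z\<bar> \<le> r}. ?g z) =
      (\<Sum>z\<in>?D. ?g z * (?f z - avg ?f z))"
    by (simp add: outer_fn_laplace[OF r(1)] right_diff_distrib sum_subtractf)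
  also have "\<dots> = (\<Sum>z\<in>?D. ?f z * \<mu> z) - (\<Sum>x\<in>nbrs ?D - ?D. ?f x * avg ?g x)"
    by (rule green_parts[OF finite_sbox \<mu>])
  also have "0 \<le> (\<Sum>x\<in>nbrs ?D - ?D. ?f x * avg ?g x)"
  proof (intro sum_nonneg mult_nonneg_nonneg avg_nonneg)
    fix x assume "x \<in> nbrs ?D - ?D"
    hence x: "\<bar>fst x\<bar> \<le> R" using nbrs_sbox[of x R H c] by auto
    define t where "t = \<bar>real_of_int (fst x)\<bar>"
    have t: "0 \<le> t" "t \<le> of_int R" using x unfolding t_def by linarith+
    show "0 \<le> ?f x"
    proof (cases "\<bar>fst x\<bar> \<le> r")
      case True
      hence tr: "t \<le> of_int r" unfolding t_def by linarith
      have "?f x = 2 * (of_int r - t) * (n - of_int r - t) + 2 * (n - 2 * of_int r - 1) * (of_int R - of_int r)"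
        using True by (simp add: outer_fn_def t_def power2_eq_square algebra_simps)
      moreover have "0 \<le> (of_int r - t) * (n - of_int r - t)"
        using tr n by (intro mult_nonneg_nonneg) auto
      moreover have "0 \<le> (n - 2 * of_int r - 1) * (of_int R - of_int r)"
        using r n by (intro mult_nonneg_nonneg) auto
      ultimately show ?thesis by (simp only: mult.assoc)
    next
      case False
      thus ?thesis using t n by (simp add: outer_fn_def t_def)
    qed
  qed (simp add: green_nonneg \<mu>)
  ultimately show ?thesis by linarith
qed

text \<open>Here the boundary sum has the unfavourable sign. On the lateral sides
  \<open>inner_fn\<close> vanishes. At top and bottom \<open>avg\<close> looks one row inside, which
  is why \<open>\<tau>\<close> is required from distance H - 1 on; fewer than 4R sites, with
  \<open>inner_fn\<close> at most 2Rn, produce the error term.\<close>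

lemma green_inner_sum_ge:
  fixes R H :: nat
  assumes R: "0 < R" "real R \<le> n" and z0: "z0 \<in> sbox R H c"
    and \<tau>: "\<And>z. int H - 1 \<le> \<bar>snd z - c\<bar> \<Longrightarrow> green (sbox R H c) (\<lambda>z. if z = z0 then 1 else 0) z \<le> \<tau>"
  shows "n * (\<Sum>k\<in>{c-int H<..<c+int H}. green (sbox R H c) (\<lambda>z. if z = z0 then 1 else 0) (0, k)) -
      (\<Sum>z\<in>sbox R H c. green (sbox R H c) (\<lambda>z. if z = z0 then 1 else 0) z)
    \<ge> inner_fn n R z0 - 8 * (real R)\<^sup>2 * n * \<tau>"
proof -
  let ?D = "sbox R H c" and ?\<mu> = "\<lambda>z. if z = z0 then 1 else 0 :: real"
  let ?g = "green (sbox R H c) ?\<mu>" and ?f = "inner_fn n R"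
  have \<mu>: "0 \<le> ?\<mu> z" for z by simp
  have "0 \<le> ?g z" for z by (simp add: green_nonneg)
  hence "0 \<le> \<tau>" using \<tau>[of "(0, c + int H)"] by (smt (verit) snd_conv)
  have "n * (\<Sum>k\<in>{c-int H<..<c+int H}. ?g (0, k)) - (\<Sum>z\<in>?D. ?g z) = (\<Sum>z\<in>?D. ?g z * (?f z - avg ?f z))"
    using fst_axis_sum[of "int R" ?g n "int H" c] R
    by (simp add: inner_fn_laplace right_diff_distrib sum_subtractf)
  also have "\<dots> = (\<Sum>z\<in>?D. ?f z * ?\<mu> z) - (\<Sum>x\<in>nbrs ?D - ?D. ?f x * avg ?g x)"
    by (rule green_parts[OF finite_sbox \<mu>])
  also have "(\<Sum>z\<in>?D. ?f z * ?\<mu> z) = (\<Sum>z\<in>?D. if z = z0 then ?f z else 0)"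
    by (intro sum.cong) auto
  also have "\<dots> = ?f z0" using z0 by simp
  finally have eq: "n * (\<Sum>k\<in>{c-int H<..<c+int H}. ?g (0, k)) - (\<Sum>z\<in>?D. ?g z) =
      ?f z0 - (\<Sum>x\<in>nbrs ?D - ?D. ?f x * avg ?g x)" .
  define B where "B = {-int R<..<int R} \<times> {c - int H, c + int H}"
  have "(\<Sum>x\<in>nbrs ?D - ?D. ?f x * avg ?g x) \<le> (\<Sum>x\<in>nbrs ?D - ?D. if x \<in> B then 2 * R * n * \<tau> else 0)"
  proof (rule sum_mono)
    fix x assume x: "x \<in> nbrs ?D - ?D"
    show "?f x * avg ?g x \<le> (if x \<in> B then 2 * R * n * \<tau> else 0)"
    proof (cases "\<bar>fst x\<bar> = int R")
      case True
      hence "\<bar>real_of_int (fst x)\<bar> = real R" by (metis of_int_abs of_int_of_nat_eq)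
      hence "?f x = 0" by (simp add: inner_fn_def)
      thus ?thesis using R \<open>0 \<le> \<tau>\<close> by simp
    next
      case False
      hence x': "\<bar>fst x\<bar> < int R" "\<bar>snd x - c\<bar> = int H" using nbrs_sbox[of x R H c] x by auto
      hence B: "x \<in> B" by (cases x) (auto simp: B_def)
      define t where "t = \<bar>real_of_int (fst x)\<bar>"
      have t: "0 \<le> t" "t \<le> R" using x' unfolding t_def by linarith+
      have "avg ?g x \<le> avg (\<lambda>_. \<tau>) x"
        using x' by (intro avg_mono \<tau>) (auto simp: dirs_def)
      hence "avg ?g x \<le> \<tau>" by simp
      moreover have "0 \<le> avg ?g x" by (intro avg_nonneg green_nonneg) auto
      moreover have "?f x \<le> 2 * R * n"
      proof (cases "n - R - t \<ge> 0")
        case True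
        have "(R - t) * (n - R - t) \<le> R * n" using t True by (intro mult_mono) auto
        thus ?thesis unfolding inner_fn_def t_def by (simp only: mult.assoc)
      next
        case False
        hence "(R - t) * (n - R - t) \<le> 0" using t by (intro mult_nonneg_nonpos) auto
        moreover have "0 \<le> R * n" using R by simp
        ultimately show ?thesis unfolding inner_fn_def t_def by (simp only: mult.assoc)
      qed
      moreover have "0 \<le> 2 * R * n" using R by simp
      ultimately have "?f x * avg ?g x \<le> (2 * R * n) * \<tau>"
        by (meson mult_mono order.trans mult_right_mono mult_left_mono)
      thus ?thesis using B by simp
    qed
  qed
  also have "\<dots> = (\<Sum>x\<in>(nbrs ?D - ?D) \<inter> B. 2 * R * n * \<tau>)"
    by (subst sum.inter_restrict) auto
  also have "\<dots> \<le> (\<Sum>x\<in>B. 2 * R * n * \<tau>)"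
    using R \<open>0 \<le> \<tau>\<close> by (intro sum_mono2) (auto simp: B_def)
  also have "\<dots> \<le> (2 * R * 2) * (2 * R * n * \<tau>)"
  proof -
    have "card B \<le> (2 * R - 1) * 2"
      unfolding B_def by (subst card_cartesian_product) (auto intro!: mult_mono simp: card_insert_if)
    hence "real (card B) \<le> 2 * R * 2" by linarith
    thus ?thesis using R \<open>0 \<le> \<tau>\<close> by (simp only: sum_constant) (intro mult_right_mono, auto)
  qed
  also have "\<dots> = 8 * (real R)\<^sup>2 * n * \<tau>" by (simp add: power2_eq_square)
  finally show ?thesis using eq by linarith
qed

section \<open>Stopping a random walk on leaving a finite set\<close>

definition exits :: "(nat \<Rightarrow> 'a) \<Rightarrow> 'a set \<Rightarrow> bool" where
  "exits w C \<longleftrightarrow> (\<exists>k. w k \<notin> C)"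

text \<open>For a path that never leaves \<open>C\<close> this is its position at an unspecified
  time; \<open>exits\<close> is therefore stated alongside where the path matters.\<close>

definition stop :: "(nat \<Rightarrow> 'a) \<Rightarrow> 'a set \<Rightarrow> 'a" where
  "stop w C = w (LEAST k. w k \<notin> C)"

lemma stop_notin: "exits w C \<Longrightarrow> stop w C \<notin> C"
  unfolding exits_def stop_def by (rule LeastI_ex)

text \<open>Before its exit from \<open>C\<close> the path is in \<open>C\<close>, hence in
  \<open>D\<close>. If the exit point is outside \<open>D\<close> already, it is also the first
  point outside \<open>D\<close>.\<close>

lemma stop_subset:
  assumes "exits w C" "stop w C \<notin> D" "C \<subseteq> D"
  shows "exits w D" "stop w D = stop w C"
proof -
  define k where "k = (LEAST k. w k \<notin> C)"
  have k: "w k \<notin> D" using assms by (simp add: stop_def k_def)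
  thus "exits w D" by (auto simp: exits_def)
  have "(LEAST k. w k \<notin> D) = k"
  proof (rule Least_equality[of "\<lambda>k. w k \<notin> D", OF k])
    fix j assume "w j \<notin> D"
    hence "w j \<notin> C" using assms by auto
    thus "k \<le> j" unfolding k_def by (rule Least_le)
  qed
  thus "stop w D = stop w C" by (simp add: stop_def k_def)
qed

lemma stop_measurable [measurable]: "(\<lambda>w. stop w C) \<in> path_space \<rightarrow>\<^sub>M count_space UNIV"
proof -
  have [measurable]: "(\<lambda>w. w k) \<in> path_space \<rightarrow>\<^sub>M count_space UNIV" for k
    by (rule measurable_component_singleton) simp
  have "(\<lambda>w. w (LEAST k. w k \<notin> C)) \<in> path_space \<rightarrow>\<^sub>M count_space UNIV"
    by (rule measurable_compose_countable[where f = "\<lambda>k w. w k"]) measurable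
  thus ?thesis unfolding stop_def .
qed

lemma exits_measurable [measurable]: "Measurable.pred path_space (\<lambda>w. exits w C)"
proof -
  have [measurable]: "(\<lambda>w. w k) \<in> path_space \<rightarrow>\<^sub>M count_space UNIV" for k
    by (rule measurable_component_singleton) simp
  show ?thesis unfolding exits_def by measurable
qed

section \<open>Optional stopping for the simple random walk\<close>

locale walk = prob_space M for M :: "'w measure" +
  fixes s :: "int \<times> int" and X :: "nat \<Rightarrow> 'w \<Rightarrow> int \<times> int"
  assumes srw: "simple_random_walk M s X"
begin

lemma X_measurable [measurable]: "X k \<in> M \<rightarrow>\<^sub>M count_space UNIV"
  using srw by (simp add: simple_random_walk_def)

lemma X_0: "AE \<omega> in M. X 0 \<omega> = s"
  using srw by (simp add: simple_random_walk_def)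

lemma path_measurable [measurable]: "(\<lambda>\<omega> k. X k \<omega>) \<in> M \<rightarrow>\<^sub>M path_space"
  by (rule measurable_PiM_single') auto

definition step :: "nat \<Rightarrow> 'w \<Rightarrow> int \<times> int" where
  "step k \<omega> = X (Suc k) \<omega> - X k \<omega>"

lemma step_indep: "indep_vars (\<lambda>_. count_space UNIV) step UNIV"
  using srw by (simp add: simple_random_walk_def step_def[abs_def])

lemma step_measurable [measurable]: "step k \<in> M \<rightarrow>\<^sub>M count_space UNIV"
  using step_indep by (simp add: indep_vars_def)

lemma step_distr: "distr M (count_space UNIV) (step k) = measure_pmf (pmf_of_set dirs)"
  using srw by (simp add: simple_random_walk_def step_def[abs_def] dirs_def)

lemma prob_step: "e \<in> dirs \<Longrightarrow> prob {\<omega> \<in> space M. step k \<omega> = e} = 1 / 4"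
proof -
  assume e: "e \<in> dirs"
  have "prob {\<omega> \<in> space M. step k \<omega> = e} = measure (distr M (count_space UNIV) (step k)) {e}"
    by (subst measure_distr) (auto intro!: arg_cong[where f = prob])
  also have "\<dots> = pmf (pmf_of_set dirs) e" by (simp add: step_distr measure_pmf_single)
  also have "\<dots> = 1 / 4" using e by (subst pmf_of_set) (auto simp: dirs_def)
  finally show ?thesis .
qed

lemma step_in_dirs: "AE \<omega> in M. step k \<omega> \<in> dirs"
proof -
  have "AE x in measure_pmf (pmf_of_set dirs). x \<in> dirs"
    using AE_measure_pmf[of "pmf_of_set dirs"] by (simp add: dirs_def)
  hence "AE x in distr M (count_space UNIV) (step k). x \<in> dirs" unfolding step_distr .
  thus ?thesis by (subst (asm) AE_distr_iff) auto
qed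

lemma X_eq_sum: "AE \<omega> in M. \<forall>k. X k \<omega> = s + (\<Sum>j<k. step j \<omega>)"
  using X_0
proof eventually_elim
  case (elim \<omega>)
  have "X k \<omega> = s + (\<Sum>j<k. step j \<omega>)" for k
    by (induction k) (simp_all add: elim step_def)
  thus ?case by simp
qed

definition alive :: "(int \<times> int) set \<Rightarrow> nat \<Rightarrow> 'w \<Rightarrow> bool" where
  "alive C t \<omega> \<longleftrightarrow> (\<forall>k\<le>t. X k \<omega> \<in> C)"

lemma alive_measurable [measurable]: "Measurable.pred M (alive C t)"
  unfolding alive_def by measurable

text \<open>The event is determined, up to a null set because the starting point is prescribed only
  almost surely, by the first t increments. These are independent of the next one.\<close>

lemma alive_step_indep:
  assumes e: "e \<in> dirs"
  shows "prob {\<omega> \<in> space M. (alive C t \<omega> \<and> X t \<omega> = y) \<and> step t \<omega> = e} =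
    prob {\<omega> \<in> space M. alive C t \<omega> \<and> X t \<omega> = y} / 4"
proof -
  let ?Ma = "PiM {..<t} (\<lambda>_. count_space (UNIV :: (int \<times> int) set))"
  let ?Mb = "PiM {t} (\<lambda>_. count_space (UNIV :: (int \<times> int) set))"
  define G where "G f \<longleftrightarrow> (\<forall>k\<le>t. s + (\<Sum>j<k. f j) \<in> C) \<and> s + (\<Sum>j<t. f j) = y" for f :: "nat \<Rightarrow> int \<times> int"
  define U where "U = {f \<in> space ?Ma. G f}"
  define V where "V = {f \<in> space ?Mb. f t = e}"
  have "?Ma = count_space (PiE {..<t} (\<lambda>_. UNIV))"
    by (rule count_space_PiM_finite) auto
  hence U: "U \<in> sets ?Ma" unfolding U_def by simp
  have V: "V \<in> sets ?Mb" unfolding V_def by measurable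
  have ind: "indep_var ?Ma (\<lambda>\<omega>. restrict (\<lambda>i. step i \<omega>) {..<t}) ?Mb (\<lambda>\<omega>. restrict (\<lambda>i. step i \<omega>) {t})"
    by (rule indep_var_restrict[OF step_indep]) auto
  have G: "AE \<omega> in M. G (restrict (\<lambda>i. step i \<omega>) {..<t}) \<longleftrightarrow> alive C t \<omega> \<and> X t \<omega> = y"
    using X_eq_sum by eventually_elim (auto simp: G_def alive_def)
  have *: "(\<lambda>\<omega>. restrict (\<lambda>i. step i \<omega>) {..<t}) -` U \<inter> space M = {\<omega> \<in> space M. G (restrict (\<lambda>i. step i \<omega>) {..<t})}"
    "(\<lambda>\<omega>. restrict (\<lambda>i. step i \<omega>) {t}) -` V \<inter> space M = {\<omega> \<in> space M. step t \<omega> = e}"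
    by (auto simp: U_def V_def space_PiM)
  have meas: "(\<lambda>\<omega>. restrict (\<lambda>i. step i \<omega>) {..<t}) \<in> M \<rightarrow>\<^sub>M ?Ma"
    using ind by (rule indep_var_rv1)
  have [measurable]: "Measurable.pred M (\<lambda>\<omega>. G (restrict (\<lambda>i. step i \<omega>) {..<t}))"
    using measurable_sets[OF meas U] unfolding * by (simp add: pred_def)
  have "prob {\<omega> \<in> space M. (alive C t \<omega> \<and> X t \<omega> = y) \<and> step t \<omega> = e} =
      prob {\<omega> \<in> space M. G (restrict (\<lambda>i. step i \<omega>) {..<t}) \<and> step t \<omega> = e}"
  proof (rule finite_measure_eq_AE)
    show "AE \<omega> in M. \<omega> \<in> {\<omega> \<in> space M. (alive C t \<omega> \<and> X t \<omega> = y) \<and> step t \<omega> = e} \<longleftrightarrow>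
        \<omega> \<in> {\<omega> \<in> space M. G (restrict (\<lambda>i. step i \<omega>) {..<t}) \<and> step t \<omega> = e}"
      using G by eventually_elim blast
  qed measurable
  also have "\<dots> = prob ((\<lambda>x. (restrict (\<lambda>i. step i x) {..<t}, restrict (\<lambda>i. step i x) {t})) -` (U \<times> V) \<inter> space M)"
    by (rule arg_cong[where f = prob]) (auto simp: U_def V_def space_PiM)
  also have "\<dots> = prob {\<omega> \<in> space M. G (restrict (\<lambda>i. step i \<omega>) {..<t})} * prob {\<omega> \<in> space M. step t \<omega> = e}"
    unfolding indep_varD[OF ind U V] * ..
  also have "prob {\<omega> \<in> space M. G (restrict (\<lambda>i. step i \<omega>) {..<t})} = prob {\<omega> \<in> space M. alive C t \<omega> \<and> X t \<omega> = y}"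
  proof (rule finite_measure_eq_AE)
    show "AE \<omega> in M. \<omega> \<in> {\<omega> \<in> space M. G (restrict (\<lambda>i. step i \<omega>) {..<t})} \<longleftrightarrow>
        \<omega> \<in> {\<omega> \<in> space M. alive C t \<omega> \<and> X t \<omega> = y}"
      using G by eventually_elim blast
  qed measurable
  finally show ?thesis by (simp add: prob_step[OF e])
qed

text \<open>The Markov property for one step, as a finite sum over the positions in \<open>C\<close>
  and the increments. \<open>c\<close> is a guaranteed loss per step: the value 1 serves to bound
  the time spent in \<open>C\<close>, the value 0 gives a plain supermartingale.\<close>

lemma one_step:
  assumes C: "finite C" and \<phi>: "\<And>x. 0 \<le> \<phi> x" "0 \<le> c" "\<And>x. x \<in> C \<Longrightarrow> avg \<phi> x + c \<le> \<phi> x"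
  shows "(\<integral>\<^sup>+\<omega>. ennreal (\<phi> (X (Suc t) \<omega>)) * indicator {\<omega>. alive C t \<omega>} \<omega> \<partial>M)
      + ennreal (c * prob {\<omega> \<in> space M. alive C t \<omega>})
    \<le> (\<integral>\<^sup>+\<omega>. ennreal (\<phi> (X t \<omega>)) * indicator {\<omega>. alive C t \<omega>} \<omega> \<partial>M)"
proof -
  define p where "p y = prob {\<omega> \<in> space M. alive C t \<omega> \<and> X t \<omega> = y}" for y
  have p0: "0 \<le> p y" for y by (simp add: p_def)
  have em: "emeasure M {\<omega> \<in> space M. alive C t \<omega> \<and> X t \<omega> = y} = ennreal (p y)" for y
    by (simp add: p_def emeasure_eq_measure)
  have em2: "emeasure M {\<omega> \<in> space M. (alive C t \<omega> \<and> X t \<omega> = y) \<and> step t \<omega> = e} = ennreal (p y / 4)"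
    if "e \<in> dirs" for y e
    using alive_step_indep[OF that] by (simp add: p_def emeasure_eq_measure)
  have inC: "alive C t \<omega> \<Longrightarrow> X t \<omega> \<in> C" for \<omega> by (simp add: alive_def)
  have "(\<integral>\<^sup>+\<omega>. ennreal (\<phi> (X (Suc t) \<omega>)) * indicator {\<omega>. alive C t \<omega>} \<omega> \<partial>M) =
      (\<integral>\<^sup>+\<omega>. (\<Sum>y\<in>C. \<Sum>e\<in>dirs. ennreal (\<phi> (y + e)) *
        indicator {\<omega> \<in> space M. (alive C t \<omega> \<and> X t \<omega> = y) \<and> step t \<omega> = e} \<omega>) \<partial>M)"
  proof (rule nn_integral_cong_AE)
    show "AE \<omega> in M. ennreal (\<phi> (X (Suc t) \<omega>)) * indicator {\<omega>. alive C t \<omega>} \<omega> =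
      (\<Sum>y\<in>C. \<Sum>e\<in>dirs. ennreal (\<phi> (y + e)) * indicator {\<omega> \<in> space M. (alive C t \<omega> \<and> X t \<omega> = y) \<and> step t \<omega> = e} \<omega>)"
      using step_in_dirs[of t] AE_space
    proof eventually_elim
      case (elim \<omega>)
      show ?case
      proof (cases "alive C t \<omega>")
        case True
        have "(\<Sum>y\<in>C. \<Sum>e\<in>dirs. ennreal (\<phi> (y + e)) * indicator {\<omega> \<in> space M. (alive C t \<omega> \<and> X t \<omega> = y) \<and> step t \<omega> = e} \<omega>)
          = (\<Sum>y\<in>C. if X t \<omega> = y then (\<Sum>e\<in>dirs. if step t \<omega> = e then ennreal (\<phi> (y + e)) else 0) else 0)"
          using True elim by (intro sum.cong refl) (auto simp: indicator_def intro!: sum.cong)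
        also have "\<dots> = ennreal (\<phi> (X t \<omega> + step t \<omega>))"
          using C elim inC[OF True] by simp
        finally show ?thesis using True by (simp add: step_def)
      qed (auto simp: indicator_def)
    qed
  qed
  also have "\<dots> = (\<Sum>y\<in>C. \<Sum>e\<in>dirs. ennreal (\<phi> (y + e)) * ennreal (p y / 4))"
  proof -
    define E where "E y e = {\<omega> \<in> space M. (alive C t \<omega> \<and> X t \<omega> = y) \<and> step t \<omega> = e}" for y e
    have [measurable]: "E y e \<in> events" for y e unfolding E_def by measurable
    have "(\<integral>\<^sup>+\<omega>. (\<Sum>y\<in>C. \<Sum>e\<in>dirs. ennreal (\<phi> (y + e)) * indicator (E y e) \<omega>) \<partial>M) =
        (\<Sum>y\<in>C. \<Sum>e\<in>dirs. ennreal (\<phi> (y + e)) * emeasure M (E y e))"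
    proof (subst nn_integral_sum)
      show "(\<Sum>y\<in>C. \<integral>\<^sup>+\<omega>. (\<Sum>e\<in>dirs. ennreal (\<phi> (y + e)) * indicator (E y e) \<omega>) \<partial>M) =
          (\<Sum>y\<in>C. \<Sum>e\<in>dirs. ennreal (\<phi> (y + e)) * emeasure M (E y e))"
        by (intro sum.cong refl, subst nn_integral_sum) (auto simp: nn_integral_cmult_indicator)
    qed measurable
    thus ?thesis using em2 by (simp add: E_def)
  qed
  also have "\<dots> = (\<Sum>y\<in>C. \<Sum>e\<in>dirs. ennreal (p y * (\<phi> (y + e) / 4)))"
    using \<phi>(1) p0 by (intro sum.cong refl) (simp add: ennreal_mult[symmetric] field_simps)
  also have "\<dots> = ennreal (\<Sum>y\<in>C. \<Sum>e\<in>dirs. p y * (\<phi> (y + e) / 4))"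
    using \<phi>(1) p0 by (simp add: sum_ennreal sum_nonneg)
  also have "(\<Sum>y\<in>C. \<Sum>e\<in>dirs. p y * (\<phi> (y + e) / 4)) = (\<Sum>y\<in>C. p y * avg \<phi> y)"
    by (simp only: avg_def sum_distrib_left sum_divide_distrib)
  finally have eq1: "(\<integral>\<^sup>+\<omega>. ennreal (\<phi> (X (Suc t) \<omega>)) * indicator {\<omega>. alive C t \<omega>} \<omega> \<partial>M) =
      ennreal (\<Sum>y\<in>C. p y * avg \<phi> y)" .
  have eq2: "prob {\<omega> \<in> space M. alive C t \<omega>} = (\<Sum>y\<in>C. p y)"
  proof -
    have "{\<omega> \<in> space M. alive C t \<omega>} = (\<Union>y\<in>C. {\<omega> \<in> space M. alive C t \<omega> \<and> X t \<omega> = y})"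
      using inC by auto
    thus ?thesis unfolding p_def
      by (simp only:) (rule finite_measure_finite_Union, use C in \<open>auto simp: disjoint_family_on_def\<close>)
  qed
  have "(\<integral>\<^sup>+\<omega>. ennreal (\<phi> (X (Suc t) \<omega>)) * indicator {\<omega>. alive C t \<omega>} \<omega> \<partial>M) +
      ennreal (c * prob {\<omega> \<in> space M. alive C t \<omega>}) =
      ennreal (\<Sum>y\<in>C. p y * avg \<phi> y) + ennreal (c * (\<Sum>y\<in>C. p y))"
    by (simp only: eq1 eq2)
  also have "ennreal (\<Sum>y\<in>C. p y * avg \<phi> y) + ennreal (c * (\<Sum>y\<in>C. p y)) =
      ennreal (\<Sum>y\<in>C. p y * (avg \<phi> y + c))"
  proof -
    have "0 \<le> (\<Sum>y\<in>C. p y * avg \<phi> y)" "0 \<le> c * (\<Sum>y\<in>C. p y)"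
      using \<phi> p0 avg_nonneg[of \<phi>] by (auto intro!: sum_nonneg mult_nonneg_nonneg)
    moreover have "(\<Sum>y\<in>C. p y * (avg \<phi> y + c)) = (\<Sum>y\<in>C. p y * avg \<phi> y) + c * (\<Sum>y\<in>C. p y)"
      by (simp add: distrib_left sum.distrib sum_distrib_right mult.commute[of c])
    ultimately show ?thesis by (simp add: ennreal_plus)
  qed
  also have "\<dots> \<le> ennreal (\<Sum>y\<in>C. p y * \<phi> y)"
    using \<phi> p0 by (intro ennreal_leI sum_mono mult_left_mono) auto
  also have "\<dots> = (\<Sum>y\<in>C. ennreal (\<phi> y) * ennreal (p y))"
  proof -
    have "ennreal (\<phi> y) * ennreal (p y) = ennreal (p y * \<phi> y)" for y
      using \<phi>(1)[of y] p0[of y] by (simp add: ennreal_mult mult.commute)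
    thus ?thesis using \<phi>(1) p0 by (simp add: sum_ennreal)
  qed
  also have "\<dots> = (\<integral>\<^sup>+\<omega>. (\<Sum>y\<in>C. ennreal (\<phi> y) * indicator {\<omega> \<in> space M. alive C t \<omega> \<and> X t \<omega> = y} \<omega>) \<partial>M)"
    by (subst nn_integral_sum) (auto intro!: sum.cong simp: nn_integral_cmult em)
  also have "\<dots> = (\<integral>\<^sup>+\<omega>. ennreal (\<phi> (X t \<omega>)) * indicator {\<omega>. alive C t \<omega>} \<omega> \<partial>M)"
  proof (rule nn_integral_cong)
    fix \<omega> assume w: "\<omega> \<in> space M"
    show "(\<Sum>y\<in>C. ennreal (\<phi> y) * indicator {\<omega> \<in> space M. alive C t \<omega> \<and> X t \<omega> = y} \<omega>) =
      ennreal (\<phi> (X t \<omega>)) * indicator {\<omega>. alive C t \<omega>} \<omega>"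
    proof (cases "alive C t \<omega>")
      case True
      have "(\<Sum>y\<in>C. ennreal (\<phi> y) * indicator {\<omega> \<in> space M. alive C t \<omega> \<and> X t \<omega> = y} \<omega>) =
          (\<Sum>y\<in>C. if X t \<omega> = y then ennreal (\<phi> y) else 0)"
        using True w by (intro sum.cong) (auto simp: indicator_def)
      thus ?thesis using C inC[OF True] True by simp
    qed (auto simp: indicator_def)
  qed
  finally show ?thesis .
qed

text \<open>The walk stopped at its exit from \<open>C\<close>. Where \<open>alive\<close> fails the
  exit has already happened, so \<open>stop\<close> does not look into the future.\<close>

definition frozen :: "(int \<times> int) set \<Rightarrow> nat \<Rightarrow> 'w \<Rightarrow> int \<times> int" where
  "frozen C t \<omega> = (if alive C t \<omega> then X t \<omega> else stop (\<lambda>k. X k \<omega>) C)"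

lemma frozen_measurable [measurable]: "frozen C t \<in> M \<rightarrow>\<^sub>M count_space UNIV"
  unfolding frozen_def by measurable

lemma frozen_Suc: "frozen C (Suc t) \<omega> = (if alive C t \<omega> then X (Suc t) \<omega> else frozen C t \<omega>)"
proof (cases "alive C t \<omega> \<and> \<not> alive C (Suc t) \<omega>")
  case True
  hence "X (Suc t) \<omega> \<notin> C" by (auto simp: alive_def le_Suc_eq)
  moreover have "Suc t \<le> j" if "X j \<omega> \<notin> C" for j
    using that True by (force simp: alive_def not_less_eq_eq)
  ultimately have "(LEAST k. X k \<omega> \<notin> C) = Suc t" by (intro Least_equality) auto
  thus ?thesis using True by (simp add: frozen_def stop_def)
next
  case False
  thus ?thesis by (auto simp: frozen_def alive_def)
qed

lemma frozen_0: "frozen C 0 \<omega> = X 0 \<omega>"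
proof -
  have "X 0 \<omega> \<notin> C \<Longrightarrow> (LEAST k. X k \<omega> \<notin> C) = 0" by (intro Least_equality) auto
  thus ?thesis by (simp add: frozen_def alive_def stop_def)
qed

lemma frozen_supermartingale:
  assumes C: "finite C" and \<phi>: "\<And>x. 0 \<le> \<phi> x" "0 \<le> c" "\<And>x. x \<in> C \<Longrightarrow> avg \<phi> x + c \<le> \<phi> x"
  shows "(\<integral>\<^sup>+\<omega>. ennreal (\<phi> (frozen C t \<omega>)) \<partial>M) + (\<Sum>k<t. ennreal (c * prob {\<omega> \<in> space M. alive C k \<omega>}))
    \<le> ennreal (\<phi> s)"
proof (induction t)
  case 0
  have "(\<integral>\<^sup>+\<omega>. ennreal (\<phi> (X 0 \<omega>)) \<partial>M) = (\<integral>\<^sup>+\<omega>. ennreal (\<phi> s) \<partial>M)"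
    using X_0 by (intro nn_integral_cong_AE) auto
  thus ?case by (simp add: frozen_0 emeasure_space_1)
next
  case (Suc t)
  let ?A = "\<lambda>\<omega>. indicator {\<omega>. alive C t \<omega>} \<omega> :: ennreal"
  let ?B = "\<lambda>\<omega>. indicator {\<omega>. \<not> alive C t \<omega>} \<omega> :: ennreal"
  have "(\<integral>\<^sup>+\<omega>. ennreal (\<phi> (frozen C (Suc t) \<omega>)) \<partial>M) + ennreal (c * prob {\<omega> \<in> space M. alive C t \<omega>}) =
    (\<integral>\<^sup>+\<omega>. ennreal (\<phi> (X (Suc t) \<omega>)) * ?A \<omega> + ennreal (\<phi> (frozen C t \<omega>)) * ?B \<omega> \<partial>M)
      + ennreal (c * prob {\<omega> \<in> space M. alive C t \<omega>})"
    by (intro arg_cong2[where f = "(+)"] refl nn_integral_cong) (auto simp: frozen_Suc)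
  also have "\<dots> = ((\<integral>\<^sup>+\<omega>. ennreal (\<phi> (X (Suc t) \<omega>)) * ?A \<omega> \<partial>M) + ennreal (c * prob {\<omega> \<in> space M. alive C t \<omega>}))
      + (\<integral>\<^sup>+\<omega>. ennreal (\<phi> (frozen C t \<omega>)) * ?B \<omega> \<partial>M)"
    by (subst nn_integral_add) (auto simp: add_ac)
  also have "\<dots> \<le> (\<integral>\<^sup>+\<omega>. ennreal (\<phi> (X t \<omega>)) * ?A \<omega> \<partial>M) + (\<integral>\<^sup>+\<omega>. ennreal (\<phi> (frozen C t \<omega>)) * ?B \<omega> \<partial>M)"
    by (intro add_right_mono one_step[OF C \<phi>])
  also have "\<dots> = (\<integral>\<^sup>+\<omega>. ennreal (\<phi> (X t \<omega>)) * ?A \<omega> + ennreal (\<phi> (frozen C t \<omega>)) * ?B \<omega> \<partial>M)"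
    by (subst nn_integral_add) auto
  also have "\<dots> = (\<integral>\<^sup>+\<omega>. ennreal (\<phi> (frozen C t \<omega>)) \<partial>M)"
    by (intro nn_integral_cong) (auto simp: frozen_def)
  finally have "(\<integral>\<^sup>+\<omega>. ennreal (\<phi> (frozen C (Suc t) \<omega>)) \<partial>M) + ennreal (c * prob {\<omega> \<in> space M. alive C t \<omega>})
    \<le> (\<integral>\<^sup>+\<omega>. ennreal (\<phi> (frozen C t \<omega>)) \<partial>M)" .
  from order_trans[OF add_right_mono[OF this, of "\<Sum>k<t. ennreal (c * prob {\<omega> \<in> space M. alive C k \<omega>})"] Suc]
  show ?case by (simp add: ac_simps)
qed

text \<open>\<open>parab\<close> loses 1 on average with each step from a site of \<open>C\<close>,
  so the expected number of such steps is bounded by its starting value.\<close>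

lemma walk_exits:
  assumes C: "finite C"
  shows "AE \<omega> in M. exits (\<lambda>k. X k \<omega>) C"
proof -
  obtain R :: nat where R: "R \<ge> 1" "\<And>z. z \<in> C \<Longrightarrow> \<bar>fst z\<bar> < int R"
    by (rule finite_bounded_fst[OF C]) blast
  \<comment> \<open>The truncation makes the function nonnegative everywhere without changing it on
    \<open>C\<close> and its neighbours.\<close>
  define \<phi> where "\<phi> z = max 0 (parab (real R) z)" for z
  have \<phi>: "avg \<phi> x + 1 \<le> \<phi> x" if x: "x \<in> C" for x
  proof -
    have "avg \<phi> x = avg (parab (real R)) x"
    proof (rule avg_cong)
      fix e assume "e \<in> dirs"
      hence "\<bar>fst (x + e)\<bar> \<le> int R" using R(2) nbrsI[OF x] by (intro fst_nbr[of _ C]) auto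
      thus "\<phi> (x + e) = parab (real R) (x + e)" using parab_nonneg by (simp add: \<phi>_def)
    qed
    thus ?thesis using parab_nonneg[of x R] R(2)[OF x] by (simp add: avg_parab \<phi>_def)
  qed
  define N where "N = {\<omega> \<in> space M. \<not> exits (\<lambda>k. X k \<omega>) C}"
  have [measurable]: "N \<in> events" unfolding N_def by measurable
  have "real t * prob N \<le> \<phi> s" for t
  proof -
    have "(\<Sum>k<t. ennreal (prob {\<omega> \<in> space M. alive C k \<omega>})) \<le> ennreal (\<phi> s)"
    proof (rule order_trans[OF add_increasing[OF zero_le order_refl]])
      show "(\<integral>\<^sup>+\<omega>. ennreal (\<phi> (frozen C t \<omega>)) \<partial>M) + (\<Sum>k<t. ennreal (prob {\<omega> \<in> space M. alive C k \<omega>})) \<le> ennreal (\<phi> s)"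
        using frozen_supermartingale[OF C, of \<phi> 1 t] \<phi> by (simp add: \<phi>_def)
    qed
    hence "(\<Sum>k<t. prob {\<omega> \<in> space M. alive C k \<omega>}) \<le> \<phi> s"
    proof -
      assume "(\<Sum>k<t. ennreal (prob {\<omega> \<in> space M. alive C k \<omega>})) \<le> ennreal (\<phi> s)"
      hence "ennreal (\<Sum>k<t. prob {\<omega> \<in> space M. alive C k \<omega>}) \<le> ennreal (\<phi> s)"
        by (simp add: sum_ennreal)
      moreover have "0 \<le> \<phi> s" by (simp add: \<phi>_def)
      ultimately show ?thesis by (simp only: ennreal_le_iff)
    qed
    moreover have "(\<Sum>k<t. prob N) \<le> (\<Sum>k<t. prob {\<omega> \<in> space M. alive C k \<omega>})"
      by (intro sum_mono finite_measure_mono) (auto simp: N_def exits_def alive_def)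
    ultimately show ?thesis by simp
  qed
  hence "prob N = 0"
  proof -
    assume *: "\<And>t. real t * prob N \<le> \<phi> s"
    show ?thesis
    proof (rule ccontr)
      assume "prob N \<noteq> 0"
      hence "0 < prob N" by (simp add: zero_less_measure_iff)
      then obtain t where "\<phi> s < real t * prob N" using reals_Archimedean3 by blast
      thus False using *[of t] by simp
    qed
  qed
  hence "N \<in> null_sets M" by (simp add: null_sets_def emeasure_eq_measure)
  thus ?thesis by (rule AE_I'[of N]) (auto simp: N_def)
qed

lemma walk_stop_le:
  assumes C: "finite C" and \<phi>: "\<And>x. 0 \<le> \<phi> x" "\<And>x. x \<in> C \<Longrightarrow> avg \<phi> x \<le> \<phi> x"
  shows "(\<integral>\<^sup>+\<omega>. ennreal (\<phi> (stop (\<lambda>k. X k \<omega>) C)) \<partial>M) \<le> ennreal (\<phi> s)"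
proof -
  have "(\<integral>\<^sup>+\<omega>. ennreal (\<phi> (stop (\<lambda>k. X k \<omega>) C)) \<partial>M) = (\<integral>\<^sup>+\<omega>. liminf (\<lambda>t. ennreal (\<phi> (frozen C t \<omega>))) \<partial>M)"
    using walk_exits[OF C]
  proof (intro nn_integral_cong_AE, eventually_elim)
    case (elim \<omega>)
    then obtain k where k: "X k \<omega> \<notin> C" by (auto simp: exits_def)
    have "eventually (\<lambda>t. ennreal (\<phi> (frozen C t \<omega>)) = ennreal (\<phi> (stop (\<lambda>k. X k \<omega>) C))) sequentially"
      using eventually_ge_at_top[of k] by eventually_elim (use k in \<open>auto simp: frozen_def alive_def\<close>)
    hence "(\<lambda>t. ennreal (\<phi> (frozen C t \<omega>))) \<longlonglongrightarrow> ennreal (\<phi> (stop (\<lambda>k. X k \<omega>) C))"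
      by (rule tendsto_eventually)
    thus ?case by (metis lim_imp_Liminf sequentially_bot)
  qed
  also have "\<dots> \<le> liminf (\<lambda>t. \<integral>\<^sup>+\<omega>. ennreal (\<phi> (frozen C t \<omega>)) \<partial>M)"
    by (intro nn_integral_liminf) measurable
  also have "\<dots> \<le> limsup (\<lambda>t. \<integral>\<^sup>+\<omega>. ennreal (\<phi> (frozen C t \<omega>)) \<partial>M)"
    by (rule Liminf_le_Limsup) simp
  also have "\<dots> \<le> ennreal (\<phi> s)"
    using frozen_supermartingale[OF C, of \<phi> 0] \<phi> by (intro Limsup_bounded always_eventually) auto
  finally show ?thesis .
qed

lemma walk_hit_le:
  assumes C: "finite C" and u: "\<And>x. 0 \<le> u x" "\<And>x. x \<in> C \<Longrightarrow> avg u x \<le> u x" "\<And>x. x \<in> Z \<Longrightarrow> 1 \<le> u x"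
  shows "prob {\<omega> \<in> space M. stop (\<lambda>k. X k \<omega>) C \<in> Z} \<le> u s"
proof -
  have "ennreal (prob {\<omega> \<in> space M. stop (\<lambda>k. X k \<omega>) C \<in> Z}) =
      (\<integral>\<^sup>+\<omega>. indicator {\<omega> \<in> space M. stop (\<lambda>k. X k \<omega>) C \<in> Z} \<omega> \<partial>M)"
    by (simp add: emeasure_eq_measure)
  also have "\<dots> \<le> (\<integral>\<^sup>+\<omega>. ennreal (u (stop (\<lambda>k. X k \<omega>) C)) \<partial>M)"
    using u(3) by (intro nn_integral_mono) (auto simp: indicator_def)
  also have "\<dots> \<le> ennreal (u s)" by (rule walk_stop_le[OF C u(1,2)])
  finally show ?thesis using u(1)[of s] by (simp add: ennreal_le_iff)
qed

text \<open>The exponential of a superharmonic function need not be superharmonic. For arguments up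
  to 1 it is bounded by an increasing affine function of \<open>\<psi>\<close>, which is
  superharmonic; the price is the second-order term with
  \<open>\<theta>\<^sup>2 * B\<close>.\<close>

lemma walk_exp_le:
  assumes C: "finite C" and \<psi>: "\<And>x. 0 \<le> \<psi> x" "\<And>x. \<psi> x \<le> B" "\<And>x. x \<in> C \<Longrightarrow> avg \<psi> x \<le> \<psi> x"
    and \<theta>: "0 \<le> \<theta>" "\<theta> * B \<le> 1"
  shows "(\<integral>\<^sup>+\<omega>. ennreal (exp (\<theta> * \<psi> (stop (\<lambda>k. X k \<omega>) C))) \<partial>M) \<le> ennreal (exp ((\<theta> + \<theta>\<^sup>2 * B) * \<psi> s))"
proof -
  have B: "0 \<le> B" using \<psi>(1,2) order_trans by blast
  have "(\<integral>\<^sup>+\<omega>. ennreal (exp (\<theta> * \<psi> (stop (\<lambda>k. X k \<omega>) C))) \<partial>M) \<le>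
      (\<integral>\<^sup>+\<omega>. ennreal (1 + (\<theta> + \<theta>\<^sup>2 * B) * \<psi> (stop (\<lambda>k. X k \<omega>) C)) \<partial>M)"
  proof (intro nn_integral_mono ennreal_leI)
    fix \<omega>
    define a where "a = \<psi> (stop (\<lambda>k. X k \<omega>) C)"
    have a: "0 \<le> a" "a \<le> B" using \<psi> by (simp_all add: a_def)
    have "\<theta> * a \<le> \<theta> * B" using a \<theta> by (intro mult_left_mono)
    hence "exp (\<theta> * a) \<le> 1 + \<theta> * a + (\<theta> * a)\<^sup>2" using a \<theta> by (intro exp_bound) auto
    also have "(\<theta> * a)\<^sup>2 \<le> \<theta>\<^sup>2 * (B * a)"
      using a unfolding power_mult_distrib power2_eq_square[of a] by (intro mult_left_mono mult_right_mono) auto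
    finally show "exp (\<theta> * \<psi> (stop (\<lambda>k. X k \<omega>) C)) \<le> 1 + (\<theta> + \<theta>\<^sup>2 * B) * \<psi> (stop (\<lambda>k. X k \<omega>) C)"
      by (simp add: a_def[symmetric] algebra_simps)
  qed
  also have "\<dots> \<le> ennreal (1 + (\<theta> + \<theta>\<^sup>2 * B) * \<psi> s)"
  proof (rule walk_stop_le[OF C])
    fix x assume "x \<in> C"
    show "avg (\<lambda>x. 1 + (\<theta> + \<theta>\<^sup>2 * B) * \<psi> x) x \<le> 1 + (\<theta> + \<theta>\<^sup>2 * B) * \<psi> x"
      unfolding avg_add avg_cmult avg_const using \<psi>(3)[OF \<open>x \<in> C\<close>] B \<theta> by (intro add_left_mono mult_left_mono) auto
  qed (use \<psi>(1) B \<theta> in auto)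
  also have "\<dots> \<le> ennreal (exp ((\<theta> + \<theta>\<^sup>2 * B) * \<psi> s))"
    by (intro ennreal_leI exp_ge_add_one_self)
  finally show ?thesis .
qed

text \<open>The counterpart for subharmonic functions, based on exp(-y) \<le> 1 - y + y^2 for y
  \<ge> 0, which follows from (1 - y + y^2)(1 + y) = 1 + y^3.\<close>

lemma walk_exp_minus_le:
  assumes C: "finite C" and \<psi>: "\<And>x. 0 \<le> \<psi> x" "\<And>x. \<psi> x \<le> B" "\<And>x. x \<in> C \<Longrightarrow> \<psi> x \<le> avg \<psi> x"
    and \<theta>: "0 \<le> \<theta>" "\<theta> * B \<le> 1"
  shows "(\<integral>\<^sup>+\<omega>. ennreal (exp (- \<theta> * \<psi> (stop (\<lambda>k. X k \<omega>) C))) \<partial>M) \<le> ennreal (exp (- (\<theta> - \<theta>\<^sup>2 * B) * \<psi> s))"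
proof -
  have B: "0 \<le> B" using \<psi>(1,2) order_trans by blast
  define b where "b = \<theta> - \<theta>\<^sup>2 * B"
  have b: "0 \<le> b" using mult_left_mono[OF \<theta>(2,1)] by (simp add: b_def power2_eq_square mult.assoc)
  have "b * B \<le> \<theta> * B" unfolding b_def using B \<theta> by (intro mult_right_mono) auto
  hence bB: "b * B \<le> 1" using \<theta> by simp
  \<comment> \<open>Written through \<open>B - \<psi>\<close>, the affine bound has nonnegative
    coefficients, so it is a nonnegative superharmonic function and \<open>walk_stop_le\<close>
    applies to it.\<close>
  have "(\<integral>\<^sup>+\<omega>. ennreal (exp (- \<theta> * \<psi> (stop (\<lambda>k. X k \<omega>) C))) \<partial>M) \<le>
      (\<integral>\<^sup>+\<omega>. ennreal ((1 - b * B) + b * (B - \<psi> (stop (\<lambda>k. X k \<omega>) C))) \<partial>M)"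
  proof (intro nn_integral_mono ennreal_leI)
    fix \<omega>
    define a where "a = \<psi> (stop (\<lambda>k. X k \<omega>) C)"
    have a: "0 \<le> a" "a \<le> B" using \<psi> by (simp_all add: a_def)
    have t: "0 \<le> \<theta> * a" using a \<theta> by simp
    have "exp (- (\<theta> * a)) \<le> 1 - \<theta> * a + (\<theta> * a)\<^sup>2"
    proof -
      have "1 \<le> (1 - \<theta> * a + (\<theta> * a)\<^sup>2) * (1 + \<theta> * a)"
      proof -
        have "(1 - \<theta> * a + (\<theta> * a)\<^sup>2) * (1 + \<theta> * a) = 1 + (\<theta> * a) ^ 3"
          by (simp add: algebra_simps power2_eq_square power3_eq_cube)
        thus ?thesis using t by simp
      qed
      also have "\<dots> \<le> (1 - \<theta> * a + (\<theta> * a)\<^sup>2) * exp (\<theta> * a)"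
      proof (intro mult_left_mono exp_ge_add_one_self)
        have "0 \<le> (\<theta> * a - 1 / 2)\<^sup>2" by simp
        thus "0 \<le> 1 - \<theta> * a + (\<theta> * a)\<^sup>2" by (simp add: power2_eq_square algebra_simps)
      qed
      finally show ?thesis by (simp add: exp_minus field_simps)
    qed
    also have "(\<theta> * a)\<^sup>2 \<le> \<theta>\<^sup>2 * (B * a)"
      using a unfolding power_mult_distrib power2_eq_square[of a] by (intro mult_left_mono mult_right_mono) auto
    finally show "exp (- \<theta> * \<psi> (stop (\<lambda>k. X k \<omega>) C)) \<le> (1 - b * B) + b * (B - \<psi> (stop (\<lambda>k. X k \<omega>) C))"
      by (simp add: a_def[symmetric] b_def algebra_simps)
  qed
  also have "\<dots> \<le> ennreal ((1 - b * B) + b * (B - \<psi> s))"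
  proof (rule walk_stop_le[OF C])
    fix x assume "x \<in> C"
    show "avg (\<lambda>x. (1 - b * B) + b * (B - \<psi> x)) x \<le> (1 - b * B) + b * (B - \<psi> x)"
      unfolding avg_add avg_cmult avg_const avg_diff using \<psi>(3)[OF \<open>x \<in> C\<close>] b
      by (intro add_left_mono mult_left_mono) auto
  qed (use \<psi>(2) b bB in auto)
  also have "\<dots> = ennreal (1 + - b * \<psi> s)" by (simp add: algebra_simps)
  also have "\<dots> \<le> ennreal (exp (- b * \<psi> s))"
    by (intro ennreal_leI exp_ge_add_one_self)
  finally show ?thesis by (simp add: b_def)
qed

end

section \<open>Aggregates in which particles leaving a box are discarded\<close>

lemma deposit_stop: "deposit w A = (if exits w A then insert (stop w A) A else A)"
  by (simp add: deposit_def exits_def stop_def)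

text \<open>The particle is discarded if it leaves the box \<open>K\<close> before it finds a vacant site.\<close>

definition cstep :: "'a set \<Rightarrow> (nat \<Rightarrow> 'a) \<Rightarrow> 'a set \<Rightarrow> 'a set" where
  "cstep K w A = (if exits w (A \<inter> K) \<and> stop w (A \<inter> K) \<in> K then insert (stop w (A \<inter> K)) A else A)"

definition dropped :: "'a set \<Rightarrow> (nat \<Rightarrow> 'a) \<Rightarrow> 'a set \<Rightarrow> bool" where
  "dropped K w A \<longleftrightarrow> \<not> (exits w (A \<inter> K) \<and> stop w (A \<inter> K) \<in> K)"

lemma cstep_finite: "finite A \<Longrightarrow> finite (cstep K w A)"
  by (simp add: cstep_def)

lemma cstep_increasing: "A \<subseteq> cstep K w A"
  by (auto simp: cstep_def)

text \<open>The walk leaves the larger set either at the same site or later; in the second case that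
  site already belongs to the larger set.\<close>

lemma deposit_mono: "A \<subseteq> B \<Longrightarrow> deposit w A \<subseteq> deposit w B"
proof (cases "exits w A \<and> stop w A \<notin> B")
  case True
  assume "A \<subseteq> B"
  with True stop_subset[of w A B] show ?thesis by (auto simp: deposit_stop)
qed (auto simp: deposit_stop)

lemma cstep_eq_deposit:
  assumes "\<not> dropped K w A"
  shows "cstep K w A = deposit w A"
proof -
  have e: "exits w (A \<inter> K)" "stop w (A \<inter> K) \<in> K" using assms by (auto simp: dropped_def)
  with stop_notin[of w "A \<inter> K"] have "stop w (A \<inter> K) \<notin> A" by auto
  with e stop_subset[of w "A \<inter> K" A] show ?thesis by (simp add: cstep_def deposit_stop)
qed

definition cfold :: "('p \<Rightarrow> 'a set) \<Rightarrow> ('p \<Rightarrow> nat \<Rightarrow> 'a) \<Rightarrow> 'p list \<Rightarrow> 'a set" where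
  "cfold K w ps = fold (\<lambda>p. cstep (K p) (w p)) ps {}"

lemma cfold_Nil [simp]: "cfold K w [] = {}"
  by (simp add: cfold_def)

lemma cfold_snoc [simp]: "cfold K w (ps @ [p]) = cstep (K p) (w p) (cfold K w ps)"
  by (simp add: cfold_def)

lemma cfold_cong: "(\<And>p. p \<in> set ps \<Longrightarrow> w p = w' p) \<Longrightarrow> cfold K w ps = cfold K w' ps"
  by (induction ps rule: rev_induct) simp_all

lemma cfold_finite: "finite (cfold K w ps)"
  by (induction ps rule: rev_induct) (simp_all add: cstep_finite)

lemma cfold_append_increasing: "cfold K w ps \<subseteq> cfold K w (ps @ qs)"
proof (induction qs rule: rev_induct)
  case (snoc q qs)
  thus ?case using cstep_increasing[of "cfold K w (ps @ qs)" "K q" "w q"]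
    by (simp add: append_assoc[symmetric] del: append_assoc)
qed simp

lemma cfold_provenance: "z \<in> cfold K w ps \<Longrightarrow> \<exists>p\<in>set ps. z \<in> K p"
  by (induction ps rule: rev_induct) (auto simp: cstep_def split: if_splits)

text \<open>Every particle adds at most one site, and this lies in its own box.\<close>

lemma card_cfold_le:
  assumes "distinct ps"
  shows "card (cfold K w ps \<inter> T) \<le> card {p \<in> set ps. K p \<inter> T \<noteq> {}}"
  using assms
proof (induction ps rule: rev_induct)
  case (snoc p ps)
  let ?A = "cfold K w ps"
  show ?case
  proof (cases "K p \<inter> T = {}")
    case True
    hence "cfold K w (ps @ [p]) \<inter> T = ?A \<inter> T" by (auto simp: cstep_def)
    moreover have "{q \<in> set (ps @ [p]). K q \<inter> T \<noteq> {}} = {q \<in> set ps. K q \<inter> T \<noteq> {}}" using True by auto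
    ultimately show ?thesis using snoc by simp
  next
    case False
    have "cfold K w (ps @ [p]) \<inter> T \<subseteq> insert (stop (w p) (?A \<inter> K p)) (?A \<inter> T)" by (auto simp: cstep_def)
    hence "card (cfold K w (ps @ [p]) \<inter> T) \<le> card (insert (stop (w p) (?A \<inter> K p)) (?A \<inter> T))"
      by (intro card_mono) (simp_all add: cfold_finite)
    also have "\<dots> \<le> Suc (card (?A \<inter> T))" by (simp add: card_insert_if cfold_finite)
    also have "\<dots> \<le> Suc (card {q \<in> set ps. K q \<inter> T \<noteq> {}})" using snoc by simp
    also have "\<dots> = card (insert p {q \<in> set ps. K q \<inter> T \<noteq> {}})" using snoc.prems by simp
    also have "insert p {q \<in> set ps. K q \<inter> T \<noteq> {}} = {q \<in> set (ps @ [p]). K q \<inter> T \<noteq> {}}" using False by auto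
    finally show ?thesis .
  qed
qed simp

lemma aggregate_snoc [simp]: "aggregate s (ps @ [p]) = deposit (s (fst p) (snd p)) (aggregate s ps)"
  by (simp add: aggregate_def case_prod_unfold)

lemma cfold_eq_aggregate:
  assumes "\<And>qs p rs. ps = qs @ p # rs \<Longrightarrow> \<not> dropped (K p) (s (fst p) (snd p)) (cfold K (\<lambda>p. s (fst p) (snd p)) qs)"
  shows "cfold K (\<lambda>p. s (fst p) (snd p)) ps = aggregate s ps"
  using assms
proof (induction ps rule: rev_induct)
  case Nil
  thus ?case by (simp add: aggregate_def)
next
  case (snoc p ps)
  have "cfold K (\<lambda>p. s (fst p) (snd p)) ps = aggregate s ps"
    by (rule snoc.IH, rule snoc.prems) simp
  thus ?case using cstep_eq_deposit[OF snoc.prems[of ps p "[]"]] by simp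
qed

text \<open>Under the clocks a larger range of levels inserts new particles between the old ones.
  This gives the monotonicity of the aggregates all the same.\<close>

lemma aggregate_filter_mono: "aggregate s (filter P ps) \<subseteq> aggregate s ps"
proof (induction ps rule: rev_induct)
  case (snoc p ps)
  thus ?case
    using deposit_mono[OF snoc, of "s (fst p) (snd p)"] by (cases "P p") (auto simp: deposit_stop)
qed simp

text \<open>Finite sets of lattice sites form a countable set, so a random aggregate is a discrete
  random variable and can be conditioned on value by value.\<close>

abbreviation fsets :: "'a set set" where
  "fsets \<equiv> {A. finite A}"

lemma countable_fsets [simp]: "countable (fsets :: 'a::countable set set)"
  by (rule countable_Collect_finite)

lemma cstep_measurable:
  assumes "finite (A :: (int \<times> int) set)"
  shows "(\<lambda>w. cstep K w A) \<in> path_space \<rightarrow>\<^sub>M count_space fsets"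
proof -
  have "(\<lambda>w. if exits w (A \<inter> K) \<and> stop w (A \<inter> K) \<in> K then insert (stop w (A \<inter> K)) A else A)
      \<in> path_space \<rightarrow>\<^sub>M count_space fsets"
  proof (intro measurable_If)
    show "(\<lambda>w. insert (stop w (A \<inter> K)) A) \<in> path_space \<rightarrow>\<^sub>M count_space fsets"
      by (rule measurable_compose[OF stop_measurable]) (use assms in simp)
  qed (use assms in \<open>simp_all, measurable?\<close>)
  thus ?thesis by (simp add: cstep_def[abs_def])
qed

lemma dropped_measurable [measurable]: "Measurable.pred path_space (\<lambda>w. dropped K w A)"
  unfolding dropped_def by measurable

lemma cfold_measurable:
  assumes "set ps \<subseteq> I"
  shows "(\<lambda>w. cfold K w ps) \<in> PiM I (\<lambda>_. path_space) \<rightarrow>\<^sub>M count_space (fsets :: (int \<times> int) set set)"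
  using assms
proof (induction ps rule: rev_induct)
  case Nil
  thus ?case by simp
next
  case (snoc p ps)
  have *: "(\<lambda>w. cfold K w ps) \<in> PiM I (\<lambda>_. path_space) \<rightarrow>\<^sub>M count_space fsets"
    using snoc by simp
  have "(\<lambda>w. cstep (K p) (w p) (cfold K w ps)) \<in> PiM I (\<lambda>_. path_space) \<rightarrow>\<^sub>M count_space fsets"
  proof (rule measurable_compose_countable'[OF _ *])
    fix A :: "(int \<times> int) set" assume "A \<in> fsets"
    hence "(\<lambda>w. cstep (K p) w A) \<in> path_space \<rightarrow>\<^sub>M count_space fsets" by (intro cstep_measurable) simp
    moreover have "(\<lambda>w. w p) \<in> PiM I (\<lambda>_. path_space) \<rightarrow>\<^sub>M path_space"
      using snoc.prems by (intro measurable_component_singleton) simp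
    ultimately show "(\<lambda>w. cstep (K p) (w p) A) \<in> PiM I (\<lambda>_. path_space) \<rightarrow>\<^sub>M count_space fsets"
      by (rule measurable_compose[rotated])
  qed simp
  thus ?case by simp
qed

lemma (in prob_space) indep_var_nn_integral:
  assumes "indep_var N1 Y N2 Z" and g[measurable]: "case_prod g \<in> borel_measurable (N1 \<Otimes>\<^sub>M N2)"
  shows "(\<integral>\<^sup>+\<omega>. g (Y \<omega>) (Z \<omega>) \<partial>M) = (\<integral>\<^sup>+\<omega>. (\<integral>\<^sup>+\<omega>'. g (Y \<omega>) (Z \<omega>') \<partial>M) \<partial>M)"
proof -
  have Y[measurable]: "Y \<in> M \<rightarrow>\<^sub>M N1" and Z[measurable]: "Z \<in> M \<rightarrow>\<^sub>M N2"
    and eq: "distr M N1 Y \<Otimes>\<^sub>M distr M N2 Z = distr M (N1 \<Otimes>\<^sub>M N2) (\<lambda>x. (Y x, Z x))"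
    using assms(1) unfolding indep_var_distribution_eq by auto
  interpret Z: prob_space "distr M N2 Z" by (rule prob_space_distr) fact
  have "(\<integral>\<^sup>+\<omega>. g (Y \<omega>) (Z \<omega>) \<partial>M) = (\<integral>\<^sup>+x. case_prod g x \<partial>distr M (N1 \<Otimes>\<^sub>M N2) (\<lambda>x. (Y x, Z x)))"
    by (subst nn_integral_distr) auto
  also have "\<dots> = (\<integral>\<^sup>+y. (\<integral>\<^sup>+z. g y z \<partial>distr M N2 Z) \<partial>distr M N1 Y)"
    by (subst eq[symmetric], subst Z.nn_integral_fst[symmetric]) auto
  also have "\<dots> = (\<integral>\<^sup>+\<omega>. (\<integral>\<^sup>+z. g (Y \<omega>) z \<partial>distr M N2 Z) \<partial>M)"
    by (subst nn_integral_distr) (auto intro: Z.borel_measurable_nn_integral)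
  also have "\<dots> = (\<integral>\<^sup>+\<omega>. (\<integral>\<^sup>+\<omega>'. g (Y \<omega>) (Z \<omega>') \<partial>M) \<partial>M)"
  proof (rule nn_integral_cong)
    fix \<omega> assume "\<omega> \<in> space M"
    hence "Y \<omega> \<in> space N1" using measurable_space[OF Y] by simp
    hence "g (Y \<omega>) \<in> borel_measurable N2" using measurable_Pair2[OF g] by simp
    thus "(\<integral>\<^sup>+z. g (Y \<omega>) z \<partial>distr M N2 Z) = (\<integral>\<^sup>+\<omega>'. g (Y \<omega>) (Z \<omega>') \<partial>M)"
      by (subst nn_integral_distr) auto
  qed
  finally show ?thesis .
qed

section \<open>The aggregate driven by independent walks\<close>

locale walks = prob_space M for M :: "'w measure" +
  fixes S :: "int \<Rightarrow> nat \<Rightarrow> nat \<Rightarrow> 'w \<Rightarrow> int \<times> int"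
  assumes walks: "independent_walks M S"
begin

definition W :: "int \<times> nat \<Rightarrow> 'w \<Rightarrow> nat \<Rightarrow> int \<times> int" where
  "W p \<omega> = (\<lambda>k. S (fst p) (snd p) k \<omega>)"

lemma walk: "p \<in> particles \<Longrightarrow> walk M (0, fst p) (\<lambda>k \<omega>. W p \<omega> k)"
  using walks by (cases p) (auto simp: walk_def walk_axioms_def independent_walks_def W_def intro: prob_space_axioms)

lemma W_indep: "indep_vars (\<lambda>_. path_space) W particles"
proof -
  have "W = (\<lambda>(i, j) \<omega> k. S i j k \<omega>)" by (auto simp: W_def fun_eq_iff)
  thus ?thesis using walks by (simp add: independent_walks_def)
qed

lemma W_measurable [measurable]: "p \<in> particles \<Longrightarrow> W p \<in> M \<rightarrow>\<^sub>M path_space"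
  using W_indep unfolding indep_vars_def by blast

definition cagg :: "(int \<times> nat \<Rightarrow> (int \<times> int) set) \<Rightarrow> (int \<times> nat) list \<Rightarrow> 'w \<Rightarrow> (int \<times> int) set" where
  "cagg K ps \<omega> = cfold K (\<lambda>p. W p \<omega>) ps"

lemma cagg_measurable:
  assumes "set ps \<subseteq> particles"
  shows "cagg K ps \<in> M \<rightarrow>\<^sub>M count_space fsets"
proof -
  have "(\<lambda>\<omega>. restrict (\<lambda>q. W q \<omega>) (set ps)) \<in> M \<rightarrow>\<^sub>M PiM (set ps) (\<lambda>_. path_space)"
    using assms by (intro measurable_restrict W_measurable) auto
  from measurable_compose[OF this cfold_measurable[OF order_refl]]
  have "(\<lambda>\<omega>. cfold K (restrict (\<lambda>q. W q \<omega>) (set ps)) ps) \<in> M \<rightarrow>\<^sub>M count_space fsets" .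
  moreover have "cfold K (restrict (\<lambda>q. W q \<omega>) (set ps)) ps = cagg K ps \<omega>" for \<omega>
    unfolding cagg_def by (intro cfold_cong) simp
  ultimately show ?thesis by simp
qed

lemma cagg_pred [measurable]: "set ps \<subseteq> particles \<Longrightarrow> Measurable.pred M (\<lambda>\<omega>. Q (cagg K ps \<omega>))"
  by (rule measurable_compose[OF cagg_measurable]) simp_all

text \<open>The aggregate depends only on the walks of the particles in \<open>ps\<close>, which are
  independent of the walk of \<open>p\<close>. One may thus integrate over the next walk with the
  aggregate held fixed.\<close>

lemma cagg_next_nn_integral:
  assumes "distinct (ps @ [p])" "set (ps @ [p]) \<subseteq> particles"
    and g: "\<And>A. finite A \<Longrightarrow> g A \<in> borel_measurable path_space"
  shows "(\<integral>\<^sup>+\<omega>. g (cagg K ps \<omega>) (W p \<omega>) \<partial>M) = (\<integral>\<^sup>+\<omega>. (\<integral>\<^sup>+\<omega>'. g (cagg K ps \<omega>) (W p \<omega>') \<partial>M) \<partial>M)"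
proof -
  let ?N1 = "PiM (set ps) (\<lambda>_. path_space)" and ?N2 = "PiM {p} (\<lambda>_. path_space)"
  have ind: "indep_var ?N1 (\<lambda>\<omega>. restrict (\<lambda>q. W q \<omega>) (set ps)) ?N2 (\<lambda>\<omega>. restrict (\<lambda>q. W q \<omega>) {p})"
    by (rule indep_var_restrict[OF W_indep]) (use assms in auto)
  have eq: "cfold K (restrict (\<lambda>q. W q \<omega>) (set ps)) ps = cagg K ps \<omega>" for \<omega>
    unfolding cagg_def by (intro cfold_cong) simp
  have "(\<lambda>yz. g (cfold K (fst yz) ps) (snd yz p)) \<in> borel_measurable (?N1 \<Otimes>\<^sub>M ?N2)"
  proof (rule measurable_compose_countable'[where I = fsets])
    fix A :: "(int \<times> int) set" assume "A \<in> fsets"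
    hence "g A \<in> borel_measurable path_space" using g by simp
    moreover have "(\<lambda>yz. snd yz p) \<in> ?N1 \<Otimes>\<^sub>M ?N2 \<rightarrow>\<^sub>M path_space"
      by (rule measurable_compose[OF measurable_snd measurable_component_singleton]) simp
    ultimately show "(\<lambda>yz. g A (snd yz p)) \<in> borel_measurable (?N1 \<Otimes>\<^sub>M ?N2)"
      by (rule measurable_compose[rotated])
  next
    show "(\<lambda>yz. cfold K (fst yz) ps) \<in> ?N1 \<Otimes>\<^sub>M ?N2 \<rightarrow>\<^sub>M count_space fsets"
      by (rule measurable_compose[OF measurable_fst cfold_measurable]) simp
  qed simp
  hence "case_prod (\<lambda>y z. g (cfold K y ps) (z p)) \<in> borel_measurable (?N1 \<Otimes>\<^sub>M ?N2)"
    by (simp add: case_prod_unfold)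
  from indep_var_nn_integral[OF ind this] show ?thesis by (simp add: eq)
qed

text \<open>This reduces an exponential moment of the whole aggregate to an estimate for one
  particle and an arbitrary finite aggregate.\<close>

lemma cagg_supermartingale:
  assumes "distinct ps" "set ps \<subseteq> particles"
    and v: "\<And>p A. p \<in> set ps \<Longrightarrow> finite A \<Longrightarrow> (\<integral>\<^sup>+\<omega>. v (cstep (K p) (W p \<omega>) A) \<partial>M) \<le> a p * v A"
  shows "(\<integral>\<^sup>+\<omega>. v (cagg K ps \<omega>) \<partial>M) \<le> (\<Prod>p\<in>set ps. a p) * (v {} :: ennreal)"
  using assms
proof (induction ps rule: rev_induct)
  case Nil
  thus ?case by (simp add: cagg_def emeasure_space_1)
next
  case (snoc p ps)
  have "(\<integral>\<^sup>+\<omega>. v (cagg K (ps @ [p]) \<omega>) \<partial>M) = (\<integral>\<^sup>+\<omega>. v (cstep (K p) (W p \<omega>) (cagg K ps \<omega>)) \<partial>M)"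
    by (simp add: cagg_def)
  also have "\<dots> = (\<integral>\<^sup>+\<omega>. (\<integral>\<^sup>+\<omega>'. v (cstep (K p) (W p \<omega>') (cagg K ps \<omega>)) \<partial>M) \<partial>M)"
  proof (rule cagg_next_nn_integral[OF snoc.prems(1,2)])
    fix A :: "(int \<times> int) set" assume "finite A"
    from cstep_measurable[OF this] show "(\<lambda>w. v (cstep (K p) w A)) \<in> borel_measurable path_space"
      by (rule measurable_compose) simp
  qed
  also have "\<dots> \<le> (\<integral>\<^sup>+\<omega>. a p * v (cagg K ps \<omega>) \<partial>M)"
    by (intro nn_integral_mono snoc.prems(3)) (simp_all add: cagg_def cfold_finite)
  also have "\<dots> = a p * (\<integral>\<^sup>+\<omega>. v (cagg K ps \<omega>) \<partial>M)"
    using snoc.prems by (intro nn_integral_cmult measurable_compose[OF cagg_measurable]) auto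
  also have "\<dots> \<le> a p * ((\<Prod>p\<in>set ps. a p) * v {})"
    using snoc by (intro mult_left_mono) auto
  also have "\<dots> = (\<Prod>p\<in>set (ps @ [p]). a p) * v {}"
    using snoc.prems by (simp add: mult.assoc)
  finally show ?case .
qed

lemma cagg_next_prob:
  assumes "distinct (ps @ [p])" "set (ps @ [p]) \<subseteq> particles"
    and R: "\<And>A. Measurable.pred path_space (R A)"
    and le: "\<And>\<omega>. Q (cagg K ps \<omega>) \<Longrightarrow> prob {\<omega>' \<in> space M. R (cagg K ps \<omega>) (W p \<omega>')} \<le> c" and c: "0 \<le> c"
  shows "prob {\<omega> \<in> space M. Q (cagg K ps \<omega>) \<and> R (cagg K ps \<omega>) (W p \<omega>)} \<le> c"
proof -
  have p: "p \<in> particles" and ps: "set ps \<subseteq> particles" using assms(2) by auto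
  define g where "g A w = (if Q A then indicator {w. R A w} w else 0 :: ennreal)" for A w
  have [measurable]: "Measurable.pred path_space (R A)" for A by (rule R)
  have gm: "g A \<in> borel_measurable path_space" for A
    unfolding g_def using R[of A] by (cases "Q A") (auto simp: pred_def)
  define E where "E = {\<omega> \<in> space M. Q (cagg K ps \<omega>) \<and> R (cagg K ps \<omega>) (W p \<omega>)}"
  have [measurable]: "Measurable.pred M (\<lambda>\<omega>. Q (cagg K ps \<omega>))" by (rule cagg_pred[OF ps])
  have [measurable]: "Measurable.pred M (\<lambda>\<omega>. R (cagg K ps \<omega>) (W p \<omega>))"
    using p ps by (intro measurable_compose_countable'[OF measurable_compose[OF W_measurable R] cagg_measurable]) auto
  have [measurable]: "E \<in> events" unfolding E_def by measurable
  have "emeasure M E = (\<integral>\<^sup>+\<omega>. indicator E \<omega> \<partial>M)" by simp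
  also have "\<dots> = (\<integral>\<^sup>+\<omega>. g (cagg K ps \<omega>) (W p \<omega>) \<partial>M)"
    by (intro nn_integral_cong) (auto simp: g_def E_def indicator_def)
  also have "\<dots> = (\<integral>\<^sup>+\<omega>. (\<integral>\<^sup>+\<omega>'. g (cagg K ps \<omega>) (W p \<omega>') \<partial>M) \<partial>M)"
    by (rule cagg_next_nn_integral[OF assms(1,2) gm])
  also have "\<dots> \<le> (\<integral>\<^sup>+\<omega>. ennreal c \<partial>M)"
  proof (rule nn_integral_mono)
    fix \<omega>
    show "(\<integral>\<^sup>+\<omega>'. g (cagg K ps \<omega>) (W p \<omega>') \<partial>M) \<le> ennreal c"
    proof (cases "Q (cagg K ps \<omega>)")
      case True
      have [measurable]: "{\<omega>' \<in> space M. R (cagg K ps \<omega>) (W p \<omega>')} \<in> events"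
        using p measurable_compose[OF W_measurable[OF p] R] by (simp add: pred_def)
      have "(\<integral>\<^sup>+\<omega>'. g (cagg K ps \<omega>) (W p \<omega>') \<partial>M) =
          (\<integral>\<^sup>+\<omega>'. indicator {\<omega>' \<in> space M. R (cagg K ps \<omega>) (W p \<omega>')} \<omega>' \<partial>M)"
        using True by (intro nn_integral_cong) (auto simp: g_def indicator_def)
      also have "\<dots> = ennreal (prob {\<omega>' \<in> space M. R (cagg K ps \<omega>) (W p \<omega>')})"
        by (simp add: emeasure_eq_measure)
      also have "\<dots> \<le> ennreal c" by (intro ennreal_leI le True)
      finally show ?thesis .
    qed (simp add: g_def)
  qed
  also have "\<dots> = ennreal c" by (simp add: emeasure_space_1)
  finally have "ennreal (prob E) \<le> ennreal c" by (simp add: emeasure_eq_measure)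
  thus ?thesis using c by (simp add: E_def)
qed

end

lemma prod_exp: "(\<Prod>p\<in>I. ennreal (exp (f p))) = ennreal (exp (\<Sum>p\<in>I. f p))"
  by (cases "finite I") (simp_all add: prod_ennreal exp_sum)

context walks
begin

text \<open>The hitting probability is bounded by the harmonic function on \<open>C\<close> with
  boundary values \<open>indicator Z\<close>, and that function by
  \<open>layered_crossing\<close>.\<close>

lemma hit_prob_layers:
  fixes \<xi> :: "int \<times> int \<Rightarrow> real"
  assumes p: "p \<in> particles" and C: "finite C" and l: "0 < l" and q: "0 \<le> q"
    and lip: "\<And>x y. \<xi> y \<le> \<xi> x + nrm (y - x)"
    and Z: "\<And>x. x \<in> Z \<Longrightarrow> x \<notin> C \<and> c + m * (l + 2) < \<xi> x"
    and dens: "\<And>x0. x0 \<in> C \<Longrightarrow> c < \<xi> x0 \<Longrightarrow> \<xi> x0 \<le> c + m * (l + 2) \<Longrightarrow>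
      card {x \<in> C. nrm (x - x0) < l} * log 2 (1 + (2 * l + 1)\<^sup>2) / l\<^sup>2 \<le> q"
    and start: "\<xi> (0, fst p) \<le> c"
  shows "prob {\<omega> \<in> space M. stop (W p \<omega>) C \<in> Z} \<le> q ^ m"
proof -
  interpret w: walk M "(0, fst p)" "\<lambda>k \<omega>. W p \<omega> k" by (rule walk[OF p])
  obtain u where off: "\<And>x. x \<notin> C \<Longrightarrow> u x = indicator Z x" and on: "\<And>x. x \<in> C \<Longrightarrow> u x = avg u x"
    and nonneg: "\<And>x. 0 \<le> u x"
    using poisson_problem[OF C, of "\<lambda>_. 0" "indicator Z"] by auto
  have "u x \<le> 1" for x
  proof (cases "x \<in> C")
    case True
    show ?thesis
    proof (rule max_principle[OF C _ _ True])
      show "x \<in> C \<Longrightarrow> u x \<le> avg u x" for x using on[of x] by linarith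
      show "y \<notin> C \<Longrightarrow> u y \<le> 1" for y using off[of y] by (simp add: indicator_def)
    qed
  qed (simp add: off indicator_def)
  moreover have "u x \<le> 0" if "x \<notin> C" "\<xi> x \<le> c + m * (l + 2)" for x
    using off[OF that(1)] Z[of x] that(2) by (auto simp: indicator_def)
  moreover have "x \<in> C \<Longrightarrow> u x \<le> avg u x" "x \<in> C \<Longrightarrow> avg u x \<le> u x" for x
    using on[of x] by linarith+
  ultimately have "u (0, fst p) \<le> q ^ m"
    using dens start by (intro layered_crossing[OF C l q lip]) simp_all
  moreover have "prob {\<omega> \<in> space M. stop (W p \<omega>) C \<in> Z} \<le> u (0, fst p)"
  proof (rule w.walk_hit_le[OF C nonneg, simplified])
    show "x \<in> C \<Longrightarrow> avg u x \<le> u x" for x using on[of x] by linarith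
    show "x \<in> Z \<Longrightarrow> 1 \<le> u x" for x using off[of x] Z[of x] by simp
  qed
  ultimately show ?thesis by linarith
qed

lemma dropped_prob_le:
  assumes p: "p \<in> particles" and A: "finite A" and K: "- K \<subseteq> Z1 \<union> Z2"
    and "prob {\<omega> \<in> space M. stop (W p \<omega>) (A \<inter> K) \<in> Z1} \<le> c1"
    and "prob {\<omega> \<in> space M. stop (W p \<omega>) (A \<inter> K) \<in> Z2} \<le> c2"
  shows "prob {\<omega> \<in> space M. dropped K (W p \<omega>) A} \<le> c1 + c2"
proof -
  interpret w: walk M "(0, fst p)" "\<lambda>k \<omega>. W p \<omega> k" by (rule walk[OF p])
  have C: "finite (A \<inter> K)" using A by simp
  have [measurable]: "(\<lambda>\<omega>. stop (W p \<omega>) (A \<inter> K)) \<in> M \<rightarrow>\<^sub>M count_space UNIV"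
    using p by (intro measurable_compose[OF W_measurable stop_measurable])
  have m: "{\<omega> \<in> space M. stop (W p \<omega>) (A \<inter> K) \<in> Z} \<in> events" for Z by measurable
  have "prob {\<omega> \<in> space M. dropped K (W p \<omega>) A} \<le>
      prob ({\<omega> \<in> space M. stop (W p \<omega>) (A \<inter> K) \<in> Z1} \<union> {\<omega> \<in> space M. stop (W p \<omega>) (A \<inter> K) \<in> Z2})"
    using w.walk_exits[OF C] K
    by (intro finite_measure_mono_AE sets.Un m) (auto simp: dropped_def elim!: eventually_mono)
  also have "\<dots> \<le> prob {\<omega> \<in> space M. stop (W p \<omega>) (A \<inter> K) \<in> Z1} + prob {\<omega> \<in> space M. stop (W p \<omega>) (A \<inter> K) \<in> Z2}"
    by (intro measure_Un_le m)
  finally show ?thesis using assms by linarith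
qed

text \<open>If \<open>z0\<close> stays vacant, the Green function with pole \<open>z0\<close> is harmonic on the aggregate, so its
  sum over the aggregate grows at the rate prescribed by the starting points; but this sum is at most
  the sum over the whole box.\<close>

lemma vacant_prob_le:
  assumes ps: "distinct ps" "set ps \<subseteq> particles"
    and D: "D = sbox R H c" and h: "h = green D (\<lambda>z. if z = z0 then 1 else 0)" and z0: "z0 \<in> D"
    and B: "\<And>x. h x \<le> B" and \<theta>: "0 \<le> \<theta>" "\<theta> * B \<le> 1"
    and K: "\<And>p. p \<in> set ps \<Longrightarrow> \<bar>fst p - c\<bar> < H \<Longrightarrow> D \<subseteq> K p"
  shows "prob {\<omega> \<in> space M. z0 \<notin> cagg K ps \<omega>} \<le>
    exp (\<theta> * (\<Sum>z\<in>D. h z) - (\<theta> - \<theta>\<^sup>2 * B) * (\<Sum>p\<in>{p \<in> set ps. \<bar>fst p - c\<bar> < H}. h (0, fst p)))"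
proof -
  have finD: "finite D" by (simp add: D)
  have h0: "0 \<le> h x" for x unfolding h using finD by (intro green_nonneg) auto
  have hout: "h x = 0" if "x \<notin> D" for x unfolding h using finD that by (intro green_outside) auto
  have heq: "h x = avg h x" if "x \<in> D" "x \<noteq> z0" for x
    using green_eq[OF finD, of "\<lambda>z. if z = z0 then 1 else 0" x] that unfolding h by simp
  define Q where "Q A = (\<Sum>z\<in>A \<inter> D. h z)" for A
  \<comment> \<open>Once \<open>z0\<close> is occupied \<open>h\<close> fails to be subharmonic on
    the aggregate; setting \<open>v\<close> to zero from then on keeps it a supermartingale.\<close>
  define v where "v A = (if z0 \<in> A then 0 else ennreal (exp (- \<theta> * Q A)))" for A
  define a where "a p = (if \<bar>fst p - c\<bar> < H then - (\<theta> - \<theta>\<^sup>2 * B) * h (0, fst p) else 0)" for p :: "int \<times> nat"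
  have Qmono: "Q A \<le> Q A'" if "A \<subseteq> A'" for A A'
    unfolding Q_def using that finD h0 by (intro sum_mono2) auto
  have vmono: "v A' \<le> v A" if "A \<subseteq> A'" for A A'
    using that Qmono[OF that] \<theta> by (auto simp: v_def mult_left_mono intro!: ennreal_leI)
  have step: "(\<integral>\<^sup>+\<omega>. v (cstep (K p) (W p \<omega>) A) \<partial>M) \<le> ennreal (exp (a p)) * v A"
    if p: "p \<in> set ps" and A: "finite A" for p A
  proof (cases "\<bar>fst p - c\<bar> < H \<and> z0 \<notin> A")
    case False
    have "(\<integral>\<^sup>+\<omega>. v (cstep (K p) (W p \<omega>) A) \<partial>M) \<le> (\<integral>\<^sup>+\<omega>. v A \<partial>M)"
      by (intro nn_integral_mono vmono cstep_increasing)
    thus ?thesis using False by (auto simp: emeasure_space_1 a_def v_def)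
  next
    case True
    have pp: "p \<in> particles" using p ps by auto
    interpret w: walk M "(0, fst p)" "\<lambda>k \<omega>. W p \<omega> k" by (rule walk[OF pp])
    have C: "finite (A \<inter> D)" using A by simp
    have DK: "D \<subseteq> K p" using K[OF p] True by auto
    have m: "(\<lambda>\<omega>. ennreal (exp (- \<theta> * h (stop (W p \<omega>) (A \<inter> D))))) \<in> borel_measurable M"
      by (rule measurable_compose[OF measurable_compose[OF W_measurable[OF pp] stop_measurable]]) simp
    have "(\<integral>\<^sup>+\<omega>. v (cstep (K p) (W p \<omega>) A) \<partial>M) \<le>
        (\<integral>\<^sup>+\<omega>. v A * ennreal (exp (- \<theta> * h (stop (W p \<omega>) (A \<inter> D)))) \<partial>M)"
    proof (rule nn_integral_mono_AE, rule eventually_mono[OF w.walk_exits[OF C]])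
      fix \<omega> assume "exits (\<lambda>k. W p \<omega> k) (A \<inter> D)"
      hence elim: "exits (W p \<omega>) (A \<inter> D)" by simp
      define e where "e = stop (W p \<omega>) (A \<inter> D)"
      have e: "e \<notin> A \<inter> D" using stop_notin[OF elim] by (simp add: e_def)
      show "v (cstep (K p) (W p \<omega>) A) \<le> v A * ennreal (exp (- \<theta> * h (stop (W p \<omega>) (A \<inter> D))))"
      proof (cases "e \<in> D")
        case eD: True
        \<comment> \<open>The walk is followed only up to its exit from \<open>A \<inter> D\<close>.
          If it ends inside \<open>D\<close>, which is part of the box of the particle, it has
          settled there; otherwise \<open>h\<close> vanishes at its end, and monotonicity of
          \<open>Q\<close> suffices.\<close>
        have "exits (W p \<omega>) (A \<inter> K p)" "stop (W p \<omega>) (A \<inter> K p) = e"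
          using stop_subset[OF elim, of "A \<inter> K p"] e eD DK by (auto simp: e_def)
        hence cs: "cstep (K p) (W p \<omega>) A = insert e A" using eD DK by (auto simp: cstep_def)
        have "Q (insert e A) = h e + Q A"
          using e eD finD by (simp add: Q_def Int_insert_left)
        hence "exp (- \<theta> * Q (insert e A)) = exp (- \<theta> * Q A) * exp (- \<theta> * h e)"
          by (simp add: exp_add[symmetric] algebra_simps)
        thus ?thesis using True by (auto simp: cs v_def e_def[symmetric] ennreal_mult[symmetric])
      next
        case False
        hence "h e = 0" by (rule hout)
        thus ?thesis using vmono[OF cstep_increasing] by (simp add: e_def[symmetric])
      qed
    qed
    also have "\<dots> = v A * (\<integral>\<^sup>+\<omega>. ennreal (exp (- \<theta> * h (stop (W p \<omega>) (A \<inter> D)))) \<partial>M)"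
      by (rule nn_integral_cmult[OF m])
    also have "\<dots> \<le> v A * ennreal (exp (- (\<theta> - \<theta>\<^sup>2 * B) * h (0, fst p)))"
    proof (intro mult_left_mono w.walk_exp_minus_le[OF C h0 B _ \<theta>])
      fix x assume "x \<in> A \<inter> D"
      thus "h x \<le> avg h x" using heq[of x] True by (cases "x = z0") auto
    qed simp
    finally show ?thesis using True by (simp add: a_def mult.commute)
  qed
  \<comment> \<open>Preparation for Markov's inequality: a lower bound for \<open>v\<close> on the
    event that \<open>z0\<close> is vacant.\<close>
  have vac: "ennreal (exp (- \<theta> * (\<Sum>z\<in>D. h z))) \<le> v A" if "z0 \<notin> A" for A
  proof -
    have "Q A \<le> (\<Sum>z\<in>D. h z)" unfolding Q_def using finD h0 by (intro sum_mono2) auto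
    thus ?thesis using that \<theta> by (auto simp: v_def mult_left_mono intro!: ennreal_leI)
  qed
  define E where "E = {\<omega> \<in> space M. z0 \<notin> cagg K ps \<omega>}"
  have [measurable]: "E \<in> events" unfolding E_def using cagg_pred[OF ps(2), of "\<lambda>A. z0 \<notin> A"] by (simp add: pred_def)
  have "ennreal (exp (- \<theta> * (\<Sum>z\<in>D. h z))) * emeasure M E =
      (\<integral>\<^sup>+\<omega>. ennreal (exp (- \<theta> * (\<Sum>z\<in>D. h z))) * indicator E \<omega> \<partial>M)"
    by (simp add: nn_integral_cmult_indicator)
  also have "\<dots> \<le> (\<integral>\<^sup>+\<omega>. v (cagg K ps \<omega>) \<partial>M)"
    using vac by (intro nn_integral_mono) (auto simp: E_def indicator_def)
  also have "\<dots> \<le> (\<Prod>p\<in>set ps. ennreal (exp (a p))) * v {}"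
    by (rule cagg_supermartingale[OF ps step])
  also have "\<dots> = ennreal (exp (\<Sum>p\<in>set ps. a p))"
    by (simp add: prod_exp v_def Q_def)
  finally have "ennreal (exp (- \<theta> * (\<Sum>z\<in>D. h z)) * prob E) \<le> ennreal (exp (\<Sum>p\<in>set ps. a p))"
    by (simp add: emeasure_eq_measure ennreal_mult)
  hence "exp (- \<theta> * (\<Sum>z\<in>D. h z)) * prob E \<le> exp (\<Sum>p\<in>set ps. a p)"
    by (simp only: ennreal_le_iff exp_ge_zero)
  hence "prob E \<le> exp (\<theta> * (\<Sum>z\<in>D. h z)) * exp (\<Sum>p\<in>set ps. a p)"
    by (simp add: exp_minus field_simps)
  also have "(\<Sum>p\<in>set ps. a p) = - (\<theta> - \<theta>\<^sup>2 * B) * (\<Sum>p\<in>{p \<in> set ps. \<bar>fst p - c\<bar> < H}. h (0, fst p))"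
    unfolding a_def by (subst sum.inter_filter[symmetric]) (simp_all add: sum_distrib_left)
  finally show ?thesis by (simp only: E_def mult_minus_left exp_add[symmetric] add_uminus_conv_diff)
qed

text \<open>The upper counterpart of \<open>vacant_prob_le\<close>: a bound for the total potential
  of the occupied sites in \<open>D'\<close>. Particles of \<open>P\<close> move where
  \<open>\<psi>\<close> is superharmonic, so the expected potential at their ends is at most that at
  their starts; the others cannot settle in \<open>D'\<close>.\<close>

lemma mass_prob_le:
  assumes ps: "distinct ps" "set ps \<subseteq> particles"
    and D: "finite D" and \<psi>: "\<psi> = green D \<mu>" and \<mu>: "\<And>x. 0 \<le> \<mu> x"
    and B: "\<And>x. \<psi> x \<le> B" and \<theta>: "0 \<le> \<theta>" "\<theta> * B \<le> 1"
    and K: "\<And>p. p \<in> set ps \<Longrightarrow> p \<in> P \<Longrightarrow> K p \<subseteq> D" "\<And>p. p \<in> set ps \<Longrightarrow> p \<notin> P \<Longrightarrow> K p \<inter> D' = {}"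
  shows "prob {\<omega> \<in> space M. x \<le> (\<Sum>z\<in>cagg K ps \<omega> \<inter> D'. \<psi> z)} \<le>
    exp ((\<theta> + \<theta>\<^sup>2 * B) * (\<Sum>p\<in>set ps \<inter> P. \<psi> (0, fst p)) - \<theta> * x)"
proof -
  have h0: "0 \<le> \<psi> x" for x unfolding \<psi> using D \<mu> by (intro green_nonneg) auto
  have heq: "avg \<psi> x \<le> \<psi> x" if "x \<in> D" for x
    using green_eq[OF D \<mu> that] \<mu>[of x] unfolding \<psi> by simp
  define Q where "Q A = (\<Sum>z\<in>A \<inter> D'. \<psi> z)" for A
  define v where "v A = ennreal (exp (\<theta> * Q A))" for A
  define a where "a p = (if p \<in> P then (\<theta> + \<theta>\<^sup>2 * B) * \<psi> (0, fst p) else 0)" for p :: "int \<times> nat"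
  have step: "(\<integral>\<^sup>+\<omega>. v (cstep (K p) (W p \<omega>) A) \<partial>M) \<le> ennreal (exp (a p)) * v A"
    if p: "p \<in> set ps" and A: "finite A" for p A
  proof (cases "p \<in> P")
    case False
    have "cstep (K p) w A \<inter> D' = A \<inter> D'" for w
      using K(2)[OF p False] by (auto simp: cstep_def)
    thus ?thesis using False by (simp add: v_def Q_def a_def emeasure_space_1)
  next
    case True
    have pp: "p \<in> particles" using p ps by auto
    interpret w: walk M "(0, fst p)" "\<lambda>k \<omega>. W p \<omega> k" by (rule walk[OF pp])
    have C: "finite (A \<inter> K p)" using A by simp
    have m: "(\<lambda>\<omega>. ennreal (exp (\<theta> * \<psi> (stop (W p \<omega>) (A \<inter> K p))))) \<in> borel_measurable M"
      by (rule measurable_compose[OF measurable_compose[OF W_measurable[OF pp] stop_measurable]]) simp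
    have "(\<integral>\<^sup>+\<omega>. v (cstep (K p) (W p \<omega>) A) \<partial>M) \<le>
        (\<integral>\<^sup>+\<omega>. v A * ennreal (exp (\<theta> * \<psi> (stop (W p \<omega>) (A \<inter> K p)))) \<partial>M)"
    proof (intro nn_integral_mono)
      fix \<omega>
      define e where "e = stop (W p \<omega>) (A \<inter> K p)"
      have "Q (cstep (K p) (W p \<omega>) A) \<le> Q (insert e A)"
        unfolding Q_def using A h0 by (intro sum_mono2) (auto simp: cstep_def e_def)
      also have "\<dots> \<le> Q A + \<psi> e"
        using A h0[of e] by (cases "e \<in> A") (auto simp: Q_def Int_insert_left insert_absorb)
      finally have "exp (\<theta> * Q (cstep (K p) (W p \<omega>) A)) \<le> exp (\<theta> * Q A) * exp (\<theta> * \<psi> e)"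
        using \<theta> by (simp add: exp_add[symmetric] distrib_left[symmetric] mult_left_mono)
      thus "v (cstep (K p) (W p \<omega>) A) \<le> v A * ennreal (exp (\<theta> * \<psi> (stop (W p \<omega>) (A \<inter> K p))))"
        by (simp add: v_def e_def ennreal_mult[symmetric] ennreal_leI)
    qed
    also have "\<dots> = v A * (\<integral>\<^sup>+\<omega>. ennreal (exp (\<theta> * \<psi> (stop (W p \<omega>) (A \<inter> K p)))) \<partial>M)"
      by (rule nn_integral_cmult[OF m])
    also have "\<dots> \<le> v A * ennreal (exp ((\<theta> + \<theta>\<^sup>2 * B) * \<psi> (0, fst p)))"
      using heq K(1)[OF p True] by (intro mult_left_mono w.walk_exp_le[OF C h0 B _ \<theta>]) auto
    finally show ?thesis using True by (simp add: a_def mult.commute)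
  qed
  define E where "E = {\<omega> \<in> space M. x \<le> Q (cagg K ps \<omega>)}"
  have [measurable]: "E \<in> events" unfolding E_def using cagg_pred[OF ps(2), of "\<lambda>A. x \<le> Q A"] by (simp add: pred_def)
  have "ennreal (exp (\<theta> * x)) * emeasure M E = (\<integral>\<^sup>+\<omega>. ennreal (exp (\<theta> * x)) * indicator E \<omega> \<partial>M)"
    by (simp add: nn_integral_cmult_indicator)
  also have "\<dots> \<le> (\<integral>\<^sup>+\<omega>. v (cagg K ps \<omega>) \<partial>M)"
    using \<theta> by (intro nn_integral_mono) (auto simp: E_def v_def indicator_def intro!: ennreal_leI mult_left_mono)
  also have "\<dots> \<le> (\<Prod>p\<in>set ps. ennreal (exp (a p))) * v {}"
    by (rule cagg_supermartingale[OF ps step])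
  also have "\<dots> = ennreal (exp (\<Sum>p\<in>set ps. a p))"
    by (simp add: prod_exp v_def Q_def)
  finally have "ennreal (exp (\<theta> * x) * prob E) \<le> ennreal (exp (\<Sum>p\<in>set ps. a p))"
    by (simp add: emeasure_eq_measure ennreal_mult)
  hence "exp (\<theta> * x) * prob E \<le> exp (\<Sum>p\<in>set ps. a p)"
    by (simp only: ennreal_le_iff exp_ge_zero)
  hence "prob E \<le> exp (\<Sum>p\<in>set ps. a p) * exp (- (\<theta> * x))"
    by (simp add: exp_minus field_simps)
  also have "(\<Sum>p\<in>set ps. a p) = (\<theta> + \<theta>\<^sup>2 * B) * (\<Sum>p\<in>set ps \<inter> P. \<psi> (0, fst p))"
    unfolding a_def by (subst sum.inter_restrict) (simp_all add: sum_distrib_left if_distrib[of "(*) _"] cong: if_cong)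
  finally show ?thesis by (simp add: E_def Q_def exp_diff exp_minus divide_inverse)
qed

text \<open>A particle may be discarded at some step only while the aggregate still satisfies any
  property \<open>Q\<close> that passes to subsets and holds at the end.\<close>

lemma some_dropped_prob_le:
  assumes ps: "distinct ps" "set ps \<subseteq> particles"
    and Q: "\<And>A B. A \<subseteq> B \<Longrightarrow> finite B \<Longrightarrow> Q B \<Longrightarrow> Q A"
    and le: "\<And>p qs \<omega>. p \<in> set ps \<Longrightarrow> distinct qs \<Longrightarrow> set qs \<subseteq> set ps \<Longrightarrow> Q (cagg K qs \<omega>) \<Longrightarrow>
      prob {\<omega>' \<in> space M. dropped (K p) (W p \<omega>') (cagg K qs \<omega>)} \<le> c p"
    and c: "\<And>p. 0 \<le> c p"
  shows "prob {\<omega> \<in> space M. Q (cagg K ps \<omega>) \<and> cagg K ps \<omega> \<noteq> aggregate (\<lambda>i j k. S i j k \<omega>) ps} \<le> (\<Sum>p\<in>set ps. c p)"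
proof -
  define qs where "qs k = take k ps" for k
  have nth: "ps ! k \<in> set ps" "qs k @ [ps ! k] = take (Suc k) ps" if "k < length ps" for k
    using that by (auto simp: qs_def take_Suc_conv_app_nth)
  define E where "E k = {\<omega> \<in> space M. Q (cagg K (qs k) \<omega>) \<and> dropped (K (ps ! k)) (W (ps ! k) \<omega>) (cagg K (qs k) \<omega>)}" for k
  have setq: "set (qs k) \<subseteq> set ps" "distinct (qs k)" for k using ps by (auto simp: qs_def dest: in_set_takeD)
  have Ek: "E k \<in> events" "prob (E k) \<le> c (ps ! k)" if k: "k < length ps" for k
  proof -
    have pk: "ps ! k \<in> particles" "set (qs k) \<subseteq> particles" using nth(1)[OF k] setq(1)[of k] ps by auto
    have [measurable]: "Measurable.pred M (\<lambda>\<omega>. Q (cagg K (qs k) \<omega>))" by (rule cagg_pred[OF pk(2)])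
    have [measurable]: "Measurable.pred M (\<lambda>\<omega>. dropped (K (ps ! k)) (W (ps ! k) \<omega>) (cagg K (qs k) \<omega>))"
      using pk by (intro measurable_compose_countable'[OF measurable_compose[OF W_measurable dropped_measurable] cagg_measurable]) auto
    show "E k \<in> events" unfolding E_def by measurable
    have "distinct (qs k @ [ps ! k])" "set (qs k @ [ps ! k]) \<subseteq> particles"
      using nth[OF k] ps by (auto dest: in_set_takeD)
    thus "prob (E k) \<le> c (ps ! k)" unfolding E_def
      using le[OF nth(1)[OF k] setq(2) setq(1)] c by (intro cagg_next_prob dropped_measurable) auto
  qed
  have "{\<omega> \<in> space M. Q (cagg K ps \<omega>) \<and> cagg K ps \<omega> \<noteq> aggregate (\<lambda>i j k. S i j k \<omega>) ps} \<subseteq> (\<Union>k<length ps. E k)"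
  proof (rule subsetI)
    fix \<omega> assume "\<omega> \<in> {\<omega> \<in> space M. Q (cagg K ps \<omega>) \<and> cagg K ps \<omega> \<noteq> aggregate (\<lambda>i j k. S i j k \<omega>) ps}"
    hence w: "\<omega> \<in> space M" "Q (cagg K ps \<omega>)" and ne: "cagg K ps \<omega> \<noteq> aggregate (\<lambda>i j k. S i j k \<omega>) ps"
      by simp_all
    have "\<exists>rs p rs'. ps = rs @ p # rs' \<and> dropped (K p) (W p \<omega>) (cagg K rs \<omega>)"
    proof (rule ccontr)
      assume *: "\<not> (\<exists>rs p rs'. ps = rs @ p # rs' \<and> dropped (K p) (W p \<omega>) (cagg K rs \<omega>))"
      have "cfold K (\<lambda>p. (\<lambda>i j k. S i j k \<omega>) (fst p) (snd p)) ps = aggregate (\<lambda>i j k. S i j k \<omega>) ps"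
      proof (rule cfold_eq_aggregate)
        fix qs p rs assume "ps = qs @ p # rs"
        with * have "\<not> dropped (K p) (W p \<omega>) (cagg K qs \<omega>)" by blast
        thus "\<not> dropped (K p) (\<lambda>k. S (fst p) (snd p) k \<omega>) (cfold K (\<lambda>p k. S (fst p) (snd p) k \<omega>) qs)"
          by (simp add: cagg_def W_def)
      qed
      thus False using ne by (simp only: cagg_def W_def simp_thms)
    qed
    then obtain rs p rs' where rs: "ps = rs @ p # rs'" "dropped (K p) (W p \<omega>) (cagg K rs \<omega>)" by blast
    define k where "k = length rs"
    have k: "k < length ps" "qs k = rs" "ps ! k = p" by (simp_all add: rs k_def qs_def)
    have "cagg K rs \<omega> \<subseteq> cagg K ps \<omega>" unfolding cagg_def rs by (rule cfold_append_increasing)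
    hence "Q (cagg K rs \<omega>)" using Q w(2) cfold_finite unfolding cagg_def by blast
    thus "\<omega> \<in> (\<Union>k<length ps. E k)" using k rs w by (auto simp: E_def)
  qed
  hence "prob {\<omega> \<in> space M. Q (cagg K ps \<omega>) \<and> cagg K ps \<omega> \<noteq> aggregate (\<lambda>i j k. S i j k \<omega>) ps} \<le> prob (\<Union>k<length ps. E k)"
  proof (rule finite_measure_mono)
    show "(\<Union>k<length ps. E k) \<in> events" using Ek(1) by (intro sets.finite_UN) auto
  qed
  also have "\<dots> \<le> (\<Sum>k<length ps. prob (E k))"
    using Ek(1) by (intro finite_measure_subadditive_finite image_subsetI) simp_all
  also have "\<dots> \<le> (\<Sum>k<length ps. c (ps ! k))" using Ek(2) by (intro sum_mono) simp
  also have "\<dots> = (\<Sum>p\<in>set ps. c p)"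
  proof -
    have "(\<Sum>p\<in>set ps. c p) = sum_list (map c ps)"
      by (rule sum_list_distinct_conv_sum_set[symmetric, OF ps(1)])
    also have "\<dots> = (\<Sum>k<length ps. map c ps ! k)"
      by (subst sum_list_sum_nth) (simp add: atLeast0LessThan)
    also have "\<dots> = (\<Sum>k<length ps. c (ps ! k))" by (intro sum.cong) auto
    finally show ?thesis ..
  qed
  finally show ?thesis .
qed

end

section \<open>Estimates for a fixed order of the particles\<close>

lemma nrm_le_abs: "nrm z \<le> \<bar>real_of_int (fst z)\<bar> + \<bar>real_of_int (snd z)\<bar>"
  unfolding nrm_def sqn_def by (rule sqrt_sum_squares_le_sum_abs)

lemma sbox_diff_bounds:
  assumes "x \<in> sbox R H c \<union> nbrs (sbox R H c)" "y \<in> sbox R H c"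
  shows "nrm (x - y) \<le> 2 * real_of_int R + 2 * real_of_int H"
proof -
  have "\<bar>fst x\<bar> \<le> R \<and> \<bar>snd x - c\<bar> \<le> H" using assms(1) nbrs_sbox[of x R H c] by (cases "x \<in> sbox R H c") auto
  hence "\<bar>fst (x - y)\<bar> \<le> 2 * R" "\<bar>snd (x - y)\<bar> \<le> 2 * H" using assms(2) by auto
  hence "\<bar>real_of_int (fst (x - y))\<bar> \<le> 2 * real_of_int R" "\<bar>real_of_int (snd (x - y))\<bar> \<le> 2 * real_of_int H"
    by linarith+
  thus ?thesis using nrm_le_abs[of "x - y"] by linarith
qed

lemma sqrt_abs_diff: "sqrt \<bar>real_of_int k\<bar> \<le> sqrt \<bar>real_of_int i\<bar> + sqrt \<bar>real_of_int (k - i)\<bar>"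
proof -
  have "sqrt \<bar>real_of_int k\<bar> \<le> sqrt (\<bar>real_of_int i\<bar> + \<bar>real_of_int (k - i)\<bar>)" by simp
  also have "\<dots> \<le> sqrt \<bar>real_of_int i\<bar> + sqrt \<bar>real_of_int (k - i)\<bar>"
    by (rule sqrt_add_le_add_sqrt) auto
  finally show ?thesis .
qed

lemma sqrt_le_div:
  assumes "0 < c" "c\<^sup>2 \<le> a"
  shows "c * sqrt a \<le> a"
proof -
  have "0 \<le> a" using assms zero_le_power2[of c] by linarith
  have "c \<le> sqrt a" using assms by (simp add: real_le_rsqrt)
  hence "c * sqrt a \<le> sqrt a * sqrt a" using \<open>0 \<le> a\<close> by (intro mult_right_mono) auto
  thus ?thesis using \<open>0 \<le> a\<close> by simp
qed

text \<open>The square root grows fast enough to make the failure probabilities summable over the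
  levels, and slowly enough that particles of far levels cannot reach a fixed window.\<close>

definition vt :: "nat \<Rightarrow> int \<Rightarrow> real" where
  "vt V i = real V + sqrt \<bar>real_of_int i\<bar>"

text \<open>The parameters: \<open>d\<close> is the order of the outer fluctuations, \<open>d0\<close> of the inner ones, \<open>vt V i\<close> the
  distance that particles of level \<open>i\<close> are allowed to travel vertically, \<open>bw i\<close> horizontally; \<open>l\<close> and
  \<open>lc i\<close> are the radii of the balls used in the fine and in the crude multi-scale argument, with \<open>m2\<close>
  and \<open>m1\<close> layers. For the levels that are not \<open>near\<close> the crude argument covers both directions.\<close>

locale params =
  fixes n d d0 V l m1 m2 :: nat and lc :: "int \<Rightarrow> real"
  assumes n: "16 \<le> n" and d0: "2 \<le> d0" "d0 \<le> d" and d: "8 * d \<le> n" and V: "n ^ 4 \<le> V"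
    and l: "1 \<le> l" "8 * l \<le> d" "2 * (m2 * (l + 2)) \<le> d"
    and tail_in: "4 * real n ^ 5 * exp (- (real n - 1)) \<le> 1"
    and tail_out: "40 * real n * real V ^ 3 * exp (- (real n / 12)) \<le> 1"
    and lc: "\<And>i. 0 < lc i" "\<And>i. lc i \<le> vt V i" "\<And>i. m1 * (lc i + 2) \<le> vt V i / n"
begin

text \<open>The linear term is at most 3d for |i| \<le> 3V, the levels that can reach the heights of
  interest. For |i| \<ge> V^2 it makes the box so wide that the level is not \<open>near\<close>;
  only finitely many levels are left for the fine argument.\<close>

definition bw :: "int \<Rightarrow> real" where
  "bw i = real n / 2 + real d + real d * \<bar>real_of_int i\<bar> / real V"

definition Bx :: "int \<Rightarrow> (int \<times> int) set" where
  "Bx i = {z. \<bar>real_of_int (fst z)\<bar> \<le> bw i \<and> \<bar>real_of_int (snd z - i)\<bar> \<le> vt V i}"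

definition near :: "int \<Rightarrow> bool" where
  "near i \<longleftrightarrow> real n * bw i < vt V i"

definition R :: int where
  "R = int (n div 2)"

definition r :: int where
  "r = R - int d0"

text \<open>Boxes of levels within 6V of \<open>i\<close> are at most 6d wider on each side than the
  box of \<open>i\<close>; the margin 7d leaves them strictly inside.\<close>

definition R1 :: "int \<Rightarrow> int" where
  "R1 i = \<lceil>bw i\<rceil> + 7 * int d + 1"

definition LL :: real where
  "LL = log 2 (1 + (30 * real V)\<^sup>2)"

text \<open>A box of width about n and height of order n^2: by \<open>green_decay\<close> the Green
  function is exponentially small at its top and bottom.\<close>

definition hin :: "int \<times> int \<Rightarrow> int \<times> int \<Rightarrow> real" where
  "hin z = green (sbox R (int (n\<^sup>2)) (snd z)) (\<lambda>x. if x = z then 1 else 0)"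

text \<open>The charge of the cap in \<open>bump_le_green\<close>, spread over a ball of twice the
  radius of the ball in which sites are counted.\<close>

definition mu :: "int \<times> int \<Rightarrow> int \<times> int \<Rightarrow> real" where
  "mu x0 x = (if nrm (x - x0) < 2 * real l then 1 / (4 * (real l)\<^sup>2) else 0)"

definition psi :: "int \<Rightarrow> int \<times> int \<Rightarrow> int \<times> int \<Rightarrow> real" where
  "psi i x0 = green (sbox (R1 i) (10 * int V) i) (mu x0)"

definition rim :: "int \<Rightarrow> (int \<times> int) set" where
  "rim i = {z \<in> Bx i. bw i - real d / 2 < \<bar>real_of_int (fst z)\<bar>}"

text \<open>The height is large enough for the balance at every near level \<open>i\<close>: this
  uses the filled strip up to |i| + 3V, which is below 2V^2.\<close>

definition inner_set :: "(int \<times> int) set" where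
  "inner_set = {z. \<bar>fst z\<bar> \<le> r \<and> \<bar>snd z\<bar> \<le> 2 * (int V)\<^sup>2}"

text \<open>The first condition feeds the crude argument. The others say that replacing the counts
  by their mean n costs only a fraction of the gain in \<open>inner_bounds\<close>, respectively one
  multiple of d d0, when tested against the Green functions in question.\<close>

definition good_counts :: "(int \<Rightarrow> nat) \<Rightarrow> bool" where
  "good_counts \<nu> \<longleftrightarrow>
     (\<forall>i. (\<Sum>k\<in>{k. \<bar>real_of_int (k - i)\<bar> \<le> 4 * vt V i}. real (\<nu> k)) \<le> 20 * n * vt V i) \<and>
     (\<forall>z\<in>inner_set. n * (\<Sum>k\<in>{snd z - int (n\<^sup>2)<..<snd z + int (n\<^sup>2)}. hin z (0, k)) - (R - \<bar>fst z\<bar>)\<^sup>2 / 2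
        \<le> (\<Sum>k\<in>{snd z - int (n\<^sup>2)<..<snd z + int (n\<^sup>2)}. \<nu> k * hin z (0, k))) \<and>
     (\<forall>i x0. near i \<longrightarrow> x0 \<in> rim i \<longrightarrow>
        (\<Sum>k\<in>{i - 10 * int V<..<i + 10 * int V}. \<nu> k * psi i x0 (0, k))
        \<le> n * (\<Sum>k\<in>{i - 10 * int V<..<i + 10 * int V}. psi i x0 (0, k)) + d * d0)"

lemma V_ge: "256 * (real n)\<^sup>2 \<le> real V" "4096 * real n \<le> real V" "65536 \<le> real V"
proof -
  have n': "16 \<le> real n" using n by simp
  have "256 * (real n)\<^sup>2 \<le> (real n)\<^sup>2 * (real n)\<^sup>2"
    using power_mono[OF n', of 2] by (intro mult_right_mono) auto
  also have "\<dots> = real (n ^ 4)" by (simp add: power_add[symmetric])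
  also have "\<dots> \<le> real V" using V by (simp only: of_nat_le_iff)
  finally show 1: "256 * (real n)\<^sup>2 \<le> real V" .
  have "4096 * real n \<le> 256 * (real n)\<^sup>2" using n' by (simp add: power2_eq_square)
  thus "4096 * real n \<le> real V" using 1 by linarith
  thus "65536 \<le> real V" using n' by linarith
qed

lemma V_pos: "0 < real V"
  using V_ge by linarith

lemma d_bounds: "2 \<le> real d" "8 * real d \<le> real n" "2 \<le> real d0" "real d0 \<le> real d" "16 \<le> real n"
  "1 \<le> real l" "8 * real l \<le> real d" "real m2 * (real l + 2) \<le> real d / 2"
proof -
  show "real m2 * (real l + 2) \<le> real d / 2"
  proof -
    have "real (2 * (m2 * (l + 2))) \<le> real d" using l(3) by (simp only: of_nat_le_iff)
    thus ?thesis by (simp add: algebra_simps)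
  qed
qed (use d d0 n l in linarith)+

lemma r_bounds: "1 \<le> r" "r < R" "0 < R" "2 * real_of_int R \<le> real n" "real n \<le> 2 * real_of_int R + 1"
  "2 * real_of_int r + 1 \<le> real n" "real n - 2 * real_of_int r - 1 \<le> 2 * real d0"
proof -
  have R: "2 * R \<le> int n" "int n \<le> 2 * R + 1" by (auto simp: R_def)
  have rr: "real_of_int r = real_of_int R - real d0" by (simp add: r_def)
  have Rr: "2 * real_of_int R \<le> real n" "real n \<le> 2 * real_of_int R + 1" using R by linarith+
  show "2 * real_of_int R \<le> real n" "real n \<le> 2 * real_of_int R + 1" by fact+
  show "2 * real_of_int r + 1 \<le> real n" "real n - 2 * real_of_int r - 1 \<le> 2 * real d0"
    using rr Rr d_bounds by linarith+
  have "1 \<le> real_of_int r" using rr Rr d_bounds by linarith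
  thus "1 \<le> r" by simp
  show "r < R" using d0 by (simp add: r_def)
  thus "0 < R" using \<open>1 \<le> r\<close> by simp
qed

lemma bw_ge: "real n / 2 + real d \<le> bw i"
  by (simp add: bw_def)

text \<open>From |i| = V^2 on, the linear term of \<open>bw i\<close> times n is at least 2 sqrt
  |i|, hence at least \<open>vt V i\<close>.\<close>

lemma near_bounds:
  assumes "near i"
  shows "\<bar>real_of_int i\<bar> < (real V)\<^sup>2" "sqrt \<bar>real_of_int i\<bar> < real V" "vt V i < 2 * real V" "bw i * real n < 2 * real V"
proof -
  define a where "a = \<bar>real_of_int i\<bar>"
  have "real n * (real d * a / real V) \<le> real n * bw i" unfolding bw_def a_def by (intro mult_left_mono) auto
  hence *: "real n * (real d * a / real V) < real V + sqrt a" using assms by (simp add: near_def vt_def a_def)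
  show 1: "\<bar>real_of_int i\<bar> < (real V)\<^sup>2"
  proof (rule ccontr)
    assume "\<not> \<bar>real_of_int i\<bar> < (real V)\<^sup>2"
    hence a: "(real V)\<^sup>2 \<le> a" by (simp add: a_def)
    hence s: "real V \<le> sqrt a" by (simp add: real_le_rsqrt)
    have "real V * sqrt a \<le> a" by (rule sqrt_le_div[OF V_pos a])
    hence "sqrt a \<le> a / real V" using V_pos by (simp add: field_simps)
    moreover have "0 \<le> a" by (simp add: a_def)
    ultimately have "2 * sqrt a \<le> real d * (a / real V)"
      using d_bounds s V_pos by (intro mult_mono) auto
    also have "\<dots> \<le> real n * (real d * (a / real V))"
    proof -
      have "0 \<le> real d * (a / real V)" by (simp add: a_def)
      thus ?thesis using d_bounds(5) mult_right_mono[of 1 "real n" "real d * (a / real V)"] by simp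
    qed
    finally show False using * s by simp
  qed
  show 2: "sqrt \<bar>real_of_int i\<bar> < real V"
    using real_sqrt_less_mono[OF 1] by simp
  show 3: "vt V i < 2 * real V" using 2 by (simp add: vt_def)
  show "bw i * real n < 2 * real V" using 3 assms by (simp add: near_def mult.commute)
qed

lemma R1_bounds: "bw i + 7 * real d + 1 \<le> real_of_int (R1 i)" "real_of_int (R1 i) \<le> bw i + 7 * real d + 2"
  unfolding R1_def by (simp_all, linarith+)

lemma R1_le:
  assumes "near i"
  shows "real_of_int (R1 i) * real n \<le> 3 * real V" "real_of_int (R1 i) \<le> real V"
proof -
  have "real_of_int (R1 i) * real n \<le> (bw i + 7 * real d + 2) * real n"
    by (intro mult_right_mono R1_bounds) auto
  also have "\<dots> = bw i * real n + (7 * real d + 2) * real n" by (simp add: algebra_simps)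
  also have "(7 * real d + 2) * real n \<le> real n * real n"
    using d_bounds by (intro mult_right_mono) auto
  also have "real n * real n \<le> real V" using V_ge(1) by (simp add: power2_eq_square) 
  finally show 1: "real_of_int (R1 i) * real n \<le> 3 * real V" using near_bounds(4)[OF assms] by linarith
  have "real_of_int (R1 i) * 16 \<le> real_of_int (R1 i) * real n"
    using d_bounds R1_bounds[of i] bw_ge[of i] by (intro mult_left_mono) auto
  thus "real_of_int (R1 i) \<le> real V" using 1 V_pos by linarith
qed

lemma LL_ge_1: "1 \<le> LL"
proof -
  have "1 \<le> (30 * real V)\<^sup>2" using V_ge by (intro one_le_power) auto
  hence "log 2 2 \<le> LL" unfolding LL_def by (intro log_mono) auto
  thus ?thesis by simp
qed

lemma logpot_le_LL: "nrm z \<le> 30 * real V \<Longrightarrow> logpot z \<le> LL"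
  unfolding LL_def by (rule logpot_le)

text \<open>The support of \<open>mu\<close> avoids the filled strip and stays within O(d) of the
  sides of the box of \<open>psi\<close>. There \<open>tent\<close> is of order d and
  \<open>outer_fn\<close> of order d d0.\<close>

lemma rim_bounds:
  assumes i: "near i" and x0: "x0 \<in> rim i" and x: "nrm (x - x0) < 2 * real l"
  shows "\<bar>fst x\<bar> < R1 i" "\<bar>snd x - i\<bar> \<le> int (2 * V + 2 * l)" "r < \<bar>fst x\<bar>" "\<bar>snd x - i\<bar> < 3 * int V"
    "real_of_int (R1 i) - \<bar>real_of_int (fst x)\<bar> \<le> 10 * real d"
proof -
  have 1: "\<bar>real_of_int (fst (x - x0))\<bar> < 2 * real l" "\<bar>real_of_int (snd (x - x0))\<bar> < 2 * real l"
    using x abs_fst_le_nrm[of "x - x0"] abs_snd_le_nrm[of "x - x0"] by linarith+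
  have 2: "\<bar>real_of_int (fst x0)\<bar> \<le> bw i" "\<bar>real_of_int (snd x0 - i)\<bar> \<le> vt V i" "bw i - real d / 2 < \<bar>real_of_int (fst x0)\<bar>"
    using x0 by (auto simp: rim_def Bx_def)
  have 3: "\<bar>real_of_int (fst x)\<bar> < bw i + 2 * real l" "bw i - real d / 2 - 2 * real l < \<bar>real_of_int (fst x)\<bar>"
    using 1(1) 2(1,3) unfolding fst_diff of_int_diff by linarith+
  have "\<bar>real_of_int (fst x)\<bar> < real_of_int (R1 i)" using 3 R1_bounds[of i] d_bounds by linarith
  thus "\<bar>fst x\<bar> < R1 i" by linarith
  have 4: "\<bar>real_of_int (snd x - i)\<bar> < 2 * real V + 2 * real l"
    using 1(2) 2(2) near_bounds(3)[OF i] by simp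
  thus "\<bar>snd x - i\<bar> \<le> int (2 * V + 2 * l)" by linarith
  have "2 * real V + 2 * real l \<le> 3 * real V" using d_bounds V_ge by linarith
  thus "\<bar>snd x - i\<bar> < 3 * int V" using 4 by linarith
  have "real_of_int r < \<bar>real_of_int (fst x)\<bar>" using 3 bw_ge[of i] d_bounds r_bounds by linarith
  thus "r < \<bar>fst x\<bar>" by linarith
  show "real_of_int (R1 i) - \<bar>real_of_int (fst x)\<bar> \<le> 10 * real d" using 3 R1_bounds[of i] d_bounds by linarith
qed

lemma mu_nonneg: "0 \<le> mu x0 x"
  by (simp add: mu_def)

lemma mu_sum: "finite D \<Longrightarrow> (\<Sum>x\<in>D. mu x0 x) \<le> 4"
proof -
  assume D: "finite D"
  \<comment> \<open>The distance is strictly below 2l, so integer coordinates differ by at most 2l -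
    1; the enclosing square then has fewer than (4l)^2 sites.\<close>
  define k where "k = 2 * int l - 1"
  define B where "B = {fst x0 - k..fst x0 + k} \<times> {snd x0 - k..snd x0 + k}"
  have k: "1 \<le> k" using l by (simp add: k_def)
  have inB: "x \<in> B" if "nrm (x - x0) < 2 * real l" for x
  proof -
    have "\<bar>real_of_int (fst (x - x0))\<bar> < 2 * real l" "\<bar>real_of_int (snd (x - x0))\<bar> < 2 * real l"
      using that abs_fst_le_nrm[of "x - x0"] abs_snd_le_nrm[of "x - x0"] by linarith+
    hence "\<bar>fst x - fst x0\<bar> \<le> k" "\<bar>snd x - snd x0\<bar> \<le> k" by (simp_all add: k_def)
    thus ?thesis by (cases x) (auto simp: B_def)
  qed
  have "(\<Sum>x\<in>D. mu x0 x) = (\<Sum>x\<in>{x \<in> D. nrm (x - x0) < 2 * real l}. 1 / (4 * (real l)\<^sup>2))"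
    using D unfolding mu_def by (subst sum.inter_filter) auto
  also have "\<dots> \<le> (\<Sum>x\<in>B. 1 / (4 * (real l)\<^sup>2))"
    using inB by (intro sum_mono2) (auto simp: B_def)
  also have "\<dots> = real (card B) * (1 / (4 * (real l)\<^sup>2))" by simp
  also have "real (card B) \<le> (4 * real l)\<^sup>2"
  proof -
    have "card B = nat (2 * k + 1) * nat (2 * k + 1)" by (simp add: B_def card_cartesian_product)
    also have "\<dots> \<le> (4 * l) * (4 * l)" unfolding k_def using l by (intro mult_mono) auto
    finally have "real (card B) \<le> real ((4 * l) * (4 * l))" by (simp only: of_nat_le_iff)
    thus ?thesis by (simp add: power2_eq_square)
  qed
  finally show ?thesis using l by (simp add: field_simps)
qed

lemma psi_nonneg: "0 \<le> psi i x0 x"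
  unfolding psi_def by (intro green_nonneg mu_nonneg) simp

lemma psi_le: "near i \<Longrightarrow> psi i x0 x \<le> 4 * LL"
proof -
  assume i: "near i"
  have "psi i x0 x \<le> LL * (\<Sum>y\<in>sbox (R1 i) (10 * int V) i. mu x0 y)"
    unfolding psi_def
  proof (intro green_le_log mu_nonneg logpot_le_LL)
    fix x y assume "x \<in> sbox (R1 i) (10 * int V) i \<union> nbrs (sbox (R1 i) (10 * int V) i)" "y \<in> sbox (R1 i) (10 * int V) i"
    from sbox_diff_bounds[OF this] R1_le[OF i] show "nrm (x - y) \<le> 30 * real V" by simp
  qed simp
  also have "\<dots> \<le> LL * 4" using LL_ge_1 by (intro mult_left_mono mu_sum) auto
  finally show ?thesis by simp
qed

lemma psi_axis_sum:
  assumes i: "near i" and x0: "x0 \<in> rim i"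
  shows "(\<Sum>k\<in>{i - 10 * int V<..<i + 10 * int V}. psi i x0 (0, k)) \<le> 80 * real d"
proof -
  let ?D = "sbox (R1 i) (10 * int V) i"
  have "0 < real_of_int (R1 i)" using R1_bounds[of i] bw_ge[of i] by linarith
  hence "(\<Sum>k\<in>{i - 10 * int V<..<i + 10 * int V}. psi i x0 (0, k)) \<le> (\<Sum>z\<in>?D. tent (R1 i) z * mu x0 z)"
    unfolding psi_def by (intro green_axis_sum_le mu_nonneg) simp
  also have "\<dots> \<le> (\<Sum>z\<in>?D. 20 * real d * mu x0 z)"
  proof (rule sum_mono)
    fix z
    show "tent (R1 i) z * mu x0 z \<le> 20 * real d * mu x0 z"
    proof (cases "nrm (z - x0) < 2 * real l")
      case True
      from rim_bounds(5)[OF i x0 True] show ?thesis by (intro mult_right_mono mu_nonneg) (simp add: tent_def)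
    qed (simp add: mu_def)
  qed
  also have "\<dots> = 20 * real d * (\<Sum>z\<in>?D. mu x0 z)" by (simp add: sum_distrib_left)
  also have "\<dots> \<le> 20 * real d * 4" by (intro mult_left_mono mu_sum) auto
  finally show ?thesis by simp
qed

text \<open>Here the filled inside pays: only a surplus of at most 2 d0 particles per level passes
  |x| = r, and it meets potentials at distance at most 10d from the sides.\<close>

lemma psi_outer_sum:
  assumes i: "near i" and x0: "x0 \<in> rim i"
  shows "n * (\<Sum>k\<in>{i - 10 * int V<..<i + 10 * int V}. psi i x0 (0, k)) -
    (\<Sum>z\<in>{z \<in> sbox (R1 i) (10 * int V) i. \<bar>fst z\<bar> \<le> r}. psi i x0 z) \<le> 160 * real d * real d0"
proof -
  let ?D = "sbox (R1 i) (10 * int V) i"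
  have R1: "r < R1 i"
  proof -
    have "real_of_int r < real_of_int (R1 i)" using R1_bounds[of i] bw_ge[of i] r_bounds d_bounds by linarith
    thus ?thesis by simp
  qed
  hence "n * (\<Sum>k\<in>{i - 10 * int V<..<i + 10 * int V}. psi i x0 (0, k)) - (\<Sum>z\<in>{z \<in> ?D. \<bar>fst z\<bar> \<le> r}. psi i x0 z)
      \<le> (\<Sum>z\<in>?D. outer_fn n r (R1 i) z * mu x0 z)"
    unfolding psi_def using r_bounds by (intro green_outer_sum_le mu_nonneg) auto
  also have "\<dots> \<le> (\<Sum>z\<in>?D. 40 * real d * real d0 * mu x0 z)"
  proof (rule sum_mono)
    fix z
    show "outer_fn n r (R1 i) z * mu x0 z \<le> 40 * real d * real d0 * mu x0 z"
    proof (cases "nrm (z - x0) < 2 * real l")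
      case True
      note b = rim_bounds[OF i x0 True]
      have "outer_fn n r (R1 i) z = 2 * ((real n - 2 * real_of_int r - 1) * (real_of_int (R1 i) - \<bar>real_of_int (fst z)\<bar>))"
        using b(3) by (simp add: outer_fn_def)
      also have "\<dots> \<le> 2 * ((2 * real d0) * (10 * real d))"
        using b(1,5) r_bounds by (intro mult_left_mono mult_mono) auto
      finally show ?thesis by (intro mult_right_mono mu_nonneg) (simp add: mult_ac)
    qed (simp add: mu_def)
  qed
  also have "\<dots> = 40 * real d * real d0 * (\<Sum>z\<in>?D. mu x0 z)" by (simp add: sum_distrib_left)
  also have "\<dots> \<le> 40 * real d * real d0 * 4" by (intro mult_left_mono mu_sum) auto
  finally show ?thesis by simp
qed

lemma psi_far:
  assumes i: "near i" and x0: "x0 \<in> rim i" and z: "3 * int V \<le> \<bar>snd z - i\<bar>"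
  shows "psi i x0 z \<le> 2 * (real V)\<^sup>2 * exp (- (real n / 12))"
proof -
  define R' where "R' = nat (R1 i)"
  have pos: "1 \<le> real_of_int (R1 i)" using R1_bounds[of i] bw_ge[of i] d_bounds by linarith
  have R': "int R' = R1 i" "1 \<le> R'" using pos by (auto simp: R'_def)
  hence R'r: "real R' = real_of_int (R1 i)" by (metis of_int_of_nat_eq)
  define T where "T = V - 2 * l"
  have "2 * real l \<le> real V / 2" using d_bounds V_ge by linarith
  hence T: "real T = real V - 2 * real l" "real V / 2 \<le> real T" "2 * V + 2 * l + T = 3 * V"
    unfolding T_def by linarith+
  have mu_le: "mu x0 x \<le> 1 / 4" for x using d_bounds(6) by (simp add: mu_def field_simps)
  have "psi i x0 z \<le> 8 * (1 / 4) * (real R')\<^sup>2 * exp (- (real T / (2 * real R')))"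
    unfolding psi_def R'(1)[symmetric]
  proof (rule green_decay[OF R'(2) mu_nonneg mu_le, where K = "2 * V + 2 * l"])
    fix x assume "mu x0 x \<noteq> 0"
    hence "nrm (x - x0) < 2 * real l" by (auto simp: mu_def split: if_splits)
    from rim_bounds(2)[OF i x0 this] show "\<bar>snd x - i\<bar> \<le> int (2 * V + 2 * l)" .
  qed (use z T(3) in linarith)
  also have "\<dots> \<le> 8 * (1 / 4) * (real V)\<^sup>2 * exp (- (real n / 12))"
  proof (intro mult_mono)
    show "(real R')\<^sup>2 \<le> (real V)\<^sup>2" using R1_le[OF i] R'r by (intro power_mono) auto
    have "real n * (2 * real R') \<le> 12 * real T" using R1_le(1)[OF i] T(2) R'r by (simp add: mult.commute)
    hence "real n / 12 \<le> real T / (2 * real R')" using R'(2) by (simp add: field_simps)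
    thus "exp (- (real T / (2 * real R'))) \<le> exp (- (real n / 12))" by simp
  qed auto
  finally show ?thesis by simp
qed

text \<open>The cost of cutting the filled strip off at distance 3V from the level, while the box of
  \<open>psi\<close> has half-height 10V.\<close>

lemma psi_far_sum:
  assumes i: "near i" and x0: "x0 \<in> rim i"
  shows "(\<Sum>z\<in>{z \<in> sbox (R1 i) (10 * int V) i. \<bar>fst z\<bar> \<le> r \<and> 3 * int V \<le> \<bar>snd z - i\<bar>}. psi i x0 z) \<le> 1"
proof -
  define B where "B = {-r..r} \<times> {i - 10 * int V<..<i + 10 * int V}"
  have cB: "real (card B) \<le> real n * (20 * real V)"
  proof -
    have "card B = nat (2 * r + 1) * nat (20 * int V - 1)" by (simp add: B_def card_cartesian_product)
    also have "\<dots> \<le> n * (20 * V)"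
      using r_bounds by (intro mult_mono) linarith+
    finally have "real (card B) \<le> real (n * (20 * V))" by (simp only: of_nat_le_iff)
    thus ?thesis by simp
  qed
  have "(\<Sum>z\<in>{z \<in> sbox (R1 i) (10 * int V) i. \<bar>fst z\<bar> \<le> r \<and> 3 * int V \<le> \<bar>snd z - i\<bar>}. psi i x0 z)
      \<le> (\<Sum>z\<in>{z \<in> sbox (R1 i) (10 * int V) i. \<bar>fst z\<bar> \<le> r \<and> 3 * int V \<le> \<bar>snd z - i\<bar>}. 2 * (real V)\<^sup>2 * exp (- (real n / 12)))"
    by (intro sum_mono psi_far[OF i x0]) auto
  also have "\<dots> \<le> (\<Sum>z\<in>B. 2 * (real V)\<^sup>2 * exp (- (real n / 12)))"
    by (intro sum_mono2) (auto simp: B_def)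
  also have "\<dots> = real (card B) * (2 * (real V)\<^sup>2 * exp (- (real n / 12)))" by simp
  also have "\<dots> \<le> real n * (20 * real V) * (2 * (real V)\<^sup>2 * exp (- (real n / 12)))"
    using cB by (intro mult_right_mono) auto
  also have "\<dots> = 40 * real n * real V ^ 3 * exp (- (real n / 12))"
    by (simp add: power2_eq_square power3_eq_cube)
  finally show ?thesis using tail_out by linarith
qed

lemma hin_nonneg: "0 \<le> hin z x"
  unfolding hin_def by (intro green_nonneg) auto

lemma n2_le_V: "2 * real (n\<^sup>2) \<le> real V" "2 * int (n\<^sup>2) \<le> int V"
proof -
  have "2 * (real n)\<^sup>2 \<le> 256 * (real n)\<^sup>2" by (intro mult_right_mono) auto
  thus 1: "2 * real (n\<^sup>2) \<le> real V" using V_ge(1) by simp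
  thus "2 * int (n\<^sup>2) \<le> int V" by linarith
qed

lemma hin_le: "hin z x \<le> LL"
proof -
  have "hin z x \<le> LL * (\<Sum>y\<in>sbox R (int (n\<^sup>2)) (snd z). if y = z then 1 else 0)"
    unfolding hin_def
  proof (intro green_le_log logpot_le_LL)
    fix x y assume "x \<in> sbox R (int (n\<^sup>2)) (snd z) \<union> nbrs (sbox R (int (n\<^sup>2)) (snd z))" "y \<in> sbox R (int (n\<^sup>2)) (snd z)"
    from sbox_diff_bounds[OF this] n2_le_V(1) r_bounds V_ge show "nrm (x - y) \<le> 30 * real V" by simp
  qed auto
  also have "\<dots> \<le> LL * 1" using LL_ge_1 by (intro mult_left_mono) auto
  finally show ?thesis by simp
qed

text \<open>With t = R - |fst z|, \<open>inner_fn\<close> at \<open>z\<close> is at least 2 t^2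
  because n - R \<ge> R; the boundary error is at most 1 by \<open>tail_in\<close>. The resulting
  inequality is the gain that makes a vacancy at \<open>z\<close> improbable.\<close>

lemma inner_bounds:
  assumes "z \<in> inner_set"
  shows "z \<in> sbox R (int (n\<^sup>2)) (snd z)" "real d0 \<le> real_of_int (R - \<bar>fst z\<bar>)"
    "n * (\<Sum>k\<in>{snd z - int (n\<^sup>2)<..<snd z + int (n\<^sup>2)}. hin z (0, k)) -
      (\<Sum>x\<in>sbox R (int (n\<^sup>2)) (snd z). hin z x) \<ge> 2 * (real_of_int (R - \<bar>fst z\<bar>))\<^sup>2 - 1"
    "(\<Sum>k\<in>{snd z - int (n\<^sup>2)<..<snd z + int (n\<^sup>2)}. hin z (0, k)) \<le> 2 * real_of_int (R - \<bar>fst z\<bar>)"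
proof -
  let ?D = "sbox R (int (n\<^sup>2)) (snd z)" and ?m = "\<lambda>x. if x = z then 1 else 0 :: real"
  have "\<bar>fst z\<bar> \<le> r" using assms by (simp add: inner_set_def)
  hence "\<bar>fst z\<bar> < R" "int d0 \<le> R - \<bar>fst z\<bar>" using r_bounds by (simp_all add: r_def)
  thus zD: "z \<in> ?D" and D: "real d0 \<le> real_of_int (R - \<bar>fst z\<bar>)"
    using n by (auto intro: order_trans simp del: of_int_diff)
  define N where "N = n div 2"
  have N: "R = int N" "0 < N" "real N \<le> real n" "2 * N \<le> n" using r_bounds by (auto simp: R_def N_def)
  define \<tau> where "\<tau> = 8 * (real N)\<^sup>2 * exp (- (real n - 1))"
  have tau: "hin z x \<le> \<tau>" if x: "int (n\<^sup>2) - 1 \<le> \<bar>snd x - snd z\<bar>" for x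
  proof -
    have n1: "1 \<le> n\<^sup>2" using n by simp
    have "hin z x \<le> 8 * 1 * (real N)\<^sup>2 * exp (- (real (n\<^sup>2 - 1) / (2 * real N)))"
      unfolding hin_def N(1)
    proof (rule green_decay[where K = 0])
      show "int (0 + (n\<^sup>2 - 1)) \<le> \<bar>snd x - snd z\<bar>" using x n1 by linarith
    qed (use N in \<open>auto split: if_splits\<close>)
    also have "real n - 1 \<le> real (n\<^sup>2 - 1) / (2 * real N)"
    proof -
      have "(real n - 1) * (2 * real N) \<le> (real n - 1) * (real n + 1)"
        using N d_bounds by (intro mult_left_mono) auto
      also have "\<dots> = real (n\<^sup>2 - 1)" using n1 by (simp add: of_nat_diff power2_eq_square algebra_simps)
      finally show ?thesis using N by (simp add: field_simps)
    qed
    hence "8 * 1 * (real N)\<^sup>2 * exp (- (real (n\<^sup>2 - 1) / (2 * real N))) \<le> \<tau>"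
      unfolding \<tau>_def by (intro mult_mono) auto
    finally show ?thesis .
  qed
  have "8 * (real N)\<^sup>2 * n * \<tau> = 64 * (real N) ^ 4 * n * exp (- (real n - 1))"
    by (simp add: \<tau>_def power2_eq_square power4_eq_xxxx)
  also have "\<dots> \<le> 64 * (real n / 2) ^ 4 * n * exp (- (real n - 1))"
    using N by (intro mult_right_mono mult_left_mono power_mono) auto
  also have "\<dots> = 4 * real n ^ 5 * exp (- (real n - 1))"
    by (simp add: power_divide power4_eq_xxxx eval_nat_numeral)
  finally have small: "8 * (real N)\<^sup>2 * n * \<tau> \<le> 1" using tail_in by linarith
  define t where "t = real_of_int (R - \<bar>fst z\<bar>)"
  have "t * t \<le> t * (real n - real N - \<bar>real_of_int (fst z)\<bar>)"
    using D N by (intro mult_left_mono) (auto simp: t_def)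
  hence f: "2 * t\<^sup>2 \<le> inner_fn n N z" by (simp only: inner_fn_def t_def N of_int_diff of_int_abs of_int_of_nat_eq power2_eq_square mult.assoc)
  have "n * (\<Sum>k\<in>{snd z - int (n\<^sup>2)<..<snd z + int (n\<^sup>2)}. hin z (0, k)) - (\<Sum>x\<in>?D. hin z x) \<ge> inner_fn n N z - 8 * (real N)\<^sup>2 * n * \<tau>"
    using tau zD unfolding hin_def N(1) by (intro green_inner_sum_ge) (use N in auto)
  thus "n * (\<Sum>k\<in>{snd z - int (n\<^sup>2)<..<snd z + int (n\<^sup>2)}. hin z (0, k)) -
      (\<Sum>x\<in>?D. hin z x) \<ge> 2 * (real_of_int (R - \<bar>fst z\<bar>))\<^sup>2 - 1"
    using f small unfolding t_def by linarith
  have "(\<Sum>k\<in>{snd z - int (n\<^sup>2)<..<snd z + int (n\<^sup>2)}. hin z (0, k)) \<le> (\<Sum>x\<in>?D. tent (real_of_int R) x * ?m x)"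
    unfolding hin_def using r_bounds by (intro green_axis_sum_le) auto
  also have "\<dots> = (\<Sum>x\<in>?D. if x = z then tent (real_of_int R) x else 0)" by (intro sum.cong) auto
  also have "\<dots> = tent (real_of_int R) z" using zD by simp
  finally show "(\<Sum>k\<in>{snd z - int (n\<^sup>2)<..<snd z + int (n\<^sup>2)}. hin z (0, k)) \<le> 2 * real_of_int (R - \<bar>fst z\<bar>)"
    by (simp add: tent_def)
qed

end

lemma pair_count_space_pred:
  assumes "f \<in> M \<rightarrow>\<^sub>M count_space (fsets :: 'a::countable set set)" "g \<in> M \<rightarrow>\<^sub>M count_space (fsets :: 'a::countable set set)"
  shows "{\<omega> \<in> space M. Q (f \<omega>) (g \<omega>)} \<in> sets M"
proof -
  have "(\<lambda>\<omega>. Q (f \<omega>) (g \<omega>)) \<in> M \<rightarrow>\<^sub>M count_space UNIV"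
  proof (rule measurable_compose_countable'[where f = "\<lambda>A \<omega>. Q A (g \<omega>)", OF _ assms(1) countable_fsets])
    fix A :: "'a set"
    show "(\<lambda>\<omega>. Q A (g \<omega>)) \<in> M \<rightarrow>\<^sub>M count_space UNIV"
      by (rule measurable_compose[OF assms(2)]) simp
  qed
  thus ?thesis by (simp add: pred_def)
qed

text \<open>With unbounded boxes nothing is discarded, so measurability carries over to the true
  aggregate.\<close>

lemma aggregate_eq_cfold: "aggregate s ps = cfold (\<lambda>_. UNIV) (\<lambda>p. s (fst p) (snd p)) ps"
  by (induction ps rule: rev_induct) (simp add: aggregate_def, simp add: deposit_stop cstep_def)

lemma (in walks) aggregate_measurable:
  assumes "set ps \<subseteq> particles"
  shows "(\<lambda>\<omega>. aggregate (\<lambda>i j k. S i j k \<omega>) ps) \<in> M \<rightarrow>\<^sub>M count_space fsets"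
  using cagg_measurable[OF assms, of "\<lambda>_. UNIV"]
  by (simp add: aggregate_eq_cfold cagg_def[abs_def] W_def)

section \<open>Sparse rims and the target shape\<close>

context params
begin

text \<open>\<open>qc\<close> and \<open>qf\<close> are the factors gained per layer in
  \<open>layered_crossing\<close>, for the crude count of sites and for the sparse rim.\<close>

definition qc :: "int \<Rightarrow> real" where
  "qc i = 20 * real n * vt V i * log 2 (1 + (2 * lc i + 1)\<^sup>2) / (lc i)\<^sup>2"

definition qf :: real where
  "qf = 400 * real d * real d0 * log 2 (1 + (2 * real l + 1)\<^sup>2) / (real l)\<^sup>2"

definition rim_sparse :: "(int \<times> int) set \<Rightarrow> bool" where
  "rim_sparse A \<longleftrightarrow> (\<forall>i x0. near i \<longrightarrow> x0 \<in> rim i \<longrightarrow>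
     real (card (A \<inter> {x. nrm (x - x0) < real l})) \<le> 400 * real d * real d0)"

text \<open>For a near level \<open>i\<close>, boxes of levels at distance 6V or more do not reach
  this slab.\<close>

definition slab :: "int \<Rightarrow> (int \<times> int) set" where
  "slab i = {z \<in> sbox (R1 i) (10 * int V) i. \<bar>snd z - i\<bar> < 3 * int V}"

text \<open>Of the margin 2 d d0 over the mean, one half is reserved for the fluctuation of the
  counts and the other for that of the walks.\<close>

definition excess :: "(int \<times> int) set \<Rightarrow> int \<Rightarrow> int \<times> int \<Rightarrow> bool" where
  "excess A i x0 \<longleftrightarrow> n * (\<Sum>k\<in>{i - 10 * int V<..<i + 10 * int V}. psi i x0 (0, k)) + 2 * d * d0
     \<le> (\<Sum>z\<in>A \<inter> slab i. psi i x0 z)"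

lemma V_int: "6 * int V \<le> (int V)\<^sup>2" "65536 \<le> int V"
proof -
  show 1: "65536 \<le> int V" using V_ge by linarith
  show "6 * int V \<le> (int V)\<^sup>2" using 1 unfolding power2_eq_square by (intro mult_right_mono) auto
qed

lemma near_abs: "near i \<Longrightarrow> \<bar>i\<bar> < (int V)\<^sup>2"
proof -
  assume "near i"
  from near_bounds(1)[OF this] have "real_of_int \<bar>i\<bar> < real_of_int ((int V)\<^sup>2)" by simp
  thus ?thesis by (simp only: of_int_less_iff)
qed

lemma rim_sparse_mono: "A \<subseteq> B \<Longrightarrow> finite B \<Longrightarrow> rim_sparse B \<Longrightarrow> rim_sparse A"
  unfolding rim_sparse_def
proof (intro allI impI)
  fix i x0 assume a: "A \<subseteq> B" "finite B" "near i" "x0 \<in> rim i"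
    "\<forall>i x0. near i \<longrightarrow> x0 \<in> rim i \<longrightarrow> real (card (B \<inter> {x. nrm (x - x0) < real l})) \<le> 400 * real d * real d0"
  have "card (A \<inter> {x. nrm (x - x0) < real l}) \<le> card (B \<inter> {x. nrm (x - x0) < real l})"
    using a by (intro card_mono) auto
  also have "real \<dots> \<le> 400 * real d * real d0" using a by blast
  finally show "real (card (A \<inter> {x. nrm (x - x0) < real l})) \<le> 400 * real d * real d0" by simp
qed

text \<open>The filled strip already uses up the mean potential except for at most 160 d d0 + 1, so
  without an excess the remaining sites carry at most 162 d d0 + 1. Each site of the ball carries at
  least 3/4 by \<open>bump_le_green\<close>.\<close>

lemma rim_sparse_if_no_excess:
  assumes A: "finite A" "inner_set \<subseteq> A" and ex: "\<And>i x0. near i \<Longrightarrow> x0 \<in> rim i \<Longrightarrow> \<not> excess A i x0"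
  shows "rim_sparse A"
  unfolding rim_sparse_def
proof (intro allI impI)
  fix i x0 assume i: "near i" and x0: "x0 \<in> rim i"
  let ?D = "sbox (R1 i) (10 * int V) i" and ?S = "n * (\<Sum>k\<in>{i - 10 * int V<..<i + 10 * int V}. psi i x0 (0, k))"
  define Bl where "Bl = A \<inter> {x. nrm (x - x0) < real l}"
  define F where "F = {z \<in> ?D. \<bar>fst z\<bar> \<le> r \<and> \<bar>snd z - i\<bar> < 3 * int V}"
  define G where "G = {z \<in> ?D. \<bar>fst z\<bar> \<le> r \<and> 3 * int V \<le> \<bar>snd z - i\<bar>}"
  have FA: "F \<subseteq> A"
  proof
    fix z assume z: "z \<in> F"
    have "\<bar>snd z\<bar> \<le> 2 * (int V)\<^sup>2" using z near_abs[OF i] V_int by (auto simp: F_def)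
    thus "z \<in> A" using z A(2) by (auto simp: F_def inner_set_def)
  qed
  have ball: "nrm (x - x0) < 2 * real l" if "x \<in> Bl" for x
    using that d_bounds by (auto simp: Bl_def)
  have disj: "F \<inter> Bl = {}" using rim_bounds(3)[OF i x0 ball] by (force simp: F_def)
  have Bslab: "Bl \<subseteq> slab i"
    using rim_bounds(1,4)[OF i x0 ball] V_int by (force simp: slab_def)
  have "F \<subseteq> ?D" "G \<subseteq> ?D" "slab i \<subseteq> ?D" by (auto simp: F_def G_def slab_def)
  hence fin: "finite F" "finite G" "finite Bl" "finite (slab i)"
    using A by (auto simp: Bl_def intro: finite_subset[OF _ finite_sbox])
  have "(3 / 4) * real (card Bl) = (\<Sum>x\<in>Bl. 3 / 4)" by simp
  also have "\<dots> \<le> (\<Sum>x\<in>Bl. psi i x0 x)"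
  proof (rule sum_mono)
    fix x assume x: "x \<in> Bl"
    have "sqn (x - x0) < (real l)\<^sup>2" using x by (subst sqn_less_iff) (auto simp: Bl_def)
    hence "3 / 4 \<le> 1 - sqn (x - x0) / (4 * (real l)\<^sup>2)" using d_bounds(6) by (simp add: field_simps)
    also have "\<dots> \<le> psi i x0 x"
      unfolding psi_def mu_def
    proof (rule bump_le_green)
      show "0 < real l" using d_bounds by simp
      fix y assume "nrm (y - x0) < 2 * real l"
      from rim_bounds(1,4)[OF i x0 this] show "y \<in> ?D" by simp
    next
      show "x \<in> ?D" using rim_bounds(1,4)[OF i x0 ball[OF x]] by simp
    qed simp
    finally show "3 / 4 \<le> psi i x0 x" .
  qed
  also have "(\<Sum>x\<in>F. psi i x0 x) + (\<Sum>x\<in>Bl. psi i x0 x) = (\<Sum>x\<in>F \<union> Bl. psi i x0 x)"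
    using fin disj by (simp add: sum.union_disjoint)
  hence "(\<Sum>x\<in>Bl. psi i x0 x) = (\<Sum>x\<in>F \<union> Bl. psi i x0 x) - (\<Sum>x\<in>F. psi i x0 x)" by linarith
  also have "(\<Sum>x\<in>F \<union> Bl. psi i x0 x) \<le> (\<Sum>z\<in>A \<inter> slab i. psi i x0 z)"
    using FA Bslab A fin psi_nonneg by (intro sum_mono2) (auto simp: F_def Bl_def slab_def)
  also have "\<dots> \<le> ?S + 2 * d * d0" using ex[OF i x0] by (simp add: excess_def)
  also have "{z \<in> ?D. \<bar>fst z\<bar> \<le> r} = F \<union> G" by (auto simp: F_def G_def)
  hence "(\<Sum>x\<in>F. psi i x0 x) = (\<Sum>z\<in>{z \<in> ?D. \<bar>fst z\<bar> \<le> r}. psi i x0 z) - (\<Sum>z\<in>G. psi i x0 z)"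
    using fin by (simp only:) (subst sum.union_disjoint, auto simp: F_def G_def)
  also have "?S + 2 * d * d0 - ((\<Sum>z\<in>{z \<in> ?D. \<bar>fst z\<bar> \<le> r}. psi i x0 z) - (\<Sum>z\<in>G. psi i x0 z))
      \<le> 162 * real d * real d0 + 1"
    using psi_outer_sum[OF i x0] psi_far_sum[OF i x0] by (simp add: G_def)
  finally have "(3 / 4) * real (card Bl) \<le> 162 * (real d * real d0) + 1" by simp
  moreover have "1 \<le> real d * real d0" using mult_mono[of 1 "real d" 1 "real d0"] d_bounds by simp
  ultimately have "real (card Bl) \<le> 400 * (real d * real d0)" by linarith
  thus "real (card (A \<inter> {x. nrm (x - x0) < real l})) \<le> 400 * real d * real d0"
    by (simp add: Bl_def mult.assoc)
qed

lemma inner_set_card: "finite inner_set" "real (card inner_set) \<le> 5 * real n * (real V)\<^sup>2"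
proof -
  have eq: "inner_set = {-r..r} \<times> {- (2 * (int V)\<^sup>2)..2 * (int V)\<^sup>2}" by (auto simp: inner_set_def)
  show "finite inner_set" by (simp add: eq)
  have V1: "1 \<le> (int V)\<^sup>2" using V_int by linarith
  have "card inner_set = nat (2 * r + 1) * nat (4 * (int V)\<^sup>2 + 1)"
    by (simp add: eq card_cartesian_product)
  also have "\<dots> \<le> n * (5 * V\<^sup>2)"
  proof (intro mult_mono)
    show "nat (2 * r + 1) \<le> n" using r_bounds by linarith
    have "nat (4 * (int V)\<^sup>2 + 1) \<le> nat (int (5 * V\<^sup>2))" using V1 by (intro nat_mono) simp
    thus "nat (4 * (int V)\<^sup>2 + 1) \<le> 5 * V\<^sup>2" by (simp only: nat_int)
  qed auto
  finally have "real (card inner_set) \<le> real (n * (5 * V\<^sup>2))" by (simp only: of_nat_le_iff)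
  thus "real (card inner_set) \<le> 5 * real n * (real V)\<^sup>2" by simp
qed

lemma rims_card: "finite (SIGMA i:Collect near. rim i)" "real (card (SIGMA i:Collect near. rim i)) \<le> 45 * real V ^ 5"
proof -
  define B where "B = {- (int V)\<^sup>2..(int V)\<^sup>2} \<times> ({- int V..int V} \<times> {- (2 * (int V)\<^sup>2)..2 * (int V)\<^sup>2})"
  have sub: "(SIGMA i:Collect near. rim i) \<subseteq> B"
  proof safe
    fix i a b assume i: "near i" and ab: "(a, b) \<in> rim i"
    have "\<bar>a\<bar> < R1 i" using rim_bounds(1)[OF i ab, of "(a, b)"] d_bounds by (simp add: nrm_def)
    hence a: "\<bar>a\<bar> \<le> int V" using R1_le(2)[OF i] by linarith
    have b: "\<bar>b - i\<bar> < 3 * int V" using rim_bounds(4)[OF i ab, of "(a, b)"] d_bounds by (simp add: nrm_def)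
    show "(i, a, b) \<in> B" using a b near_abs[OF i] V_int by (auto simp: B_def)
  qed
  have "finite B" by (simp add: B_def)
  thus "finite (SIGMA i:Collect near. rim i)" using sub finite_subset by blast
  have V1: "1 \<le> (int V)\<^sup>2" "1 \<le> V" using V_int by linarith+
  have c1: "nat (2 * (int V)\<^sup>2 + 1) \<le> 3 * V\<^sup>2"
  proof -
    have "nat (2 * (int V)\<^sup>2 + 1) \<le> nat (int (3 * V\<^sup>2))" using V1 by (intro nat_mono) simp
    thus ?thesis by (simp only: nat_int)
  qed
  have c2: "nat (4 * (int V)\<^sup>2 + 1) \<le> 5 * V\<^sup>2"
  proof -
    have "nat (4 * (int V)\<^sup>2 + 1) \<le> nat (int (5 * V\<^sup>2))" using V1 by (intro nat_mono) simp
    thus ?thesis by (simp only: nat_int)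
  qed
  have "card (SIGMA i:Collect near. rim i) \<le> card B" using sub \<open>finite B\<close> by (rule card_mono[rotated])
  also have "card B = nat (2 * (int V)\<^sup>2 + 1) * (nat (2 * int V + 1) * nat (4 * (int V)\<^sup>2 + 1))"
    by (simp add: B_def card_cartesian_product)
  also have "\<dots> \<le> (3 * V\<^sup>2) * ((3 * V) * (5 * V\<^sup>2))"
    using V1 c1 c2 by (intro mult_mono) auto
  also have "\<dots> = 45 * V ^ 5" by (simp add: power_numeral_reduce)
  finally have "real (card (SIGMA i:Collect near. rim i)) \<le> real (45 * V ^ 5)" by (simp only: of_nat_le_iff)
  thus "real (card (SIGMA i:Collect near. rim i)) \<le> 45 * real V ^ 5" by simp
qed

definition shape :: "(int \<times> int) set \<Rightarrow> bool" where
  "shape A \<longleftrightarrow> inner_set \<subseteq> A \<and> (\<forall>z\<in>A. \<bar>snd z\<bar> \<le> int V \<longrightarrow> \<bar>real_of_int (fst z)\<bar> \<le> real n / 2 + 4 * real d)"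

text \<open>A box that meets the heights up to V belongs to a level with |i| \<le> 3V, because
  \<open>vt\<close> is sublinear.\<close>

lemma Bx_width:
  assumes "z \<in> Bx i" "\<bar>snd z\<bar> \<le> int V"
  shows "\<bar>real_of_int (fst z)\<bar> \<le> real n / 2 + 4 * real d"
proof -
  define a where "a = \<bar>real_of_int i\<bar>"
  have "\<bar>real_of_int (snd z)\<bar> \<le> real V" using assms(2) by linarith
  moreover have "\<bar>real_of_int (snd z - i)\<bar> \<le> vt V i" using assms(1) by (simp add: Bx_def)
  ultimately have 1: "a \<le> 2 * real V + sqrt a" unfolding a_def vt_def of_int_diff by linarith
  have "a \<le> 3 * real V"
  proof (rule ccontr)
    assume *: "\<not> a \<le> 3 * real V"
    hence "4 * sqrt a \<le> a" using V_ge by (intro sqrt_le_div) auto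
    thus False using 1 * by linarith
  qed
  hence "real d * a \<le> real d * (3 * real V)" by (intro mult_left_mono) auto
  hence "real d * a / real V \<le> 3 * real d" using V_pos by (simp add: field_simps)
  thus ?thesis using assms(1) by (simp add: Bx_def bw_def a_def)
qed

end

section \<open>Probabilities for fixed counts and a fixed order\<close>

text \<open>The walks are the only randomness left. Levels up to 3V^2 contain all starting points
  that the estimates on \<open>inner_set\<close> and at the rims use.\<close>

locale core = walks M S + params n d d0 V l m1 m2 lc
  for M :: "'w measure" and S and n d d0 V l m1 m2 lc +
  fixes \<nu> :: "int \<Rightarrow> nat" and m :: nat and ps :: "(int \<times> nat) list"
  assumes ps: "distinct ps" "set ps = {(i, j). \<bar>i\<bar> \<le> int m \<and> 1 \<le> j \<and> j \<le> \<nu> i}"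
    and good: "good_counts \<nu>" and m: "3 * V\<^sup>2 \<le> m"
begin

abbreviation K :: "int \<times> nat \<Rightarrow> (int \<times> int) set" where
  "K \<equiv> \<lambda>p. Bx (fst p)"

lemma ps_particles: "set ps \<subseteq> particles"
  by (auto simp: ps)

lemma sum_ps:
  fixes f :: "int \<Rightarrow> real"
  assumes "I \<subseteq> {- int m..int m}"
  shows "(\<Sum>p\<in>{p \<in> set ps. fst p \<in> I}. f (fst p)) = (\<Sum>k\<in>I. \<nu> k * f k)"
proof -
  have fin: "finite I" using assms by (rule finite_subset) simp
  have "{p \<in> set ps. fst p \<in> I} = (SIGMA k:I. {1..\<nu> k})" using assms by (force simp: ps)
  hence "(\<Sum>p\<in>{p \<in> set ps. fst p \<in> I}. f (fst p)) = (\<Sum>k\<in>I. \<Sum>j\<in>{1..\<nu> k}. f k)"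
    using sum.Sigma[OF fin, of "\<lambda>k. {1..\<nu> k}" "\<lambda>k j. f k"] by (simp add: case_prod_unfold)
  thus ?thesis by simp
qed

lemma m_int: "3 * (int V)\<^sup>2 \<le> int m"
proof -
  have "int (3 * V\<^sup>2) \<le> int m" using m by (simp only: of_nat_le_iff)
  thus ?thesis by simp
qed

lemma vacant_prob:
  assumes z: "z \<in> inner_set"
  shows "prob {\<omega> \<in> space M. z \<notin> cagg K ps \<omega>} \<le> exp (- (real d0 ^ 3 / (8 * LL * real n)))"
proof -
  define t where "t = real_of_int (R - \<bar>fst z\<bar>)"
  \<comment> \<open>Chosen such that the second-order term, \<open>\<theta>\<^sup>2 * LL\<close>
    times the bound 2nt on the expected potential, equals \<open>\<theta>\<close> times t^2 /
    4.\<close>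
  define \<theta> where "\<theta> = t / (8 * LL * real n)"
  define I where "I = {snd z - int (n\<^sup>2)<..<snd z + int (n\<^sup>2)}"
  define Sn where "Sn = real n * (\<Sum>k\<in>I. hin z (0, k))"
  define T where "T = (\<Sum>k\<in>I. \<nu> k * hin z (0, k))"
  define Sh where "Sh = (\<Sum>x\<in>sbox R (int (n\<^sup>2)) (snd z). hin z x)"
  have t: "2 \<le> t" "real d0 \<le> t" "t \<le> real n" using inner_bounds(2)[OF z] d_bounds r_bounds by (simp_all add: t_def)
  have n0: "0 < real n" "0 < LL" using d_bounds LL_ge_1 by linarith+
  have f1: "2 * t\<^sup>2 - 1 \<le> Sn - Sh" using inner_bounds(3)[OF z] by (simp add: Sn_def Sh_def I_def t_def)
  have f2: "Sn \<le> real n * (2 * t)" unfolding Sn_def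
    using inner_bounds(4)[OF z] by (intro mult_left_mono) (auto simp: I_def t_def)
  have f3: "Sn - t\<^sup>2 / 2 \<le> T" using good z by (auto simp: good_counts_def Sn_def T_def I_def t_def)
  have \<theta>: "0 \<le> \<theta>" "\<theta> * LL \<le> 1" using t n0 by (simp_all add: \<theta>_def field_simps)
  have "snd z \<le> 2 * (int V)\<^sup>2" "- (2 * (int V)\<^sup>2) \<le> snd z" using z by (auto simp: inner_set_def)
  hence I: "I \<subseteq> {- int m..int m}" using n2_le_V m_int V_int by (auto simp: I_def)
  have "prob {\<omega> \<in> space M. z \<notin> cagg K ps \<omega>} \<le>
      exp (\<theta> * Sh - (\<theta> - \<theta>\<^sup>2 * LL) * (\<Sum>p\<in>{p \<in> set ps. \<bar>fst p - snd z\<bar> < int (n\<^sup>2)}. hin z (0, fst p)))"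
    unfolding Sh_def
  proof (rule vacant_prob_le[OF ps(1) ps_particles refl hin_def inner_bounds(1)[OF z] hin_le \<theta>])
    fix p assume p: "\<bar>fst p - snd z\<bar> < int (n\<^sup>2)"
    show "sbox R (int (n\<^sup>2)) (snd z) \<subseteq> Bx (fst p)"
    proof
      fix y assume y: "y \<in> sbox R (int (n\<^sup>2)) (snd z)"
      hence "\<bar>real_of_int (fst y)\<bar> < real_of_int R" by (simp, linarith)
      hence 1: "\<bar>real_of_int (fst y)\<bar> \<le> bw (fst p)" using bw_ge[of "fst p"] r_bounds d_bounds by linarith
      have "\<bar>snd y - fst p\<bar> \<le> int V" using y p n2_le_V by auto
      hence "\<bar>real_of_int (snd y - fst p)\<bar> \<le> real V" by linarith
      hence "\<bar>real_of_int (snd y - fst p)\<bar> \<le> vt V (fst p)" by (simp add: vt_def add_increasing2)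
      thus "y \<in> Bx (fst p)" using 1 by (simp add: Bx_def)
    qed
  qed
  also have "{p \<in> set ps. \<bar>fst p - snd z\<bar> < int (n\<^sup>2)} = {p \<in> set ps. fst p \<in> I}" by (auto simp: I_def)
  also have "(\<Sum>p\<in>{p \<in> set ps. fst p \<in> I}. hin z (0, fst p)) = T" unfolding T_def by (rule sum_ps[OF I])
  \<comment> \<open>In units of \<open>\<theta>\<close>: the gain is 2 t^2 - 1, the counts cost t^2
    / 2, the second-order term t^2 / 4, and 1 \<le> t^2 / 4 since t \<ge> 2. What remains is
    t^2.\<close>
  also have "\<theta> * Sh - (\<theta> - \<theta>\<^sup>2 * LL) * T \<le> - (\<theta> * t\<^sup>2)"
  proof -
    have c: "0 \<le> \<theta> - \<theta>\<^sup>2 * LL" using mult_left_mono[OF \<theta>(2,1)] by (simp add: power2_eq_square mult.assoc)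
    have "(\<theta> - \<theta>\<^sup>2 * LL) * (Sn - t\<^sup>2 / 2) \<le> (\<theta> - \<theta>\<^sup>2 * LL) * T" by (rule mult_left_mono[OF f3 c])
    moreover have "\<theta> * Sh \<le> \<theta> * (Sn - 2 * t\<^sup>2 + 1)" using f1 \<theta> by (intro mult_left_mono) auto
    moreover have "\<theta>\<^sup>2 * LL * (Sn - t\<^sup>2 / 2) \<le> \<theta>\<^sup>2 * LL * (real n * (2 * t))"
      using f2 n0 by (intro mult_left_mono) (auto intro: order_trans[of _ Sn])
    moreover have "\<theta>\<^sup>2 * LL * (real n * (2 * t)) = \<theta> * (t\<^sup>2 / 4)"
      using n0 by (simp add: \<theta>_def power2_eq_square)
    moreover have "\<theta> * 4 \<le> \<theta> * t\<^sup>2" using t \<theta> power_mono[of 2 t 2] by (intro mult_left_mono) auto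
    ultimately show ?thesis by (simp add: algebra_simps)
  qed
  also have "\<theta> * t\<^sup>2 = t ^ 3 / (8 * LL * real n)" by (simp add: \<theta>_def power2_eq_square power3_eq_cube)
  also have "- (t ^ 3 / (8 * LL * real n)) \<le> - (real d0 ^ 3 / (8 * LL * real n))"
    using t n0 by (simp add: divide_right_mono power_mono)
  finally show ?thesis by simp
qed

lemma excess_prob:
  assumes i: "near i" and x0: "x0 \<in> rim i"
  shows "prob {\<omega> \<in> space M. excess (cagg K ps \<omega>) i x0} \<le> exp (- (real d0 ^ 2 * real d / (1296 * LL * real n)))"
proof -
  \<comment> \<open>Boxes of these levels lie inside the box of \<open>psi\<close>, and the boxes of
    all other levels miss the slab, as \<open>mass_prob_le\<close> requires.\<close>
  define P where "P = {p :: int \<times> nat. fst p \<in> {i - 6 * int V<..<i + 6 * int V}}"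
  define J where "J = {i - 10 * int V<..<i + 10 * int V}"
  define Sn where "Sn = real n * (\<Sum>k\<in>J. psi i x0 (0, k))"
  define x where "x = Sn + 2 * d * d0"
  \<comment> \<open>With the bound 81 n d on the expected potential and 4 LL on \<open>psi\<close>,
    the second-order term takes half of d d0: 648 = 2 * 4 * 81.\<close>
  define \<theta> where "\<theta> = real d0 / (648 * LL * real n)"
  define T where "T = (\<Sum>p\<in>set ps \<inter> P. psi i x0 (0, fst p))"
  let ?D = "sbox (R1 i) (10 * int V) i"
  have n0: "0 < real n" "0 < LL" using d_bounds LL_ge_1 by linarith+
  have \<theta>: "0 \<le> \<theta>" "\<theta> * (4 * LL) \<le> 1" using n0 d_bounds by (simp_all add: \<theta>_def field_simps)
  note nb = near_bounds[OF i]
  have sub: "Bx (fst p) \<subseteq> ?D" if "p \<in> P" for p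
  proof
    define k where "k = fst p"
    have k: "\<bar>real_of_int (k - i)\<bar> \<le> 6 * real V" using that by (simp add: P_def k_def) linarith
    have "sqrt \<bar>real_of_int (k - i)\<bar> \<le> sqrt ((real V)\<^sup>2)"
      using k V_ge by (intro real_sqrt_le_mono) (auto simp: power2_eq_square intro: order_trans[OF _ mult_right_mono[of 6]])
    hence "sqrt \<bar>real_of_int k\<bar> \<le> 2 * real V" using sqrt_abs_diff[of k i] nb by simp
    hence v: "vt V k \<le> 3 * real V" by (simp add: vt_def)
    have "real d * \<bar>real_of_int k\<bar> \<le> real d * (\<bar>real_of_int i\<bar> + 6 * real V)"
      using k by (intro mult_left_mono) auto
    hence "real d * \<bar>real_of_int k\<bar> / real V \<le> real d * \<bar>real_of_int i\<bar> / real V + 6 * real d"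
      using V_pos by (simp add: field_simps)
    hence b: "bw k \<le> bw i + 6 * real d" by (simp add: bw_def)
    fix z assume "z \<in> Bx (fst p)"
    hence z: "\<bar>real_of_int (fst z)\<bar> \<le> bw k" "\<bar>real_of_int (snd z - k)\<bar> \<le> vt V k" by (auto simp: Bx_def k_def)
    have "\<bar>real_of_int (fst z)\<bar> < real_of_int (R1 i)" using z b R1_bounds[of i] d_bounds by linarith
    moreover have "\<bar>real_of_int (snd z - i)\<bar> < 10 * real V" using z v k V_pos unfolding of_int_diff by linarith
    ultimately show "z \<in> ?D" by (simp, linarith)
  qed
  have off: "Bx (fst p) \<inter> slab i = {}" if "p \<notin> P" for p
  proof -
    define k where "k = fst p"
    define a where "a = \<bar>real_of_int (k - i)\<bar>"
    have a: "6 * real V \<le> a" using that by (simp add: P_def k_def a_def) linarith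
    have "6 * sqrt a \<le> a" using a V_ge by (intro sqrt_le_div) auto
    hence "a - sqrt a \<ge> 5 * real V" using a by linarith
    moreover have "vt V k < 2 * real V + sqrt a" using sqrt_abs_diff[of k i] nb by (simp add: vt_def a_def)
    ultimately have "\<not> \<bar>real_of_int (snd z - i)\<bar> < 3 * real V" if "\<bar>real_of_int (snd z - k)\<bar> \<le> vt V k" for z :: "int \<times> int"
      using that by (simp add: a_def)
    hence "\<not> \<bar>snd z - i\<bar> < 3 * int V" if "z \<in> Bx k" for z using that by (fastforce simp: Bx_def)
    thus ?thesis by (auto simp: slab_def k_def)
  qed
  have "P \<inter> set ps = {p \<in> set ps. fst p \<in> {i - 6 * int V<..<i + 6 * int V}}" by (auto simp: P_def)
  moreover have "{i - 6 * int V<..<i + 6 * int V} \<subseteq> {- int m..int m}"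
    using near_abs[OF i] m_int V_int by auto
  ultimately have "T = (\<Sum>k\<in>{i - 6 * int V<..<i + 6 * int V}. \<nu> k * psi i x0 (0, k))"
    unfolding T_def Int_commute[of _ P]
    using sum_ps[of "{i - 6 * int V<..<i + 6 * int V}" "\<lambda>k. psi i x0 (0, k)"] by simp
  also have "\<dots> \<le> (\<Sum>k\<in>J. \<nu> k * psi i x0 (0, k))"
    unfolding J_def by (intro sum_mono2) (auto simp: psi_nonneg)
  also have "\<dots> \<le> Sn + d * d0" using good i x0 unfolding good_counts_def Sn_def J_def by blast
  finally have T: "T \<le> Sn + real d * real d0" by simp
  have S: "Sn \<le> real n * (80 * real d)" unfolding Sn_def J_def
    by (intro mult_left_mono psi_axis_sum[OF i x0]) auto
  have "prob {\<omega> \<in> space M. x \<le> (\<Sum>z\<in>cagg K ps \<omega> \<inter> slab i. psi i x0 z)} \<le>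
      exp ((\<theta> + \<theta>\<^sup>2 * (4 * LL)) * T - \<theta> * x)"
    unfolding T_def
    by (rule mass_prob_le[OF ps(1) ps_particles _ psi_def mu_nonneg psi_le[OF i] \<theta>]) (use sub off in auto)
  also have "(\<theta> + \<theta>\<^sup>2 * (4 * LL)) * T - \<theta> * x \<le> - (\<theta> * (real d * real d0) / 2)"
  proof -
    have "(\<theta> + \<theta>\<^sup>2 * (4 * LL)) * T \<le> (\<theta> + \<theta>\<^sup>2 * (4 * LL)) * (Sn + real d * real d0)"
      using T \<theta> n0 by (intro mult_left_mono) auto
    moreover have "\<theta>\<^sup>2 * (4 * LL) * (Sn + real d * real d0) \<le> \<theta>\<^sup>2 * (4 * LL) * (81 * (real n * real d))"
    proof (intro mult_left_mono)
      have "real d * real d0 \<le> real d * real n" using d_bounds by (intro mult_left_mono) auto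
      thus "Sn + real d * real d0 \<le> 81 * (real n * real d)" using S by (simp add: algebra_simps)
    qed (use n0 in auto)
    moreover have "\<theta>\<^sup>2 * (4 * LL) * (81 * (real n * real d)) = \<theta> * (real d * real d0) / 2"
      using n0 by (simp add: \<theta>_def power2_eq_square mult_ac)
    moreover have "(\<theta> + \<theta>\<^sup>2 * (4 * LL)) * (Sn + real d * real d0) =
        \<theta> * (Sn + real d * real d0) + \<theta>\<^sup>2 * (4 * LL) * (Sn + real d * real d0)" by (rule distrib_right)
    moreover have "\<theta> * x = \<theta> * (Sn + real d * real d0) + \<theta> * (real d * real d0)"
      by (simp add: x_def algebra_simps)
    ultimately show ?thesis by linarith
  qed
  also have "- (\<theta> * (real d * real d0) / 2) = - (real d0 ^ 2 * real d / (1296 * LL * real n))"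
    using n0 by (simp add: \<theta>_def power2_eq_square field_simps)
  finally show ?thesis by (simp add: excess_def x_def Sn_def J_def)
qed

text \<open>A level whose box meets this range is at distance at most 4 \<open>vt V i\<close> from
  \<open>i\<close>, again because of the slow growth of \<open>vt\<close>; the number of sites is
  then at most the number of particles.\<close>

lemma card_near_level:
  assumes "distinct qs" "set qs \<subseteq> set ps"
  shows "real (card (cagg K qs \<omega> \<inter> {x. \<bar>real_of_int (snd x - i)\<bar> \<le> 2 * vt V i})) \<le> 20 * n * vt V i"
proof -
  define I where "I = {k. \<bar>real_of_int (k - i)\<bar> \<le> 4 * vt V i} \<inter> {- int m..int m}"
  define I' where "I' = {k. \<bar>real_of_int (k - i)\<bar> \<le> 4 * vt V i}"
  let ?T = "{x :: int \<times> int. \<bar>real_of_int (snd x - i)\<bar> \<le> 2 * vt V i}"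
  have vi: "real V \<le> vt V i" by (simp add: vt_def)
  have sub: "{p \<in> set qs. Bx (fst p) \<inter> ?T \<noteq> {}} \<subseteq> {p \<in> set ps. fst p \<in> I}"
  proof
    fix p assume "p \<in> {p \<in> set qs. Bx (fst p) \<inter> ?T \<noteq> {}}"
    then obtain x where p: "p \<in> set ps" and x: "x \<in> Bx (fst p)" "x \<in> ?T" using assms(2) by auto
    define k where "k = fst p"
    define a where "a = \<bar>real_of_int (k - i)\<bar>"
    have "vt V k \<le> vt V i + sqrt a" using sqrt_abs_diff[of k i] by (simp add: vt_def a_def)
    moreover have "\<bar>real_of_int (snd x - k)\<bar> \<le> vt V k" "\<bar>real_of_int (snd x - i)\<bar> \<le> 2 * vt V i"
      using x by (auto simp: Bx_def k_def)
    ultimately have 1: "a \<le> 3 * vt V i + sqrt a" unfolding a_def of_int_diff by linarith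
    have "a \<le> 4 * vt V i"
    proof (rule ccontr)
      assume *: "\<not> a \<le> 4 * vt V i"
      hence "4 * sqrt a \<le> a" using vi V_ge by (intro sqrt_le_div) auto
      thus False using 1 * by linarith
    qed
    thus "p \<in> {p \<in> set ps. fst p \<in> I}" using p ps by (auto simp: I_def k_def a_def)
  qed
  have fin: "finite I'"
  proof (rule finite_subset)
    show "I' \<subseteq> {i - \<lceil>4 * vt V i\<rceil>..i + \<lceil>4 * vt V i\<rceil>}" by (auto simp: I'_def abs_le_iff) linarith+
  qed simp
  have "card (cagg K qs \<omega> \<inter> ?T) \<le> card {p \<in> set qs. Bx (fst p) \<inter> ?T \<noteq> {}}"
    unfolding cagg_def by (rule card_cfold_le[OF assms(1)])
  also have "\<dots> \<le> card {p \<in> set ps. fst p \<in> I}" by (intro card_mono sub) simp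
  also have "real \<dots> = (\<Sum>k\<in>I. \<nu> k * 1)" using sum_ps[of I "\<lambda>_. 1"] by (simp add: I_def)
  also have "\<dots> \<le> (\<Sum>k\<in>I'. real (\<nu> k))" using fin by (simp, intro sum_mono2) (auto simp: I_def I'_def)
  also have "\<dots> \<le> 20 * n * vt V i" using good by (auto simp: good_counts_def I'_def)
  finally show ?thesis by simp
qed

text \<open>An exit through top or bottom passes the depth vt / n in the maximum norm, and so does a
  lateral exit if the level is not near, since then vt / n \<le> bw. These exits (\<open>Z1\<close>)
  are covered by the crude count; lateral exits of near levels (\<open>Z2\<close>) by the sparse
  rim.\<close>

lemma dropped_prob:
  assumes p: "p \<in> set ps" and qs: "distinct qs" "set qs \<subseteq> set ps" and sp: "rim_sparse (cagg K qs \<omega>)"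
  shows "prob {\<omega>' \<in> space M. dropped (K p) (W p \<omega>') (cagg K qs \<omega>)} \<le>
    qc (fst p) ^ m1 + (if near (fst p) then qf ^ m2 else 0)"
proof -
  define i where "i = fst p"
  define A where "A = cagg K qs \<omega>"
  define \<xi> where "\<xi> x = max \<bar>real_of_int (fst x)\<bar> \<bar>real_of_int (snd x - i)\<bar>" for x :: "int \<times> int"
  define Z1 where "Z1 = {x. x \<notin> Bx i \<and> vt V i / n < \<xi> x}"
  define Z2 where "Z2 = {x. x \<notin> Bx i \<and> near i \<and> bw i < \<bar>real_of_int (fst x)\<bar>}"
  have pp: "p \<in> particles" using p ps_particles by auto
  have A: "finite A" by (simp add: A_def cagg_def cfold_finite)
  have C: "finite (A \<inter> Bx i)" using A by simp
  have vi: "0 < vt V i" using V_pos by (simp add: vt_def add_pos_nonneg)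
  have vn: "vt V i / n \<le> vt V i"
    using vi d_bounds by (simp add: field_simps mult_le_cancel_left1)
  have L: "0 \<le> log 2 (1 + (2 * x + 1)\<^sup>2)" for x :: real
    by (intro zero_le_log_cancel_iff[THEN iffD2] add_pos_nonneg) auto
  have "prob {\<omega> \<in> space M. stop (W p \<omega>) (A \<inter> Bx i) \<in> Z1} \<le> qc i ^ m1"
  proof (rule hit_prob_layers[OF pp C lc(1)])
    show "0 \<le> qc i" using vi L unfolding qc_def by (intro divide_nonneg_nonneg mult_nonneg_nonneg) auto
    show "\<xi> y \<le> \<xi> x + nrm (y - x)" for x y
      using abs_fst_le_nrm[of "y - x"] abs_snd_le_nrm[of "y - x"] unfolding \<xi>_def by (simp, linarith)
    show "x \<notin> A \<inter> Bx i \<and> 0 + real m1 * (lc i + 2) < \<xi> x" if "x \<in> Z1" for x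
      using that lc(3)[of i] by (auto simp: Z1_def)
    show "\<xi> (0, fst p) \<le> 0" by (simp add: \<xi>_def i_def)
    fix x0 assume x0: "\<xi> x0 \<le> 0 + real m1 * (lc i + 2)"
    have "{x \<in> A \<inter> Bx i. nrm (x - x0) < lc i} \<subseteq> A \<inter> {x. \<bar>real_of_int (snd x - i)\<bar> \<le> 2 * vt V i}"
    proof safe
      fix a b assume "nrm ((a, b) - x0) < lc i"
      hence "\<bar>real_of_int (b - snd x0)\<bar> < lc i" using abs_snd_le_nrm[of "(a, b) - x0"] by simp
      moreover have "\<bar>real_of_int (snd x0 - i)\<bar> \<le> vt V i" using x0 lc(3)[of i] vn by (simp add: \<xi>_def)
      ultimately show "\<bar>real_of_int (snd (a, b) - i)\<bar> \<le> 2 * vt V i" using lc(2)[of i] unfolding snd_conv of_int_diff by linarith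
    qed
    hence "card {x \<in> A \<inter> Bx i. nrm (x - x0) < lc i} \<le> card (A \<inter> {x. \<bar>real_of_int (snd x - i)\<bar> \<le> 2 * vt V i})"
      using A by (intro card_mono) auto
    also have "real \<dots> \<le> 20 * n * vt V i" unfolding A_def by (rule card_near_level[OF qs])
    finally show "real (card {x \<in> A \<inter> Bx i. nrm (x - x0) < lc i}) * log 2 (1 + (2 * lc i + 1)\<^sup>2) / (lc i)\<^sup>2 \<le> qc i"
      unfolding qc_def using L by (intro divide_right_mono mult_right_mono) auto
  qed
  moreover have "prob {\<omega> \<in> space M. stop (W p \<omega>) (A \<inter> Bx i) \<in> Z2} \<le> (if near i then qf ^ m2 else 0)"
  proof (cases "near i")
    case False
    thus ?thesis by (simp add: Z2_def)
  next
    case True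
    have "prob {\<omega> \<in> space M. stop (W p \<omega>) (A \<inter> Bx i) \<in> Z2} \<le> qf ^ m2"
    proof (rule hit_prob_layers[OF pp C, where l = "real l" and c = "bw i - real d / 2" and \<xi> = "\<lambda>x. \<bar>real_of_int (fst x)\<bar>"])
      show "0 < real l" using d_bounds by simp
      show "0 \<le> qf" unfolding qf_def using L by (intro divide_nonneg_nonneg mult_nonneg_nonneg) auto
      show "\<bar>real_of_int (fst y)\<bar> \<le> \<bar>real_of_int (fst x)\<bar> + nrm (y - x)" for x y
        using abs_fst_le_nrm[of "y - x"] unfolding fst_diff of_int_diff by linarith
      show "x \<notin> A \<inter> Bx i \<and> bw i - real d / 2 + real m2 * (real l + 2) < \<bar>real_of_int (fst x)\<bar>" if "x \<in> Z2" for x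
        using that d_bounds(8) by (auto simp: Z2_def)
      show "\<bar>real_of_int (fst (0, fst p))\<bar> \<le> bw i - real d / 2" using bw_ge[of i] d_bounds by simp
      fix x0 assume x0: "x0 \<in> A \<inter> Bx i" "bw i - real d / 2 < \<bar>real_of_int (fst x0)\<bar>"
      have "card {x \<in> A \<inter> Bx i. nrm (x - x0) < real l} \<le> card (A \<inter> {x. nrm (x - x0) < real l})"
        using A by (intro card_mono) auto
      also have "x0 \<in> rim i" using x0 by (simp add: rim_def)
      hence "real (card (A \<inter> {x. nrm (x - x0) < real l})) \<le> 400 * real d * real d0"
        using sp True unfolding rim_sparse_def A_def by blast
      finally show "real (card {x \<in> A \<inter> Bx i. nrm (x - x0) < real l}) * log 2 (1 + (2 * real l + 1)\<^sup>2) / (real l)\<^sup>2 \<le> qf"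
        unfolding qf_def using L by (intro divide_right_mono mult_right_mono) auto
    qed
    thus ?thesis using True by simp
  qed
  moreover have "- Bx i \<subseteq> Z1 \<union> Z2"
  proof
    fix x assume "x \<in> - Bx i"
    hence x: "x \<notin> Bx i" "bw i < \<bar>real_of_int (fst x)\<bar> \<or> vt V i < \<bar>real_of_int (snd x - i)\<bar>" by (auto simp: Bx_def)
    show "x \<in> Z1 \<union> Z2"
    proof (cases "bw i < \<bar>real_of_int (fst x)\<bar>")
      case True
      show ?thesis
      proof (cases "near i")
        case False
        hence "vt V i / n \<le> bw i" using d_bounds by (simp add: near_def field_simps)
        thus ?thesis using True x by (auto simp: Z1_def \<xi>_def)
      qed (use True x in \<open>auto simp: Z2_def\<close>)
    next
      case False
      hence "vt V i < \<xi> x" using x(2) by (simp add: \<xi>_def)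
      thus ?thesis using x(1) vn by (auto simp: Z1_def)
    qed
  qed
  ultimately show ?thesis
    unfolding i_def[symmetric] A_def[symmetric] using dropped_prob_le[OF pp A, of "Bx i" Z1 Z2] by blast
qed

lemma nu_le: "real (\<nu> k) \<le> 20 * n * vt V k"
proof -
  have "finite {j. \<bar>real_of_int (j - k)\<bar> \<le> 4 * vt V k}"
  proof (rule finite_subset)
    show "{j. \<bar>real_of_int (j - k)\<bar> \<le> 4 * vt V k} \<subseteq> {k - \<lceil>4 * vt V k\<rceil>..k + \<lceil>4 * vt V k\<rceil>}"
      by (auto simp: abs_le_iff) linarith+
  qed simp
  hence "real (\<nu> k) \<le> (\<Sum>j\<in>{j. \<bar>real_of_int (j - k)\<bar> \<le> 4 * vt V k}. real (\<nu> j))"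
    by (intro member_le_sum) (auto simp: vt_def)
  also have "\<dots> \<le> 20 * n * vt V k" using good by (auto simp: good_counts_def)
  finally show ?thesis .
qed

lemma shape_prob:
  "prob {\<omega> \<in> space M. \<not> shape (aggregate (\<lambda>i j k. S i j k \<omega>) ps)} \<le>
     5 * real n * (real V)\<^sup>2 * exp (- (real d0 ^ 3 / (8 * LL * real n))) +
     45 * real V ^ 5 * exp (- (real d0 ^ 2 * real d / (1296 * LL * real n))) +
     (\<Sum>k\<in>{- int m..int m}. 20 * n * vt V k * (qc k ^ m1 + (if near k then qf ^ m2 else 0)))"
proof -
  define B where "B = cagg K ps"
  define c where "c k = qc k ^ m1 + (if near k then qf ^ m2 else 0)" for k
  have L: "0 \<le> log 2 (1 + (2 * x + 1)\<^sup>2)" for x :: real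
    by (intro zero_le_log_cancel_iff[THEN iffD2] add_pos_nonneg) auto
  have c0: "0 \<le> c k" for k
  proof -
    have "0 \<le> vt V k" by (simp add: vt_def)
    hence "0 \<le> qc k" "0 \<le> qf" using L unfolding qc_def qf_def by (auto intro!: divide_nonneg_nonneg mult_nonneg_nonneg)
    thus ?thesis by (simp add: c_def)
  qed
  have pr: "{\<omega> \<in> space M. Q (B \<omega>)} \<in> events" for Q
    using cagg_pred[OF ps_particles, of Q K] by (simp add: B_def pred_def)
  define E1 where "E1 = (\<Union>z\<in>inner_set. {\<omega> \<in> space M. z \<notin> B \<omega>})"
  define E2 where "E2 = (\<Union>q\<in>(SIGMA i:Collect near. rim i). {\<omega> \<in> space M. excess (B \<omega>) (fst q) (snd q)})"
  define E3 where "E3 = {\<omega> \<in> space M. rim_sparse (B \<omega>) \<and> B \<omega> \<noteq> aggregate (\<lambda>i j k. S i j k \<omega>) ps}"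
  have E1: "E1 \<in> events" unfolding E1_def using inner_set_card by (intro sets.finite_UN pr) auto
  have E2: "E2 \<in> events" unfolding E2_def using rims_card by (intro sets.finite_UN pr) auto
  have "(\<lambda>\<omega>. aggregate (\<lambda>i j k. S i j k \<omega>) ps) \<in> M \<rightarrow>\<^sub>M count_space fsets"
    by (rule aggregate_measurable[OF ps_particles])
  hence E3: "E3 \<in> events" unfolding E3_def
    using cagg_measurable[OF ps_particles, of K]
    by (intro pair_count_space_pred[where f = B and Q = "\<lambda>A A'. rim_sparse A \<and> A \<noteq> A'"]) (simp_all add: B_def)
  have "prob E1 \<le> (\<Sum>z\<in>inner_set. prob {\<omega> \<in> space M. z \<notin> B \<omega>})"
    unfolding E1_def using inner_set_card pr by (intro finite_measure_subadditive_finite) auto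
  also have "\<dots> \<le> (\<Sum>z\<in>inner_set. exp (- (real d0 ^ 3 / (8 * LL * real n))))"
    unfolding B_def by (intro sum_mono vacant_prob)
  also have "\<dots> \<le> 5 * real n * (real V)\<^sup>2 * exp (- (real d0 ^ 3 / (8 * LL * real n)))"
    using inner_set_card by (simp add: mult_right_mono)
  finally have p1: "prob E1 \<le> 5 * real n * (real V)\<^sup>2 * exp (- (real d0 ^ 3 / (8 * LL * real n)))" .
  have "prob E2 \<le> (\<Sum>q\<in>(SIGMA i:Collect near. rim i). prob {\<omega> \<in> space M. excess (B \<omega>) (fst q) (snd q)})"
    unfolding E2_def using rims_card pr by (intro finite_measure_subadditive_finite) auto
  also have "\<dots> \<le> (\<Sum>q\<in>(SIGMA i:Collect near. rim i). exp (- (real d0 ^ 2 * real d / (1296 * LL * real n))))"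
    unfolding B_def by (intro sum_mono excess_prob) auto
  also have "\<dots> \<le> 45 * real V ^ 5 * exp (- (real d0 ^ 2 * real d / (1296 * LL * real n)))"
    using rims_card by (simp add: mult_right_mono)
  finally have p2: "prob E2 \<le> 45 * real V ^ 5 * exp (- (real d0 ^ 2 * real d / (1296 * LL * real n)))" .
  have "prob E3 \<le> (\<Sum>p\<in>set ps. c (fst p))"
    unfolding E3_def B_def
  proof (rule some_dropped_prob_le[OF ps(1) ps_particles, where Q = "\<lambda>A. rim_sparse A" ])
    fix p qs \<omega> assume "p \<in> set ps" "distinct qs" "set qs \<subseteq> set ps" "rim_sparse (cagg K qs \<omega>)"
    from dropped_prob[OF this] show "prob {\<omega>' \<in> space M. dropped (K p) (W p \<omega>') (cagg K qs \<omega>)} \<le> c (fst p)"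
      by (simp add: c_def)
  qed (use c0 rim_sparse_mono in auto)
  also have "(\<Sum>p\<in>set ps. c (fst p)) = (\<Sum>p\<in>{p \<in> set ps. fst p \<in> {- int m..int m}}. c (fst p))"
    by (intro sum.cong) (auto simp: ps)
  also have "\<dots> = (\<Sum>k\<in>{- int m..int m}. \<nu> k * c k)" by (rule sum_ps) simp
  also have "\<dots> \<le> (\<Sum>k\<in>{- int m..int m}. 20 * n * vt V k * c k)"
    using c0 nu_le by (intro sum_mono mult_right_mono) auto
  finally have p3: "prob E3 \<le> (\<Sum>k\<in>{- int m..int m}. 20 * n * vt V k * c k)" .
  \<comment> \<open>Outside the three events the inside is full and no ball has an excess, hence the
    rims are sparse; then nothing is discarded, so \<open>B\<close> is the true aggregate and its
    sites lie in the boxes.\<close>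
  have "{\<omega> \<in> space M. \<not> shape (aggregate (\<lambda>i j k. S i j k \<omega>) ps)} \<subseteq> E1 \<union> E2 \<union> E3"
  proof (rule subsetI, rule ccontr)
    fix \<omega> assume w: "\<omega> \<in> {\<omega> \<in> space M. \<not> shape (aggregate (\<lambda>i j k. S i j k \<omega>) ps)}" and "\<omega> \<notin> E1 \<union> E2 \<union> E3"
    hence in1: "inner_set \<subseteq> B \<omega>" and n2: "\<And>i x0. near i \<Longrightarrow> x0 \<in> rim i \<Longrightarrow> \<not> excess (B \<omega>) i x0"
      and n3: "rim_sparse (B \<omega>) \<Longrightarrow> B \<omega> = aggregate (\<lambda>i j k. S i j k \<omega>) ps"
      by (force simp: E1_def E2_def E3_def)+
    have "finite (B \<omega>)" by (simp add: B_def cagg_def cfold_finite)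
    hence eq: "B \<omega> = aggregate (\<lambda>i j k. S i j k \<omega>) ps" using rim_sparse_if_no_excess[OF _ in1 n2] n3 by blast
    have "shape (B \<omega>)" unfolding shape_def
    proof (intro conjI in1 ballI impI)
      fix z assume z: "z \<in> B \<omega>" "\<bar>snd z\<bar> \<le> int V"
      have "\<exists>p\<in>set ps. z \<in> Bx (fst p)"
        using cfold_provenance[of z K "\<lambda>p. W p \<omega>" ps] z(1) by (simp add: B_def cagg_def)
      then obtain p where "z \<in> Bx (fst p)" by auto
      thus "\<bar>real_of_int (fst z)\<bar> \<le> real n / 2 + 4 * real d" using z(2) by (rule Bx_width)
    qed
    thus False using w eq by simp
  qed
  hence "prob {\<omega> \<in> space M. \<not> shape (aggregate (\<lambda>i j k. S i j k \<omega>) ps)} \<le> prob (E1 \<union> E2 \<union> E3)"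
    using E1 E2 E3 by (intro finite_measure_mono) auto
  also have "\<dots> \<le> prob (E1 \<union> E2) + prob E3" using E1 E2 E3 by (intro measure_Un_le) auto
  also have "prob (E1 \<union> E2) \<le> prob E1 + prob E2" using E1 E2 by (intro measure_Un_le) auto
  finally show ?thesis using p1 p2 p3 unfolding c_def by linarith
qed

end

section \<open>Poisson numbers of particles\<close>

lemma poisson_mgf:
  assumes "0 < \<beta>"
  shows "(\<integral>\<^sup>+k. ennreal (exp (t * real k)) \<partial>measure_pmf (poisson_pmf \<beta>)) = ennreal (exp (\<beta> * (exp t - 1)))"
proof -
  have "(\<integral>\<^sup>+k. ennreal (exp (t * real k)) \<partial>measure_pmf (poisson_pmf \<beta>)) =
      (\<integral>\<^sup>+k. ennreal (\<beta> ^ k / fact k * exp (- \<beta>) * exp (t * real k)) \<partial>count_space UNIV)"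
    using assms by (subst nn_integral_measure_pmf) (auto intro!: nn_integral_cong simp: ennreal_mult[symmetric])
  also have "\<dots> = (\<integral>\<^sup>+k. ennreal (exp (- \<beta>) * ((\<beta> * exp t) ^ k /\<^sub>R fact k)) \<partial>count_space UNIV)"
    by (intro nn_integral_cong arg_cong[where f = ennreal])
       (simp add: power_mult_distrib exp_of_nat_mult[symmetric] divide_inverse mult_ac)
  also have "\<dots> = (\<Sum>k. ennreal (exp (- \<beta>) * ((\<beta> * exp t) ^ k /\<^sub>R fact k)))"
    by (rule nn_integral_count_space_nat)
  also have "\<dots> = ennreal (exp (- \<beta>) * exp (\<beta> * exp t))"
    using assms by (intro suminf_ennreal_eq sums_mult exp_converges) auto
  also have "exp (- \<beta>) * exp (\<beta> * exp t) = exp (\<beta> * (exp t - 1))"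
    by (simp add: exp_add[symmetric] algebra_simps)
  finally show ?thesis .
qed

lemma exp_minus_one_le:
  fixes x b \<theta> a :: real
  assumes "0 \<le> \<theta>" "0 \<le> a" "a \<le> b" "\<theta> * b \<le> 1"
  shows "exp (\<theta> * a) - 1 \<le> (\<theta> + \<theta>\<^sup>2 * b) * a" "exp (- (\<theta> * a)) - 1 \<le> - ((\<theta> - \<theta>\<^sup>2 * b) * a)"
proof -
  define y where "y = \<theta> * a"
  have "\<theta> * a \<le> \<theta> * b" using assms by (intro mult_left_mono)
  hence y: "0 \<le> y" "y \<le> 1" using assms by (auto simp: y_def)
  have "a * a \<le> b * a" using assms by (intro mult_right_mono)
  hence y2: "y\<^sup>2 \<le> \<theta>\<^sup>2 * b * a" unfolding y_def power2_eq_square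
    using mult_left_mono[of "a * a" "b * a" "\<theta> * \<theta>"] assms by (simp add: mult_ac)
  have "exp y \<le> 1 + y + y\<^sup>2" using y by (intro exp_bound)
  thus "exp (\<theta> * a) - 1 \<le> (\<theta> + \<theta>\<^sup>2 * b) * a" using y2 by (simp add: y_def distrib_right)
  have "1 + y ^ 3 = (1 - y + y\<^sup>2) * (1 + y)" by (simp add: algebra_simps power2_eq_square power3_eq_cube)
  also have "\<dots> \<le> (1 - y + y\<^sup>2) * exp y" using y by (intro mult_left_mono exp_ge_add_one_self) auto
  finally have "1 \<le> (1 - y + y\<^sup>2) * exp y" using y by (smt (verit) zero_le_power)
  hence "exp (- y) \<le> 1 - y + y\<^sup>2" by (simp add: exp_minus field_simps)
  thus "exp (- (\<theta> * a)) - 1 \<le> - ((\<theta> - \<theta>\<^sup>2 * b) * a)" using y2 by (simp add: y_def left_diff_distrib)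
qed

locale poisson_counts = prob_space M for M :: "'w measure" +
  fixes n :: nat and N :: "int \<Rightarrow> 'w \<Rightarrow> nat"
  assumes n_pos: "0 < n" and N_indep: "indep_vars (\<lambda>_. count_space UNIV) N UNIV"
    and N_distr: "\<And>i. distr M (count_space UNIV) (N i) = measure_pmf (poisson_pmf (real n))"
begin

lemma N_measurable [measurable]: "N i \<in> M \<rightarrow>\<^sub>M count_space UNIV"
  using N_indep unfolding indep_vars_def by blast

lemma mgf_sum:
  fixes t :: "int \<Rightarrow> real"
  assumes "finite I"
  shows "(\<integral>\<^sup>+\<omega>. ennreal (exp (\<Sum>k\<in>I. t k * N k \<omega>)) \<partial>M) = ennreal (exp (n * (\<Sum>k\<in>I. exp (t k) - 1)))"
proof -
  define X where "X k \<omega> = ennreal (exp (t k * real (N k \<omega>)))" for k \<omega>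
  have ind: "indep_vars (\<lambda>_. borel) X I"
    unfolding X_def
    by (rule indep_vars_compose2[where Y = "\<lambda>k x. ennreal (exp (t k * real x))", OF indep_vars_subset[OF N_indep]]) auto
  have one: "(\<integral>\<^sup>+\<omega>. X k \<omega> \<partial>M) = ennreal (exp (n * (exp (t k) - 1)))" for k
  proof -
    have "(\<integral>\<^sup>+\<omega>. X k \<omega> \<partial>M) = (\<integral>\<^sup>+x. ennreal (exp (t k * real x)) \<partial>distr M (count_space UNIV) (N k))"
      unfolding X_def by (subst nn_integral_distr) auto
    thus ?thesis using n_pos by (simp add: N_distr poisson_mgf)
  qed
  have "(\<integral>\<^sup>+\<omega>. ennreal (exp (\<Sum>k\<in>I. t k * N k \<omega>)) \<partial>M) = (\<integral>\<^sup>+\<omega>. (\<Prod>k\<in>I. X k \<omega>) \<partial>M)"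
    unfolding X_def by (simp only: prod_exp)
  also have "\<dots> = (\<Prod>k\<in>I. ennreal (exp (n * (exp (t k) - 1))))"
    by (subst indep_vars_nn_integral[OF assms ind]) (simp_all add: one)
  also have "\<dots> = ennreal (exp (n * (\<Sum>k\<in>I. exp (t k) - 1)))"
    by (simp add: prod_exp sum_distrib_left)
  finally show ?thesis .
qed

lemma chernoff:
  fixes t :: "int \<Rightarrow> real" and x :: real
  assumes "finite I"
  shows "prob {\<omega> \<in> space M. x \<le> (\<Sum>k\<in>I. t k * N k \<omega>)} \<le> exp (n * (\<Sum>k\<in>I. exp (t k) - 1) - x)"
proof -
  define E where "E = {\<omega> \<in> space M. x \<le> (\<Sum>k\<in>I. t k * N k \<omega>)}"
  have [measurable]: "E \<in> events" unfolding E_def by measurable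
  have "ennreal (exp x) * emeasure M E = (\<integral>\<^sup>+\<omega>. ennreal (exp x) * indicator E \<omega> \<partial>M)"
    by (simp add: nn_integral_cmult_indicator)
  also have "\<dots> \<le> (\<integral>\<^sup>+\<omega>. ennreal (exp (\<Sum>k\<in>I. t k * N k \<omega>)) \<partial>M)"
    by (intro nn_integral_mono) (auto simp: E_def indicator_def intro!: ennreal_leI)
  also have "\<dots> = ennreal (exp (n * (\<Sum>k\<in>I. exp (t k) - 1)))" by (rule mgf_sum[OF assms])
  finally have "ennreal (exp x * prob E) \<le> ennreal (exp (n * (\<Sum>k\<in>I. exp (t k) - 1)))"
    by (simp add: emeasure_eq_measure ennreal_mult)
  hence "exp x * prob E \<le> exp (n * (\<Sum>k\<in>I. exp (t k) - 1))" by (simp only: ennreal_le_iff exp_ge_zero)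
  thus ?thesis by (simp add: E_def exp_diff field_simps)
qed

text \<open>The same second-order form as for the walks in \<open>walk_exp_le\<close>, so that
  counts and walks can be treated with the same \<open>\<theta>\<close> and
  \<open>b\<close>.\<close>

lemma upper_tail:
  fixes a :: "int \<Rightarrow> real" and x b \<theta> :: real
  assumes "finite I" "\<And>k. 0 \<le> a k" "\<And>k. a k \<le> b" "0 \<le> \<theta>" "\<theta> * b \<le> 1"
  shows "prob {\<omega> \<in> space M. x < (\<Sum>k\<in>I. N k \<omega> * a k)} \<le> exp ((\<theta> + \<theta>\<^sup>2 * b) * (n * (\<Sum>k\<in>I. a k)) - \<theta> * x)"
proof -
  have "prob {\<omega> \<in> space M. x < (\<Sum>k\<in>I. N k \<omega> * a k)} \<le> prob {\<omega> \<in> space M. \<theta> * x \<le> (\<Sum>k\<in>I. (\<theta> * a k) * N k \<omega>)}"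
  proof (rule finite_measure_mono)
    have "\<theta> * x \<le> (\<Sum>k\<in>I. (\<theta> * a k) * N k \<omega>)" if "x < (\<Sum>k\<in>I. N k \<omega> * a k)" for \<omega>
      using mult_left_mono[OF less_imp_le[OF that] assms(4)] by (simp add: sum_distrib_left mult_ac)
    thus "{\<omega> \<in> space M. x < (\<Sum>k\<in>I. N k \<omega> * a k)} \<subseteq> {\<omega> \<in> space M. \<theta> * x \<le> (\<Sum>k\<in>I. (\<theta> * a k) * N k \<omega>)}"
      by blast
  qed measurable
  also have "\<dots> \<le> exp (n * (\<Sum>k\<in>I. exp (\<theta> * a k) - 1) - \<theta> * x)" by (rule chernoff[OF assms(1)])
  also have "n * (\<Sum>k\<in>I. exp (\<theta> * a k) - 1) \<le> (\<theta> + \<theta>\<^sup>2 * b) * (n * (\<Sum>k\<in>I. a k))"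
  proof -
    have "(\<Sum>k\<in>I. exp (\<theta> * a k) - 1) \<le> (\<Sum>k\<in>I. (\<theta> + \<theta>\<^sup>2 * b) * a k)"
      by (intro sum_mono exp_minus_one_le assms)
    hence "n * (\<Sum>k\<in>I. exp (\<theta> * a k) - 1) \<le> n * (\<Sum>k\<in>I. (\<theta> + \<theta>\<^sup>2 * b) * a k)"
      by (rule mult_left_mono) simp
    also have "(\<Sum>k\<in>I. (\<theta> + \<theta>\<^sup>2 * b) * a k) = (\<theta> + \<theta>\<^sup>2 * b) * (\<Sum>k\<in>I. a k)"
      by (simp only: sum_distrib_left)
    finally show ?thesis by (simp only: mult.left_commute)
  qed
  finally show ?thesis by simp
qed

lemma lower_tail:
  fixes a :: "int \<Rightarrow> real" and x b \<theta> :: real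
  assumes "finite I" "\<And>k. 0 \<le> a k" "\<And>k. a k \<le> b" "0 \<le> \<theta>" "\<theta> * b \<le> 1"
  shows "prob {\<omega> \<in> space M. (\<Sum>k\<in>I. N k \<omega> * a k) < x} \<le> exp (\<theta> * x - (\<theta> - \<theta>\<^sup>2 * b) * (n * (\<Sum>k\<in>I. a k)))"
proof -
  have "prob {\<omega> \<in> space M. (\<Sum>k\<in>I. N k \<omega> * a k) < x} \<le> prob {\<omega> \<in> space M. - (\<theta> * x) \<le> (\<Sum>k\<in>I. - (\<theta> * a k) * N k \<omega>)}"
  proof (rule finite_measure_mono)
    have "- (\<theta> * x) \<le> (\<Sum>k\<in>I. - (\<theta> * a k) * N k \<omega>)" if "(\<Sum>k\<in>I. N k \<omega> * a k) < x" for \<omega>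
      using mult_left_mono[OF less_imp_le[OF that] assms(4)] by (simp add: sum_distrib_left sum_negf mult_ac)
    thus "{\<omega> \<in> space M. (\<Sum>k\<in>I. N k \<omega> * a k) < x} \<subseteq> {\<omega> \<in> space M. - (\<theta> * x) \<le> (\<Sum>k\<in>I. - (\<theta> * a k) * N k \<omega>)}"
      by blast
  qed measurable
  also have "\<dots> \<le> exp (n * (\<Sum>k\<in>I. exp (- (\<theta> * a k)) - 1) - - (\<theta> * x))" by (rule chernoff[OF assms(1)])
  also have "n * (\<Sum>k\<in>I. exp (- (\<theta> * a k)) - 1) \<le> - ((\<theta> - \<theta>\<^sup>2 * b) * (n * (\<Sum>k\<in>I. a k)))"
  proof -
    have "(\<Sum>k\<in>I. exp (- (\<theta> * a k)) - 1) \<le> (\<Sum>k\<in>I. - ((\<theta> - \<theta>\<^sup>2 * b) * a k))"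
      by (intro sum_mono exp_minus_one_le assms)
    hence "n * (\<Sum>k\<in>I. exp (- (\<theta> * a k)) - 1) \<le> n * (\<Sum>k\<in>I. - ((\<theta> - \<theta>\<^sup>2 * b) * a k))"
      by (rule mult_left_mono) simp
    also have "(\<Sum>k\<in>I. - ((\<theta> - \<theta>\<^sup>2 * b) * a k)) = - ((\<theta> - \<theta>\<^sup>2 * b) * (\<Sum>k\<in>I. a k))"
      by (simp only: sum_negf sum_distrib_left)
    finally show ?thesis by (simp only: mult_minus_right mult.left_commute)
  qed
  finally show ?thesis by (simp add: algebra_simps)
qed

end

lemma sum_inverse_squares: "(\<Sum>k<Suc m. 1 / (1 + real k)\<^sup>2) \<le> 2 - 1 / (1 + real m)"
proof (induction m)
  case (Suc m)
  define x where "x = 1 + real m"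
  have x: "0 < x" "1 + real (Suc m) = x + 1" by (simp_all add: x_def)
  have "1 / (x + 1)\<^sup>2 \<le> 1 / (x * (x + 1))"
    using x by (intro divide_left_mono) (auto simp: power2_eq_square)
  also have "\<dots> = 1 / x - 1 / (x + 1)" using x by (simp add: field_simps)
  finally show ?case using Suc x(2) by (simp add: x_def)
qed simp

lemma sum_inverse_squares_int: "(\<Sum>k\<in>{- int m..int m}. 1 / (1 + \<bar>real_of_int k\<bar>)\<^sup>2) \<le> 4"
proof -
  have "{- int m..int m} = int ` {..m} \<union> (\<lambda>k. - int k) ` {..m}"
  proof safe
    fix x assume "x \<in> {- int m..int m}" "x \<notin> (\<lambda>k. - int k) ` {..m}"
    hence "x = int (nat x)" "nat x \<in> {..m}"
      using image_eqI[of x "\<lambda>k. - int k" "nat (- x)"] by (cases "x \<ge> 0"; auto)+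
    thus "x \<in> int ` {..m}" by blast
  qed auto
  hence "(\<Sum>k\<in>{- int m..int m}. 1 / (1 + \<bar>real_of_int k\<bar>)\<^sup>2) \<le>
      (\<Sum>k\<in>int ` {..m}. 1 / (1 + \<bar>real_of_int k\<bar>)\<^sup>2) + (\<Sum>k\<in>(\<lambda>k. - int k) ` {..m}. 1 / (1 + \<bar>real_of_int k\<bar>)\<^sup>2)"
    by (simp only:) (subst sum_Un, auto intro!: sum_nonneg)
  also have "\<dots> = 2 * (\<Sum>k<Suc m. 1 / (1 + real k)\<^sup>2)"
    by (subst (1 2) sum.reindex) (auto simp: inj_on_def lessThan_Suc_atMost)
  finally show ?thesis using sum_inverse_squares[of m] by (smt (verit) divide_nonneg_nonneg of_nat_0_le_iff)
qed

text \<open>Turns the square-root growth of \<open>vt\<close> into a summable bound over the levels,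
  by (1 + x/4)^4 \<le> exp x with x = sqrt a.\<close>

lemma exp_minus_sqrt_le: "0 \<le> a \<Longrightarrow> exp (- sqrt a) \<le> 256 / (1 + a)\<^sup>2"
proof -
  assume a: "0 \<le> a"
  define x where "x = sqrt a"
  have x: "0 \<le> x" "x\<^sup>2 = a" using a by (simp_all add: x_def)
  have "(1 + a)\<^sup>2 \<le> (1 + x) ^ 4"
  proof -
    have "1 + a \<le> (1 + x)\<^sup>2" using x by (simp add: power2_eq_square algebra_simps)
    hence "(1 + a)\<^sup>2 \<le> ((1 + x)\<^sup>2)\<^sup>2" using a by (intro power_mono) auto
    thus ?thesis by (simp add: power_mult[symmetric])
  qed
  also have "\<dots> \<le> (4 * (1 + x / 4)) ^ 4" using x by (intro power_mono) auto
  also have "\<dots> \<le> (4 * exp (x / 4)) ^ 4"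
    using x by (intro power_mono mult_left_mono exp_ge_add_one_self) auto
  also have "\<dots> = 256 * exp x" by (simp add: power_mult_distrib exp_of_nat_mult[symmetric])
  finally show ?thesis using a by (simp add: x_def exp_minus field_simps)
qed

lemma (in prob_space) prob_ex_int_le:
  assumes A: "\<And>i :: int. A i \<in> events" and le: "\<And>i. prob (A i) \<le> c / (1 + \<bar>real_of_int i\<bar>)\<^sup>2"
  shows "prob (\<Union>i. A i) \<le> 4 * c"
proof -
  define B where "B m = (\<Union>i\<in>{- int m..int m}. A i)" for m
  have B: "B m \<in> events" for m unfolding B_def using A by (intro sets.finite_UN) auto
  have c: "0 \<le> c" by (rule order_trans[OF measure_nonneg[of M "A 0"]]) (use le[of 0] in simp)
  have "prob (B m) \<le> 4 * c" for m
  proof -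
    have "prob (B m) \<le> (\<Sum>i\<in>{- int m..int m}. prob (A i))"
      unfolding B_def using A by (intro finite_measure_subadditive_finite) auto
    also have "\<dots> \<le> (\<Sum>i\<in>{- int m..int m}. c * (1 / (1 + \<bar>real_of_int i\<bar>)\<^sup>2))"
      using le by (intro sum_mono) simp
    also have "\<dots> = c * (\<Sum>i\<in>{- int m..int m}. 1 / (1 + \<bar>real_of_int i\<bar>)\<^sup>2)" by (simp add: sum_distrib_left)
    also have "\<dots> \<le> c * 4" by (intro mult_left_mono sum_inverse_squares_int c)
    finally show ?thesis by simp
  qed
  moreover have "(\<lambda>m. prob (B m)) \<longlonglongrightarrow> prob (\<Union>m. B m)"
  proof (rule finite_Lim_measure_incseq)
    show "range B \<subseteq> events" using B by auto
    show "incseq B" unfolding incseq_def B_def by (intro allI impI UN_mono) auto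
  qed
  ultimately have "prob (\<Union>m. B m) \<le> 4 * c" by (intro LIMSEQ_le_const2) auto
  also have "(\<Union>m. B m) = (\<Union>i. A i)"
  proof (rule equalityI)
    show "(\<Union>i. A i) \<subseteq> (\<Union>m. B m)"
    proof
      fix x assume "x \<in> (\<Union>i. A i)"
      then obtain i where "x \<in> A i" by blast
      hence "x \<in> B (nat \<bar>i\<bar>)" by (auto simp: B_def intro!: bexI[of _ i])
      thus "x \<in> (\<Union>m. B m)" by blast
    qed
  qed (auto simp: B_def)
  finally show ?thesis .
qed

locale poisson_params = params n d d0 V l m1 m2 lc + poisson_counts M n N
  for n d d0 V l m1 m2 lc and M :: "'w measure" and N
begin

text \<open>One event per condition of \<open>good_counts\<close>. The first is a union over all
  levels, summable by \<open>exp_minus_sqrt_le\<close>; the other two use the values of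
  \<open>\<theta>\<close> from \<open>vacant_prob\<close> and \<open>excess_prob\<close>.\<close>

lemma bad_counts_prob:
  "\<exists>E\<in>events. {\<omega> \<in> space M. \<not> good_counts (\<lambda>i. N i \<omega>)} \<subseteq> E \<and>
     prob E \<le> 1024 * exp (- real V) + 5 * real n * (real V)\<^sup>2 * exp (- (real d0 ^ 3 / (32 * LL * real n))) +
     45 * real V ^ 5 * exp (- (real d0 ^ 2 * real d / (1296 * LL * real n)))"
proof -
  have n0: "0 < real n" "0 < LL" using d_bounds LL_ge_1 by linarith+
  define E1 where "E1 = (\<Union>i. {\<omega> \<in> space M. 20 * n * vt V i < (\<Sum>k\<in>{k. \<bar>real_of_int (k - i)\<bar> \<le> 4 * vt V i}. real (N k \<omega>) * 1)})"
  define I where "I z = {snd z - int (n\<^sup>2)<..<snd z + int (n\<^sup>2)}" for z :: "int \<times> int"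
  define J where "J i = {i - 10 * int V<..<i + 10 * int V}" for i
  define E2 where "E2 = (\<Union>z\<in>inner_set. {\<omega> \<in> space M. (\<Sum>k\<in>I z. N k \<omega> * hin z (0, k)) <
     n * (\<Sum>k\<in>I z. hin z (0, k)) - (R - \<bar>fst z\<bar>)\<^sup>2 / 2})"
  define E3 where "E3 = (\<Union>q\<in>(SIGMA i:Collect near. rim i). {\<omega> \<in> space M.
     n * (\<Sum>k\<in>J (fst q). psi (fst q) (snd q) (0, k)) + d * d0 < (\<Sum>k\<in>J (fst q). N k \<omega> * psi (fst q) (snd q) (0, k))})"
  have E1: "E1 \<in> events" unfolding E1_def by (intro sets.countable_UN'') (auto, measurable)
  have E2: "E2 \<in> events" unfolding E2_def using inner_set_card by (intro sets.finite_UN) measurable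
  have E3: "E3 \<in> events" unfolding E3_def using rims_card by (intro sets.finite_UN) measurable
  have "prob E1 \<le> 4 * (256 * exp (- real V))"
    unfolding E1_def
  proof (rule prob_ex_int_le)
    fix i
    let ?T = "{k. \<bar>real_of_int (k - i)\<bar> \<le> 4 * vt V i}"
    show "{\<omega> \<in> space M. 20 * n * vt V i < (\<Sum>k\<in>?T. real (N k \<omega>) * 1)} \<in> events" by measurable
    have sub: "?T \<subseteq> {i - \<lfloor>4 * vt V i\<rfloor>..i + \<lfloor>4 * vt V i\<rfloor>}" by (auto simp: abs_le_iff) linarith+
    hence fin: "finite ?T" by (rule finite_subset) simp
    have vt1: "1 \<le> vt V i" using V_ge by (simp add: vt_def add_increasing2)
    have "card ?T \<le> nat (2 * \<lfloor>4 * vt V i\<rfloor> + 1)" using card_mono[OF _ sub] by simp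
    hence "real (card ?T) \<le> real (nat (2 * \<lfloor>4 * vt V i\<rfloor> + 1))" by simp
    also have "\<dots> \<le> 9 * vt V i" using vt1 by simp linarith
    finally have c: "real (card ?T) \<le> 9 * vt V i" .
    have "prob {\<omega> \<in> space M. 20 * n * vt V i < (\<Sum>k\<in>?T. real (N k \<omega>) * 1)} \<le>
        exp ((1 + 1\<^sup>2 * 1) * (n * (\<Sum>k\<in>?T. 1 :: real)) - 1 * (20 * n * vt V i))"
      by (rule upper_tail[OF fin]) auto
    \<comment> \<open>At most 9 \<open>vt V i\<close> levels with mean n give 18 n
      \<open>vt V i\<close> after the factor 2, against 20 n \<open>vt V i\<close>.\<close>
    also have "(1 + 1\<^sup>2 * 1) * (n * (\<Sum>k\<in>?T. 1 :: real)) - 1 * (20 * n * vt V i) \<le> - vt V i"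
    proof -
      have "real n * real (card ?T) \<le> 9 * (real n * vt V i)"
        using mult_left_mono[OF c, of "real n"] by (simp add: mult.left_commute)
      moreover have "1 * vt V i \<le> real n * vt V i" using vt1 d_bounds by (intro mult_right_mono) auto
      moreover have "real (20 * n) * vt V i = 20 * (real n * vt V i)" by simp
      ultimately show ?thesis using vt1 by (simp only: sum_constant power_one mult_1 mult_1_right one_add_one)
    qed
    also have "exp (- vt V i) = exp (- real V) * exp (- sqrt \<bar>real_of_int i\<bar>)"
      by (simp add: vt_def exp_add[symmetric])
    also have "\<dots> \<le> exp (- real V) * (256 / (1 + \<bar>real_of_int i\<bar>)\<^sup>2)"
      by (intro mult_left_mono exp_minus_sqrt_le) auto
    finally show "prob {\<omega> \<in> space M. 20 * n * vt V i < (\<Sum>k\<in>?T. real (N k \<omega>) * 1)} \<le>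
        256 * exp (- real V) / (1 + \<bar>real_of_int i\<bar>)\<^sup>2" by (simp add: mult.commute)
  qed
  hence p1: "prob E1 \<le> 1024 * exp (- real V)" by simp
  have "prob E2 \<le> (\<Sum>z\<in>inner_set. prob {\<omega> \<in> space M. (\<Sum>k\<in>I z. N k \<omega> * hin z (0, k)) <
     n * (\<Sum>k\<in>I z. hin z (0, k)) - (R - \<bar>fst z\<bar>)\<^sup>2 / 2})"
    unfolding E2_def using inner_set_card by (intro finite_measure_subadditive_finite) auto
  also have "\<dots> \<le> (\<Sum>z\<in>inner_set. exp (- (real d0 ^ 3 / (32 * LL * real n))))"
  proof (rule sum_mono)
    fix z assume z: "z \<in> inner_set"
    define t where "t = real_of_int (R - \<bar>fst z\<bar>)"
    define \<theta> where "\<theta> = t / (8 * LL * real n)"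
    define Sn where "Sn = real n * (\<Sum>k\<in>I z. hin z (0, k))"
    have t: "2 \<le> t" "real d0 \<le> t" "t \<le> real n" using inner_bounds(2)[OF z] d_bounds r_bounds by (simp_all add: t_def)
    have \<theta>: "0 \<le> \<theta>" "\<theta> * LL \<le> 1" using t n0 by (simp_all add: \<theta>_def field_simps)
    have S: "Sn \<le> real n * (2 * t)" unfolding Sn_def
      using inner_bounds(4)[OF z] by (intro mult_left_mono) (auto simp: I_def t_def)
    have "prob {\<omega> \<in> space M. (\<Sum>k\<in>I z. N k \<omega> * hin z (0, k)) < n * (\<Sum>k\<in>I z. hin z (0, k)) - (R - \<bar>fst z\<bar>)\<^sup>2 / 2} \<le>
        exp (\<theta> * (Sn - t\<^sup>2 / 2) - (\<theta> - \<theta>\<^sup>2 * LL) * Sn)"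
      using lower_tail[of "I z" "\<lambda>k. hin z (0, k)" LL \<theta> "Sn - t\<^sup>2 / 2"] hin_nonneg hin_le \<theta>
      by (simp add: I_def Sn_def t_def)
    also have "\<theta> * (Sn - t\<^sup>2 / 2) - (\<theta> - \<theta>\<^sup>2 * LL) * Sn = \<theta>\<^sup>2 * LL * Sn - \<theta> * t\<^sup>2 / 2" by (simp add: algebra_simps)
    also have "\<theta>\<^sup>2 * LL * Sn \<le> \<theta>\<^sup>2 * LL * (real n * (2 * t))" using S n0 by (intro mult_left_mono) auto
    also have "\<theta>\<^sup>2 * LL * (real n * (2 * t)) = \<theta> * t\<^sup>2 / 4" using n0 by (simp add: \<theta>_def power2_eq_square)
    also have "\<theta> * t\<^sup>2 / 4 - \<theta> * t\<^sup>2 / 2 = - (t ^ 3 / (32 * LL * real n))"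
      using n0 by (simp add: \<theta>_def power2_eq_square power3_eq_cube field_simps)
    also have "\<dots> \<le> - (real d0 ^ 3 / (32 * LL * real n))"
      using t n0 by (simp add: divide_right_mono power_mono)
    finally show "prob {\<omega> \<in> space M. (\<Sum>k\<in>I z. N k \<omega> * hin z (0, k)) < n * (\<Sum>k\<in>I z. hin z (0, k)) - (R - \<bar>fst z\<bar>)\<^sup>2 / 2} \<le>
        exp (- (real d0 ^ 3 / (32 * LL * real n)))" by simp
  qed
  also have "\<dots> \<le> 5 * real n * (real V)\<^sup>2 * exp (- (real d0 ^ 3 / (32 * LL * real n)))"
    using inner_set_card by (simp add: mult_right_mono)
  finally have p2: "prob E2 \<le> 5 * real n * (real V)\<^sup>2 * exp (- (real d0 ^ 3 / (32 * LL * real n)))" .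
  have "prob E3 \<le> (\<Sum>q\<in>(SIGMA i:Collect near. rim i). prob {\<omega> \<in> space M.
     n * (\<Sum>k\<in>J (fst q). psi (fst q) (snd q) (0, k)) + d * d0 < (\<Sum>k\<in>J (fst q). N k \<omega> * psi (fst q) (snd q) (0, k))})"
    unfolding E3_def using rims_card by (intro finite_measure_subadditive_finite) auto
  also have "\<dots> \<le> (\<Sum>q\<in>(SIGMA i:Collect near. rim i). exp (- (real d0 ^ 2 * real d / (1296 * LL * real n))))"
  proof (rule sum_mono)
    fix q assume "q \<in> (SIGMA i:Collect near. rim i)"
    hence q: "near (fst q)" "snd q \<in> rim (fst q)" by auto
    define \<theta> where "\<theta> = real d0 / (648 * LL * real n)"
    define Sn where "Sn = real n * (\<Sum>k\<in>J (fst q). psi (fst q) (snd q) (0, k))"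
    have \<theta>: "0 \<le> \<theta>" "\<theta> * (4 * LL) \<le> 1" using n0 d_bounds by (simp_all add: \<theta>_def field_simps)
    have S: "Sn \<le> real n * (81 * real d)" unfolding Sn_def J_def
      using psi_axis_sum[OF q] by (intro mult_left_mono) auto
    have "prob {\<omega> \<in> space M. Sn + d * d0 < (\<Sum>k\<in>J (fst q). N k \<omega> * psi (fst q) (snd q) (0, k))} \<le>
        exp ((\<theta> + \<theta>\<^sup>2 * (4 * LL)) * Sn - \<theta> * (Sn + d * d0))"
      unfolding Sn_def by (rule upper_tail) (use psi_nonneg psi_le[OF q(1)] \<theta> in \<open>auto simp: J_def\<close>)
    also have "(\<theta> + \<theta>\<^sup>2 * (4 * LL)) * Sn - \<theta> * (Sn + d * d0) = \<theta>\<^sup>2 * (4 * LL) * Sn - \<theta> * (real d * real d0)"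
      by (simp add: algebra_simps)
    also have "\<theta>\<^sup>2 * (4 * LL) * Sn \<le> \<theta>\<^sup>2 * (4 * LL) * (real n * (81 * real d))" using S n0 by (intro mult_left_mono) auto
    also have "\<theta>\<^sup>2 * (4 * LL) * (real n * (81 * real d)) = \<theta> * (real d * real d0) / 2"
      using n0 by (simp add: \<theta>_def power2_eq_square mult_ac)
    also have "\<theta> * (real d * real d0) / 2 - \<theta> * (real d * real d0) = - (real d0 ^ 2 * real d / (1296 * LL * real n))"
      using n0 by (simp add: \<theta>_def power2_eq_square field_simps)
    finally show "prob {\<omega> \<in> space M. n * (\<Sum>k\<in>J (fst q). psi (fst q) (snd q) (0, k)) + d * d0 <
        (\<Sum>k\<in>J (fst q). N k \<omega> * psi (fst q) (snd q) (0, k))} \<le> exp (- (real d0 ^ 2 * real d / (1296 * LL * real n)))"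
      by (simp add: Sn_def)
  qed
  also have "\<dots> \<le> 45 * real V ^ 5 * exp (- (real d0 ^ 2 * real d / (1296 * LL * real n)))"
    using rims_card by (simp add: mult_right_mono)
  finally have p3: "prob E3 \<le> 45 * real V ^ 5 * exp (- (real d0 ^ 2 * real d / (1296 * LL * real n)))" .
  have "{\<omega> \<in> space M. \<not> good_counts (\<lambda>i. N i \<omega>)} \<subseteq> E1 \<union> E2 \<union> E3"
  proof (rule subsetI, rule ccontr)
    fix \<omega> assume w: "\<omega> \<in> {\<omega> \<in> space M. \<not> good_counts (\<lambda>i. N i \<omega>)}" and "\<omega> \<notin> E1 \<union> E2 \<union> E3"
    hence 1: "\<omega> \<notin> E1" and 2: "\<omega> \<notin> E2" and 3: "\<omega> \<notin> E3" and ws: "\<omega> \<in> space M" by auto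
    have "good_counts (\<lambda>i. N i \<omega>)"
      unfolding good_counts_def
    proof (intro conjI allI ballI impI)
      fix i show "(\<Sum>k\<in>{k. \<bar>real_of_int (k - i)\<bar> \<le> 4 * vt V i}. real (N k \<omega>)) \<le> 20 * n * vt V i"
        using 1 ws by (auto simp: E1_def not_less)
    next
      fix z assume "z \<in> inner_set"
      thus "n * (\<Sum>k\<in>{snd z - int (n\<^sup>2)<..<snd z + int (n\<^sup>2)}. hin z (0, k)) - (R - \<bar>fst z\<bar>)\<^sup>2 / 2
        \<le> (\<Sum>k\<in>{snd z - int (n\<^sup>2)<..<snd z + int (n\<^sup>2)}. N k \<omega> * hin z (0, k))"
        using 2 ws unfolding E2_def I_def by (force simp only: not_less UN_iff mem_Collect_eq)
    next
      fix i x0 assume "near i" "x0 \<in> rim i"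
      hence "(i, x0) \<in> (SIGMA i:Collect near. rim i)" by simp
      hence "\<not> n * (\<Sum>k\<in>J (fst (i, x0)). psi (fst (i, x0)) (snd (i, x0)) (0, k)) + d * d0 <
          (\<Sum>k\<in>J (fst (i, x0)). N k \<omega> * psi (fst (i, x0)) (snd (i, x0)) (0, k))"
        using 3 ws unfolding E3_def by blast
      thus "(\<Sum>k\<in>{i - 10 * int V<..<i + 10 * int V}. N k \<omega> * psi i x0 (0, k))
        \<le> n * (\<Sum>k\<in>{i - 10 * int V<..<i + 10 * int V}. psi i x0 (0, k)) + d * d0"
        by (simp add: J_def not_less)
    qed
    thus False using w by simp
  qed
  moreover have "prob (E1 \<union> E2 \<union> E3) \<le> prob E1 + prob E2 + prob E3"
    using measure_Un_le[of "E1 \<union> E2" M E3] measure_Un_le[of E1 M E2] E1 E2 E3 by force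
  moreover have "E1 \<union> E2 \<union> E3 \<in> events" using E1 E2 E3 by auto
  ultimately show ?thesis using p1 p2 p3 by (intro bexI[of _ "E1 \<union> E2 \<union> E3"]) auto
qed

end

section \<open>Random orders of the particles\<close>

text \<open>Decomposition by the value of the order: \<open>F ps\<close> is the event that the order
  is \<open>ps\<close>, there are countably many lists, and each \<open>F ps\<close> is independent
  of what the walks do with that list. The weights \<open>prob (F ps)\<close> sum to at most
  1.\<close>

lemma (in walks) random_order_prob:
  assumes ind: "indep_elements M Ma Y walks_space (all_walks S)"
    and F: "\<And>ps. F ps \<in> sets (vimage_algebra (space M) Y Ma)" and disj: "disjoint_family F"
    and G: "\<And>ps. ps \<in> G \<Longrightarrow> set ps \<subseteq> particles"
      "\<And>ps. ps \<in> G \<Longrightarrow> prob {\<omega> \<in> space M. Q (aggregate (\<lambda>i j k. S i j k \<omega>) ps)} \<le> \<delta>"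
    and \<delta>: "0 \<le> \<delta>"
  defines "U \<equiv> \<Union>ps\<in>G. F ps \<inter> {\<omega> \<in> space M. Q (aggregate (\<lambda>i j k. S i j k \<omega>) ps)}"
  shows "U \<in> events" "prob U \<le> \<delta>"
proof -
  have set_ind: "indep_set (sets (vimage_algebra (space M) Y Ma)) (sets (vimage_algebra (space M) (all_walks S) walks_space))"
    using ind by (simp add: indep_elements_def)
  hence sub: "sets (vimage_algebra (space M) Y Ma) \<subseteq> events" by (simp add: indep_sets2_eq)
  define B where "B ps = {\<omega> \<in> space M. Q (aggregate (\<lambda>i j k. S i j k \<omega>) ps)}" for ps
  have B: "B ps \<in> sets (vimage_algebra (space M) (all_walks S) walks_space)" if "ps \<in> G" for ps
  proof -
    have aw: "all_walks S \<in> M \<rightarrow>\<^sub>M walks_space" using ind by (simp add: indep_elements_def)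
    define E where "E = {w \<in> space walks_space. Q (cfold (\<lambda>_. UNIV) w ps)}"
    have "Q \<in> count_space fsets \<rightarrow>\<^sub>M count_space UNIV" by simp
    hence "Measurable.pred walks_space (\<lambda>w. Q (cfold (\<lambda>_. UNIV) w ps))"
      unfolding walks_space_def by (rule measurable_compose[OF cfold_measurable[OF G(1)[OF that]]])
    hence "E \<in> sets walks_space" unfolding E_def by (simp add: pred_def)
    moreover have "B ps = all_walks S -` E \<inter> space M"
    proof -
      have "cfold (\<lambda>_. UNIV) (all_walks S \<omega>) ps = aggregate (\<lambda>i j k. S i j k \<omega>) ps" for \<omega>
        unfolding aggregate_eq_cfold using G(1)[OF that]
        by (intro cfold_cong) (auto simp: all_walks_def)
      thus ?thesis using measurable_space[OF aw] by (auto simp: B_def E_def)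
    qed
    ultimately show ?thesis by (simp only: in_vimage_algebra)
  qed
  have B_ev: "ps \<in> G \<Longrightarrow> B ps \<in> events" for ps
    using B set_ind by (auto simp: indep_sets2_eq)
  have F_ev: "F ps \<in> events" for ps using F sub by auto
  have U: "U = (\<Union>ps\<in>G. F ps \<inter> B ps)" by (simp add: U_def B_def)
  show ev: "U \<in> events" unfolding U using B_ev F_ev
    by (intro sets.countable_UN'') (auto intro: countableI_type)
  have disjF: "disjoint_family_on F G" and disjFB: "disjoint_family_on (\<lambda>ps. F ps \<inter> B ps) G"
    using disj unfolding disjoint_family_on_def by blast+
  have "emeasure M U = (\<integral>\<^sup>+ps. emeasure M (F ps \<inter> B ps) \<partial>count_space G)"
    unfolding U using B_ev F_ev disjFB by (intro emeasure_UN_countable) (auto intro: countableI_type)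
  also have "\<dots> \<le> (\<integral>\<^sup>+ps. ennreal \<delta> * emeasure M (F ps) \<partial>count_space G)"
  proof (rule nn_integral_mono)
    fix ps assume "ps \<in> space (count_space G)"
    hence ps: "ps \<in> G" by simp
    have "prob (F ps \<inter> B ps) = prob (F ps) * prob (B ps)" by (rule indep_setD[OF set_ind F B[OF ps]])
    also have "\<dots> \<le> prob (F ps) * \<delta>" using G(2)[OF ps] by (intro mult_left_mono) (auto simp: B_def)
    finally show "emeasure M (F ps \<inter> B ps) \<le> ennreal \<delta> * emeasure M (F ps)"
      using \<delta> by (simp add: emeasure_eq_measure ennreal_mult[symmetric] mult.commute)
  qed
  also have "\<dots> = ennreal \<delta> * (\<integral>\<^sup>+ps. emeasure M (F ps) \<partial>count_space G)"
    by (rule nn_integral_cmult) simp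
  also have "(\<integral>\<^sup>+ps. emeasure M (F ps) \<partial>count_space G) = emeasure M (\<Union>ps\<in>G. F ps)"
    using F_ev disjF by (intro emeasure_UN_countable[symmetric]) (auto intro: countableI_type)
  also have "\<dots> \<le> 1" by (rule measure_le_1)
  finally have "emeasure M U \<le> ennreal \<delta>" by (simp add: mult_left_mono)
  thus "prob U \<le> \<delta>" using \<delta> by (simp add: emeasure_eq_measure)
qed

context params
begin

definition err :: "real \<Rightarrow> real" where
  "err \<kappa> = 1024 * exp (- real V) + 5 * real n * (real V)\<^sup>2 * exp (- (real d0 ^ 3 / (32 * LL * real n))) +
     45 * real V ^ 5 * exp (- (real d0 ^ 2 * real d / (1296 * LL * real n))) +
     (5 * real n * (real V)\<^sup>2 * exp (- (real d0 ^ 3 / (8 * LL * real n))) +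
     45 * real V ^ 5 * exp (- (real d0 ^ 2 * real d / (1296 * LL * real n))) +
     (4 * \<kappa> + 120 * real n * real V ^ 3 * qf ^ m2))"

lemma qf_nonneg: "0 \<le> qf"
  unfolding qf_def
  by (intro divide_nonneg_nonneg mult_nonneg_nonneg zero_le_log_cancel_iff[THEN iffD2] add_pos_nonneg) auto

text \<open>The crude part is summable over all levels, so the bound is uniform in \<open>m\<close>.
  The fine part occurs at no more than 3V^2 near levels.\<close>

lemma layers_sum_le:
  assumes \<kappa>: "\<And>k. 20 * real n * vt V k * qc k ^ m1 \<le> \<kappa> / (1 + \<bar>real_of_int k\<bar>)\<^sup>2"
  shows "(\<Sum>k\<in>{- int m..int m}. 20 * n * vt V k * (qc k ^ m1 + (if near k then qf ^ m2 else 0)))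
    \<le> 4 * \<kappa> + 120 * real n * real V ^ 3 * qf ^ m2"
proof -
  have L: "0 \<le> log 2 (1 + (2 * x + 1)\<^sup>2)" for x :: real
    by (intro zero_le_log_cancel_iff[THEN iffD2] add_pos_nonneg) auto
  have "0 \<le> 20 * real n * vt V 0 * qc 0 ^ m1"
    using L unfolding qc_def
    by (intro mult_nonneg_nonneg zero_le_power[of _ m1] divide_nonneg_nonneg zero_le_power2) (auto simp: vt_def)
  hence k0: "0 \<le> \<kappa>" using \<kappa>[of 0] by simp
  have "(\<Sum>k\<in>{- int m..int m}. 20 * n * vt V k * (qc k ^ m1 + (if near k then qf ^ m2 else 0))) =
      (\<Sum>k\<in>{- int m..int m}. 20 * real n * vt V k * qc k ^ m1) +
      (\<Sum>k\<in>{- int m..int m}. if near k then 20 * real n * vt V k * qf ^ m2 else 0)"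
    by (simp add: sum.distrib[symmetric] distrib_left) (intro sum.cong, auto)
  also have "(\<Sum>k\<in>{- int m..int m}. 20 * real n * vt V k * qc k ^ m1) \<le>
      (\<Sum>k\<in>{- int m..int m}. \<kappa> * (1 / (1 + \<bar>real_of_int k\<bar>)\<^sup>2))"
    using \<kappa> by (intro sum_mono) simp
  also have "\<dots> = \<kappa> * (\<Sum>k\<in>{- int m..int m}. 1 / (1 + \<bar>real_of_int k\<bar>)\<^sup>2)" by (simp add: sum_distrib_left)
  also have "\<dots> \<le> \<kappa> * 4" by (intro mult_left_mono sum_inverse_squares_int k0)
  also have "(\<Sum>k\<in>{- int m..int m}. if near k then 20 * real n * vt V k * qf ^ m2 else 0) =
      (\<Sum>k\<in>{k \<in> {- int m..int m}. near k}. 20 * real n * vt V k * qf ^ m2)"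
    by (subst sum.inter_filter) auto
  also have "\<dots> \<le> (\<Sum>k\<in>{k \<in> {- int m..int m}. near k}. 40 * real n * real V * qf ^ m2)"
  proof (rule sum_mono)
    fix k assume "k \<in> {k \<in> {- int m..int m}. near k}"
    hence "vt V k \<le> 2 * real V" using near_bounds(3)[of k] by simp
    hence "20 * real n * vt V k \<le> 20 * real n * (2 * real V)" by (intro mult_left_mono) auto
    hence "20 * real n * vt V k * qf ^ m2 \<le> 20 * real n * (2 * real V) * qf ^ m2"
      using qf_nonneg by (intro mult_right_mono) auto
    thus "20 * real n * vt V k * qf ^ m2 \<le> 40 * real n * real V * qf ^ m2" by simp
  qed
  also have "\<dots> = real (card {k \<in> {- int m..int m}. near k}) * (40 * real n * real V * qf ^ m2)" by simp
  also have "\<dots> \<le> (3 * (real V)\<^sup>2) * (40 * real n * real V * qf ^ m2)"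
  proof (rule mult_right_mono)
    have "card {k \<in> {- int m..int m}. near k} \<le> card {- (int V)\<^sup>2..(int V)\<^sup>2}"
    proof (intro card_mono subsetI)
      fix k assume "k \<in> {k \<in> {- int m..int m}. near k}"
      thus "k \<in> {- (int V)\<^sup>2..(int V)\<^sup>2}" using near_abs[of k] by auto
    qed simp
    also have "\<dots> = nat (2 * (int V)\<^sup>2 + 1)" by simp
    also have "\<dots> \<le> nat (int (3 * V\<^sup>2))" using V_int by (intro nat_mono) simp
    finally have "card {k \<in> {- int m..int m}. near k} \<le> 3 * V\<^sup>2" by (simp only: nat_int)
    hence "real (card {k \<in> {- int m..int m}. near k}) \<le> real (3 * V\<^sup>2)" by (simp only: of_nat_le_iff)
    thus "real (card {k \<in> {- int m..int m}. near k}) \<le> 3 * (real V)\<^sup>2" by simp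
  qed (use qf_nonneg in simp)
  also have "\<dots> = 120 * real n * real V ^ 3 * qf ^ m2" by (simp add: power2_eq_square power3_eq_cube)
  finally show ?thesis by simp
qed

end

locale ordered_model = poisson_params n d d0 V l m1 m2 lc M N + walks M S
  for n d d0 V l m1 m2 lc and M :: "'w measure" and N S
begin

lemma ordered_shape:
  assumes ind: "indep_elements M Ma Y walks_space (all_walks S)"
    and F: "\<And>ps. F ps \<in> sets (vimage_algebra (space M) Y Ma)" and disj: "disjoint_family F"
    and ps: "\<And>ps \<omega>. \<omega> \<in> F ps \<Longrightarrow> distinct ps \<and> set ps = {(i, j). \<bar>i\<bar> \<le> int m \<and> 1 \<le> j \<and> j \<le> N i \<omega>}"
    and m: "3 * V\<^sup>2 \<le> m" and \<kappa>: "\<And>k. 20 * real n * vt V k * qc k ^ m1 \<le> \<kappa> / (1 + \<bar>real_of_int k\<bar>)\<^sup>2"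
  shows "\<exists>E\<in>events. prob E \<le> err \<kappa> \<and>
    (\<forall>\<omega>\<in>space M. \<forall>ps. \<omega> \<in> F ps \<longrightarrow> \<not> shape (aggregate (\<lambda>i j k. S i j k \<omega>) ps) \<longrightarrow> \<omega> \<in> E)"
proof -
  obtain E0 where E0: "E0 \<in> events" "{\<omega> \<in> space M. \<not> good_counts (\<lambda>i. N i \<omega>)} \<subseteq> E0"
    "prob E0 \<le> 1024 * exp (- real V) + 5 * real n * (real V)\<^sup>2 * exp (- (real d0 ^ 3 / (32 * LL * real n))) +
     45 * real V ^ 5 * exp (- (real d0 ^ 2 * real d / (1296 * LL * real n)))"
    using bad_counts_prob by blast
  define G where "G = {ps. \<exists>\<omega>\<in>space M. \<omega> \<in> F ps \<and> good_counts (\<lambda>i. N i \<omega>)}"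
  define \<delta> where "\<delta> = 5 * real n * (real V)\<^sup>2 * exp (- (real d0 ^ 3 / (8 * LL * real n))) +
     45 * real V ^ 5 * exp (- (real d0 ^ 2 * real d / (1296 * LL * real n))) +
     (4 * \<kappa> + 120 * real n * real V ^ 3 * qf ^ m2)"
  have G1: "set ps \<subseteq> particles" if "ps \<in> G" for ps
    using that assms(4) by (fastforce simp: G_def)
  have G2: "prob {\<omega> \<in> space M. \<not> shape (aggregate (\<lambda>i j k. S i j k \<omega>) ps)} \<le> \<delta>" if psG: "ps \<in> G" for ps
  proof -
    \<comment> \<open>The counts of one outcome with this order serve as the deterministic counts of
      \<open>core\<close>; they fit because the order determines the set of particles.\<close>
    obtain \<omega>0 where w: "\<omega>0 \<in> F ps" "good_counts (\<lambda>i. N i \<omega>0)" using psG by (auto simp: G_def)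
    interpret core M S n d d0 V l m1 m2 lc "\<lambda>i. N i \<omega>0" m ps
      using assms(4)[OF w(1)] w(2) m by unfold_locales auto
    show ?thesis using shape_prob layers_sum_le[OF \<kappa>, of m] unfolding \<delta>_def by linarith
  qed
  have "0 \<le> \<kappa> / (1 + \<bar>real_of_int 0\<bar>)\<^sup>2"
    by (rule order_trans[OF _ \<kappa>])
       (auto simp: qc_def vt_def intro!: mult_nonneg_nonneg zero_le_power[of _ m1] divide_nonneg_nonneg
         zero_le_log_cancel_iff[THEN iffD2] add_pos_nonneg)
  hence \<delta>: "0 \<le> \<delta>" unfolding \<delta>_def using qf_nonneg by (intro add_nonneg_nonneg mult_nonneg_nonneg) auto
  define U where "U = (\<Union>ps\<in>G. F ps \<inter> {\<omega> \<in> space M. \<not> shape (aggregate (\<lambda>i j k. S i j k \<omega>) ps)})"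
  have U: "U \<in> events" "prob U \<le> \<delta>"
    unfolding U_def using random_order_prob[OF ind F disj G1 G2 \<delta>] by auto
  show ?thesis
  proof (intro bexI[of _ "E0 \<union> U"] conjI ballI allI impI)
    show "prob (E0 \<union> U) \<le> err \<kappa>"
      using measure_Un_le[OF E0(1) U(1)] E0(3) U(2) unfolding err_def \<delta>_def by linarith
    fix \<omega> ps assume w: "\<omega> \<in> space M" "\<omega> \<in> F ps" "\<not> shape (aggregate (\<lambda>i j k. S i j k \<omega>) ps)"
    show "\<omega> \<in> E0 \<union> U"
    proof (cases "good_counts (\<lambda>i. N i \<omega>)")
      case True
      hence "ps \<in> G" using w by (auto simp: G_def)
      thus ?thesis using w by (auto simp: U_def)
    qed (use E0 w in auto)
  qed (use E0 U in auto)
qed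

end

section \<open>The order by levels\<close>

definition star_list :: "(int \<Rightarrow> nat) \<Rightarrow> nat \<Rightarrow> (int \<times> nat) list" where
  "star_list \<nu> m = concat (map (\<lambda>i. map (Pair i) [1..<Suc (\<nu> i)]) (levels m))"

lemma levels: "set (levels m) = {- int m..int m}" "distinct (levels m)"
proof -
  show 1: "set (levels m) = {- int m..int m}" for m
  proof (induction m)
    case (Suc m)
    have "{- int (Suc m)..int (Suc m)} = {- int m..int m} \<union> {int (Suc m), - int (Suc m)}" by force
    thus ?case by (simp only: levels.simps set_append Suc list.set)
  qed simp
  show "distinct (levels m)"
  proof (induction m)
    case (Suc m)
    have "distinct [int (Suc m), - int (Suc m)]" "set (levels m) \<inter> set [int (Suc m), - int (Suc m)] = {}"
      unfolding 1 by auto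
    thus ?case using Suc by (simp only: levels.simps distinct_append)
  qed simp
qed

lemma star_list_props:
  "distinct (star_list \<nu> m)" "set (star_list \<nu> m) = {(i, j). \<bar>i\<bar> \<le> int m \<and> 1 \<le> j \<and> j \<le> \<nu> i}"
proof -
  have "distinct (concat (map (\<lambda>i. map (Pair i) [1..<Suc (\<nu> i)]) xs))" if "distinct xs" for xs
    using that by (induction xs) (auto simp: distinct_map inj_on_def)
  thus "distinct (star_list \<nu> m)" unfolding star_list_def using levels(2) by blast
  show "set (star_list \<nu> m) = {(i, j). \<bar>i\<bar> \<le> int m \<and> 1 \<le> j \<and> j \<le> \<nu> i}"
    unfolding star_list_def set_concat set_map levels(1) set_upt by (auto simp: image_iff)
qed

lemma star_list_measurable:
  "(\<lambda>\<nu>. star_list \<nu> m) \<in> PiM UNIV (\<lambda>_. count_space UNIV) \<rightarrow>\<^sub>M count_space UNIV"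
proof -
  have "(\<lambda>\<nu>. concat (map (\<lambda>i. map (Pair i) [1..<Suc (\<nu> i)]) xs)) \<in> PiM UNIV (\<lambda>_. count_space UNIV) \<rightarrow>\<^sub>M count_space UNIV"
    for xs :: "int list"
  proof (induction xs)
    case (Cons i xs)
    have "(\<lambda>\<nu> :: int \<Rightarrow> nat. \<nu> i) \<in> PiM UNIV (\<lambda>_. count_space UNIV) \<rightarrow>\<^sub>M count_space UNIV"
      by (rule measurable_component_singleton) simp
    hence "(\<lambda>\<nu>. map (Pair i) [1..<Suc (\<nu> i)]) \<in> PiM UNIV (\<lambda>_. count_space UNIV) \<rightarrow>\<^sub>M count_space UNIV"
      by (rule measurable_compose) simp
    moreover have "(\<lambda>\<nu>. ys @ concat (map (\<lambda>i. map (Pair i) [1..<Suc (\<nu> i)]) xs)) \<in> PiM UNIV (\<lambda>_. count_space UNIV) \<rightarrow>\<^sub>M count_space UNIV"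
      for ys by (rule measurable_compose[OF Cons]) simp
    ultimately have "(\<lambda>\<nu>. map (Pair i) [1..<Suc (\<nu> i)] @ concat (map (\<lambda>i. map (Pair i) [1..<Suc (\<nu> i)]) xs))
        \<in> PiM UNIV (\<lambda>_. count_space UNIV) \<rightarrow>\<^sub>M count_space UNIV"
      by (rule measurable_compose_countable[where f = "\<lambda>ys \<nu>. ys @ concat (map (\<lambda>i. map (Pair i) [1..<Suc (\<nu> i)]) xs)", rotated])
    thus ?case by (simp del: upt_Suc)
  qed simp
  thus ?thesis unfolding star_list_def .
qed

lemma A_star_mono: "A_star s \<nu> m \<subseteq> A_star s \<nu> (Suc m)"
proof -
  have "star_list \<nu> (Suc m) = star_list \<nu> m @ concat (map (\<lambda>i. map (Pair i) [1..<Suc (\<nu> i)]) [int (Suc m), - int (Suc m)])"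
    by (simp add: star_list_def)
  thus ?thesis unfolding A_star_def star_list_def[symmetric]
    by (simp only: aggregate_eq_cfold cfold_append_increasing)
qed

lemma (in params) star_shape:
  assumes M: "prob_space M" "star_model M n S N" and m: "3 * V\<^sup>2 \<le> m"
    and \<kappa>: "\<And>k. 20 * real n * vt V k * qc k ^ m1 \<le> \<kappa> / (1 + \<bar>real_of_int k\<bar>)\<^sup>2"
  shows "\<exists>E\<in>sets M. measure M E \<le> err \<kappa> \<and>
    (AE \<omega> in M. \<not> shape (A_star (\<lambda>i j k. S i j k \<omega>) (\<lambda>i. N i \<omega>) m) \<longrightarrow> \<omega> \<in> E)"
proof -
  interpret prob_space M by (rule M(1))
  interpret ordered_model n d d0 V l m1 m2 lc M N S
    using M(2) n by unfold_locales (auto simp: star_model_def)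
  let ?Ma = "PiM UNIV (\<lambda>_. count_space UNIV)" and ?Y = "\<lambda>\<omega> i. N i \<omega>"
  define F where "F ps = {\<omega> \<in> space M. star_list (\<lambda>i. N i \<omega>) m = ps}" for ps
  have ind: "indep_elements M ?Ma ?Y walks_space (all_walks S)" using M(2) by (simp add: star_model_def)
  have "F ps \<in> sets (vimage_algebra (space M) ?Y ?Ma)" for ps
  proof -
    have "F ps = ?Y -` ((\<lambda>\<nu>. star_list \<nu> m) -` {ps} \<inter> space ?Ma) \<inter> space M"
      by (auto simp: F_def space_PiM)
    moreover have "(\<lambda>\<nu>. star_list \<nu> m) -` {ps} \<inter> space ?Ma \<in> sets ?Ma"
      by (rule measurable_sets[OF star_list_measurable]) simp
    ultimately show ?thesis by (simp only: in_vimage_algebra)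
  qed
  moreover have "disjoint_family F" by (auto simp: disjoint_family_on_def F_def)
  moreover have "distinct ps \<and> set ps = {(i, j). \<bar>i\<bar> \<le> int m \<and> 1 \<le> j \<and> j \<le> N i \<omega>}" if "\<omega> \<in> F ps" for ps \<omega>
    using that star_list_props[of "\<lambda>i. N i \<omega>" m] by (auto simp: F_def)
  ultimately obtain E where E: "E \<in> events" "prob E \<le> err \<kappa>"
    "\<And>\<omega> ps. \<omega> \<in> space M \<Longrightarrow> \<omega> \<in> F ps \<Longrightarrow> \<not> shape (aggregate (\<lambda>i j k. S i j k \<omega>) ps) \<Longrightarrow> \<omega> \<in> E"
    using ordered_shape[OF ind _ _ _ m \<kappa>, of F] by blast
  have "AE \<omega> in M. \<not> shape (A_star (\<lambda>i j k. S i j k \<omega>) (\<lambda>i. N i \<omega>) m) \<longrightarrow> \<omega> \<in> E"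
    using AE_space
  proof eventually_elim
    case (elim \<omega>)
    thus ?case using E(3)[of \<omega> "star_list (\<lambda>i. N i \<omega>) m"] by (simp add: F_def A_star_def star_list_def)
  qed
  thus ?thesis using E by blast
qed

section \<open>Choice of the parameters\<close>

text \<open>Sixteen layers of radius vt / (32 n) fit into the depth vt / n. In powers of u = v^(1/4)
  each gains u^(-2), so that all together gain u^(-32) against the number 20 n u^4 of particles of
  the level.\<close>

lemma crude_layers_small:
  fixes n A :: nat and k :: int
  assumes n: "491520 \<le> n" and A: "16 \<le> A"
  defines "v \<equiv> vt (n ^ A) k" and "lc \<equiv> vt (n ^ A) k / (32 * real n)"
  shows "20 * real n * v * (20 * real n * v * log 2 (1 + (2 * lc + 1)\<^sup>2) / lc\<^sup>2) ^ 16
    \<le> 1 / real n ^ 3 / (1 + \<bar>real_of_int k\<bar>)\<^sup>2"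
    and "0 < lc" "lc \<le> v" "16 * (lc + 2) \<le> v / real n"
proof -
  have n1: "1 \<le> real n" "491520 \<le> real n" using n by auto
  have "real n ^ 16 \<le> real n ^ A" using n1 A by (intro power_increasing) auto
  hence v16: "real n ^ 16 \<le> v" by (simp add: v_def vt_def add_increasing2)
  have "real n ^ 2 \<le> real n ^ 16" using n1 by (intro power_increasing) auto
  hence v2: "real n * real n \<le> v" using v16 by (simp add: power2_eq_square)
  have "491520 * real n \<le> real n * real n" using n1 by (intro mult_right_mono) auto
  hence vn: "491520 * real n \<le> v" using v2 by linarith
  have vpos: "2 \<le> v" using vn n1 by linarith
  show lc0: "0 < lc" using n1 vpos by (simp add: lc_def v_def[symmetric])
  have lc_eq: "lc = v / (32 * real n)" by (simp add: lc_def v_def)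
  show "lc \<le> v" using n1 vpos by (simp add: lc_eq field_simps)
  show "16 * (lc + 2) \<le> v / real n" using n1 vn by (simp add: lc_eq field_simps)
  define u where "u = sqrt (sqrt v)"
  have "u ^ 4 = (u\<^sup>2)\<^sup>2" by (simp add: power_mult[symmetric])
  hence u4: "u ^ 4 = v" using vpos by (simp add: u_def)
  have u0: "0 < u" using vpos by (simp add: u_def)
  have "(real n ^ 4) ^ 4 \<le> u ^ 4" using v16 by (simp add: u4 power_mult[symmetric])
  hence un: "real n ^ 4 \<le> u" using u0 by (subst (asm) power_mono_iff) auto
  \<comment> \<open>491520 = 20 * 24 * 1024: the constant of the crude count, the one of the
    logarithm, and 32^2 from the radius.\<close>
  have "491520 * real n ^ 3 \<le> real n * real n ^ 3" using n1 by (intro mult_right_mono) auto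
  hence un3: "491520 * real n ^ 3 \<le> u" using un by (simp add: power_Suc[symmetric] del: power_Suc)
  have log: "log 2 (1 + (2 * lc + 1)\<^sup>2) \<le> 24 * u"
  proof -
    have "2 * lc + 1 \<le> v"
    proof -
      have "2 * lc \<le> v / 2" using n1 vpos by (simp add: lc_eq field_simps)
      thus ?thesis using vpos by linarith
    qed
    hence "(2 * lc + 1)\<^sup>2 \<le> v\<^sup>2" using lc0 by (intro power_mono) auto
    moreover have "1 \<le> v\<^sup>2" using vpos by (intro one_le_power) auto
    moreover have "2 * v\<^sup>2 \<le> v * v\<^sup>2" using vpos by (intro mult_right_mono) auto
    ultimately have "1 + (2 * lc + 1)\<^sup>2 \<le> v ^ 3" by (simp add: power3_eq_cube power2_eq_square)
    moreover have "v ^ 3 = u ^ 12" by (simp add: u4[symmetric] power_mult[symmetric])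
    ultimately have "ln (1 + (2 * lc + 1)\<^sup>2) \<le> ln (u ^ 12)"
      using u0 by (intro ln_mono) (auto intro: add_pos_nonneg)
    also have "\<dots> = 12 * ln u" using u0 by (simp add: ln_realpow)
    also have "\<dots> \<le> 12 * u" using ln_less_self[OF u0] by simp
    finally have "ln (1 + (2 * lc + 1)\<^sup>2) \<le> 12 * u" .
    also have "12 * u \<le> (24 * u) * ln 2" using u0 ln2_ge_two_thirds by simp
    finally show ?thesis by (simp add: log_def divide_le_eq)
  qed
  have qc: "20 * real n * v * log 2 (1 + (2 * lc + 1)\<^sup>2) / lc\<^sup>2 \<le> 1 / u\<^sup>2"
  proof -
    have "20 * real n * v * log 2 (1 + (2 * lc + 1)\<^sup>2) / lc\<^sup>2 \<le> 20 * real n * v * (24 * u) / lc\<^sup>2"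
      using log vpos n1 by (intro divide_right_mono mult_left_mono) auto
    also have "\<dots> = (491520 * real n ^ 3 * u ^ 5) / (u ^ 3 * u ^ 5)"
    proof -
      have "lc\<^sup>2 = (u ^ 3 * u ^ 5) / (1024 * (real n)\<^sup>2)"
        unfolding lc_eq u4[symmetric] by (simp add: power_divide power_mult_distrib power_mult[symmetric] power_add[symmetric])
      moreover have "20 * real n * v * (24 * u) * (1024 * (real n)\<^sup>2) = 491520 * real n ^ 3 * u ^ 5"
        unfolding u4[symmetric] by (simp add: eval_nat_numeral)
      ultimately show ?thesis by simp
    qed
    also have "\<dots> = 491520 * real n ^ 3 / u ^ 3" by (rule nonzero_mult_divide_mult_cancel_right) (use u0 in simp)
    also have "\<dots> \<le> u / u ^ 3" using un3 u0 by (intro divide_right_mono) auto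
    also have "\<dots> = 1 / u\<^sup>2" using u0 by (simp add: power2_eq_square power3_eq_cube)
    finally show ?thesis .
  qed
  have "0 \<le> log 2 (1 + (2 * lc + 1)\<^sup>2)"
    by (intro zero_le_log_cancel_iff[THEN iffD2] add_pos_nonneg) auto
  hence "(20 * real n * v * log 2 (1 + (2 * lc + 1)\<^sup>2) / lc\<^sup>2) ^ 16 \<le> (1 / u\<^sup>2) ^ 16"
    using qc vpos by (intro power_mono) auto
  hence "20 * real n * v * (20 * real n * v * log 2 (1 + (2 * lc + 1)\<^sup>2) / lc\<^sup>2) ^ 16 \<le> 20 * real n * v * (1 / u\<^sup>2) ^ 16"
    using vpos by (intro mult_left_mono) auto
  also have "\<dots> = 20 * real n / (u ^ 12 * u ^ 16)"
    using u0 unfolding u4[symmetric] by (simp add: power_divide power_mult[symmetric] field_simps power_add[symmetric])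
  \<comment> \<open>The 28 remaining powers of u are split: u^12 yields the power of n, and u^16 =
    v^4 the summability over the levels.\<close>
  also have "\<dots> \<le> 20 * real n / (20 * real n ^ 4 * (1 + \<bar>real_of_int k\<bar>)\<^sup>2)"
  proof (intro divide_left_mono mult_mono)
    have "real n ^ 1 \<le> real n ^ 4" using n1 by (intro power_increasing) auto
    hence "real n ^ 4 \<le> u" "20 \<le> u" using un n1 unfolding power_one_right by linarith+
    have "20 * real n ^ 4 \<le> u * u" using \<open>real n ^ 4 \<le> u\<close> \<open>20 \<le> u\<close> by (intro mult_mono) auto
    also have "\<dots> = u ^ 2" by (simp add: power2_eq_square)
    also have "\<dots> \<le> u ^ 12" using \<open>20 \<le> u\<close> by (intro power_increasing) auto
    finally show "20 * real n ^ 4 \<le> u ^ 12" .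
    define y where "y = sqrt \<bar>real_of_int k\<bar>"
    have y: "0 \<le> y" "y\<^sup>2 = \<bar>real_of_int k\<bar>" by (simp_all add: y_def)
    have "1 + \<bar>real_of_int k\<bar> \<le> (1 + y)\<^sup>2" using y by (simp add: power2_eq_square algebra_simps)
    also have "(1 + y)\<^sup>2 \<le> v\<^sup>2"
    proof (rule power_mono)
      have "1 \<le> real (n ^ A)" using n1 by simp
      thus "1 + y \<le> v" by (simp add: v_def vt_def y_def)
    qed (use y in simp)
    finally have "(1 + \<bar>real_of_int k\<bar>)\<^sup>2 \<le> (v\<^sup>2)\<^sup>2" by (intro power_mono) auto
    also have "\<dots> = u ^ 16" by (simp add: u4[symmetric] power_mult[symmetric])
    finally show "(1 + \<bar>real_of_int k\<bar>)\<^sup>2 \<le> u ^ 16" .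
  qed (use u0 n1 in auto)
  also have "\<dots> = 1 / real n ^ 3 / (1 + \<bar>real_of_int k\<bar>)\<^sup>2"
  proof -
    have "20 * real n / (20 * (real n ^ 3 * real n) * K) = 1 / real n ^ 3 / K" for K
      using n1 by simp
    moreover have "real n ^ 4 = real n ^ 3 * real n" by (simp add: eval_nat_numeral)
    ultimately show ?thesis by (simp only:)
  qed
  finally show "20 * real n * v * (20 * real n * v * log 2 (1 + (2 * lc + 1)\<^sup>2) / lc\<^sup>2) ^ 16
    \<le> 1 / real n ^ 3 / (1 + \<bar>real_of_int k\<bar>)\<^sup>2" .
qed

text \<open>With d ~ n^(1/2) and d0 ~ n^(2/5) the exponents d0^3 / n and d0^2 d / n are n^(1/5) and
  n^(3/10); \<open>LL\<close> is at most n^(1/20), which leaves n^(3/20) and n^(1/4). As l is a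
  fixed fraction of d, \<open>qf\<close> is n^(-1/10) up to a logarithm, hence at most
  n^(-1/20).\<close>

lemma eventually_params:
  fixes A :: nat
  assumes A: "16 \<le> A"
  shows "\<forall>\<^sub>F n in sequentially. \<exists>d d0 l m1 m2 lc. params n d d0 (n ^ A) l m1 m2 lc \<and>
    (\<forall>k. 20 * real n * vt (n ^ A) k * params.qc n (n ^ A) lc k ^ m1 \<le> 1 / real n ^ 3 / (1 + \<bar>real_of_int k\<bar>)\<^sup>2) \<and>
    params.err n d d0 (n ^ A) l m2 (1 / real n ^ 3) \<le> 1 / (real n)\<^sup>2 \<and>
    real d \<le> 2 * sqrt (real n) \<and> real d0 \<le> 2 * real n powr (2/5)"
proof -
  define a where "a = real A"
  have a: "0 < a" using A by (simp add: a_def)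
  \<comment> \<open>Since \<open>qf\<close> is at most n^(-1/20), this many layers give n^(-(3A+4)),
    which beats n V^3 = n^(3A+1) by the factor n^(-3).\<close>
  define m2 where "m2 = 20 * (3 * A + 4)"
  define m where "m = real m2"
  have m: "0 < m" by (simp add: m_def m2_def)
  have e1: "\<forall>\<^sub>F n in sequentially. 8 * real_of_int \<lceil>sqrt (real n)\<rceil> \<le> real n" by real_asymp
  have e2: "\<forall>\<^sub>F n in sequentially. real_of_int \<lceil>real n powr (2/5)\<rceil> \<le> real_of_int \<lceil>sqrt (real n)\<rceil>" by real_asymp
  have e3: "\<forall>\<^sub>F n in sequentially. 2 \<le> real n powr (2/5)" by real_asymp
  have e4: "\<forall>\<^sub>F n in sequentially. 16 * m \<le> sqrt (real n)" by real_asymp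
  have e5: "\<forall>\<^sub>F n in sequentially. 4 * real n ^ 5 * exp (- (real n - 1)) \<le> 1" by real_asymp
  have e6: "\<forall>\<^sub>F n in sequentially. 40 * real n * (real n powr a) ^ 3 * exp (- (real n / 12)) \<le> 1" using a by real_asymp
  have e7: "\<forall>\<^sub>F n in sequentially. log 2 (1 + (30 * real n powr a)\<^sup>2) \<le> real n powr (1/20)" using a by real_asymp
  have e8: "\<forall>\<^sub>F n in sequentially. 1024 * exp (- (real n powr a)) \<le> 1 / real n ^ 3" using a by real_asymp
  have e9: "\<forall>\<^sub>F n in sequentially. 5 * real n * (real n powr a)\<^sup>2 * exp (- (real n powr (3/20) / 32)) \<le> 1 / real n ^ 3"
    using a by real_asymp
  have e10: "\<forall>\<^sub>F n in sequentially. 45 * (real n powr a) ^ 5 * exp (- (real n powr (1/4) / 1296)) \<le> 1 / real n ^ 3"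
    using a by real_asymp
  have e11: "\<forall>\<^sub>F n in sequentially. 400 * (2 * sqrt (real n)) * (2 * real n powr (2/5)) * log 2 (1 + (real n)\<^sup>2) / (sqrt (real n) / (16 * m))\<^sup>2
      \<le> real n powr (-1/20)"
    using m by real_asymp
  have e12: "\<forall>\<^sub>F n in sequentially. (491520 :: nat) \<le> n" by (rule eventually_ge_at_top)
  show ?thesis
    using e1 e2 e3 e4 e5 e6 e7 e8 e9 e10 e11 e12
  proof eventually_elim
    case (elim n)
    note h = elim
    define d where "d = nat \<lceil>sqrt (real n)\<rceil>"
    define d0 where "d0 = nat \<lceil>real n powr (2/5)\<rceil>"
    \<comment> \<open>The factor 1 / (8 m) lets \<open>m2\<close> layers of width l + 2 fit into
      half of \<open>d\<close>.\<close>
    define l where "l = nat \<lfloor>real d / (8 * m)\<rfloor>"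
    define lc where "lc k = vt (n ^ A) k / (32 * real n)" for k
    define V where "V = n ^ A"
    have n1: "491520 \<le> real n" using h(12) by simp
    have s0: "16 * m \<le> sqrt (real n)" "1 \<le> sqrt (real n)" using h(4) n1 by auto
    have dr: "real d = real_of_int \<lceil>sqrt (real n)\<rceil>" using s0 by (simp add: d_def)
    have d0r: "real d0 = real_of_int \<lceil>real n powr (2/5)\<rceil>" by (simp add: d0_def)
    have db: "sqrt (real n) \<le> real d" "real d \<le> 2 * sqrt (real n)" using s0 unfolding dr by linarith+
    have d0b: "real n powr (2/5) \<le> real d0" "real d0 \<le> 2 * real n powr (2/5)" "2 \<le> real d0"
      using h(3) unfolding d0r by linarith+
    have Vr: "real V = real n powr a" using n1 by (simp add: V_def a_def powr_realpow)
    have m1: "1 \<le> m" by (simp add: m_def m2_def)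
    have x: "2 \<le> real d / (8 * m)" using s0 db m1 by (simp add: field_simps)
    have lr: "real l = real_of_int \<lfloor>real d / (8 * m)\<rfloor>" using x by (simp add: l_def)
    have lb: "real l \<le> real d / (8 * m)" "real d / (16 * m) \<le> real l" "1 \<le> real l"
    proof -
      show "real l \<le> real d / (8 * m)" "1 \<le> real l" unfolding lr using x by linarith+
      have "real d / (8 * m) = 2 * (real d / (16 * m))" by simp
      thus "real d / (16 * m) \<le> real l" unfolding lr using x by linarith
    qed
    have l8m: "8 * (m * real l) \<le> real d" using lb(1) m1 by (simp add: field_simps)
    have l8: "8 * real l \<le> real d"
    proof -
      have "1 * real l \<le> m * real l" using m1 by (intro mult_right_mono) auto
      thus ?thesis using l8m by linarith
    qed
    interpret params n d d0 V l 16 m2 lc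
    proof
      show "16 \<le> n" using h(12) by simp
      show "2 \<le> d0" using d0b(3) by simp
      have "real d0 \<le> real d" using h(2) by (simp only: dr d0r)
      thus "d0 \<le> d" by simp
      have "8 * real d \<le> real n" using h(1) by (simp only: dr)
      thus "8 * d \<le> n" by linarith
      show "n ^ 4 \<le> V" unfolding V_def using A h(12) by (intro power_increasing) auto
      show "1 \<le> l" using lb(3) by simp
      show "8 * l \<le> d" using l8 by linarith
      have "2 * (m * (real l + 2)) \<le> real d" using l8m s0 db by (simp add: algebra_simps)
      moreover have "real (2 * (m2 * (l + 2))) = 2 * (m * (real l + 2))" by (simp add: m_def algebra_simps)
      ultimately have "real (2 * (m2 * (l + 2))) \<le> real d" by (simp only:)
      thus "2 * (m2 * (l + 2)) \<le> d" by (simp only: of_nat_le_iff)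
      show "4 * real n ^ 5 * exp (- (real n - 1)) \<le> 1" by (rule h(5))
      show "40 * real n * real V ^ 3 * exp (- (real n / 12)) \<le> 1" using h(6) by (simp only: Vr)
      show "0 < lc i" "lc i \<le> vt V i" "real 16 * (lc i + 2) \<le> vt V i / real n" for i
        using crude_layers_small(2,3,4)[OF h(12) A, of i] by (simp_all add: lc_def V_def)
    qed
    have qc: "20 * real n * vt V k * qc k ^ 16 \<le> 1 / real n ^ 3 / (1 + \<bar>real_of_int k\<bar>)\<^sup>2" for k
      using crude_layers_small(1)[OF h(12) A, of k] unfolding qc_def unfolding lc_def V_def by assumption
    have LL: "LL \<le> real n powr (1/20)" "0 < LL" using h(7) LL_ge_1 by (simp_all add: LL_def Vr)
    have n0: "0 < real n" using n1 by simp
    have p1: "real n powr (3/20) / 32 \<le> real d0 ^ 3 / (32 * LL * real n)"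
    proof -
      have "real n powr (3/20) / 32 = (real n powr (2/5)) ^ 3 / (32 * real n powr (1/20) * real n)"
      proof -
        have "(real n powr (2/5)) ^ 3 = real n powr (3/20) * (real n powr (1/20) * real n powr 1)"
          using n0 by (simp only: powr_power powr_add[symmetric]) simp
        thus ?thesis using n0 by simp
      qed
      also have "\<dots> \<le> real d0 ^ 3 / (32 * LL * real n)"
        using d0b LL n0 by (intro frac_le power_mono mult_right_mono mult_left_mono) auto
      finally show ?thesis .
    qed
    have p2: "real n powr (1/4) / 1296 \<le> real d0 ^ 2 * real d / (1296 * LL * real n)"
    proof -
      have "real n powr (1/4) / 1296 = (real n powr (2/5)) ^ 2 * sqrt (real n) / (1296 * real n powr (1/20) * real n)"
      proof -
        have "(real n powr (2/5)) ^ 2 * real n powr (1/2) = real n powr (1/4) * (real n powr (1/20) * real n powr 1)"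
          using n0 by (simp only: powr_power powr_add[symmetric]) simp
        thus ?thesis using n0 by (simp add: powr_half_sqrt)
      qed
      also have "\<dots> \<le> real d0 ^ 2 * real d / (1296 * LL * real n)"
        using d0b db LL n0 by (intro frac_le power_mono mult_mono mult_right_mono mult_left_mono) auto
      finally show ?thesis .
    qed
    have p3: "real n powr (3/20) / 32 \<le> real d0 ^ 3 / (8 * LL * real n)"
      using p1 by (rule order_trans) (use LL n0 in \<open>intro divide_left_mono mult_right_mono; simp\<close>)
    have t1: "5 * real n * (real V)\<^sup>2 * exp (- (real d0 ^ 3 / (32 * LL * real n))) \<le> 1 / real n ^ 3"
      by (rule order_trans[OF mult_left_mono h(9)[folded Vr]]) (use p1 in auto)
    have t2: "45 * real V ^ 5 * exp (- (real d0 ^ 2 * real d / (1296 * LL * real n))) \<le> 1 / real n ^ 3"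
      by (rule order_trans[OF mult_left_mono h(10)[folded Vr]]) (use p2 in auto)
    have t3: "5 * real n * (real V)\<^sup>2 * exp (- (real d0 ^ 3 / (8 * LL * real n))) \<le> 1 / real n ^ 3"
      by (rule order_trans[OF mult_left_mono h(9)[folded Vr]]) (use p3 in auto)
    have "qf \<le> 400 * (2 * sqrt (real n)) * (2 * real n powr (2/5)) * log 2 (1 + (real n)\<^sup>2) / (sqrt (real n) / (16 * m))\<^sup>2"
    proof -
      have l2: "(2 * real l + 1)\<^sup>2 \<le> (real n)\<^sup>2"
        using l8 lb(3) h(1) s0 unfolding dr[symmetric] by (intro power_mono) linarith+
      have "log 2 (1 + (2 * real l + 1)\<^sup>2) \<le> log 2 (1 + (real n)\<^sup>2)"
        using l2 by (intro log_mono) (auto intro: add_pos_nonneg)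
      moreover have "0 \<le> log 2 (1 + (2 * real l + 1)\<^sup>2)"
        by (intro zero_le_log_cancel_iff[THEN iffD2] add_pos_nonneg) auto
      moreover have "sqrt (real n) / (16 * m) \<le> real l"
        using lb(2) db(1) m1 divide_right_mono[of "sqrt (real n)" "real d" "16 * m"] by linarith
      hence "(sqrt (real n) / (16 * m))\<^sup>2 \<le> (real l)\<^sup>2" using m1 s0 by (intro power_mono) auto
      moreover have "0 < (sqrt (real n) / (16 * m))\<^sup>2" using m1 s0 by (intro zero_less_power divide_pos_pos) auto
      ultimately show ?thesis unfolding qf_def using db d0b n0
        by (intro frac_le mult_mono) auto
    qed
    hence "qf \<le> real n powr (-1/20)" using h(11) by linarith
    hence "qf ^ m2 \<le> (real n powr (-1/20)) ^ m2" using qf_nonneg by (intro power_mono) auto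
    also have "\<dots> = real n powr (- real (3 * A + 4))"
      using n0 by (simp add: powr_power m2_def add_divide_distrib)
    also have "\<dots> = 1 / real n ^ (3 * A + 4)" using n0 by (simp only: powr_minus powr_realpow inverse_eq_divide)
    finally have "120 * real n * real V ^ 3 * qf ^ m2 \<le> 120 * real n * real V ^ 3 * (1 / real n ^ (3 * A + 4))"
      by (intro mult_left_mono) auto
    also have "\<dots> = 120 / real n ^ 3"
      using n0 by (simp add: V_def power_add power_mult[symmetric] mult.commute[of A] field_simps eval_nat_numeral)
    finally have t4: "120 * real n * real V ^ 3 * qf ^ m2 \<le> 120 * (1 / real n ^ 3)" by simp
    have "err (1 / real n ^ 3) \<le> 130 * (1 / real n ^ 3)"
    proof -
      have "a1 + a2 + a3 + (a4 + a3 + (4 * x + a5)) \<le> 130 * x"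
        if "a2 \<le> x" "a3 \<le> x" "a4 \<le> x" "a5 \<le> 120 * x" "a1 \<le> x" "0 \<le> x" for a1 a2 a3 a4 a5 x :: real
        using that by linarith
      from this[OF t1 t2 t3 t4 h(8)[folded Vr]] show ?thesis unfolding err_def by simp
    qed
    also have "\<dots> \<le> real n * (1 / real n ^ 3)" using n1 by (intro mult_right_mono) auto
    also have "\<dots> = 1 / (real n)\<^sup>2" using n0 by (simp add: power2_eq_square power3_eq_cube)
    finally have "err (1 / real n ^ 3) \<le> 1 / (real n)\<^sup>2" .
    thus ?case using params_axioms qc db d0b unfolding V_def by blast
  qed
qed

section \<open>The infinite aggregates\<close>

context params
begin

text \<open>If infinitely many aggregates of an increasing sequence have the shape, so has their
  union. A failure of the union is thus a failure for all large m, and lies in the lower limit of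
  the exceptional events, whose probability is again at most \<open>\<delta>\<close>.\<close>

lemma union_shape:
  fixes M :: "'w measure" and A :: "nat \<Rightarrow> 'w \<Rightarrow> (int \<times> int) set"
  assumes "prob_space M" and mono: "AE \<omega> in M. \<forall>m. A m \<omega> \<subseteq> A (Suc m) \<omega>"
    and ex: "\<And>m. m0 \<le> m \<Longrightarrow> \<exists>E\<in>sets M. measure M E \<le> \<delta> \<and> (AE \<omega> in M. \<not> shape (A m \<omega>) \<longrightarrow> \<omega> \<in> E)"
  shows "\<exists>E\<in>sets M. measure M E \<le> \<delta> \<and> (AE \<omega> in M. \<not> shape (\<Union>m. A m \<omega>) \<longrightarrow> \<omega> \<in> E)"
proof -
  interpret prob_space M by fact
  have "\<forall>m. \<exists>E. E \<in> events \<and> prob E \<le> \<delta> \<and> (AE \<omega> in M. \<not> shape (A (m0 + m) \<omega>) \<longrightarrow> \<omega> \<in> E)"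
    using ex by (metis le_add1)
  then obtain E where E: "\<And>m. E m \<in> events" "\<And>m. prob (E m) \<le> \<delta>"
    "\<And>m. AE \<omega> in M. \<not> shape (A (m0 + m) \<omega>) \<longrightarrow> \<omega> \<in> E m" by metis
  define C where "C k = (\<Inter>m\<in>{k..}. E m)" for k
  have C: "C k \<in> events" for k unfolding C_def using E(1) by (intro sets.countable_INT') auto
  have C_le: "prob (C k) \<le> \<delta>" for k
    using finite_measure_mono[of "C k" "E k"] E(1,2)[of k] by (force simp: C_def)
  have "incseq C" by (intro incseq_SucI) (auto simp: C_def)
  hence "(\<lambda>k. prob (C k)) \<longlonglongrightarrow> prob (\<Union>k. C k)" using C by (intro finite_Lim_measure_incseq) auto
  hence "prob (\<Union>k. C k) \<le> \<delta>" using C_le by (intro LIMSEQ_le_const2) auto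
  moreover have "(\<Union>k. C k) \<in> events" using C by auto
  moreover have "AE \<omega> in M. \<forall>m. \<not> shape (A (m0 + m) \<omega>) \<longrightarrow> \<omega> \<in> E m"
    using E(3) by (simp add: AE_all_countable)
  hence "AE \<omega> in M. \<not> shape (\<Union>m. A m \<omega>) \<longrightarrow> \<omega> \<in> (\<Union>k. C k)"
    using mono
  proof eventually_elim
    case (elim \<omega>)
    have inc: "A k \<omega> \<subseteq> A m \<omega>" if "k \<le> m" for k m
      using that by (induction rule: dec_induct) (use elim(2) in auto)
    show ?case
    proof (rule impI, rule ccontr)
      assume ns: "\<not> shape (\<Union>m. A m \<omega>)" and "\<omega> \<notin> (\<Union>k. C k)"
      have *: "\<exists>m\<ge>k. shape (A m \<omega>)" for k
      proof -
        obtain m where "k \<le> m" "\<omega> \<notin> E m" using \<open>\<omega> \<notin> (\<Union>k. C k)\<close> by (auto simp: C_def)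
        thus ?thesis using elim(1) by (intro exI[of _ "m0 + m"]) auto
      qed
      have "inner_set \<subseteq> (\<Union>m. A m \<omega>)" using *[of 0] by (auto simp: shape_def)
      moreover have "\<bar>real_of_int (fst z)\<bar> \<le> real n / 2 + 4 * real d"
        if "z \<in> A k \<omega>" "\<bar>snd z\<bar> \<le> int V" for z k
        using *[of k] inc that unfolding shape_def by blast
      ultimately show False using ns unfolding shape_def by blast
    qed
  qed
  ultimately show ?thesis by blast
qed

lemma shape_strips:
  assumes sh: "shape U" and b: "4 * real d \<le> b" "real d0 + 1 \<le> b" "h \<le> real V"
  shows "vstrip (real n / 2 - b) \<inter> hstrip h \<subseteq> U \<inter> hstrip h"
    and "U \<inter> hstrip h \<subseteq> vstrip (real n / 2 + b) \<inter> hstrip h"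
proof -
  have V: "\<bar>snd z\<bar> \<le> int V" if "z \<in> hstrip h" for z
  proof -
    have "real_of_int \<bar>snd z\<bar> \<le> real_of_int (int V)" using that b(3) by (auto simp: hstrip_def)
    thus ?thesis by (simp only: of_int_le_iff)
  qed
  show "vstrip (real n / 2 - b) \<inter> hstrip h \<subseteq> U \<inter> hstrip h"
  proof (intro subsetI IntI)
    fix z assume z: "z \<in> vstrip (real n / 2 - b) \<inter> hstrip h"
    \<comment> \<open>The rounding in \<open>n div 2\<close> is the reason for the summand 1 next to
      \<open>d0\<close>.\<close>
    have "real n / 2 \<le> real (n div 2) + 1" by linarith
    moreover have "real_of_int \<bar>fst z\<bar> \<le> real n / 2 - b" using z by (auto simp: vstrip_def)
    ultimately have "real_of_int \<bar>fst z\<bar> \<le> real_of_int r" using b(2) by (simp add: r_def R_def)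
    hence "\<bar>fst z\<bar> \<le> r" by (simp only: of_int_le_iff)
    have "int V \<le> (int V)\<^sup>2"
      using le_square[of V] by (simp only: power2_eq_square of_nat_mult[symmetric] of_nat_le_iff)
    hence "\<bar>snd z\<bar> \<le> 2 * (int V)\<^sup>2" using V[of z] IntD2[OF z] by linarith
    hence "z \<in> inner_set" using \<open>\<bar>fst z\<bar> \<le> r\<close> by (simp add: inner_set_def)
    thus "z \<in> U" using sh by (auto simp: shape_def)
  qed auto
  show "U \<inter> hstrip h \<subseteq> vstrip (real n / 2 + b) \<inter> hstrip h"
  proof (intro subsetI IntI)
    fix z assume z: "z \<in> U \<inter> hstrip h"
    hence "\<bar>real_of_int (fst z)\<bar> \<le> real n / 2 + 4 * real d" using sh V[of z] by (simp add: shape_def)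
    thus "z \<in> vstrip (real n / 2 + b)" using b(1) by (simp add: vstrip_def split_beta)
  qed auto
qed

end

text \<open>The errors 1 / n^2 are summable. The first Borel-Cantelli lemma needs nothing about the
  joint law for different n, so any coupling of the models is allowed.\<close>

lemma (in prob_space) eventually_strips:
  fixes A :: "nat \<Rightarrow> nat \<Rightarrow> 'a \<Rightarrow> (int \<times> int) set"
  assumes \<epsilon>: "0 < \<epsilon>" and mono: "\<And>n. 1 \<le> n \<Longrightarrow> AE \<omega> in M. \<forall>m. A n m \<omega> \<subseteq> A n (Suc m) \<omega>"
    and sh: "\<And>n d d0 V l m1 m2 lc \<kappa> m. params n d d0 V l m1 m2 lc \<Longrightarrow> 3 * V\<^sup>2 \<le> m \<Longrightarrow>
      (\<And>k. 20 * real n * vt V k * params.qc n V lc k ^ m1 \<le> \<kappa> / (1 + \<bar>real_of_int k\<bar>)\<^sup>2) \<Longrightarrow>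
      \<exists>E\<in>events. prob E \<le> params.err n d d0 V l m2 \<kappa> \<and>
        (AE \<omega> in M. \<not> params.shape n d d0 V (A n m \<omega>) \<longrightarrow> \<omega> \<in> E)"
  shows "AE \<omega> in M. \<exists>n0\<ge>1. \<forall>n\<ge>n0.
    vstrip (real n / 2 - real n powr (1/2 + \<epsilon>)) \<inter> hstrip (real n powr \<alpha>)
      \<subseteq> (\<Union>m. A n m \<omega>) \<inter> hstrip (real n powr \<alpha>) \<and>
    (\<Union>m. A n m \<omega>) \<inter> hstrip (real n powr \<alpha>)
      \<subseteq> vstrip (real n / 2 + real n powr (1/2 + \<epsilon>)) \<inter> hstrip (real n powr \<alpha>)"
    (is "AE \<omega> in M. \<exists>n0\<ge>1. \<forall>n\<ge>n0. ?P n \<omega>")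
proof -
  \<comment> \<open>The exponent of V = n^a: at least \<open>\<alpha>\<close>, so that the window
    lies in the heights up to V, and at least 16 for \<open>crude_layers_small\<close>.\<close>
  define a where "a = max 16 (nat \<lceil>\<alpha>\<rceil>)"
  have a: "16 \<le> a" "\<alpha> \<le> real a" by (auto simp: a_def) linarith
  have e1: "\<forall>\<^sub>F n in sequentially. 8 * sqrt (real n) \<le> real n powr (1/2 + \<epsilon>)" using \<epsilon> by real_asymp
  have e2: "\<forall>\<^sub>F n in sequentially. 2 * real n powr (2/5) + 1 \<le> real n powr (1/2 + \<epsilon>)" using \<epsilon> by real_asymp
  have "\<forall>\<^sub>F n in sequentially. \<exists>E\<in>events. prob E \<le> 1 / (real n)\<^sup>2 \<and> (AE \<omega> in M. \<not> ?P n \<omega> \<longrightarrow> \<omega> \<in> E)"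
    using eventually_params[OF a(1)] e1 e2 eventually_ge_at_top[of 1]
  proof eventually_elim
    case (elim n)
    then obtain d d0 l m1 m2 lc where *: "params n d d0 (n ^ a) l m1 m2 lc"
      "\<And>k. 20 * real n * vt (n ^ a) k * params.qc n (n ^ a) lc k ^ m1 \<le> 1 / real n ^ 3 / (1 + \<bar>real_of_int k\<bar>)\<^sup>2"
      "params.err n d d0 (n ^ a) l m2 (1 / real n ^ 3) \<le> 1 / (real n)\<^sup>2"
      "real d \<le> 2 * sqrt (real n)" "real d0 \<le> 2 * real n powr (2/5)" by blast
    define V where "V = n ^ a"
    interpret params n d d0 V l m1 m2 lc using *(1) by (simp only: V_def)
    have n1: "1 \<le> real n" using elim(4) by simp
    have Va: "real n powr \<alpha> \<le> real V"
      using powr_mono[OF a(2) n1] n1 by (simp add: V_def powr_realpow)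
    have "\<exists>E\<in>events. prob E \<le> 1 / (real n)\<^sup>2 \<and> (AE \<omega> in M. \<not> shape (\<Union>m. A n m \<omega>) \<longrightarrow> \<omega> \<in> E)"
    proof (rule union_shape[OF prob_space_axioms mono])
      fix m assume "3 * V\<^sup>2 \<le> m"
      from sh[OF params_axioms this *(2)[folded V_def]]
      show "\<exists>E\<in>events. prob E \<le> 1 / (real n)\<^sup>2 \<and> (AE \<omega> in M. \<not> shape (A n m \<omega>) \<longrightarrow> \<omega> \<in> E)"
        using *(3)[folded V_def] by (meson order_trans)
    qed (use elim in simp)
    moreover have "?P n \<omega>" if "shape (\<Union>m. A n m \<omega>)" for \<omega>
      using shape_strips[OF that _ _ Va, of "real n powr (1/2 + \<epsilon>)"] *(4,5) elim(2,3) by force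
    ultimately show ?case by (force elim!: AE_mp)
  qed
  then obtain n1 where "\<And>n. n1 \<le> n \<Longrightarrow> \<exists>E\<in>events. prob E \<le> 1 / (real n)\<^sup>2 \<and> (AE \<omega> in M. \<not> ?P n \<omega> \<longrightarrow> \<omega> \<in> E)"
    unfolding eventually_sequentially by blast
  hence "\<forall>n. \<exists>E. n1 \<le> n \<longrightarrow> E \<in> events \<and> prob E \<le> 1 / (real n)\<^sup>2 \<and> (AE \<omega> in M. \<not> ?P n \<omega> \<longrightarrow> \<omega> \<in> E)" by blast
  then obtain E where E_all: "\<forall>n. n1 \<le> n \<longrightarrow> E n \<in> events \<and> prob (E n) \<le> 1 / (real n)\<^sup>2 \<and>
      (AE \<omega> in M. \<not> ?P n \<omega> \<longrightarrow> \<omega> \<in> E n)"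
    by (rule choice[THEN exE])
  have E: "E n \<in> events" "prob (E n) \<le> 1 / (real n)\<^sup>2" "AE \<omega> in M. \<not> ?P n \<omega> \<longrightarrow> \<omega> \<in> E n"
    if "n1 \<le> n" for n using E_all that by blast+
  have "summable (\<lambda>n. 1 / (real n)\<^sup>2)" using inverse_power_summable[of 2, where 'a = real] by (simp add: inverse_eq_divide)
  hence "summable (\<lambda>n. 1 / (real (n + n1))\<^sup>2)" by (rule summable_ignore_initial_segment)
  hence "summable (\<lambda>n. prob (E (n + n1)))"
  proof (rule summable_comparison_test'[of _ 0])
    show "norm (prob (E (n + n1))) \<le> 1 / (real (n + n1))\<^sup>2" for n
      using E(2)[of "n + n1"] by simp
  qed
  hence "AE \<omega> in M. \<forall>\<^sub>F n in sequentially. \<omega> \<in> space M - E (n + n1)"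
    using E(1) by (intro borel_cantelli_AE1) (auto simp: emeasure_eq_measure less_top[symmetric])
  moreover have "AE \<omega> in M. \<forall>n. \<not> ?P (n + n1) \<omega> \<longrightarrow> \<omega> \<in> E (n + n1)"
    unfolding AE_all_countable by (intro allI E(3) le_add2)
  ultimately show ?thesis
  proof eventually_elim
    case (elim \<omega>)
    obtain k where k: "\<And>n. k \<le> n \<Longrightarrow> \<omega> \<notin> E (n + n1)"
      using elim(1) unfolding eventually_sequentially by blast
    show ?case
    proof (intro exI[of _ "Suc (k + n1)"] conjI allI impI)
      fix n assume n: "Suc (k + n1) \<le> n"
      hence "\<omega> \<notin> E (n - n1 + n1)" by (intro k) simp
      hence "?P (n - n1 + n1) \<omega>" by (rule contrapos_np[OF _ elim(2)[rule_format]])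
      thus "vstrip (real n / 2 - real n powr (1/2 + \<epsilon>)) \<inter> hstrip (real n powr \<alpha>)
          \<subseteq> (\<Union>m. A n m \<omega>) \<inter> hstrip (real n powr \<alpha>)"
        "(\<Union>m. A n m \<omega>) \<inter> hstrip (real n powr \<alpha>)
          \<subseteq> vstrip (real n / 2 + real n powr (1/2 + \<epsilon>)) \<inter> hstrip (real n powr \<alpha>)" using n by simp_all
    qed simp
  qed
qed

section \<open>Poisson clocks\<close>

lemma sorted_wrt_distinct:
  assumes "\<And>x. \<not> R x x" "sorted_wrt R xs"
  shows "distinct xs"
  using assms(2) by (induction xs) (use assms(1) in auto)

lemma sorted_wrt_unique:
  assumes R: "\<And>x y. R x y \<Longrightarrow> \<not> R y x" and "sorted_wrt R xs" "sorted_wrt R ys" "set xs = set ys"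
  shows "xs = ys"
  using assms(2-)
proof (induction xs arbitrary: ys)
  case (Cons x xs)
  then obtain y ys' where ys: "ys = y # ys'" by (cases ys) auto
  have xy: "x = y"
  proof (rule ccontr)
    assume "x \<noteq> y"
    hence "x \<in> set ys'" "y \<in> set xs" using Cons.prems(3) unfolding ys by auto
    hence "R y x" "R x y" using Cons.prems(1,2) unfolding ys by auto
    thus False using R by blast
  qed
  moreover have "x \<notin> set xs" "y \<notin> set ys'" using Cons.prems(1,2) R unfolding ys by auto
  ultimately have "set xs = set ys'" using Cons.prems(3) unfolding ys by auto
  thus ?case using Cons xy unfolding ys by simp
qed simp

locale clocks =
  fixes X :: "int \<Rightarrow> real set"
  assumes nonneg: "X i \<subseteq> {0..}" and fin: "finite (X i \<inter> {0..t})"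
    and infinite_points: "infinite (X i)" and disj: "i \<noteq> i' \<Longrightarrow> X i \<inter> X i' = {}"
begin

abbreviation cnt :: "int \<Rightarrow> real \<Rightarrow> nat" where
  "cnt i t \<equiv> card (X i \<inter> {0..t})"

abbreviation T :: "int \<times> nat \<Rightarrow> real" where
  "T p \<equiv> nth_point (X (fst p)) (snd p)"

lemma cnt_mono: "s \<le> t \<Longrightarrow> cnt i s \<le> cnt i t"
  by (intro card_mono fin) auto

lemma cnt_less: "s < t \<Longrightarrow> t \<in> X i \<Longrightarrow> cnt i s < cnt i t"
  using nonneg[of i] by (intro psubset_card_mono fin) force

text \<open>The witness is the smallest point whose count is at least \<open>j\<close>. The set of
  candidates is cut off at the maximum of \<open>j\<close> chosen points to make it finite; removing
  the smallest candidate from its own count shows that the count is exactly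
  \<open>j\<close>.\<close>

lemma nth_point_ex:
  assumes j: "1 \<le> j"
  shows "\<exists>!t. t \<in> X i \<and> cnt i t = j"
proof -
  obtain B where B: "finite B" "card B = j" "B \<subseteq> X i"
    using infinite_arbitrarily_large[OF infinite_points[of i]] by blast
  have B0: "B \<noteq> {}" using B j by auto
  define Q where "Q = {t \<in> X i \<inter> {0..Max B}. j \<le> cnt i t}"
  have "B \<subseteq> X i \<inter> {0..Max B}" using B nonneg[of i] by auto
  hence "j \<le> cnt i (Max B)" using card_mono[OF fin] B(2) by metis
  moreover have "Max B \<in> X i \<inter> {0..Max B}" using Max_in[OF B(1) B0] B(3) nonneg[of i] by auto
  ultimately have "Q \<noteq> {}" by (auto simp: Q_def)
  moreover have "finite Q" by (rule finite_subset[OF _ fin[of i "Max B"]]) (auto simp: Q_def)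
  ultimately have Q: "finite Q" "Q \<noteq> {}" by auto
  define t where "t = Min Q"
  have t: "t \<in> X i" "j \<le> cnt i t" "0 \<le> t" "t \<le> Max B" using Min_in[OF Q] by (auto simp: t_def Q_def)
  have "cnt i t \<le> j"
  proof (rule ccontr)
    assume "\<not> cnt i t \<le> j"
    moreover define D where "D = X i \<inter> {0..t} - {t}"
    moreover have D_fin: "finite D" using fin by (simp add: D_def)
    ultimately have cD: "j \<le> card D" using t by (simp add: D_def card_Diff_singleton)
    hence "D \<noteq> {}" using j by auto
    define t' where "t' = Max D"
    have t': "t' \<in> X i" "0 \<le> t'" "t' < t" using Max_in[OF D_fin \<open>D \<noteq> {}\<close>] by (auto simp: t'_def D_def)
    have "D \<subseteq> X i \<inter> {0..t'}" using D_fin by (auto simp: t'_def) (auto simp: D_def)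
    hence "j \<le> cnt i t'" using card_mono[OF fin] cD order_trans by metis
    hence "t' \<in> Q" using t t' by (auto simp: Q_def)
    hence "t \<le> t'" unfolding t_def by (rule Min_le[OF Q(1)])
    thus False using t'(3) by simp
  qed
  moreover have "s = s'" if "s \<in> X i" "s' \<in> X i" "cnt i s = cnt i s'" for s s'
    using cnt_less[of s s' i] cnt_less[of s' s i] that by (cases s s' rule: linorder_cases) auto
  ultimately show ?thesis using t by (metis le_antisym)
qed

lemma nth_point:
  assumes "1 \<le> snd p"
  shows "T p \<in> X (fst p)" "cnt (fst p) (T p) = snd p"
  using theI'[OF nth_point_ex[OF assms, of "fst p"]] by (simp_all add: nth_point_def)

lemma nth_point_le: "1 \<le> snd p \<Longrightarrow> T p \<le> t \<longleftrightarrow> snd p \<le> cnt (fst p) t"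
  using cnt_mono[of "T p" t "fst p"] cnt_less[of t "T p" "fst p"] nth_point[of p] by (cases "T p \<le> t") auto

lemma nth_point_inj:
  assumes "1 \<le> snd p" "1 \<le> snd q" "T p = T q"
  shows "p = q"
proof -
  have eq: "fst p = fst q"
    using nth_point(1)[OF assms(1)] nth_point(1)[OF assms(2)] disj[of "fst p" "fst q"] unfolding assms(3) by blast
  have "cnt (fst p) (T p) = cnt (fst q) (T q)"
    by (rule arg_cong2[OF eq assms(3), where f = "\<lambda>i t. cnt i t"])
  hence "snd p = snd q" unfolding nth_point(2)[OF assms(1)] nth_point(2)[OF assms(2)] .
  with eq show ?thesis by (rule prod_eqI)
qed

lemma clock_particles_eq: "clock_particles X n m = {p. \<bar>fst p\<bar> \<le> int m \<and> 1 \<le> snd p \<and> snd p \<le> cnt (fst p) n}"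
proof (intro set_eqI)
  fix p show "p \<in> clock_particles X n m \<longleftrightarrow> p \<in> {p. \<bar>fst p\<bar> \<le> int m \<and> 1 \<le> snd p \<and> snd p \<le> cnt (fst p) n}"
    using nth_point_le[of p "real n"] by (auto simp: clock_particles_def split_beta)
qed

lemma finite_clock_particles: "finite (clock_particles X n m)"
proof (rule finite_subset)
  show "clock_particles X n m \<subseteq> (SIGMA i:{- int m..int m}. {..cnt i n})"
    unfolding clock_particles_eq by force
qed auto

lemma clock_order_ex1:
  "\<exists>!ps. set ps = clock_particles X n m \<and> sorted_wrt (\<lambda>(i, j) (i', j'). nth_point (X i) j < nth_point (X i') j') ps"
proof -
  have R: "(\<lambda>(i, j) (i', j'). nth_point (X i) j < nth_point (X i') j') = (\<lambda>p q. T p < T q)"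
    by (simp only: case_prod_unfold)
  obtain xs where xs: "set xs = clock_particles X n m" "distinct xs"
    using finite_distinct_list[OF finite_clock_particles] by blast
  define ys where "ys = sort_key T xs"
  have "inj_on T (set ys)"
    using nth_point_inj unfolding inj_on_def ys_def set_sort xs clock_particles_eq by blast
  hence "distinct (map T ys)" using xs(2) by (simp add: distinct_map ys_def)
  moreover have "sorted (map T ys)" by (simp add: ys_def)
  ultimately have "sorted_wrt (<) (map T ys)" by (simp add: strict_sorted_iff)
  hence ys: "sorted_wrt (\<lambda>p q. T p < T q) ys" "set ys = clock_particles X n m"
    by (simp_all add: sorted_wrt_map ys_def xs)
  show ?thesis unfolding R
    by (intro ex1I[of _ ys] conjI ys) (elim conjE, rule sorted_wrt_unique[of "\<lambda>p q. T p < T q"], use ys in auto)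
qed

lemma clock_order:
  "set (clock_order X n m) = clock_particles X n m" "sorted_wrt (\<lambda>p q. T p < T q) (clock_order X n m)"
proof -
  have "set (clock_order X n m) = clock_particles X n m \<and>
      sorted_wrt (\<lambda>(i, j) (i', j'). nth_point (X i) j < nth_point (X i') j') (clock_order X n m)"
    unfolding clock_order_def by (rule theI'[OF clock_order_ex1])
  thus "set (clock_order X n m) = clock_particles X n m" "sorted_wrt (\<lambda>p q. T p < T q) (clock_order X n m)"
    by (simp_all only: case_prod_unfold)
qed

text \<open>Restricting the larger order to the smaller range of levels gives the smaller order, by
  uniqueness of sorted lists; deleting particles shrinks the aggregate.\<close>

lemma A_dag_mono: "A_dag s X n m \<subseteq> A_dag s X n (Suc m)"
proof -
  have "filter (\<lambda>p. \<bar>fst p\<bar> \<le> int m) (clock_order X n (Suc m)) = clock_order X n m"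
  proof (rule sorted_wrt_unique[of "\<lambda>p q. T p < T q"])
    show "sorted_wrt (\<lambda>p q. T p < T q) (filter (\<lambda>p. \<bar>fst p\<bar> \<le> int m) (clock_order X n (Suc m)))"
      by (intro sorted_wrt_filter clock_order)
    show "set (filter (\<lambda>p. \<bar>fst p\<bar> \<le> int m) (clock_order X n (Suc m))) = set (clock_order X n m)"
      unfolding set_filter clock_order clock_particles_eq by auto
  qed (auto intro: clock_order)
  thus ?thesis unfolding A_dag_def by (metis aggregate_filter_mono)
qed

end

text \<open>A rational time at which the first particle has been sent and the second has not. For
  true clocks this means that the first of the two times is strictly smaller, expressed by counts on
  countably many intervals.\<close>

definition clock_less :: "(int \<Rightarrow> real set \<Rightarrow> nat) \<Rightarrow> int \<times> nat \<Rightarrow> int \<times> nat \<Rightarrow> bool" where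
  "clock_less c p p' \<longleftrightarrow> (\<exists>q :: rat. snd p \<le> c (fst p) {0..of_rat q} \<and> c (fst p') {0..of_rat q} < snd p')"

text \<open>Whether \<open>ps\<close> is the clock order, expressed by countably many counts and hence measurable.\<close>

definition is_clock_order :: "nat \<Rightarrow> nat \<Rightarrow> (int \<Rightarrow> real set \<Rightarrow> nat) \<Rightarrow> (int \<times> nat) list \<Rightarrow> bool" where
  "is_clock_order n m c ps \<longleftrightarrow>
     (\<forall>p. p \<in> set ps \<longleftrightarrow> \<bar>fst p\<bar> \<le> int m \<and> 1 \<le> snd p \<and> snd p \<le> c (fst p) {0..real n}) \<and>
     (\<forall>k k'. k < k' \<longrightarrow> k' < length ps \<longrightarrow> clock_less c (ps ! k) (ps ! k'))"

lemma Icc_bounded_borel: "{0..t} \<in> bounded_borel"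
  by (auto simp: bounded_borel_def)

lemma counts_Icc: "counts X {0..t} = card (X \<inter> {0..t})"
  using Icc_bounded_borel by (simp add: counts_def)

lemma (in clocks) is_clock_order_clock_order: "is_clock_order n m (\<lambda>i. counts (X i)) (clock_order X n m)"
proof -
  have less: "clock_less (\<lambda>i. counts (X i)) p p'" if T: "T p < T p'" "1 \<le> snd p" "1 \<le> snd p'" for p p'
  proof -
    obtain q where "T p < of_rat q" "of_rat q < T p'" using of_rat_dense[OF T(1)] by blast
    thus ?thesis unfolding clock_less_def counts_Icc
      using nth_point_le[OF T(2), of "of_rat q"] nth_point_le[OF T(3), of "of_rat q"] by (intro exI[of _ q]) auto
  qed
  have pos: "1 \<le> snd (clock_order X n m ! k)" if "k < length (clock_order X n m)" for k
    using nth_mem[OF that] unfolding clock_order clock_particles_eq by blast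
  show ?thesis unfolding is_clock_order_def
  proof (intro conjI allI impI)
    fix k k' assume k: "k < k'" "k' < length (clock_order X n m)"
    show "clock_less (\<lambda>i. counts (X i)) (clock_order X n m ! k) (clock_order X n m ! k')"
      using sorted_wrt_nth_less[OF clock_order(2) k] pos k by (intro less) auto
  qed (unfold clock_order clock_particles_eq counts_Icc, blast)
qed

lemma clock_less_asym:
  assumes fin: "\<And>i t. finite (X i \<inter> {0..t :: real})" and "clock_less (\<lambda>i. counts (X i)) p p'"
  shows "\<not> clock_less (\<lambda>i. counts (X i)) p' p"
proof
  have mono: "card (X i \<inter> {0..s}) \<le> card (X i \<inter> {0..t})" if "s \<le> t" for i s t
    using that by (intro card_mono fin) auto
  assume "clock_less (\<lambda>i. counts (X i)) p' p"
  then obtain q q' :: rat where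
    "snd p \<le> card (X (fst p) \<inter> {0..of_rat q})" "card (X (fst p') \<inter> {0..of_rat q}) < snd p'"
    "snd p' \<le> card (X (fst p') \<inter> {0..of_rat q'})" "card (X (fst p) \<inter> {0..of_rat q'}) < snd p"
    using assms(2) unfolding clock_less_def counts_Icc by blast
  moreover have "of_rat q \<le> (of_rat q' :: real) \<or> of_rat q' \<le> (of_rat q :: real)" by linarith
  ultimately show False using mono[of "of_rat q" "of_rat q'" "fst p"] mono[of "of_rat q'" "of_rat q" "fst p'"] by linarith
qed

text \<open>Local finiteness suffices here, and it holds for every outcome. The events attached to
  different lists are therefore disjoint, not merely up to null sets.\<close>

lemma is_clock_order_unique:
  assumes fin: "\<And>i t. finite (X i \<inter> {0..t :: real})" and "is_clock_order n m (\<lambda>i. counts (X i)) ps"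
  shows "distinct ps" "is_clock_order n m (\<lambda>i. counts (X i)) qs \<Longrightarrow> ps = qs"
proof -
  note asym = clock_less_asym[of X, OF fin]
  have sorted: "sorted_wrt (clock_less (\<lambda>i. counts (X i))) xs" if "is_clock_order n m (\<lambda>i. counts (X i)) xs" for xs
    using that by (simp add: is_clock_order_def sorted_wrt_iff_nth_less)
  show "distinct ps" using asym by (intro sorted_wrt_distinct[OF _ sorted[OF assms(2)]]) blast
  show "ps = qs" if "is_clock_order n m (\<lambda>i. counts (X i)) qs"
  proof (rule sorted_wrt_unique[OF asym sorted[OF assms(2)] sorted[OF that]])
    show "set ps = set qs" using assms(2) that unfolding is_clock_order_def by blast
  qed
qed

lemma is_clock_order_measurable:
  "Measurable.pred (PiM UNIV (\<lambda>_. counts_space)) (\<lambda>c. is_clock_order n m c ps)"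
proof -
  have [measurable]: "(\<lambda>c. c i {0..t}) \<in> PiM UNIV (\<lambda>_. counts_space) \<rightarrow>\<^sub>M count_space UNIV" for i :: int and t
  proof (rule measurable_compose[OF measurable_component_singleton])
    show "(\<lambda>x. x {0..t}) \<in> counts_space \<rightarrow>\<^sub>M count_space UNIV"
      unfolding counts_space_def by (rule measurable_component_singleton[OF Icc_bounded_borel])
  qed simp
  show ?thesis unfolding is_clock_order_def clock_less_def by measurable
qed

section \<open>Almost sure properties of the clocks\<close>

locale clock_model = walks M S for M :: "'w measure" and S +
  fixes X :: "int \<Rightarrow> 'w \<Rightarrow> real set"
  assumes poisson: "\<And>i. unit_poisson_process M (X i)"
    and clocks_indep: "indep_vars (\<lambda>_. counts_space) (\<lambda>i \<omega>. counts (X i \<omega>)) UNIV"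
    and clocks_walks: "indep_elements M (PiM UNIV (\<lambda>_. counts_space)) (\<lambda>\<omega> i. counts (X i \<omega>)) walks_space (all_walks S)"
begin

lemma points: "\<omega> \<in> space M \<Longrightarrow> X i \<omega> \<subseteq> {0..}" "\<omega> \<in> space M \<Longrightarrow> finite (X i \<omega> \<inter> {0..t})"
  using poisson[of i] by (auto simp: unit_poisson_process_def)

lemma card_indep:
  assumes "B \<in> bounded_borel"
  shows "indep_vars (\<lambda>_. count_space UNIV) (\<lambda>i \<omega>. card (X i \<omega> \<inter> B)) UNIV"
proof -
  have "indep_vars (\<lambda>_. count_space UNIV) (\<lambda>i \<omega>. counts (X i \<omega>) B) UNIV"
    using clocks_indep
  proof (rule indep_vars_compose2)
    show "(\<lambda>c. c B) \<in> counts_space \<rightarrow>\<^sub>M count_space UNIV"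
      unfolding counts_space_def by (rule measurable_component_singleton[OF assms])
  qed
  thus ?thesis using assms by (simp add: counts_def)
qed

lemma card_measurable: "B \<in> bounded_borel \<Longrightarrow> (\<lambda>\<omega>. card (X i \<omega> \<inter> B)) \<in> M \<rightarrow>\<^sub>M count_space UNIV"
  using card_indep unfolding indep_vars_def by blast

lemma prob_card:
  assumes "B \<in> bounded_borel"
  shows "prob {\<omega> \<in> space M. card (X i \<omega> \<inter> B) = k} = measure lborel B ^ k / fact k * exp (- measure lborel B)"
  using poisson[of i] assms by (simp add: unit_poisson_process_def)

lemma poisson_counts:
  assumes "0 < n"
  shows "poisson_counts M n (\<lambda>i \<omega>. card (X i \<omega> \<inter> {0..real n}))"
proof
  show "0 < n" by fact
  show "indep_vars (\<lambda>_. count_space UNIV) (\<lambda>i \<omega>. card (X i \<omega> \<inter> {0..real n})) UNIV"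
    by (rule card_indep[OF Icc_bounded_borel])
  note [measurable] = card_measurable[OF Icc_bounded_borel]
  show "distr M (count_space UNIV) (\<lambda>\<omega>. card (X i \<omega> \<inter> {0..real n})) = measure_pmf (poisson_pmf (real n))" for i
  proof (rule measure_eqI_countable[of _ UNIV])
    fix k :: nat
    have "emeasure (distr M (count_space UNIV) (\<lambda>\<omega>. card (X i \<omega> \<inter> {0..real n}))) {k} =
        emeasure M {\<omega> \<in> space M. card (X i \<omega> \<inter> {0..real n}) = k}"
      by (subst emeasure_distr) (auto intro!: arg_cong[where f = "emeasure M"])
    also have "\<dots> = ennreal (pmf (poisson_pmf (real n)) k)"
      using prob_card[OF Icc_bounded_borel, of i "real n" k] assms by (simp add: emeasure_eq_measure)
    finally show "emeasure (distr M (count_space UNIV) (\<lambda>\<omega>. card (X i \<omega> \<inter> {0..real n}))) {k} =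
        emeasure (measure_pmf (poisson_pmf (real n))) {k}" by (simp add: emeasure_pmf_single)
  qed auto
qed

text \<open>The probability of fewer than K points in [0, t] is a polynomial in t times exp(-t),
  which tends to 0.\<close>

lemma AE_infinite: "AE \<omega> in M. infinite (X i \<omega>)"
proof -
  note [measurable] = card_measurable[OF Icc_bounded_borel]
  define B where "B K = (\<Inter>t. {\<omega> \<in> space M. card (X i \<omega> \<inter> {0..real t}) < K})" for K
  have B: "B K \<in> events" for K unfolding B_def by measurable
  have "prob (B K) = 0" for K
  proof -
    have "prob (B K) \<le> (\<Sum>k<K. real t ^ k / fact k * exp (- real t))" for t
    proof -
      have "prob (B K) \<le> prob (\<Union>k<K. {\<omega> \<in> space M. card (X i \<omega> \<inter> {0..real t}) = k})"
        by (intro finite_measure_mono) (auto simp: B_def)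
      also have "\<dots> \<le> (\<Sum>k<K. prob {\<omega> \<in> space M. card (X i \<omega> \<inter> {0..real t}) = k})"
        by (intro finite_measure_subadditive_finite) auto
      finally show ?thesis using prob_card[OF Icc_bounded_borel, of i "real t"] by simp
    qed
    moreover have "(\<lambda>t. \<Sum>k<K. real t ^ k / fact k * exp (- real t)) \<longlonglongrightarrow> 0"
    proof (rule tendsto_null_sum)
      fix k
      have "(\<lambda>t. real t ^ k / exp (real t)) \<longlonglongrightarrow> 0"
        by (rule filterlim_compose[OF tendsto_power_div_exp_0 filterlim_real_sequentially])
      from tendsto_mult_right_zero[OF this, of "1 / fact k"]
      show "(\<lambda>t. real t ^ k / fact k * exp (- real t)) \<longlonglongrightarrow> 0" by (simp add: exp_minus field_simps)
    qed
    ultimately have "prob (B K) \<le> 0" by (intro LIMSEQ_le_const) auto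
    thus ?thesis by (simp add: measure_le_0_iff)
  qed
  hence "AE \<omega> in M. \<forall>K. \<omega> \<notin> B K"
    using B by (simp add: AE_all_countable AE_iff_measurable[of "B _"] prob_eq_0[symmetric])
  thus ?thesis using AE_space
  proof eventually_elim
    case (elim \<omega>)
    show ?case
    proof
      assume "finite (X i \<omega>)"
      hence "card (X i \<omega> \<inter> {0..real t}) < Suc (card (X i \<omega>))" for t
        by (simp add: less_Suc_eq_le card_mono)
      thus False using elim by (auto simp: B_def)
    qed
  qed
qed

lemma prob_both_hit:
  assumes B: "B \<in> bounded_borel" and "i \<noteq> i'"
  shows "prob {\<omega> \<in> space M. X i \<omega> \<inter> B \<noteq> {} \<and> X i' \<omega> \<inter> B \<noteq> {}} \<le> (measure lborel B)\<^sup>2"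
    and "{\<omega> \<in> space M. X i \<omega> \<inter> B \<noteq> {} \<and> X i' \<omega> \<inter> B \<noteq> {}} \<in> events"
proof -
  note [measurable] = card_measurable[OF B]
  have fin: "finite (X i \<omega> \<inter> B)" if "\<omega> \<in> space M" for i \<omega>
  proof -
    obtain b where "\<And>x. x \<in> B \<Longrightarrow> \<bar>x\<bar> \<le> b" using B unfolding bounded_borel_def bounded_real by auto
    hence "X i \<omega> \<inter> B \<subseteq> X i \<omega> \<inter> {0..b}" using points(1)[OF that, of i] by force
    thus ?thesis using points(2)[OF that] finite_subset by blast
  qed
  define H where "H i = (\<lambda>\<omega>. card (X i \<omega> \<inter> B)) -` {1..} \<inter> space M" for i
  have eq: "{\<omega> \<in> space M. X i \<omega> \<inter> B \<noteq> {} \<and> X i' \<omega> \<inter> B \<noteq> {}} = (\<Inter>j\<in>{i, i'}. H j)"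
    using fin by (auto simp: H_def Suc_le_eq card_gt_0_iff)
  have Hev: "H j \<in> events" for j unfolding H_def by measurable
  show "{\<omega> \<in> space M. X i \<omega> \<inter> B \<noteq> {} \<and> X i' \<omega> \<inter> B \<noteq> {}} \<in> events" unfolding eq using Hev by auto
  have P: "prob (H j) \<le> measure lborel B" for j
  proof -
    have "H j = space M - {\<omega> \<in> space M. card (X j \<omega> \<inter> B) = 0}" by (auto simp: H_def)
    hence "prob (H j) = 1 - exp (- measure lborel B)"
      using prob_card[OF B, of j 0] by (simp add: prob_compl)
    also have "\<dots> \<le> measure lborel B" using exp_ge_add_one_self[of "- measure lborel B"] by linarith
    finally show ?thesis .
  qed
  have "prob (\<Inter>j\<in>{i, i'}. H j) = (\<Prod>j\<in>{i, i'}. prob (H j))"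
    unfolding H_def by (rule indep_varsD[OF card_indep[OF B]]) auto
  also have "\<dots> = prob (H i) * prob (H i')" using assms(2) by simp
  also have "\<dots> \<le> measure lborel B * measure lborel B" using P by (intro mult_mono) auto
  finally show "prob {\<omega> \<in> space M. X i \<omega> \<inter> B \<noteq> {} \<and> X i' \<omega> \<inter> B \<noteq> {}} \<le> (measure lborel B)\<^sup>2"
    unfolding eq by (simp add: power2_eq_square)
qed

text \<open>Cut [0, b) into b (k+1) intervals of length 1 / (k+1). A common point means that both
  processes hit one of them, which has probability at most 1 / (k+1)^2 for each interval, hence b /
  (k+1) in total, for every k.\<close>

lemma AE_disjoint:
  assumes "i \<noteq> i'"
  shows "AE \<omega> in M. X i \<omega> \<inter> X i' \<omega> = {}"
proof -
  define I where "I k a = {real a / real (Suc k)..<(real a + 1) / real (Suc k)}" for k a :: nat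
  define C where "C k a = {\<omega> \<in> space M. X i \<omega> \<inter> I k a \<noteq> {} \<and> X i' \<omega> \<inter> I k a \<noteq> {}}" for k a
  have I: "I k a \<in> bounded_borel" for k a
    using bounded_Ico unfolding bounded_borel_def I_def by (auto intro: order_trans[of 0 "real a / real (Suc k)"])
  have lI: "measure lborel (I k a) = 1 / real (Suc k)" for k a
    unfolding I_def by (simp add: divide_right_mono diff_divide_distrib[symmetric])
  have C: "C k a \<in> events" "prob (C k a) \<le> (1 / real (Suc k))\<^sup>2" for k a
    using prob_both_hit[OF I assms, of k a] unfolding C_def lI by auto
  define D where "D b = (\<Inter>k. \<Union>a<b * Suc k. C k a)" for b
  have D: "D b \<in> events" for b unfolding D_def using C(1) by auto
  have "prob (D b) = 0" for b
  proof -
    have "prob (D b) \<le> real b * (1 / real (Suc k))" for k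
    proof -
      have "prob (D b) \<le> prob (\<Union>a<b * Suc k. C k a)"
        using C(1) by (intro finite_measure_mono) (auto simp: D_def)
      also have "\<dots> \<le> (\<Sum>a<b * Suc k. prob (C k a))"
        using C(1) by (intro finite_measure_subadditive_finite) auto
      also have "\<dots> \<le> (\<Sum>a<b * Suc k. (1 / real (Suc k))\<^sup>2)" by (intro sum_mono C(2))
      also have "\<dots> = real b * real (Suc k) * (1 / real (Suc k))\<^sup>2" by (simp add: algebra_simps)
      also have "\<dots> = real b * (1 / real (Suc k))" by (simp add: power2_eq_square)
      finally show ?thesis .
    qed
    moreover have "(\<lambda>k. real b * (1 / real (Suc k))) \<longlonglongrightarrow> 0"
      using tendsto_mult_right_zero[OF LIMSEQ_inverse_real_of_nat] by (simp add: inverse_eq_divide)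
    ultimately have "prob (D b) \<le> 0" by (intro LIMSEQ_le_const) auto
    thus ?thesis by (simp add: measure_le_0_iff)
  qed
  hence "AE \<omega> in M. \<forall>b. \<omega> \<notin> D b"
    using D by (simp add: AE_all_countable prob_eq_0[symmetric])
  thus ?thesis using AE_space
  proof eventually_elim
    case (elim \<omega>)
    show ?case
    proof (rule ccontr)
      assume "X i \<omega> \<inter> X i' \<omega> \<noteq> {}"
      then obtain x where x: "x \<in> X i \<omega>" "x \<in> X i' \<omega>" by blast
      hence x0: "0 \<le> x" using points(1)[OF elim(2), of i] by auto
      define b where "b = nat \<lfloor>x\<rfloor> + 1"
      have b: "x < real b" using x0 unfolding b_def by linarith
      have "\<omega> \<in> (\<Union>a<b * Suc k. C k a)" for k
      proof -
        define a where "a = nat \<lfloor>x * real (Suc k)\<rfloor>"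
        have "0 \<le> x * real (Suc k)" using x0 by simp
        hence a: "real a \<le> x * real (Suc k)" "x * real (Suc k) < real a + 1" unfolding a_def by linarith+
        hence "x \<in> I k a" unfolding I_def by (simp add: divide_le_eq less_divide_eq)
        hence "\<omega> \<in> C k a" using x elim(2) by (auto simp: C_def)
        moreover have "x * real (Suc k) < real b * real (Suc k)" using b by (intro mult_strict_right_mono) auto
        hence "real a < real (b * Suc k)" using a by (simp only: of_nat_mult)
        hence "a < b * Suc k" by (simp only: of_nat_less_iff)
        ultimately show ?thesis by blast
      qed
      hence "\<omega> \<in> D b" by (simp add: D_def)
      thus False using elim by blast
    qed
  qed
qed

lemma AE_clocks: "AE \<omega> in M. clocks (\<lambda>i. X i \<omega>)"
proof -
  have "AE \<omega> in M. \<forall>i. infinite (X i \<omega>)" using AE_infinite by (simp add: AE_all_countable)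
  moreover have "AE \<omega> in M. \<forall>i i'. i \<noteq> i' \<longrightarrow> X i \<omega> \<inter> X i' \<omega> = {}"
    using AE_disjoint by (simp add: AE_all_countable)
  ultimately show ?thesis using AE_space
  proof eventually_elim
    case (elim \<omega>)
    thus ?case using points by unfold_locales blast+
  qed
qed

end

lemma (in params) dag_shape:
  assumes M: "clock_model M S X" and m: "3 * V\<^sup>2 \<le> m"
    and \<kappa>: "\<And>k. 20 * real n * vt V k * qc k ^ m1 \<le> \<kappa> / (1 + \<bar>real_of_int k\<bar>)\<^sup>2"
  shows "\<exists>E\<in>sets M. measure M E \<le> err \<kappa> \<and>
    (AE \<omega> in M. \<not> shape (A_dag (\<lambda>i j k. S i j k \<omega>) (\<lambda>i. X i \<omega>) n m) \<longrightarrow> \<omega> \<in> E)"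
proof -
  interpret clock_model M S X by (rule M)
  define N where "N i \<omega> = card (X i \<omega> \<inter> {0..real n})" for i \<omega>
  interpret poisson_counts M n N
    unfolding N_def using n by (intro poisson_counts) simp
  interpret ordered_model n d d0 V l m1 m2 lc M N S by unfold_locales
  let ?Ma = "PiM UNIV (\<lambda>_. counts_space)" and ?Y = "\<lambda>\<omega> i. counts (X i \<omega>)"
  define F where "F ps = {\<omega> \<in> space M. is_clock_order n m (\<lambda>i. counts (X i \<omega>)) ps}" for ps
  have Y: "?Y \<in> M \<rightarrow>\<^sub>M ?Ma" using clocks_walks by (simp add: indep_elements_def)
  have "F ps \<in> sets (vimage_algebra (space M) ?Y ?Ma)" for ps
  proof -
    have "F ps = ?Y -` {c \<in> space ?Ma. is_clock_order n m c ps} \<inter> space M"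
      using measurable_space[OF Y] by (auto simp: F_def)
    moreover have "{c \<in> space ?Ma. is_clock_order n m c ps} \<in> sets ?Ma"
      using is_clock_order_measurable[of n m ps] by (simp add: pred_def)
    ultimately show ?thesis by (simp only: in_vimage_algebra)
  qed
  moreover have "disjoint_family F"
    unfolding disjoint_family_on_def
  proof (intro ballI impI equals0I)
    fix ps qs \<omega> assume "ps \<noteq> qs" "\<omega> \<in> F ps \<inter> F qs"
    hence w: "\<omega> \<in> space M" "is_clock_order n m (\<lambda>i. counts (X i \<omega>)) ps" "is_clock_order n m (\<lambda>i. counts (X i \<omega>)) qs"
      by (auto simp: F_def)
    from is_clock_order_unique(2)[OF points(2)[OF w(1)] w(2,3)] show False using \<open>ps \<noteq> qs\<close> by simp
  qed
  moreover have "distinct ps \<and> set ps = {(i, j). \<bar>i\<bar> \<le> int m \<and> 1 \<le> j \<and> j \<le> N i \<omega>}" if "\<omega> \<in> F ps" for ps \<omega>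
  proof
    have w: "\<omega> \<in> space M" "is_clock_order n m (\<lambda>i. counts (X i \<omega>)) ps" using that by (auto simp: F_def)
    show "distinct ps" using is_clock_order_unique(1)[OF points(2)[OF w(1)] w(2)] .
    show "set ps = {(i, j). \<bar>i\<bar> \<le> int m \<and> 1 \<le> j \<and> j \<le> N i \<omega>}"
      using w(2) unfolding is_clock_order_def counts_Icc N_def by (intro set_eqI) (unfold case_prod_unfold mem_Collect_eq, blast)
  qed
  ultimately obtain E where E: "E \<in> events" "prob E \<le> err \<kappa>"
    "\<And>\<omega> ps. \<omega> \<in> space M \<Longrightarrow> \<omega> \<in> F ps \<Longrightarrow> \<not> shape (aggregate (\<lambda>i j k. S i j k \<omega>) ps) \<Longrightarrow> \<omega> \<in> E"
    using ordered_shape[OF clocks_walks _ _ _ m \<kappa>, of F] by blast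
  have "AE \<omega> in M. \<not> shape (A_dag (\<lambda>i j k. S i j k \<omega>) (\<lambda>i. X i \<omega>) n m) \<longrightarrow> \<omega> \<in> E"
    using AE_clocks AE_space
  proof eventually_elim
    case (elim \<omega>)
    hence "\<omega> \<in> F (clock_order (\<lambda>i. X i \<omega>) n m)"
      using clocks.is_clock_order_clock_order[OF elim(1)] by (simp add: F_def)
    thus ?case using E(3)[OF elim(2)] by (auto simp: A_dag_def)
  qed
  thus ?thesis using E by blast
qed

theorem theorem6p2:
  fixes M :: "'w measure" and \<epsilon> \<alpha> :: real
    and S :: "nat \<Rightarrow> int \<Rightarrow> nat \<Rightarrow> nat \<Rightarrow> 'w \<Rightarrow> int \<times> int"
    and N :: "nat \<Rightarrow> int \<Rightarrow> 'w \<Rightarrow> nat"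
    and S' :: "int \<Rightarrow> nat \<Rightarrow> nat \<Rightarrow> 'w \<Rightarrow> int \<times> int"
    and X :: "int \<Rightarrow> 'w \<Rightarrow> real set"
  assumes "prob_space M"
    and "0 < \<epsilon>" and "\<epsilon> < 1/2" and "0 < \<alpha>"
  shows
    "((\<forall>n\<ge>1. star_model M n (S n) (N n)) \<longrightarrow>
       (AE \<omega> in M. \<exists>n0\<ge>1. \<forall>n\<ge>n0.
          vstrip (real n / 2 - real n powr (1/2 + \<epsilon>)) \<inter> hstrip (real n powr \<alpha>)
            \<subseteq> A_star_inf (\<lambda>i j k. S n i j k \<omega>) (\<lambda>i. N n i \<omega>) \<inter> hstrip (real n powr \<alpha>) \<and>
          A_star_inf (\<lambda>i j k. S n i j k \<omega>) (\<lambda>i. N n i \<omega>) \<inter> hstrip (real n powr \<alpha>)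
            \<subseteq> vstrip (real n / 2 + real n powr (1/2 + \<epsilon>)) \<inter> hstrip (real n powr \<alpha>)))
     \<and>
     (dag_model M S' X \<longrightarrow>
       (AE \<omega> in M. \<exists>n0\<ge>1. \<forall>n\<ge>n0.
          vstrip (real n / 2 - real n powr (1/2 + \<epsilon>)) \<inter> hstrip (real n powr \<alpha>)
            \<subseteq> A_dag_inf (\<lambda>i j k. S' i j k \<omega>) (\<lambda>i. X i \<omega>) n \<inter> hstrip (real n powr \<alpha>) \<and>
          A_dag_inf (\<lambda>i j k. S' i j k \<omega>) (\<lambda>i. X i \<omega>) n \<inter> hstrip (real n powr \<alpha>)
            \<subseteq> vstrip (real n / 2 + real n powr (1/2 + \<epsilon>)) \<inter> hstrip (real n powr \<alpha>)))"
proof (intro conjI impI)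
  interpret prob_space M by fact
  assume star: "\<forall>n\<ge>1. star_model M n (S n) (N n)"
  show "AE \<omega> in M. \<exists>n0\<ge>1. \<forall>n\<ge>n0.
      vstrip (real n / 2 - real n powr (1/2 + \<epsilon>)) \<inter> hstrip (real n powr \<alpha>)
        \<subseteq> A_star_inf (\<lambda>i j k. S n i j k \<omega>) (\<lambda>i. N n i \<omega>) \<inter> hstrip (real n powr \<alpha>) \<and>
      A_star_inf (\<lambda>i j k. S n i j k \<omega>) (\<lambda>i. N n i \<omega>) \<inter> hstrip (real n powr \<alpha>)
        \<subseteq> vstrip (real n / 2 + real n powr (1/2 + \<epsilon>)) \<inter> hstrip (real n powr \<alpha>)"
    unfolding A_star_inf_def
  proof (rule eventually_strips[OF \<open>0 < \<epsilon>\<close>])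
    fix n d d0 V l m1 m2 lc \<kappa> m assume "params n d d0 V l m1 m2 lc"
      and "3 * V\<^sup>2 \<le> m" "\<And>k. 20 * real n * vt V k * params.qc n V lc k ^ m1 \<le> \<kappa> / (1 + \<bar>real_of_int k\<bar>)\<^sup>2"
    moreover from this(1) have "1 \<le> n" by (auto simp: params_def)
    ultimately show "\<exists>E\<in>events. prob E \<le> params.err n d d0 V l m2 \<kappa> \<and>
        (AE \<omega> in M. \<not> params.shape n d d0 V (A_star (\<lambda>i j k. S n i j k \<omega>) (\<lambda>i. N n i \<omega>) m) \<longrightarrow> \<omega> \<in> E)"
      using star by (intro params.star_shape prob_space_axioms) auto
  qed (use A_star_mono in auto)
next
  interpret prob_space M by fact
  assume dag: "dag_model M S' X"
  interpret clock_model M S' X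
    using dag by unfold_locales (auto simp: dag_model_def)
  show "AE \<omega> in M. \<exists>n0\<ge>1. \<forall>n\<ge>n0.
      vstrip (real n / 2 - real n powr (1/2 + \<epsilon>)) \<inter> hstrip (real n powr \<alpha>)
        \<subseteq> A_dag_inf (\<lambda>i j k. S' i j k \<omega>) (\<lambda>i. X i \<omega>) n \<inter> hstrip (real n powr \<alpha>) \<and>
      A_dag_inf (\<lambda>i j k. S' i j k \<omega>) (\<lambda>i. X i \<omega>) n \<inter> hstrip (real n powr \<alpha>)
        \<subseteq> vstrip (real n / 2 + real n powr (1/2 + \<epsilon>)) \<inter> hstrip (real n powr \<alpha>)"
    unfolding A_dag_inf_def
  proof (rule eventually_strips[OF \<open>0 < \<epsilon>\<close>])
    show "AE \<omega> in M. \<forall>m. A_dag (\<lambda>i j k. S' i j k \<omega>) (\<lambda>i. X i \<omega>) n m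
        \<subseteq> A_dag (\<lambda>i j k. S' i j k \<omega>) (\<lambda>i. X i \<omega>) n (Suc m)" for n
      using AE_clocks by eventually_elim (intro allI clocks.A_dag_mono)
  qed (intro params.dag_shape clock_model_axioms)
qed

end
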